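(* Let $n\ge2$, $1\le d\le n-1$, $X=\mathrm{Sp}_{2n}(2)$, let $\epsilon,\epsilon'\in\{+,-\}$ with $(n,d,\epsilon)\ne(2,1,+)$, let $\Gamma=\Gamma(n,d,\epsilon,\epsilon')$ in $J(\mathcal{Q}^\epsilon,k)$, and let $A=\mathrm{Aut}(\Gamma)$. Then: (a) for each codeword $\Delta(U)$ ($U$ nondegenerate of dimension $2d$), $X_U\le X_{\Delta(U)}$, with equality unless $(d,\epsilon)=(n/2,+)$; in this exceptional case $X_{\Delta(U)}=X_{\Delta(U^\perp)}=X_{\{U,U^\perp\}}\cong\mathrm{Sp}_n(2)\wr S_2$, a maximal subgroup of $X$ (the stabiliser of the decomposition $V=U\oplus U^\perp$); (b) $\Gamma$ is $X$-strongly incidence-transitive; (c) $k=2^{n-2}(2^d+\epsilon')(2^{n-d}+\epsilon\epsilon')$ and $3\le k\le|\mathcal{Q}^\epsilon|-3$; (d) $\Gamma$ is self-complementary if and only if $(d,\epsilon)=(n/2,-)$; (e) $A=X$ unless $(d,\epsilon)=(n/2,-)$, and in this exceptional case $A=X\times\langle s\rangle$ where $s$ is the complementing map, and for each codeword $\Delta(U)$, $A_{\Delta(U)}=X_U\rtimes\langle xs\rangle\cong\mathrm{Sp}_n(2)\wr S_2$ for some involution $x\in X_{\{U,U^\perp\}}$ interchanging $U$ and $U^\perp$.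
   Context: Let $V=\mathbb{F}_2^{2n}$ with a symplectic form $B$, and $X=\mathrm{Sp}_{2n}(2)$ its isometry group (acting on the right). $\mathcal{Q}$ is the set of quadratic forms $\phi:V\to\mathbb{F}_2$ with $\phi(x+y)+\phi(x)+\phi(y)=B(x,y)$; $\mathcal{Q}^\epsilon$ those of type $\epsilon\in\{+,-\}$. Signs are $\pm1$ in arithmetic ($|\mathcal{Q}^\epsilon|=2^{n-1}(2^n+\epsilon)$); $\epsilon\epsilon'$ is the product sign. $X$ acts on $\mathcal{Q}^\epsilon$ by $\phi^g(x)=\phi(xg^{-1})$. $U^\perp$ is the $B$-orthogonal complement; $U$ nondegenerate means $U\cap U^\perp=0$; $\phi_U$ is the restriction of $\phi$ to $U$; $X_U$ and $X_{\{U,U^\perp\}}$ are setwise stabilisers of $U$ and of the pair $\{U,U^\perp\}$; $X_{\Delta}$ is the setwise stabiliser of $\Delta\subseteq\mathcal{Q}^\epsilon$. $J(\mathcal V,k)$: vertices the $k$-subsets of $\mathcal V$, adjacent iff they meet in $k-1$ points. A code is a nonempty vertex set; $\mathrm{Aut}(\Gamma)$ is the group of graph automorphisms of $J(\mathcal V,k)$ preserving $\Gamma$ (for $k=|\mathcal V|/2$ the complementing map $s:\Delta\mapsto\mathcal V\setminus\Delta$ is a graph automorphism). $\Gamma$ is $G$-strongly incidence-transitive if $G$ (acting on $\mathcal V$, preserving $\Gamma$) is transitive on $\Gamma$ and each $G_\Delta$ is transitive on $\Delta\times(\mathcal V\setminus\Delta)$. $\Gamma$ is self-complementary if $\{\mathcal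 V\setminus\Delta:\Delta\in\Gamma\}=\Gamma$. $\Gamma(n,d,\epsilon,\epsilon')$ is the code in $J(\mathcal{Q}^\epsilon,k)$, $k=2^{n-2}(2^d+\epsilon')(2^{n-d}+\epsilon\epsilon')$, consisting of $\Delta(U)=\{\phi\in\mathcal{Q}^\epsilon:\phi_U$ has type $\epsilon'$ and $\phi_{U^\perp}$ has type $\epsilon\epsilon'\}$ for all nondegenerate $2d$-dimensional subspaces $U$. *)

theory Defs
  imports
    "HOL-Analysis.Analysis"
    "HOL-Library.Z2"
    "HOL-Library.Function_Algebras"
    "HOL-Algebra.Bij"
    "HOL-Algebra.Generated_Groups"
    "HOL-Algebra.Group_Action"
    "HOL-Algebra.Sym_Groups"
begin

text \<open>
  Permutation groups are subgroups of \<^const>\<open>BijGroup\<close>. A right action $x g$ is written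
  as function application \<open>g x\<close>, so the product of \<open>g\<close> and \<open>h\<close> is \<open>g \<circ> h\<close>.
  Signs are the integers \<open>1\<close> and \<open>-1\<close>.
\<close>

subsection \<open>Symplectic spaces over the field with two elements\<close>

definition symplectic_form :: "(bit^'m \<Rightarrow> bit^'m \<Rightarrow> bit) \<Rightarrow> bool" where
  "symplectic_form B \<longleftrightarrow>
     (\<forall>x. Vector_Spaces.linear (*s) (*) (B x)) \<and>
     (\<forall>y. Vector_Spaces.linear (*s) (*) (\<lambda>x. B x y)) \<and>
     (\<forall>x. B x x = 0) \<and>
     (\<forall>x. (\<forall>y. B x y = 0) \<longrightarrow> x = 0)"

definition perp :: "(bit^'m \<Rightarrow> bit^'m \<Rightarrow> bit) \<Rightarrow> (bit^'m) set \<Rightarrow> (bit^'m) set" where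
  "perp B U = {x. \<forall>u\<in>U. B x u = 0}"

definition nondegenerate :: "(bit^'m \<Rightarrow> bit^'m \<Rightarrow> bit) \<Rightarrow> (bit^'m) set \<Rightarrow> bool" where
  "nondegenerate B U \<longleftrightarrow> U \<inter> perp B U = {0}"

definition nondeg_subspaces ::
  "(bit^'m \<Rightarrow> bit^'m \<Rightarrow> bit) \<Rightarrow> nat \<Rightarrow> (bit^'m) set set" where
  "nondeg_subspaces B r = {U. vec.subspace U \<and> vec.dim U = r \<and> nondegenerate B U}"

text \<open>
  \<open>W\<close> is (the carrier of) a vector space over \<^typ>\<open>bit\<close> with scalar multiplication
  \<open>sc\<close>.
\<close>

definition isometry_group ::
  "(bit \<Rightarrow> 'v \<Rightarrow> 'v) \<Rightarrow> 'v::ab_group_add set \<Rightarrow> ('v \<Rightarrow> 'v \<Rightarrow> bit) \<Rightarrow> ('v \<Rightarrow> 'v) monoid" where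
  "isometry_group sc W B = BijGroup W
     \<lparr>carrier := {g \<in> Bij W.
        (\<forall>x\<in>W. \<forall>y\<in>W. g (x + y) = g x + g y) \<and>
        (\<forall>c. \<forall>x\<in>W. g (sc c x) = sc c (g x)) \<and>
        (\<forall>x\<in>W. \<forall>y\<in>W. B (g x) (g y) = B x y)}\<rparr>"

definition Sp :: "(bit^'m \<Rightarrow> bit^'m \<Rightarrow> bit) \<Rightarrow> (bit^'m \<Rightarrow> bit^'m) monoid" where
  "Sp B = isometry_group (*s) UNIV B"

text \<open>
  The abstract group $\mathrm{Sp}_r(2)$, for even \<open>r\<close> that need not be the size of a type:
  the space $\mathbb{F}_2^r$ is modelled by functions on \<^typ>\<open>nat\<close> vanishing from \<open>r\<close> on,
  and coordinates \<open>2 * i\<close>, \<open>2 * i + 1\<close> form hyperbolic pairs.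
\<close>

definition Sp_std :: "nat \<Rightarrow> ((nat \<Rightarrow> bit) \<Rightarrow> (nat \<Rightarrow> bit)) monoid" where
  "Sp_std r = isometry_group (\<lambda>c v i. c * v i) {v. \<forall>i\<ge>r. v i = 0}
     (\<lambda>x y. \<Sum>i<r div 2. x (2 * i) * y (2 * i + 1) + x (2 * i + 1) * y (2 * i))"

subsection \<open>Quadratic forms\<close>

definition quad_forms :: "(bit^'m \<Rightarrow> bit^'m \<Rightarrow> bit) \<Rightarrow> (bit^'m \<Rightarrow> bit) set" where
  "quad_forms B = {\<phi>. (\<forall>c x. \<phi> (c *s x) = c\<^sup>2 * \<phi> x) \<and>
                      (\<forall>x y. \<phi> (x + y) + \<phi> x + \<phi> y = B x y)}"

definition witt_index :: "(bit^'m \<Rightarrow> bit) \<Rightarrow> (bit^'m) set \<Rightarrow> nat" where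
  "witt_index \<phi> W = Max {vec.dim S |S. vec.subspace S \<and> S \<subseteq> W \<and> (\<forall>x\<in>S. \<phi> x = 0)}"

text \<open>
  On a nondegenerate space of dimension $2m$ the type is $+$ if the Witt index is $m$, and $-$
  if it is $m - 1$.
\<close>

definition has_type :: "(bit^'m \<Rightarrow> bit) \<Rightarrow> (bit^'m) set \<Rightarrow> int \<Rightarrow> bool" where
  "has_type \<phi> W \<epsilon> \<longleftrightarrow>
     \<epsilon> = 1 \<and> vec.dim W = 2 * witt_index \<phi> W \<or>
     \<epsilon> = -1 \<and> vec.dim W = 2 * (witt_index \<phi> W + 1)"

definition quads :: "(bit^'m \<Rightarrow> bit^'m \<Rightarrow> bit) \<Rightarrow> int \<Rightarrow> (bit^'m \<Rightarrow> bit) set" where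
  "quads B \<epsilon> = {\<phi> \<in> quad_forms B. has_type \<phi> UNIV \<epsilon>}"

definition form_act ::
  "(bit^'m \<Rightarrow> bit^'m \<Rightarrow> bit) \<Rightarrow> int \<Rightarrow> (bit^'m \<Rightarrow> bit^'m) \<Rightarrow> (bit^'m \<Rightarrow> bit) \<Rightarrow> (bit^'m \<Rightarrow> bit)" where
  "form_act B \<epsilon> g = (\<lambda>\<phi>\<in>quads B \<epsilon>. \<phi> \<circ> inv_into UNIV g)"

subsection \<open>Stabilisers\<close>

definition stab_subspace ::
  "(bit^'m \<Rightarrow> bit^'m \<Rightarrow> bit) \<Rightarrow> (bit^'m) set \<Rightarrow> (bit^'m \<Rightarrow> bit^'m) set" where
  "stab_subspace B U = {g \<in> carrier (Sp B). g ` U = U}"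

definition stab_pair ::
  "(bit^'m \<Rightarrow> bit^'m \<Rightarrow> bit) \<Rightarrow> (bit^'m) set \<Rightarrow> (bit^'m \<Rightarrow> bit^'m) set" where
  "stab_pair B U = {g \<in> carrier (Sp B). {g ` U, g ` perp B U} = {U, perp B U}}"

definition stab_codeword ::
  "(bit^'m \<Rightarrow> bit^'m \<Rightarrow> bit) \<Rightarrow> int \<Rightarrow> (bit^'m \<Rightarrow> bit) set \<Rightarrow> (bit^'m \<Rightarrow> bit^'m) set" where
  "stab_codeword B \<epsilon> \<Delta> = {g \<in> carrier (Sp B). form_act B \<epsilon> g ` \<Delta> = \<Delta>}"

subsection \<open>Group theory\<close>

definition maximal_subgroup :: "'a set \<Rightarrow> ('a, 'b) monoid_scheme \<Rightarrow> bool" where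
  "maximal_subgroup M G \<longleftrightarrow> subgroup M G \<and> M \<noteq> carrier G \<and>
     (\<forall>K. subgroup K G \<and> M \<subseteq> K \<longrightarrow> K = M \<or> K = carrier G)"

definition internal_semidirect ::
  "('a, 'b) monoid_scheme \<Rightarrow> 'a set \<Rightarrow> 'a set \<Rightarrow> bool" where
  "internal_semidirect G N K \<longleftrightarrow>
     N \<lhd> G \<and> subgroup K G \<and> N \<inter> K = {\<one>\<^bsub>G\<^esub>} \<and> N <#>\<^bsub>G\<^esub> K = carrier G"

text \<open>The wreath product of \<open>H\<close> by the symmetric group $S_r$ acting on $\{1,\dots,r\}$.\<close>

definition wreath_sym ::
  "('a, 'b) monoid_scheme \<Rightarrow> nat \<Rightarrow> ((nat \<Rightarrow> 'a) \<times> (nat \<Rightarrow> nat)) monoid" where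
  "wreath_sym H r =
     \<lparr>carrier = ({1..r} \<rightarrow>\<^sub>E carrier H) \<times> carrier (sym_group r),
      mult = (\<lambda>(f, p) (h, q).
        (\<lambda>i\<in>{1..r}. f i \<otimes>\<^bsub>H\<^esub> h (inv_into UNIV p i), p \<otimes>\<^bsub>sym_group r\<^esub> q)),
      one = (\<lambda>i\<in>{1..r}. \<one>\<^bsub>H\<^esub>, \<one>\<^bsub>sym_group r\<^esub>)\<rparr>"

subsection \<open>Codes in Johnson graphs\<close>

definition johnson_vertices :: "'p set \<Rightarrow> nat \<Rightarrow> 'p set set" where
  "johnson_vertices P k = {\<Delta>. \<Delta> \<subseteq> P \<and> finite \<Delta> \<and> card \<Delta> = k}"

definition johnson_adj :: "nat \<Rightarrow> 'p set \<Rightarrow> 'p set \<Rightarrow> bool" where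
  "johnson_adj k \<Delta> \<Delta>' \<longleftrightarrow> int (card (\<Delta> \<inter> \<Delta>')) = int k - 1"

definition johnson_aut :: "'p set \<Rightarrow> nat \<Rightarrow> ('p set \<Rightarrow> 'p set) monoid" where
  "johnson_aut P k = BijGroup (johnson_vertices P k)
     \<lparr>carrier := {f \<in> Bij (johnson_vertices P k).
        \<forall>\<Delta>\<in>johnson_vertices P k. \<forall>\<Delta>'\<in>johnson_vertices P k.
          johnson_adj k (f \<Delta>) (f \<Delta>') \<longleftrightarrow> johnson_adj k \<Delta> \<Delta>'}\<rparr>"

definition johnson_code :: "'p set \<Rightarrow> nat \<Rightarrow> 'p set set \<Rightarrow> bool" where
  "johnson_code P k \<Gamma> \<longleftrightarrow> \<Gamma> \<noteq> {} \<and> \<Gamma> \<subseteq> johnson_vertices P k"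

definition code_aut :: "'p set \<Rightarrow> nat \<Rightarrow> 'p set set \<Rightarrow> ('p set \<Rightarrow> 'p set) monoid" where
  "code_aut P k \<Gamma> = (johnson_aut P k)
     \<lparr>carrier := {f \<in> carrier (johnson_aut P k). f ` \<Gamma> = \<Gamma>}\<rparr>"

definition compl_map :: "'p set \<Rightarrow> nat \<Rightarrow> 'p set \<Rightarrow> 'p set" where
  "compl_map P k = (\<lambda>\<Delta>\<in>johnson_vertices P k. P - \<Delta>)"

definition self_complementary :: "'p set \<Rightarrow> 'p set set \<Rightarrow> bool" where
  "self_complementary P \<Gamma> \<longleftrightarrow> {P - \<Delta> |\<Delta>. \<Delta> \<in> \<Gamma>} = \<Gamma>"

definition strongly_incidence_transitive ::
  "('g, 'b) monoid_scheme \<Rightarrow> ('g \<Rightarrow> 'p \<Rightarrow> 'p) \<Rightarrow> 'p set \<Rightarrow> 'p set set \<Rightarrow> bool" where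
  "strongly_incidence_transitive G act P \<Gamma> \<longleftrightarrow>
     group_action G P act \<and>
     (\<forall>g\<in>carrier G. (`) (act g) ` \<Gamma> = \<Gamma>) \<and>
     (\<forall>\<Delta>\<in>\<Gamma>. \<forall>\<Delta>'\<in>\<Gamma>. \<exists>g\<in>carrier G. act g ` \<Delta> = \<Delta>') \<and>
     (\<forall>\<Delta>\<in>\<Gamma>. \<forall>a\<in>\<Delta>. \<forall>b\<in>P - \<Delta>. \<forall>a'\<in>\<Delta>. \<forall>b'\<in>P - \<Delta>.
        \<exists>g\<in>carrier G. act g ` \<Delta> = \<Delta> \<and> act g a = a' \<and> act g b = b')"

definition induced_act ::
  "('g \<Rightarrow> 'p \<Rightarrow> 'p) \<Rightarrow> 'p set \<Rightarrow> nat \<Rightarrow> 'g \<Rightarrow> 'p set \<Rightarrow> 'p set" where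
  "induced_act act P k g = (\<lambda>\<Delta>\<in>johnson_vertices P k. act g ` \<Delta>)"

subsection \<open>The codes\<close>

definition codeword ::
  "(bit^'m \<Rightarrow> bit^'m \<Rightarrow> bit) \<Rightarrow> int \<Rightarrow> int \<Rightarrow> (bit^'m) set \<Rightarrow> (bit^'m \<Rightarrow> bit) set" where
  "codeword B \<epsilon> \<epsilon>' U =
     {\<phi> \<in> quads B \<epsilon>. has_type \<phi> U \<epsilon>' \<and> has_type \<phi> (perp B U) (\<epsilon> * \<epsilon>')}"

definition sp_code ::
  "(bit^'m \<Rightarrow> bit^'m \<Rightarrow> bit) \<Rightarrow> nat \<Rightarrow> int \<Rightarrow> int \<Rightarrow> (bit^'m \<Rightarrow> bit) set set" where
  "sp_code B d \<epsilon> \<epsilon>' = codeword B \<epsilon> \<epsilon>' ` nondeg_subspaces B (2 * d)"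

end

theory Submission
  imports Defs "HOL-Algebra.Multiplicative_Group"
begin

text \<open>
  With \<open>sg\<close> the nontrivial additive character of the two-element field, the type of a form \<open>\<phi>\<close> on a
  nondegenerate \<open>W\<close> is the sign of the Gauss sum of \<open>sg (\<phi> x)\<close> over \<open>x \<in> W\<close>. Every form is a translate
  \<open>\<phi> + B a\<close> of a fixed one, so relative to a base form \<open>\<phi>\<close> the point set is the set of singular vectors
  \<open>a\<close> of \<open>\<phi>\<close>, and a codeword consists of those singular vectors whose two components along \<open>U\<close> and
  \<open>perp B U\<close> are singular. Products of at most two transvections fixing a subspace pointwise give all
  the transitivity that is needed, and maximality of the stabiliser of \<open>{U, perp B U}\<close>, since
  transvections generate the symplectic group.

  For the automorphism group, every automorphism of the Johnson graph comes from a permutation of the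
  points, possibly followed by complementation, because the neighbours of a vertex form a rook graph. A
  permutation preserving the code may be assumed to fix \<open>\<phi>\<close>. It then acts on the singular vectors of \<open>\<phi>\<close>
  and preserves the number of codewords through any three or four points. Evaluating these numbers by
  Gauss sums shows that they determine \<open>B a b\<close>, and a permutation of the singular vectors that preserves
  \<open>B\<close> extends to an isometry, since singular vectors span.
\<close>

subsection \<open>Vector spaces over the field with two elements\<close>

text \<open>Types are handled as signs because Gauss sums multiply over \<open>U\<close> and
  \<open>perp B U\<close> and change by a factor \<open>sg\<close> under twisting; Witt indices
  offer nothing comparable. For codewords through \<open>\<phi>\<close> the sums on the two summands
  are the constants \<open>y = \<epsilon>' * 2 ^ d\<close> and
  \<open>z = \<epsilon> * \<epsilon>' * 2 ^ (n - d)\<close>, so every count inside a codeword is a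
  polynomial in \<open>y\<close> and \<open>z\<close>.

  Isometries of \<open>\<phi>\<close> are transitive on pairs of singular vectors of each kind, so
  the number of codewords through a pair depends on its kind only. Equality of the numbers for the
  two kinds is a polynomial equation that factors completely, and \<open>y + z\<close> is its only
  factor that can vanish. It vanishes exactly for \<open>2 * d = n\<close> and
  \<open>\<epsilon> = -1\<close>, which forces the use of four points there. Transitivity needs
  room: \<open>3 \<le> n\<close> for pairs, \<open>4 \<le> n\<close> for triples. What is left is
  \<open>n = 2\<close> in minus type, where distinct nonzero singular vectors are never orthogonal,
  so there is nothing to tell apart.\<close>

declare add_bit_eq_xor [simp del] mult_bit_eq_and [simp del]

instance bit :: finite
proof
  have "(UNIV :: bit set) = {0, 1}"
    by auto
  then show "finite (UNIV :: bit set)"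
    by (metis finite.simps)
qed

lemma bit_add_self [simp]: "a + a = (0::bit)"
  by (cases a) auto

lemma bit_add_self_left [simp]: "a + (a + b) = (b::bit)"
  by (simp flip: add.assoc)

lemma bit_add_eq_0_iff [simp]: "a + b = (0::bit) \<longleftrightarrow> a = b"
  by (cases a; cases b) auto

lemma vec_add_self [simp]: "x + x = (0 :: bit^'m)"
  by (simp add: vec_eq_iff)

lemma vec_add_self_left [simp]: "x + (x + y) = (y :: bit^'m)"
  by (simp flip: add.assoc)

lemma vec_add_eq_0_iff [simp]: "x + y = (0 :: bit^'m) \<longleftrightarrow> x = y"
  by (metis add_0_right vec_add_self_left)

text \<open>The only scalars are 0 and 1, so closure under scaling comes for free.\<close>

lemma subspace_bit_iff:
  "vec.subspace (U :: (bit^'m) set) \<longleftrightarrow> 0 \<in> U \<and> (\<forall>x\<in>U. \<forall>y\<in>U. x + y \<in> U)"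
proof -
  have "c *s x \<in> U" if "0 \<in> U" "x \<in> U" for c :: bit and x :: "bit^'m"
    using that by (cases c) auto
  then show ?thesis
    by (auto simp: vec.subspace_def)
qed

lemma additive_imp_linear:
  assumes "\<And>x y. g (x + y) = g x + g (y :: bit^'m)"
  shows "Vector_Spaces.linear (*s) (*s) (g :: bit^'m \<Rightarrow> bit^'m)"
proof -
  have "g 0 = 0"
    by (metis add_0_right assms vec_add_self)
  then have "g (c *s x) = c *s g x" for c x
    by (cases c) auto
  then show ?thesis
    using assms by unfold_locales (auto simp: vector_space_over_itself.scale_right_distrib
      vec.scale_right_distrib vec.scale_left_distrib)
qed

text \<open>Adding a generator adds at most one coset, the shift by \<open>x\<close>. Dimension
  arguments are run as counting arguments by means of this doubling.\<close>

lemma span_insert_bit: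
  "vec.span (insert x S) = vec.span S \<union> (\<lambda>y. x + y) ` vec.span (S :: (bit^'m) set)"
proof -
  have "y \<in> (\<lambda>y. x + y) ` vec.span S \<longleftrightarrow> y - x \<in> vec.span S" for y
    by (auto simp: image_iff) (metis add.commute diff_add_cancel)
  moreover have "(\<exists>c. P c) \<longleftrightarrow> P 0 \<or> P 1" for P :: "bit \<Rightarrow> bool"
    by (metis bit.exhaust)
  ultimately show ?thesis
    by (auto simp: vec.span_insert)
qed

lemma card_span_le: "finite S \<Longrightarrow> card (vec.span (S :: (bit^'m) set)) \<le> 2 ^ card S"
proof (induction rule: finite_induct)
  case (insert x S)
  have "card (vec.span (insert x S)) \<le> card (vec.span S) + card ((\<lambda>y. x + y) ` vec.span S)"
    unfolding span_insert_bit by (rule card_Un_le)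
  also have "\<dots> \<le> 2 * card (vec.span S)"
    by (simp add: card_image_le)
  finally show ?case
    using insert by simp
qed simp

lemma card_span_insert:
  assumes "x \<notin> vec.span (S :: (bit^'m) set)"
  shows "card (vec.span (insert x S)) = 2 * card (vec.span S)"
proof -
  have "x + y \<notin> vec.span S" if "y \<in> vec.span S" for y
    using that assms by (metis vec.span_add_eq2)
  then have "vec.span S \<inter> (\<lambda>y. x + y) ` vec.span S = {}"
    by auto
  then show ?thesis
    unfolding span_insert_bit by (subst card_Un_disjoint) (auto simp: card_image)
qed

lemma card_subspace: "vec.subspace U \<Longrightarrow> card U = 2 ^ vec.dim (U :: (bit^'m) set)"
proof -
  assume U: "vec.subspace U"
  obtain b where b: "b \<subseteq> U" "vec.independent b" "U \<subseteq> vec.span b" "card b = vec.dim U"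
    using vec.basis_exists by blast
  have "card (vec.span b) = 2 ^ card b"
    if "finite b" "vec.independent b" for b :: "(bit^'m) set"
    using that
  proof (induction rule: finite_induct)
    case (insert x S)
    then show ?case
      using card_span_insert[of x S] by (auto simp: vec.independent_insert split: if_splits)
  qed simp
  moreover have "vec.span b = U"
    using b U by (simp add: vec.span_minimal subset_antisym)
  ultimately show ?thesis
    using b by (metis finite)
qed

lemma subspace_eq_by_card:
  assumes "U \<subseteq> W" "card W \<le> card (U :: (bit^'m) set)"
  shows "U = W"
  using assms by (simp add: card_seteq)

definition sg :: "bit \<Rightarrow> int" where
  "sg b = (if b = 0 then 1 else -1)"

lemma sg_simps [simp]: "sg 0 = 1" "sg 1 = -1"
  by (auto simp: sg_def)

lemma sg_add: "sg (a + b) = sg a * sg b"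
  by (cases a; cases b) auto

lemma sg_square [simp]: "sg a * sg a = 1" "sg a * (sg a * t) = t"
  by (cases a; simp)+

lemma sg_eq_iff [simp]: "sg a = sg b \<longleftrightarrow> a = b"
  by (cases a; cases b) auto

text \<open>Translation by a vector at which \<open>f\<close> is 1 reverses every sign. This
  orthogonality relation is behind all evaluations of Gauss sums below.\<close>

lemma character_sum:
  assumes "vec.subspace (U :: (bit^'m) set)"
    and add: "\<And>x y. x \<in> U \<Longrightarrow> y \<in> U \<Longrightarrow> f (x + y) = f x + f y"
  shows "(\<Sum>x\<in>U. sg (f x)) = (if \<forall>x\<in>U. f x = 0 then int (card U) else 0)"
proof (cases "\<forall>x\<in>U. f x = 0")
  case False
  then obtain y where y: "y \<in> U" "f y = 1"
    by auto
  have U: "x + z \<in> U" if "x \<in> U" "z \<in> U" for x z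
    using that assms(1) by (simp add: subspace_bit_iff)
  have "(\<Sum>x\<in>U. sg (f x)) = (\<Sum>x\<in>U. sg (f (x + y)))"
    by (rule sum.reindex_bij_witness[of _ "\<lambda>x. x + y" "\<lambda>x. x + y"])
      (auto simp: add.assoc U y)
  also have "\<dots> = - (\<Sum>x\<in>U. sg (f x))"
    by (simp add: add y sg_add sum_negf)
  finally show ?thesis
    using False by auto
qed simp

text \<open>The kernel and one translate of it cover \<open>U\<close>. Each further linear condition
  therefore costs at most a factor of two, which is how \<open>nonsingular_move\<close> estimates
  the room it has.\<close>

lemma card_kernel_ge:
  assumes "vec.subspace (U :: (bit^'m) set)"
    and add: "\<And>x y. x \<in> U \<Longrightarrow> y \<in> U \<Longrightarrow> f (x + y) = f x + (f y :: bit)"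
  shows "card U \<le> 2 * card {x\<in>U. f x = 0}"
proof (cases "\<exists>y\<in>U. f y = 1")
  case True
  then obtain y where y: "y \<in> U" "f y = 1"
    by auto
  have "U \<subseteq> {x\<in>U. f x = 0} \<union> (\<lambda>x. x + y) ` {x\<in>U. f x = 0}"
  proof
    fix x assume x: "x \<in> U"
    then have "x + y \<in> U"
      using assms(1) y by (simp add: subspace_bit_iff)
    moreover have "x = (x + y) + y"
      by (simp add: add.assoc)
    ultimately show "x \<in> {x\<in>U. f x = 0} \<union> (\<lambda>x. x + y) ` {x\<in>U. f x = 0}"
      using add[OF x y(1)] x y by (cases "f x") (auto intro!: image_eqI[where x="x+y"])
  qed
  then have "card U \<le> card ({x\<in>U. f x = 0} \<union> (\<lambda>x. x + y) ` {x\<in>U. f x = 0})"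
    by (simp add: card_mono)
  also have "\<dots> \<le> card {x\<in>U. f x = 0} + card ((\<lambda>x. x + y) ` {x\<in>U. f x = 0})"
    by (rule card_Un_le)
  also have "\<dots> \<le> 2 * card {x\<in>U. f x = 0}"
    by (simp add: card_image_le)
  finally show ?thesis .
next
  case False
  then have "{x\<in>U. f x = 0} = U"
    by auto
  then show ?thesis
    by simp
qed

section \<open>Orthogonal complements and projections\<close>

locale symplectic_space =
  fixes B :: "bit^'m \<Rightarrow> bit^'m \<Rightarrow> bit"
  assumes symplectic: "symplectic_form B"
begin

lemma B_add [simp]: "B (x + y) z = B x z + B y z" "B x (y + z) = B x y + B x z"
  using symplectic vec.linear_add
  unfolding symplectic_form_def Vector_Spaces.linear_def module_hom_def module_hom_axioms_def
  by metis+

lemma B_zero [simp]: "B 0 x = 0" "B x 0 = 0"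
  using B_add by (metis add_0_right bit_add_self vec_add_self)+

lemma B_self [simp]: "B x x = 0"
  using symplectic by (simp add: symplectic_form_def)

lemma B_sym: "B x y = B y x"
proof -
  have "B (x + y) (x + y) = B x x + B y x + (B x y + B y y)"
    by (simp only: B_add)
  then have "B y x + B x y = 0"
    by (simp only: B_self) simp
  then show ?thesis
    by simp
qed

lemma B_nondeg: "(\<And>y. B x y = 0) \<Longrightarrow> x = 0"
  using symplectic by (simp add: symplectic_form_def)

lemma B_eqI: "(\<And>z. B x z = B y z) \<Longrightarrow> x = y"
  using B_nondeg[of "x + y"] by simp

lemma subspace_perp [simp, intro]: "vec.subspace (perp B U)"
  by (auto simp: subspace_bit_iff perp_def)

lemma perp_antimono: "U \<subseteq> W \<Longrightarrow> perp B W \<subseteq> perp B U"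
  by (auto simp: perp_def)

lemma perpD: "x \<in> perp B U \<Longrightarrow> u \<in> U \<Longrightarrow> B x u = 0" "x \<in> perp B U \<Longrightarrow> u \<in> U \<Longrightarrow> B u x = 0"
  by (auto simp: perp_def B_sym)

lemma perp_span [simp]: "perp B (vec.span S) = perp B S"
proof
  have "vec.span S \<subseteq> perp B (perp B S)"
    by (rule vec.span_minimal[OF _ subspace_perp]) (auto simp: perpD perp_def[of B "perp B S"])
  then show "perp B S \<subseteq> perp B (vec.span S)"
    using B_sym by (fastforce simp: perp_def)
qed (auto simp: perp_def vec.span_base)

lemma perp_UNIV [simp]: "perp B UNIV = {0}"
  by (auto simp: perp_def intro: B_nondeg)

definition nondeg :: "(bit^'m) set \<Rightarrow> bool" where
  "nondeg U \<longleftrightarrow> vec.subspace U \<and> nondegenerate B U"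

lemma nondeg_UNIV [simp]: "nondeg UNIV"
  by (simp add: nondeg_def nondegenerate_def)

lemma nondegD:
  assumes "nondeg U"
  shows "vec.subspace U" "0 \<in> U" "x \<in> U \<Longrightarrow> y \<in> U \<Longrightarrow> x + y \<in> U"
    "x \<in> U \<Longrightarrow> (\<And>y. y \<in> U \<Longrightarrow> B x y = 0) \<Longrightarrow> x = 0"
    "x \<in> U \<Longrightarrow> x \<in> perp B U \<Longrightarrow> x = 0"
  using assms by (auto simp: nondeg_def nondegenerate_def subspace_bit_iff perp_def)

lemma nondeg_add_in_iff: "nondeg U \<Longrightarrow> x \<in> U \<Longrightarrow> x + y \<in> U \<longleftrightarrow> y \<in> U"
  by (metis nondegD(3) vec_add_self_left)

text \<open>Double counting of the sum of \<open>sg (B x u)\<close> over \<open>W\<close> and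
  \<open>U\<close>: summing over \<open>U\<close> first keeps the \<open>x\<close> orthogonal to
  \<open>U\<close>, summing over \<open>W\<close> first keeps only \<open>u = 0\<close>, as
  \<open>W\<close> is nondegenerate.\<close>

lemma card_perp_in:
  assumes U: "vec.subspace U" and W: "nondeg W" "U \<subseteq> W"
  shows "card U * card (W \<inter> perp B U) = card W"
proof -
  have "(\<Sum>x\<in>W. \<Sum>u\<in>U. sg (B x u)) = (\<Sum>x\<in>W. if x \<in> perp B U then int (card U) else 0)"
    using U by (intro sum.cong refl, subst character_sum) (auto simp: perp_def)
  also have "\<dots> = int (card U * card (W \<inter> perp B U))"
    by (simp flip: sum.inter_filter add: Int_def)
  finally have 1: "(\<Sum>x\<in>W. \<Sum>u\<in>U. sg (B x u)) = int (card U * card (W \<inter> perp B U))" .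
  have "(\<Sum>x\<in>W. \<Sum>u\<in>U. sg (B x u)) = (\<Sum>u\<in>U. \<Sum>x\<in>W. sg (B x u))"
    by (rule sum.swap)
  also have "\<dots> = (\<Sum>u\<in>U. if u = 0 then int (card W) else 0)"
  proof (rule sum.cong[OF refl])
    fix u assume "u \<in> U"
    then have "u \<in> W"
      using W by auto
    then have "(\<forall>x\<in>W. B x u = 0) \<longleftrightarrow> u = 0"
      using nondegD(4)[OF W(1), of u] B_sym by fastforce
    then show "(\<Sum>x\<in>W. sg (B x u)) = (if u = 0 then int (card W) else 0)"
      using nondegD(1)[OF W(1)] by (subst character_sum) auto
  qed
  also have "\<dots> = int (card W)"
    using U by (simp add: subspace_bit_iff)
  finally show ?thesis
    using 1 by linarith
qed

lemma card_perp: "vec.subspace U \<Longrightarrow> card U * card (perp B U) = CARD(bit^'m)"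
  using card_perp_in[of U UNIV] by simp

text \<open>One inclusion is immediate; two uses of \<open>card_perp\<close> show that the sizes
  agree.\<close>

lemma perp_perp [simp]:
  assumes "vec.subspace U"
  shows "perp B (perp B U) = U"
proof (rule sym, rule subspace_eq_by_card)
  show "U \<subseteq> perp B (perp B U)"
    by (auto simp: perp_def B_sym)
  have "card U * card (perp B U) = card (perp B U) * card (perp B (perp B U))"
    by (simp add: card_perp assms)
  moreover have "card (perp B U) > 0"
    by (simp add: card_gt_0_iff) (metis empty_iff subspace_bit_iff subspace_perp)
  ultimately show "card (perp B (perp B U)) \<le> card U"
    by (auto simp: card_gt_0_iff)
qed

lemma nondeg_perp [simp]: "nondeg U \<Longrightarrow> nondeg (perp B U)"
  by (auto simp: nondeg_def nondegenerate_def)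

lemma nondeg_perp_perp [simp]: "nondeg U \<Longrightarrow> perp B (perp B U) = U"
  by (simp add: nondeg_def)

lemma bij_betw_sum:
  assumes "nondeg U"
  shows "bij_betw (\<lambda>(u, w). u + w) (U \<times> perp B U) UNIV"
proof -
  have "inj_on (\<lambda>(u, w). u + w) (U \<times> perp B U)"
  proof (rule inj_onI, clarify)
    fix u w u' w' assume *: "u \<in> U" "w \<in> perp B U" "u' \<in> U" "w' \<in> perp B U" "u + w = u' + w'"
    then have "u + u' = w + w'"
      by (metis add.assoc add.commute vec_add_self_left)
    moreover have "u + u' \<in> U" "w + w' \<in> perp B U"
      using * assms by (auto simp: nondegD nondegD(3)[OF nondeg_perp])
    ultimately have "u + u' = 0"
      using assms nondegD(5) by metis
    then show "u = u' \<and> w = w'"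
      using * by simp
  qed
  moreover have "(\<lambda>(u, w). u + w) ` (U \<times> perp B U) = UNIV"
    using assms calculation
    by (intro card_subset_eq) (auto simp: card_image card_cartesian_product card_perp nondegD)
  ultimately show ?thesis
    by (simp add: bij_betw_def)
qed

lemma nondeg_decomp:
  assumes "nondeg U"
  obtains u w where "u \<in> U" "w \<in> perp B U" "x = u + w"
  using bij_betw_sum[OF assms] by (force simp: bij_betw_def image_iff set_eq_iff)

lemma sum_nondeg_decomp:
  assumes "nondeg U"
  shows "(\<Sum>x\<in>UNIV. f x) = (\<Sum>u\<in>U. \<Sum>w\<in>perp B U. f (u + w))"
  by (simp add: sum.cartesian_product sum.reindex_bij_betw[OF bij_betw_sum[OF assms], symmetric]
      case_prod_unfold)

text \<open>The orthogonal projection onto \<open>U\<close>. In characteristic two the complementary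
  component of \<open>x\<close> is \<open>x + proj U x\<close>, and it is written in this way
  throughout.\<close>

definition proj :: "(bit^'m) set \<Rightarrow> bit^'m \<Rightarrow> bit^'m" where
  "proj U x = (THE u. u \<in> U \<and> x + u \<in> perp B U)"

lemma proj_eqI:
  assumes "nondeg U" "u \<in> U" "x + u \<in> perp B U"
  shows "proj U x = u"
  unfolding proj_def
proof (rule the_equality)
  fix v assume v: "v \<in> U \<and> x + v \<in> perp B U"
  then have "u + v \<in> U" "(x + u) + (x + v) \<in> perp B U"
    using assms nondegD(3) nondeg_perp by blast+
  moreover have "(x + u) + (x + v) = u + v"
    by (simp add: add_ac)
  ultimately show "v = u"
    using nondegD(5)[OF assms(1), of "u + v"] by simp
qed (use assms in auto)

lemma proj_add [simp]:
  assumes "nondeg U" "u \<in> U" "w \<in> perp B U"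
  shows "proj U (u + w) = u"
  using assms by (intro proj_eqI) (auto simp: add_ac)

lemma proj_props:
  assumes "nondeg U"
  shows "proj U x \<in> U" "x + proj U x \<in> perp B U" "proj (perp B U) x = x + proj U x"
    "x \<in> U \<Longrightarrow> proj U x = x" "x \<in> perp B U \<Longrightarrow> proj U x = 0"
    "proj U (x + y) = proj U x + proj U y"
proof -
  show 1: "proj U x \<in> U" "x + proj U x \<in> perp B U" for x
    by (rule nondeg_decomp[OF assms, of x]; simp add: assms add_ac)+
  show "proj (perp B U) x = x + proj U x"
    using assms 1 by (intro proj_eqI) auto
  show "x \<in> U \<Longrightarrow> proj U x = x" "x \<in> perp B U \<Longrightarrow> proj U x = 0"
    using assms by (auto intro!: proj_eqI simp: nondegD nondegD[OF nondeg_perp])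
  have "(x + proj U x) + (y + proj U y) \<in> perp B U"
    using 1 nondegD(3)[OF nondeg_perp[OF assms]] by blast
  then have "(x + y) + (proj U x + proj U y) \<in> perp B U"
    by (simp add: add_ac)
  then show "proj U (x + y) = proj U x + proj U y"
    using 1 assms nondegD(3)[OF assms] by (intro proj_eqI) auto
qed

lemma B_proj: 
  assumes "nondeg U" "y \<in> U"
  shows "B x y = B (proj U x) y"
  using proj_props(2)[OF assms(1), of x] assms(2) by (auto dest!: perpD(1))

end

subsection \<open>Quadratic forms and their types\<close>

context symplectic_space
begin

definition qsum :: "(bit^'m \<Rightarrow> bit) \<Rightarrow> (bit^'m) set \<Rightarrow> int" where
  "qsum \<phi> W = (\<Sum>x\<in>W. sg (\<phi> x))"

definition twist :: "(bit^'m \<Rightarrow> bit) \<Rightarrow> bit^'m \<Rightarrow> bit^'m \<Rightarrow> bit" where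
  "twist \<phi> a = (\<lambda>x. \<phi> x + B a x)"

lemma quad_forms_iff: "\<phi> \<in> quad_forms B \<longleftrightarrow> (\<forall>x y. \<phi> (x + y) = \<phi> x + \<phi> y + B x y)"
proof
  assume "\<phi> \<in> quad_forms B"
  then have *: "B x y = \<phi> (x + y) + \<phi> x + \<phi> y" for x y
    by (simp add: quad_forms_def)
  show "\<forall>x y. \<phi> (x + y) = \<phi> x + \<phi> y + B x y"
    unfolding * by (simp add: add_ac)
next
  assume *: "\<forall>x y. \<phi> (x + y) = \<phi> x + \<phi> y + B x y"
  then have "\<phi> (0 + 0) = \<phi> 0 + \<phi> 0 + B 0 0"
    by blast
  then have "\<phi> 0 = 0"
    by simp
  then have "\<phi> (c *s x) = c\<^sup>2 * \<phi> x" for c x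
    by (cases c) auto
  moreover have "\<phi> (x + y) + \<phi> x + \<phi> y = B x y" for x y
    by (subst *[rule_format]) (simp add: add_ac)
  ultimately show "\<phi> \<in> quad_forms B"
    by (simp add: quad_forms_def)
qed

lemma quad_add: "\<phi> \<in> quad_forms B \<Longrightarrow> \<phi> (x + y) = \<phi> x + \<phi> y + B x y"
  by (simp add: quad_forms_iff)

lemma quad_zero [simp]: "\<phi> \<in> quad_forms B \<Longrightarrow> \<phi> 0 = 0"
  using quad_add[of \<phi> 0 0] by simp

lemma twist_quad [simp, intro]: "\<phi> \<in> quad_forms B \<Longrightarrow> twist \<phi> a \<in> quad_forms B"
  by (simp add: quad_forms_iff twist_def add_ac)

lemma twist_twist [simp]: "twist (twist \<phi> a) b = twist \<phi> (a + b)"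
  by (simp add: twist_def add_ac)

lemma twist_zero [simp]: "twist \<phi> 0 = \<phi>"
  by (simp add: twist_def)

lemma twist_inj [simp]: "twist \<phi> a = twist \<phi> b \<longleftrightarrow> a = b"
  by (auto simp: twist_def fun_eq_iff intro: B_eqI)

text \<open>A nonzero vector \<open>a\<close> orthogonal to the kernel of \<open>f\<close> gives a
  functional \<open>B a\<close> that vanishes on this kernel and is constant off it; being nonzero,
  it must be \<open>f\<close>.\<close>

lemma functional_representation:
  assumes add: "\<And>x y. f (x + y) = f x + f y"
  obtains a where "\<And>x. f x = B a x"
proof (cases "\<forall>x. f x = 0")
  case True
  then show ?thesis
    using that[of 0] by simp
next
  case False
  then obtain y where y: "f y = 1"
    by auto
  define K where "K = {x. f x = 0}"
  have f0: "f 0 = 0"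
    using add[of 0 0] by simp
  have K: "vec.subspace K"
    using f0 by (auto simp: K_def subspace_bit_iff add)
  have "K \<noteq> UNIV"
    using y by (metis K_def UNIV_I mem_Collect_eq zero_neq_one)
  have "perp B K \<noteq> {0}"
    using perp_perp[OF K] \<open>K \<noteq> UNIV\<close> by (auto simp: perp_def[of _ "{0}"])
  then obtain a where a: "a \<in> perp B K" "a \<noteq> 0"
    using subspace_perp[of K] by (auto simp: subspace_bit_iff)
  have off: "B a x = B a y" if "f x = 1" for x
  proof -
    have "x + y \<in> K"
      using that y by (simp add: K_def add)
    then show ?thesis
      using a(1) by (auto dest: perpD(1))
  qed
  have on: "B a x = 0" if "f x = 0" for x
    using that a(1) by (auto simp: K_def dest: perpD(1))
  have "B a y = 1"
  proof (rule ccontr)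
    assume "B a y \<noteq> 1"
    then have "B a x = 0" for x
      using on[of x] off[of x] by (cases "f x") auto
    then show False
      using a(2) B_nondeg by blast
  qed
  then have "f x = B a x" for x
    using on[of x] off[of x] by (cases "f x") auto
  then show ?thesis
    using that by blast
qed

text \<open>The polar forms cancel in the sum of the two forms, which is therefore additive and
  represented by a vector.\<close>

lemma quad_forms_twist:
  assumes "\<phi> \<in> quad_forms B" "\<psi> \<in> quad_forms B"
  obtains a where "\<psi> = twist \<phi> a"
proof -
  have "\<phi> (x + y) + \<psi> (x + y) = (\<phi> x + \<psi> x) + (\<phi> y + \<psi> y)" for x y
    using assms by (simp add: quad_add add_ac)
  then obtain a where a: "\<phi> x + \<psi> x = B a x" for x
    using functional_representation[of "\<lambda>x. \<phi> x + \<psi> x"] by metis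
  have "\<psi> x = \<phi> x + B a x" for x
    unfolding a[symmetric] by simp
  then show ?thesis
    using that by (auto simp: twist_def)
qed

text \<open>The classical modulus of a Gauss sum: after the substitution \<open>y = x + z\<close>
  the inner sum over \<open>x\<close> is a character sum that vanishes unless
  \<open>z = 0\<close>.\<close>

lemma qsum_square:
  assumes "\<phi> \<in> quad_forms B" "nondeg W"
  shows "qsum \<phi> W * qsum \<phi> W = int (card W)"
proof -
  have "qsum \<phi> W * qsum \<phi> W = (\<Sum>x\<in>W. \<Sum>y\<in>W. sg (\<phi> x) * sg (\<phi> y))"
    by (simp add: qsum_def sum_product)
  also have "\<dots> = (\<Sum>x\<in>W. \<Sum>z\<in>W. sg (\<phi> z) * sg (B z x))"
  proof (rule sum.cong[OF refl])
    fix x assume x: "x \<in> W"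
    have "(\<Sum>y\<in>W. sg (\<phi> x) * sg (\<phi> y)) = (\<Sum>z\<in>W. sg (\<phi> x) * sg (\<phi> (x + z)))"
      by (rule sum.reindex_bij_witness[of _ "\<lambda>z. x + z" "\<lambda>z. x + z"])
        (auto simp: x nondegD(3)[OF assms(2)])
    then show "(\<Sum>y\<in>W. sg (\<phi> x) * sg (\<phi> y)) = (\<Sum>z\<in>W. sg (\<phi> z) * sg (B z x))"
      using assms(1) by (simp add: quad_add sg_add B_sym[of _ x] mult.assoc)
  qed
  also have "\<dots> = (\<Sum>z\<in>W. sg (\<phi> z) * (\<Sum>x\<in>W. sg (B z x)))"
    by (subst sum.swap) (simp add: sum_distrib_left)
  also have "\<dots> = (\<Sum>z\<in>W. if z = 0 then int (card W) else 0)"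
  proof (rule sum.cong[OF refl])
    fix z assume z: "z \<in> W"
    have "(\<forall>x\<in>W. B z x = 0) \<longleftrightarrow> z = 0"
      using nondegD(4)[OF assms(2) z] by auto
    then show "sg (\<phi> z) * (\<Sum>x\<in>W. sg (B z x)) = (if z = 0 then int (card W) else 0)"
      using assms by (subst character_sum) (auto simp: nondegD)
  qed
  also have "\<dots> = int (card W)"
    using assms(2) by (simp add: nondegD)
  finally show ?thesis .
qed

lemma qsum_cong: "(\<And>x. x \<in> W \<Longrightarrow> \<phi> x = \<psi> x) \<Longrightarrow> qsum \<phi> W = qsum \<psi> W"
  by (simp add: qsum_def)

text \<open>Completing the square:
  \<open>\<phi> x + B a x = \<phi> (x + a) + \<phi> a\<close>.\<close>

lemma qsum_twist_in:
  assumes "\<phi> \<in> quad_forms B" "nondeg W" "a \<in> W"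
  shows "qsum (twist \<phi> a) W = sg (\<phi> a) * qsum \<phi> W"
proof -
  have "qsum (twist \<phi> a) W = (\<Sum>x\<in>W. sg (\<phi> a) * sg (\<phi> (x + a)))"
    unfolding qsum_def twist_def using assms(1)
    by (intro sum.cong refl) (simp add: quad_add sg_add B_sym[of _ a] mult_ac)
  also have "\<dots> = (\<Sum>x\<in>W. sg (\<phi> a) * sg (\<phi> x))"
    by (rule sum.reindex_bij_witness[of _ "\<lambda>z. z + a" "\<lambda>z. z + a"])
      (auto simp: assms nondegD(3)[OF assms(2)] add.assoc)
  finally show ?thesis
    by (simp add: qsum_def sum_distrib_left)
qed

lemma qsum_twist:
  assumes "\<phi> \<in> quad_forms B" "nondeg W"
  shows "qsum (twist \<phi> a) W = sg (\<phi> (proj W a)) * qsum \<phi> W"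
proof -
  have "qsum (twist \<phi> a) W = qsum (twist \<phi> (proj W a)) W"
    using B_proj[OF assms(2), of _ a] by (intro qsum_cong) (simp add: twist_def)
  then show ?thesis
    by (simp add: qsum_twist_in assms proj_props)
qed

lemma qsum_decomp:
  assumes "\<phi> \<in> quad_forms B" "nondeg U"
  shows "qsum \<phi> UNIV = qsum \<phi> U * qsum \<phi> (perp B U)"
  unfolding qsum_def sum_nondeg_decomp[OF assms(2)] sum_product
  using assms(1) by (intro sum.cong refl) (simp add: quad_add perpD sg_add)

text \<open>Averaging over translations by \<open>s \<in> T\<close>: since
  \<open>\<phi> (x + s) = \<phi> x + B x s\<close>, the contributions of all \<open>x\<close> not
  orthogonal to \<open>T\<close> cancel.\<close>

lemma qsum_tot_singular:
  assumes \<phi>: "\<phi> \<in> quad_forms B" and W: "nondeg W" and T: "vec.subspace T" "T \<subseteq> W"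
    and sing: "\<And>x. x \<in> T \<Longrightarrow> \<phi> x = 0"
  shows "qsum \<phi> W = qsum \<phi> (W \<inter> perp B T)"
proof -
  have "int (card T) * qsum \<phi> W = (\<Sum>s\<in>T. \<Sum>x\<in>W. sg (\<phi> x))"
    by (simp add: qsum_def)
  also have "\<dots> = (\<Sum>s\<in>T. \<Sum>x\<in>W. sg (\<phi> x) * sg (B x s))"
  proof (rule sum.cong[OF refl])
    fix s assume s: "s \<in> T"
    have "(\<Sum>x\<in>W. sg (\<phi> x)) = (\<Sum>x\<in>W. sg (\<phi> (x + s)))"
      using s T(2)
      by (intro sum.reindex_bij_witness[of _ "\<lambda>z. z + s" "\<lambda>z. z + s"])
        (auto simp: nondegD(3)[OF W] add.assoc)
    then show "(\<Sum>x\<in>W. sg (\<phi> x)) = (\<Sum>x\<in>W. sg (\<phi> x) * sg (B x s))"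
      using \<phi> s sing by (simp add: quad_add sg_add)
  qed
  also have "\<dots> = (\<Sum>x\<in>W. sg (\<phi> x) * (\<Sum>s\<in>T. sg (B x s)))"
    by (subst sum.swap) (simp add: sum_distrib_left)
  also have "\<dots> = (\<Sum>x\<in>W. if x \<in> perp B T then int (card T) * sg (\<phi> x) else 0)"
    using T by (intro sum.cong refl, subst character_sum) (auto simp: perp_def)
  also have "\<dots> = int (card T) * qsum \<phi> (W \<inter> perp B T)"
    by (simp flip: sum.inter_filter add: Int_def qsum_def sum_distrib_left)
  finally have "int (card T) * qsum \<phi> W = int (card T) * qsum \<phi> (W \<inter> perp B T)" .
  moreover have "card T \<noteq> 0"
    using T(1) by (auto simp: subspace_bit_iff)
  ultimately show ?thesis
    by simp
qed

lemma dim_le_witt_index: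
  assumes "vec.subspace T" "T \<subseteq> W" "\<And>x. x \<in> T \<Longrightarrow> \<phi> x = 0"
  shows "vec.dim T \<le> witt_index \<phi> W"
  unfolding witt_index_def using assms
  by (intro Max_ge) (auto intro: finite_subset[OF _ finite_imageI[of UNIV vec.dim]])

text \<open>For a totally singular \<open>T\<close> of maximal dimension \<open>t\<close>, all
  vectors of \<open>M = W \<inter> perp B T\<close> outside \<open>T\<close> have value 1. The Gauss
  sum is thus \<open>2 * card T - card M = 2 * 2 ^ t - 2 ^ u\<close> with
  \<open>t + u = 2 * m\<close>, and its square is \<open>2 ^ (2 * m)\<close>, which leaves only
  \<open>t = m\<close> and \<open>t = m - 1\<close>.\<close>

lemma witt_index_cases:
  assumes \<phi>: "\<phi> \<in> quad_forms B" and W: "nondeg W" and m: "vec.dim W = 2 * m"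
  shows "witt_index \<phi> W = m \<and> qsum \<phi> W = 2 ^ m \<or> witt_index \<phi> W + 1 = m \<and> qsum \<phi> W = - (2 ^ m)"
proof -
  let ?D = "{vec.dim S |S. vec.subspace S \<and> S \<subseteq> W \<and> (\<forall>x\<in>S. \<phi> x = 0)}"
  have "vec.dim ({0} :: (bit^'m) set) \<in> ?D"
    using \<phi> nondegD(2)[OF W] by (intro CollectI exI[of _ "{0}"]) (auto simp: subspace_bit_iff)
  moreover have "finite ?D"
    by (rule finite_subset[OF _ finite_imageI[of UNIV vec.dim]]) auto
  ultimately have "witt_index \<phi> W \<in> ?D"
    unfolding witt_index_def by (intro Max_in) auto
  then obtain T where T: "witt_index \<phi> W = vec.dim T" "vec.subspace T" "T \<subseteq> W"
    and sing: "\<And>x. x \<in> T \<Longrightarrow> \<phi> x = 0"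
    by blast
  define t where "t = witt_index \<phi> W"
  define M where "M = W \<inter> perp B T"
  have cT: "card T = 2 ^ t"
    using card_subspace[OF T(2)] T(1) by (simp add: t_def)
  have TM: "T \<subseteq> M"
  proof
    fix x assume x: "x \<in> T"
    have "B x y = 0" if "y \<in> T" for y
      using quad_add[OF \<phi>, of x y] sing x that T(2) by (auto simp: subspace_bit_iff)
    then show "x \<in> M"
      using x T(3) by (auto simp: M_def perp_def)
  qed
  have M: "vec.subspace M"
    using nondegD(1)[OF W] subspace_perp[of T] by (auto simp: M_def subspace_bit_iff)
  then obtain u where u: "card M = 2 ^ u"
    using card_subspace by blast
  have cW: "card W = 2 ^ (2 * m)"
    using card_subspace[OF nondegD(1)[OF W]] m by simp
  have "(2::nat) ^ (t + u) = 2 ^ (2 * m)"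
    using card_perp_in[OF T(2) W T(3)] cT u cW by (simp add: M_def power_add)
  then have tu: "t + u = 2 * m"
    by simp
  have "(2::nat) ^ t \<le> 2 ^ u"
    using card_mono[OF _ TM] cT u by simp
  then have "t \<le> u"
    by simp
  \<comment> \<open>Otherwise adjoining \<open>w\<close> to \<open>T\<close> would give a larger
    totally singular subspace.\<close>
  have nonsing: "\<phi> w = 1" if w: "w \<in> M" "w \<notin> T" for w
  proof (rule ccontr)
    assume "\<phi> w \<noteq> 1"
    then have "\<phi> w = 0"
      by simp
    let ?T = "vec.span (insert w T)"
    have span: "?T = T \<union> (\<lambda>y. w + y) ` T"
      using T(2) by (simp add: span_insert_bit vec.span_eq_iff[THEN iffD2])
    have "?T \<subseteq> W"
      using w T(3) nondegD(3)[OF W] by (auto simp: span M_def)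
    moreover have "\<phi> x = 0" if "x \<in> ?T" for x
      using that \<open>\<phi> w = 0\<close> sing w by (auto simp: span quad_add[OF \<phi>] M_def perpD)
    ultimately have "vec.dim ?T \<le> t"
      unfolding t_def by (intro dim_le_witt_index) auto
    moreover have "card ?T = 2 ^ (t + 1)"
      using card_span_insert[of w T] w(2) T(2) cT by (simp add: vec.span_eq_iff[THEN iffD2])
    then have "(2::nat) ^ vec.dim ?T = 2 ^ (t + 1)"
      using card_subspace[of ?T] by simp
    then have "vec.dim ?T = t + 1"
      by (simp only: power_inject_exp)
    ultimately show False
      by simp
  qed
  have "qsum \<phi> W = qsum \<phi> M"
    unfolding M_def using \<phi> W T(2,3) sing by (rule qsum_tot_singular)
  also have "\<dots> = (\<Sum>x\<in>T. sg (\<phi> x)) + (\<Sum>x\<in>M - T. sg (\<phi> x))"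
    unfolding qsum_def using sum.subset_diff[OF TM, of "\<lambda>x. sg (\<phi> x)"] by simp
  also have "\<dots> = int (card T) - int (card (M - T))"
    using sing nonsing by simp
  also have "\<dots> = 2 * int (card T) - int (card M)"
    using TM by (simp add: card_Diff_subset of_nat_diff card_mono)
  finally have q: "qsum \<phi> W = 2 * 2 ^ t - 2 ^ u"
    using cT u by simp
  have q2: "qsum \<phi> W * qsum \<phi> W = 2 ^ m * 2 ^ m"
    using qsum_square[OF \<phi> W] cW by (simp flip: power_add add: mult_2)
  then have q3: "qsum \<phi> W = 2 ^ m \<or> qsum \<phi> W = - (2 ^ m)"
    by (simp flip: power2_eq_square add: power2_eq_iff)
  consider "t = m" | "t + 1 = m" | "t + 2 \<le> m"
    using tu \<open>t \<le> u\<close> by linarith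
  then show ?thesis
  proof cases
    case 1
    then have "u = m"
      using tu by simp
    then show ?thesis
      using 1 q by (simp add: t_def)
  next
    case 2
    then have "u = m + 1"
      using tu by simp
    have "m = Suc t"
      using 2 by simp
    then show ?thesis
      using q \<open>u = m + 1\<close> by (simp add: t_def)
  next
    \<comment> \<open>Here \<open>2 ^ u\<close> is at least \<open>4 * 2 ^ m\<close> and
      \<open>2 * 2 ^ t\<close> is at most half of \<open>2 ^ m\<close>, so the Gauss sum would lie
      below \<open>- (2 ^ m)\<close>.\<close>
    case 3
    then obtain j where j: "m = t + 2 + j"
      using le_Suc_ex by blast
    then have "u = m + 2 + j"
      using tu by simp
    have "(2::int) ^ m = 4 * (2 ^ t * 2 ^ j)"
      using j by (simp add: power_add)
    moreover have "(2::int) ^ u = 4 * (2 ^ m * 2 ^ j)"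
      using \<open>u = m + 2 + j\<close> by (simp add: power_add)
    moreover have "(2::int) ^ m * 1 \<le> 2 ^ m * 2 ^ j" "(2::int) ^ t * 1 \<le> 2 ^ t * 2 ^ j"
      by (intro mult_left_mono; simp)+
    moreover have "(2::int) ^ m > 0" "(2::int)^t > 0"
      by simp_all
    ultimately show ?thesis
      using q q3 by linarith
  qed
qed

lemma has_type_iff:
  assumes "\<phi> \<in> quad_forms B" "nondeg W" "vec.dim W = 2 * m"
  shows "has_type \<phi> W \<epsilon> \<longleftrightarrow> \<epsilon> \<in> {1, -1} \<and> qsum \<phi> W = \<epsilon> * 2 ^ m"
proof -
  have "(2::int) ^ m > 0"
    by simp
  then show ?thesis
    using witt_index_cases[OF assms] unfolding has_type_def assms(3) by auto
qed

text \<open>In minus type the Witt index is only \<open>m - 1\<close>. This bound yields the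
  contradictions in \<open>nonsingular_move\<close> and in the case \<open>n = 2\<close> of
  \<open>B_not_equal\<close>.\<close>

lemma card_tot_singular:
  assumes "\<phi> \<in> quad_forms B" "nondeg W" "vec.dim W = 2 * m" "qsum \<phi> W < 0"
    and "vec.subspace T" "T \<subseteq> W" "\<And>x. x \<in> T \<Longrightarrow> \<phi> x = 0"
  shows "2 * card T \<le> 2 ^ m"
proof -
  have "qsum \<phi> W \<noteq> 2 ^ m"
    using assms(4) by (metis not_less zero_le_numeral zero_le_power)
  then have "witt_index \<phi> W + 1 = m"
    using witt_index_cases[OF assms(1-3)] by auto
  then have "Suc (vec.dim T) \<le> m"
    using dim_le_witt_index[of T W \<phi>] assms(5-7) by auto
  then have "(2::nat) ^ Suc (vec.dim T) \<le> 2 ^ m"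
    by (rule power_increasing) simp
  then show ?thesis
    by (simp add: card_subspace assms(5))
qed

end

subsection \<open>The symplectic group\<close>

text \<open>In a finite group the inverse of \<open>a\<close> is the power of \<open>a\<close> with
  exponent \<open>order G - 1\<close>, so closure under products suffices.\<close>

lemma (in group) subgroup_carrier_updateI:
  assumes "S \<subseteq> carrier G" "\<one> \<in> S" "\<And>x y. x \<in> S \<Longrightarrow> y \<in> S \<Longrightarrow> x \<otimes> y \<in> S"
    and "finite (carrier G)"
  shows "subgroup S G"
proof (rule subgroupI)
  fix a assume a: "a \<in> S"
  have "inv a = a [^] (order G - 1)"
  proof (rule inv_equality)
    have "order G > 0"
      using assms(4) by (simp add: order_gt_0_iff_finite)
    then have "a [^] (order G - 1) \<otimes> a = a [^] order G"
      by (metis Suc_pred' nat_pow_Suc)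
    then show "a [^] (order G - 1) \<otimes> a = \<one>"
      using a assms(1) pow_order_eq_1 by auto
  qed (use a assms in auto)
  moreover have "a [^] (n::nat) \<in> S" for n
    by (induction n) (use a assms in auto)
  ultimately show "inv a \<in> S"
    by simp
qed (use assms in auto)

context symplectic_space
begin

text \<open>Preserving a nondegenerate form makes a map injective, hence bijective on a finite
  space, and additive maps over the two-element field are linear.\<close>

lemma sp_iff:
  "g \<in> carrier (Sp B) \<longleftrightarrow> (\<forall>x y. g (x + y) = g x + g y) \<and> (\<forall>x y. B (g x) (g y) = B x y)"
proof
  assume *: "(\<forall>x y. g (x + y) = g x + g y) \<and> (\<forall>x y. B (g x) (g y) = B x y)"
  then have "inj g"
    by (metis B_eqI injI)
  then have "bij g"
    by (simp add: bij_def finite_UNIV_inj_surj)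
  moreover have "g (c *s x) = c *s g x" for c x
    using additive_imp_linear[of g] * vec.linear_scale by blast
  ultimately show "g \<in> carrier (Sp B)"
    using * by (simp add: Sp_def isometry_group_def Bij_def)
qed (simp add: Sp_def isometry_group_def)

lemma sp_add: "g \<in> carrier (Sp B) \<Longrightarrow> g (x + y) = g x + g y"
  by (simp add: sp_iff)

lemma sp_B: "g \<in> carrier (Sp B) \<Longrightarrow> B (g x) (g y) = B x y"
  by (simp add: sp_iff)

lemma sp_zero: "g \<in> carrier (Sp B) \<Longrightarrow> g 0 = 0"
  using sp_add[of g 0 0] by simp

lemma sp_bij: "g \<in> carrier (Sp B) \<Longrightarrow> bij g"
  by (simp add: Sp_def isometry_group_def Bij_def)

lemma sp_inj: "g \<in> carrier (Sp B) \<Longrightarrow> g x = g y \<longleftrightarrow> x = y"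
  using sp_bij by (auto simp: bij_def inj_def)

lemma subgroup_Sp: "subgroup (carrier (Sp B)) (BijGroup (UNIV :: (bit^'m) set))"
proof (rule group.subgroup_carrier_updateI[OF group_BijGroup])
  show "carrier (Sp B) \<subseteq> carrier (BijGroup UNIV)"
    by (auto simp: Sp_def isometry_group_def BijGroup_def)
  then show "x \<otimes>\<^bsub>BijGroup UNIV\<^esub> y \<in> carrier (Sp B)"
    if "x \<in> carrier (Sp B)" "y \<in> carrier (Sp B)" for x y
    using that by (auto simp: sp_iff BijGroup_def compose_def subset_iff)
qed (auto simp: sp_iff BijGroup_def)

lemma group_Sp: "group (Sp B)"
proof -
  have "Sp B = BijGroup UNIV\<lparr>carrier := carrier (Sp B)\<rparr>"
    by (simp add: Sp_def isometry_group_def)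
  then show ?thesis
    using subgroup.subgroup_is_group[OF subgroup_Sp group_BijGroup] by simp
qed

lemma Sp_one [simp]: "\<one>\<^bsub>Sp B\<^esub> = id"
  by (auto simp: Sp_def isometry_group_def BijGroup_def)

lemma Sp_mult [simp]:
  assumes "g \<in> carrier (Sp B)" "h \<in> carrier (Sp B)"
  shows "g \<otimes>\<^bsub>Sp B\<^esub> h = g \<circ> h"
proof -
  have "g \<in> Bij UNIV" "h \<in> Bij UNIV"
    using assms by (auto simp: Sp_def isometry_group_def)
  then show ?thesis
    by (simp add: Sp_def isometry_group_def BijGroup_def compose_def comp_def restrict_def)
qed

lemma sp_comp: "g \<in> carrier (Sp B) \<Longrightarrow> h \<in> carrier (Sp B) \<Longrightarrow> g \<circ> h \<in> carrier (Sp B)"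
  by (simp add: sp_iff)

lemma sp_id: "id \<in> carrier (Sp B)"
  by (simp add: sp_iff)

lemma sp_inv: 
  assumes "g \<in> carrier (Sp B)" 
  shows "inv_into UNIV g \<in> carrier (Sp B)" "g (inv_into UNIV g x) = x" "inv_into UNIV g (g x) = x"
proof -
  show 1: "g (inv_into UNIV g x) = x" "inv_into UNIV g (g x) = x" for x
    using sp_bij[OF assms] by (simp_all add: bij_is_surj surj_f_inv_f bij_is_inj)
  show "inv_into UNIV g \<in> carrier (Sp B)"
    unfolding sp_iff using assms 1 by (metis sp_B sp_add)
qed

lemma Sp_inv [simp]:
  assumes "g \<in> carrier (Sp B)" 
  shows "inv\<^bsub>Sp B\<^esub> g = inv_into UNIV g"
  using assms sp_inv[OF assms] by (intro group.inv_equality[OF group_Sp]) auto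

lemma finite_Sp: "finite (carrier (Sp B))"
  by simp

lemma sp_perp_image:
  assumes g: "g \<in> carrier (Sp B)"
  shows "g ` perp B U = perp B (g ` U)"
proof -
  have "y \<in> g ` perp B U" if "y \<in> perp B (g ` U)" for y
  proof
    show "y = g (inv_into UNIV g y)"
      using sp_inv[OF g] by simp
    show "inv_into UNIV g y \<in> perp B U"
      using that sp_B[OF g, of "inv_into UNIV g y"] sp_inv[OF g] by (auto simp: perp_def)
  qed
  then show ?thesis
    using sp_B[OF g] by (auto simp: perp_def)
qed

lemma sp_subspace_image: "g \<in> carrier (Sp B) \<Longrightarrow> vec.subspace U \<Longrightarrow> vec.subspace (g ` U)"
  by (auto simp: subspace_bit_iff image_iff sp_zero simp flip: sp_add intro: bexI[of _ 0])

lemma sp_card_image: "g \<in> carrier (Sp B) \<Longrightarrow> card (g ` U) = card U"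
  by (metis card_image inj_on_subset sp_bij bij_is_inj subset_UNIV)

lemma sp_nondeg_image:
  assumes "g \<in> carrier (Sp B)" "nondeg U"
  shows "nondeg (g ` U)"
proof -
  have "inj g"
    using sp_bij[OF assms(1)] by (rule bij_is_inj)
  then have "g ` U \<inter> g ` perp B U = g ` (U \<inter> perp B U)"
    by (rule image_Int[symmetric])
  then show ?thesis
    using assms sp_subspace_image sp_zero
    by (auto simp: nondeg_def nondegenerate_def simp flip: sp_perp_image)
qed

text \<open>Over the two-element field each vector determines a single transvection, and it is its
  own inverse.\<close>

definition transv :: "bit^'m \<Rightarrow> bit^'m \<Rightarrow> bit^'m" where
  "transv v x = x + B x v *s v"

lemma transv_simps: "B x v = 0 \<Longrightarrow> transv v x = x" "B x v = 1 \<Longrightarrow> transv v x = x + v"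
  by (simp_all add: transv_def)

lemma transv_sp [simp, intro]: "transv v \<in> carrier (Sp B)"
proof -
  have "transv v (x + y) = transv v x + transv v y" for x y
    by (cases "B x v"; cases "B y v") (auto simp: transv_def add_ac)
  moreover have "B (transv v x) (transv v y) = B x y" for x y
    by (cases "B x v"; cases "B y v") (auto simp: transv_def B_sym[of v])
  ultimately show ?thesis
    by (simp add: sp_iff)
qed

lemma transv_swap: "B c c' = 1 \<Longrightarrow> transv (c + c') c = c'"
  by (simp add: transv_simps)

lemma transv_fix: "B a c = B a c' \<Longrightarrow> transv (c + c') a = a"
  by (simp add: transv_simps)

lemma transv_transv [simp]: "transv v (transv v x) = x"
  by (cases "B x v") (auto simp: transv_def add.assoc)

text \<open>From \<open>\<phi> (transv v x) = \<phi> x + (\<phi> v + 1) * B v x\<close>. Singular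
  \<open>v\<close> serve to move one form to another, nonsingular \<open>v\<close> to move vectors
  while keeping the form.\<close>

lemma quad_transv:
  assumes "\<phi> \<in> quad_forms B"
  shows "\<phi> v = 0 \<Longrightarrow> \<phi> \<circ> transv v = twist \<phi> v" "\<phi> v = 1 \<Longrightarrow> \<phi> \<circ> transv v = \<phi>"
proof -
  have "\<phi> (transv v x) = \<phi> x + (\<phi> v + 1) * B v x" for x
    using assms by (cases "B x v"; cases "\<phi> v") (auto simp: transv_def quad_add B_sym[of v] add_ac)
  then show "\<phi> v = 0 \<Longrightarrow> \<phi> \<circ> transv v = twist \<phi> v" "\<phi> v = 1 \<Longrightarrow> \<phi> \<circ> transv v = \<phi>"
    by (auto simp: fun_eq_iff twist_def)
qed

lemma twist_comp:
  assumes "g \<in> carrier (Sp B)"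
  shows "twist \<phi> (g a) \<circ> g = twist (\<phi> \<circ> g) a"
  by (simp add: fun_eq_iff twist_def sp_B[OF assms])

lemma quad_comp: "g \<in> carrier (Sp B) \<Longrightarrow> \<phi> \<in> quad_forms B \<Longrightarrow> \<phi> \<circ> g \<in> quad_forms B"
  by (simp add: quad_forms_iff sp_add sp_B)

lemma qsum_comp:
  assumes "g \<in> carrier (Sp B)"
  shows "qsum (\<phi> \<circ> g) W = qsum \<phi> (g ` W)"
proof -
  have "inj_on g W"
    using sp_bij[OF assms] by (meson bij_is_inj inj_on_subset subset_UNIV)
  then show ?thesis
    by (simp add: qsum_def sum.reindex)
qed

subsection \<open>Transvections\<close>

text \<open>Each of \<open>c\<close> and \<open>c'\<close> has a partner in \<open>perp B A\<close>,
  because \<open>A\<close> is its own double complement. If neither partner serves both vectors,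
  their sum does.\<close>

lemma common_partner:
  assumes A: "vec.subspace A" and "c \<notin> A" "c' \<notin> A"
  shows "\<exists>u\<in>perp B A. B u c = 1 \<and> B u c' = 1"
proof -
  have partner: "\<exists>u\<in>perp B A. B u x = 1" if "x \<notin> A" for x
  proof (rule ccontr)
    assume "\<not> (\<exists>u\<in>perp B A. B u x = 1)"
    then have "x \<in> perp B (perp B A)"
      by (auto simp: perp_def[of B "perp B A"] B_sym[of x])
    then show False
      using that A by simp
  qed
  obtain u where u: "u \<in> perp B A" "B u c = 1"
    using partner[OF assms(2)] by blast
  obtain u' where u': "u' \<in> perp B A" "B u' c' = 1"
    using partner[OF assms(3)] by blast
  have "u + u' \<in> perp B A"
    using u u' subspace_perp[of A] by (simp add: subspace_bit_iff)
  then show ?thesis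
    using u u' by (cases "B u c'"; cases "B u' c") (auto intro: bexI[of _ "u + u'"])
qed

text \<open>If \<open>B c c' = 1\<close>, the transvection by \<open>c + c'\<close> does it.
  Otherwise the detour through \<open>e = c + u\<close>, with \<open>u\<close> a common partner of
  \<open>c\<close> and \<open>c'\<close>, consists of two steps of this kind. Only vectors of
  \<open>perp B A\<close> are used, so \<open>A\<close> stays fixed pointwise. \<open>K\<close> is
  arbitrary because maximality is about overgroups not yet known to be the whole group.\<close>

lemma transvections_move:
  assumes A: "vec.subspace A" and c: "c \<notin> A" "c' \<notin> A" "\<And>a. a \<in> A \<Longrightarrow> B a c = B a c'"
    and K: "subgroup K (Sp B)" "\<And>v. v \<in> perp B A \<Longrightarrow> transv v \<in> K"
  shows "\<exists>g\<in>K. (\<forall>a\<in>A. g a = a) \<and> g c = c'"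
proof -
  have cc: "c + c' \<in> perp B A"
  proof -
    have "B c a = B c' a" if "a \<in> A" for a
      using c(3)[OF that] by (simp add: B_sym[of a])
    then show ?thesis
      by (simp add: perp_def)
  qed
  have Kcomp: "g \<circ> h \<in> K" if "g \<in> K" "h \<in> K" for g h
    using subgroup.m_closed[OF K(1) that] that subgroup.subset[OF K(1)] by (auto simp: subset_iff)
  show ?thesis
  proof (cases "B c c' = 1")
    case 1: True
    have "\<forall>a\<in>A. transv (c + c') a = a"
      using c(3) by (simp add: transv_fix)
    then show ?thesis
      using K(2)[OF cc] transv_swap[OF 1] by blast
  next
    case False
    then have 0: "B c c' = 0"
      by simp
    obtain u where u: "u \<in> perp B A" "B u c = 1" "B u c' = 1"
      using common_partner[OF A c(1,2)] by blast
    define e where "e = c + u"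
    have e: "transv u c = e" "B e c' = 1"
      using u 0 by (simp_all add: e_def transv_simps B_sym[of c u])
    have ec: "e + c' \<in> perp B A"
    proof -
      have "(c + c') + u \<in> perp B A"
        using cc u(1) subspace_perp[of A] by (simp only: subspace_bit_iff)
      then show ?thesis
        by (simp add: e_def add_ac)
    qed
    have "transv (e + c') e = c'"
      using e(2) by (rule transv_swap)
    moreover have "transv u a = a" "transv (e + c') a = a" if "a \<in> A" for a
      using that u(1) ec by (auto intro: transv_simps(1) dest: perpD(2))
    ultimately have "(\<forall>a\<in>A. (transv (e + c') \<circ> transv u) a = a) \<and> (transv (e + c') \<circ> transv u) c = c'"
      using e(1) by simp
    then show ?thesis
      using Kcomp[OF K(2)[OF ec] K(2)[OF u(1)]] by blast
  qed
qed

text \<open>Induction on the number of vectors moved by \<open>g\<close>. Some element of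
  \<open>K\<close> agrees with \<open>g\<close> on the fixed space of \<open>g\<close> and at one
  further vector \<open>c\<close>; removing it from \<open>g\<close> enlarges the fixed
  space.\<close>

lemma transvections_generate:
  assumes K: "subgroup K (Sp B)" "\<And>v. transv v \<in> K"
  shows "K = carrier (Sp B)"
proof
  show "K \<subseteq> carrier (Sp B)"
    using K(1) by (rule subgroup.subset)
  have "g \<in> K" if "g \<in> carrier (Sp B)" for g
    using that
  proof (induction "CARD(bit^'m) - card {x. g x = x}" arbitrary: g rule: less_induct)
    case less
    define A where "A = {x. g x = x}"
    have A: "vec.subspace A"
      using sp_zero[OF less.prems] sp_add[OF less.prems] by (auto simp: A_def subspace_bit_iff)
    show ?case
    proof (cases "A = UNIV")
      case True
      then have "g = id"
        by (auto simp: A_def fun_eq_iff set_eq_iff)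
      then show ?thesis
        using subgroup.one_closed[OF K(1)] by simp
    next
      case False
      then obtain c where c: "c \<notin> A"
        by auto
      have "g c \<notin> A"
        using c sp_inj[OF less.prems] by (auto simp: A_def)
      moreover have "B a c = B a (g c)" if "a \<in> A" for a
        using that sp_B[OF less.prems, of a c] by (simp add: A_def)
      ultimately obtain t where t: "t \<in> K" "\<And>a. a \<in> A \<Longrightarrow> t a = a" "t c = g c"
        using transvections_move[OF A c _ _ K(1)] K(2) by metis
      have tS: "t \<in> carrier (Sp B)"
        using t(1) subgroup.subset[OF K(1)] by auto
      define h where "h = inv_into UNIV t \<circ> g"
      have h: "h \<in> carrier (Sp B)"
        using sp_inv(1)[OF tS] less.prems by (simp add: h_def sp_comp)
      have "h c = c"
        using t(3) sp_inv(3)[OF tS, of c] by (simp add: h_def)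
      moreover have "h x = x" if "x \<in> A" for x
        using t(2)[OF that] sp_inv(3)[OF tS, of x] that by (simp add: h_def A_def)
      ultimately have "insert c A \<subseteq> {x. h x = x}"
        by auto
      then have "card (insert c A) \<le> card {x. h x = x}"
        by (intro card_mono) auto
      then have "card A < card {x. h x = x}"
        using c by simp
      moreover have "card {x. h x = x} \<le> CARD(bit^'m)"
        by (rule card_mono) auto
      ultimately have "h \<in> K"
        using less.hyps[OF _ h] by (simp add: A_def)
      moreover have "g = t \<otimes>\<^bsub>Sp B\<^esub> h"
        using tS h sp_inv(2)[OF tS] by (simp add: h_def fun_eq_iff)
      ultimately show ?thesis
        using t(1) subgroup.m_closed[OF K(1)] by auto
    qed
  qed
  then show "carrier (Sp B) \<subseteq> K"
    by blast
qed

text \<open>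
  A form of Witt's theorem: the obstruction to finding the second transvection is that a certain
  orthogonal complement is totally isotropic, which the size bound excludes.
\<close>

lemma singular_move:
  assumes \<phi>: "\<phi> \<in> quad_forms B" and A: "vec.subspace A" 
    and c: "c \<notin> A" "c' \<notin> A" "\<And>a. a \<in> A \<Longrightarrow> B a c = B a c'" "\<phi> c = 0" "\<phi> c' = 0"
    and size: "card (vec.span (insert c (insert c' A))) * card (vec.span (insert c (insert c' A))) \<le> CARD(bit^'m)"
  shows "\<exists>g\<in>carrier (Sp B). \<phi> \<circ> g = \<phi> \<and> (\<forall>a\<in>A. g a = a) \<and> g c = c'"
proof (cases "B c c' = 1")
  case 1: True
  have "\<phi> (c + c') = 1"
    using \<phi> c 1 by (simp add: quad_add)
  then have "\<phi> \<circ> transv (c + c') = \<phi>"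
    using \<phi> by (simp add: quad_transv)
  moreover have "\<forall>a\<in>A. transv (c + c') a = a"
    using c(3) by (simp add: transv_fix)
  ultimately show ?thesis
    using transv_swap[OF 1] by blast
next
  case False
  then have 0: "B c c' = 0"
    by simp
  define L where "L = vec.span (insert c (insert c' A))"
  define M where "M = perp B L"
  have L: "vec.subspace L" and cL: "c \<in> L" "c' \<in> L" "A \<subseteq> L"
    by (auto simp: L_def vec.span_base)
  obtain u0 where u0: "u0 \<in> perp B A" "B u0 c = 1" "B u0 c' = 1"
    using common_partner[OF A c(1,2)] by blast
  \<comment> \<open>The transvection by a partner preserves \<open>\<phi>\<close> only if the
    partner has value 1. A partner remains one after adding any vector of
    \<open>M = perp B L\<close>, and this freedom has to produce the value 1.\<close>
  have "\<exists>x\<in>M. \<phi> (u0 + x) = 1"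
  proof (rule ccontr)
    assume "\<not> (\<exists>x\<in>M. \<phi> (u0 + x) = 1)"
    then have z: "\<phi> (u0 + x) = 0" if "x \<in> M" for x
      using that by auto
    have "0 \<in> M"
      using subspace_perp[of L] by (simp add: M_def subspace_bit_iff)
    then have "\<phi> u0 = 0"
      using z[of 0] by simp
    then have lin: "\<phi> x = B u0 x" if "x \<in> M" for x
      using z[OF that] quad_add[OF \<phi>, of u0 x] by simp
    have "M \<subseteq> perp B M"
    proof
      fix x assume x: "x \<in> M"
      have "B x y = 0" if y: "y \<in> M" for y
      proof -
        have "x + y \<in> M"
          using x y subspace_perp[of L] by (simp add: M_def subspace_bit_iff)
        then show ?thesis
          using quad_add[OF \<phi>, of x y] lin x y by simp
      qed
      then show "x \<in> perp B M"
        by (simp add: perp_def)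
    qed
    then have "M \<subseteq> L"
      using L by (simp add: M_def)
    have "card L * card L \<le> card L * card M"
      using size card_perp[OF L] by (simp add: L_def[symmetric] M_def)
    moreover have "card L > 0"
      using cL by (auto simp: card_gt_0_iff)
    ultimately have "card L \<le> card M"
      by simp
    \<comment> \<open>Then \<open>c\<close> lies in \<open>M\<close>, on which \<open>\<phi>\<close>
      agrees with \<open>B u0\<close>; but \<open>\<phi> c = 0\<close> and
      \<open>B u0 c = 1\<close>.\<close>
    then have "M = L"
      using \<open>M \<subseteq> L\<close> by (rule subspace_eq_by_card[rotated])
    then show False
      using lin[of c] cL u0 c by simp
  qed
  then obtain x where x: "x \<in> M" "\<phi> (u0 + x) = 1"
    by blast
  define u where "u = u0 + x"
  have u: "B u c = 1" "B u c' = 1" "\<phi> u = 1" "\<And>a. a \<in> A \<Longrightarrow> B a u = 0"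
    using x u0 cL by (auto simp: u_def M_def perpD)
  define e where "e = c + u"
  have e: "transv u c = e" "B e c' = 1" "\<phi> e = 0"
    using u 0 c quad_add[OF \<phi>, of c u] by (simp_all add: e_def transv_simps B_sym[of c u])
  have "\<phi> (e + c') = 1"
    using e c quad_add[OF \<phi>, of e c'] by simp
  then have "\<phi> \<circ> transv (e + c') = \<phi>" "\<phi> \<circ> transv u = \<phi>"
    using \<phi> u(3) by (simp_all add: quad_transv)
  then have "\<phi> \<circ> (transv (e + c') \<circ> transv u) = \<phi>"
    by (simp add: comp_assoc[symmetric])
  moreover have "transv (e + c') e = c'"
    using e(2) by (rule transv_swap)
  moreover have "transv u a = a" "transv (e + c') a = a" if "a \<in> A" for a
    using that u(4) c(3) by (simp_all add: transv_simps e_def)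
  ultimately show ?thesis
    using e(1) by (intro bexI[of _ "transv (e + c') \<circ> transv u"]) (auto intro: sp_comp)
qed

text \<open>Two vectors of value 1 with \<open>B x y = 1\<close> are interchanged by the
  transvection by \<open>x + y\<close>, which has value 1 too; orthogonal ones are joined through an
  intermediate \<open>e\<close>. Minus type guarantees that \<open>e\<close> exists: in plus type
  and dimension four the transvections preserving the form have two orbits on vectors of value
  1.\<close>

lemma nonsingular_move:
  assumes \<phi>: "\<phi> \<in> quad_forms B" and U: "nondeg U" "vec.dim U = 2 * m" and neg: "qsum \<phi> U < 0"
    and c: "c \<in> U" "c' \<in> U" "\<phi> c = 1" "\<phi> c' = 1"
  shows "\<exists>g\<in>carrier (Sp B). \<phi> \<circ> g = \<phi> \<and> (\<forall>a\<in>perp B U. g a = a) \<and> g c = c'"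
proof -
  have adj: "\<phi> \<circ> transv (x + y) = \<phi> \<and> (\<forall>a\<in>perp B U. transv (x + y) a = a) \<and> transv (x + y) x = y"
    if "x \<in> U" "y \<in> U" "\<phi> x = 1" "\<phi> y = 1" "B x y = 1" for x y
    using that quad_add[OF \<phi>, of x y] quad_transv(2)[OF \<phi>, of "x + y"]
    by (auto simp: transv_swap transv_simps perpD)
  consider "c = c'" | "B c c' = 1" | "c \<noteq> c'" "B c c' = 0"
    by (cases "B c c'") auto
  then show ?thesis
  proof cases
    case 1
    then show ?thesis
      using sp_id by (intro bexI[of _ id]) auto
  next
    case 2
    then show ?thesis
      using adj[OF c 2] by blast
  next
    case 3
    have "c \<noteq> 0" "c' \<noteq> 0"
      using c \<phi> by auto
    then have nP: "c \<notin> perp B U" "c' \<notin> perp B U"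
      using c nondegD(5)[OF U(1)] by blast+
    then obtain e0 where e0: "e0 \<in> perp B (perp B U)" "B e0 c = 1" "B e0 c' = 1"
      using common_partner[OF subspace_perp] by blast
    define M where "M = {x\<in>{x\<in>U. B x c = 0}. B x c' = 0}"
    have e0U: "e0 \<in> U"
      using e0(1) U(1) by simp
    have Usub: "vec.subspace U"
      using U(1) by (rule nondegD)
    have U1: "vec.subspace {x\<in>U. B x c = 0}" and M: "vec.subspace M"
      using Usub by (auto simp: subspace_bit_iff M_def)
    have "card U \<le> 2 * card {x\<in>U. B x c = 0}"
      using Usub by (rule card_kernel_ge) simp
    moreover have "card {x\<in>U. B x c = 0} \<le> 2 * card M"
      unfolding M_def using U1 by (rule card_kernel_ge) simp
    ultimately have cM: "card U \<le> 4 * card M"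
      by simp
    \<comment> \<open>If all candidates were singular, \<open>e0\<close> and the part of
      \<open>M\<close> orthogonal to it would span a totally singular \<open>T\<close> with at least
      a quarter of the \<open>2 ^ (2 * m)\<close> elements of \<open>U\<close>, while minus type
      allows at most \<open>2 ^ (m - 1)\<close>. These bounds are compatible only for
      \<open>m \<le> 1\<close>, and then \<open>T\<close>, having at least two elements, is still
      too large.\<close>
    have "\<exists>x\<in>M. \<phi> (e0 + x) = 1"
    proof (rule ccontr)
      assume "\<not> (\<exists>x\<in>M. \<phi> (e0 + x) = 1)"
      then have z: "\<phi> (e0 + x) = 0" if "x \<in> M" for x
        using that by auto
      define M0 where "M0 = {x\<in>M. B e0 x = 0}"
      have "card M \<le> 2 * card M0"
        unfolding M0_def using M by (rule card_kernel_ge) simp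
      have M0: "vec.subspace M0"
        using M by (auto simp: subspace_bit_iff M0_def)
      have "0 \<in> M"
        using M by (simp add: subspace_bit_iff)
      then have "\<phi> e0 = 0"
        using z[of 0] by simp
      then have sing0: "\<phi> x = 0" if "x \<in> M0" for x
        using z[of x] that quad_add[OF \<phi>, of e0 x] by (auto simp: M0_def)
      define T where "T = vec.span (insert e0 M0)"
      have T: "T = M0 \<union> (\<lambda>y. e0 + y) ` M0"
        using M0 by (simp add: T_def span_insert_bit vec.span_eq_iff[THEN iffD2])
      have "e0 \<notin> M0"
        using e0(2) by (auto simp: M0_def M_def)
      then have cT: "card T = 2 * card M0"
        unfolding T_def using M0 by (subst card_span_insert) (simp_all add: vec.span_eq_iff[THEN iffD2])
      have TU: "T \<subseteq> U"
        using e0U nondegD(3)[OF U(1)] by (auto simp: T M0_def M_def)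
      have Tsing: "\<phi> x = 0" if "x \<in> T" for x
        using that z sing0 by (auto simp: T M0_def)
      have "2 * card T \<le> 2 ^ m"
        using \<phi> U neg by (rule card_tot_singular) (use TU Tsing in \<open>auto simp: T_def\<close>)
      moreover have "card U = 2 ^ m * 2 ^ m"
        using card_subspace[OF Usub] U(2) by (simp flip: power_add add: mult_2)
      moreover have "card M \<le> card T" "card M0 > 0"
        using \<open>card M \<le> 2 * card M0\<close> cT M0 by (auto simp: card_gt_0_iff subspace_bit_iff)
      ultimately have *: "2 ^ m * 2 ^ m \<le> 2 * (2::nat) ^ m" "4 \<le> (2::nat) ^ m"
        using cM cT by linarith+
      then have "(2::nat) ^ m \<le> 2"
        by (metis mult_le_cancel2 zero_less_numeral zero_less_power)
      then show False
        using * by simp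
    qed
    then obtain x where x: "x \<in> M" "\<phi> (e0 + x) = 1"
      by blast
    define e where "e = e0 + x"
    have e: "e \<in> U" "\<phi> e = 1" "B c e = 1" "B e c' = 1"
      using x e0 e0U nondegD(3)[OF U(1)] by (auto simp: e_def M_def B_sym[of c])
    define g where "g = transv (e + c') \<circ> transv (c + e)"
    have "\<phi> \<circ> g = \<phi>"
      using adj[OF c(1) e(1) c(3) e(2,3)] adj[OF e(1) c(2) e(2) c(4) e(4)]
      by (simp add: g_def comp_assoc[symmetric])
    moreover have "g \<in> carrier (Sp B)"
      by (simp add: g_def sp_comp)
    moreover have "(\<forall>a\<in>perp B U. g a = a) \<and> g c = c'"
      using adj[OF c(1) e(1) c(3) e(2,3)] adj[OF e(1) c(2) e(2) c(4) e(4)]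
      by (simp add: g_def)
    ultimately show ?thesis
      by blast
  qed
qed

lemma sp_fix_perp_image:
  assumes "g \<in> carrier (Sp B)" "nondeg U" "\<And>a. a \<in> perp B U \<Longrightarrow> g a = a"
  shows "g ` U = U"
proof -
  have "g ` perp B U = perp B U"
    using assms(3) by force
  then have "perp B (g ` U) = perp B U"
    using sp_perp_image[OF assms(1)] by simp
  then show ?thesis
    using sp_nondeg_image[OF assms(1,2)] assms(2) nondeg_perp_perp by metis
qed

text \<open>On \<open>U\<close> every form is a twist of \<open>\<phi>\<close> by a vector of
  \<open>U\<close>, singular if the type is that of \<open>\<phi>\<close> and of value 1 otherwise.
  The transvection \<open>t\<close> by the singular \<open>v\<close> belonging to
  \<open>\<phi>'\<close> turns \<open>\<phi>'\<close> into \<open>\<phi>\<close>; what remains is to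
  move the vector \<open>u\<close> describing \<open>\<psi>\<close> to the vector \<open>u'\<close>
  describing \<open>\<psi>' \<circ> t\<close> by an isometry of \<open>\<phi>\<close>.\<close>

lemma form_pair_move_neg:
  assumes forms: "\<phi> \<in> quad_forms B" "\<psi> \<in> quad_forms B" "\<phi>' \<in> quad_forms B" "\<psi>' \<in> quad_forms B"
    and U: "nondeg U" "vec.dim U = 2 * m" and neg: "qsum \<phi> U < 0"
    and q: "qsum \<phi>' U = qsum \<phi> U" "qsum \<psi> U = - qsum \<phi> U" "qsum \<psi>' U = - qsum \<phi> U"
  shows "\<exists>g\<in>carrier (Sp B). (\<forall>a\<in>perp B U. g a = a) \<and> (\<forall>x\<in>U. \<phi>' (g x) = \<phi> x \<and> \<psi>' (g x) = \<psi> x)"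
proof -
  have rel: "\<exists>u\<in>U. sg (\<phi> u) * qsum \<phi> U = qsum \<theta> U \<and> (\<forall>x\<in>U. \<theta> x = \<phi> x + B u x)"
    if \<theta>: "\<theta> \<in> quad_forms B" for \<theta>
  proof -
    obtain a where a: "\<theta> = twist \<phi> a"
      using quad_forms_twist[OF forms(1) \<theta>] by blast
    have "sg (\<phi> (proj U a)) * qsum \<phi> U = qsum \<theta> U"
      using qsum_twist[OF forms(1) U(1)] a by simp
    moreover have "\<theta> x = \<phi> x + B (proj U a) x" if "x \<in> U" for x
      using B_proj[OF U(1) that, of a] by (simp add: a twist_def)
    ultimately show ?thesis
      using proj_props(1)[OF U(1)] by blast
  qed
  obtain v where v: "v \<in> U" "sg (\<phi> v) * qsum \<phi> U = qsum \<phi>' U" "\<And>x. x \<in> U \<Longrightarrow> \<phi>' x = \<phi> x + B v x"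
    using rel[OF forms(3)] by blast
  have v0: "\<phi> v = 0"
    using v(2) q(1) neg by (cases "\<phi> v") auto
  define t where "t = transv v"
  have t: "t \<in> carrier (Sp B)" "\<And>x. t (t x) = x"
    by (auto simp: t_def)
  have tfix: "t a = a" if "a \<in> perp B U" for a
    using that v(1) by (auto simp: t_def transv_simps perpD)
  have tU: "t ` U = U"
    using t(1) U(1) tfix by (rule sp_fix_perp_image)
  have tphi: "\<phi> (t x) = \<phi>' x" if "x \<in> U" for x
    using fun_cong[OF quad_transv(1)[OF forms(1) v0], of x] v(3)[OF that] by (simp add: t_def twist_def)
  define \<psi>'' where "\<psi>'' = \<psi>' \<circ> t"
  have psi2: "\<psi>'' \<in> quad_forms B" "qsum \<psi>'' U = - qsum \<phi> U"
    using quad_comp[OF t(1) forms(4)] qsum_comp[OF t(1)] tU q(3) by (auto simp: \<psi>''_def)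
  obtain u where u: "u \<in> U" "sg (\<phi> u) * qsum \<phi> U = qsum \<psi> U" "\<And>x. x \<in> U \<Longrightarrow> \<psi> x = \<phi> x + B u x"
    using rel[OF forms(2)] by blast
  obtain u' where u': "u' \<in> U" "sg (\<phi> u') * qsum \<phi> U = qsum \<psi>'' U" "\<And>x. x \<in> U \<Longrightarrow> \<psi>'' x = \<phi> x + B u' x"
    using rel[OF psi2(1)] by blast
  have "\<phi> u = 1" "\<phi> u' = 1"
    using u(2) u'(2) q(2) psi2(2) neg by (cases "\<phi> u"; cases "\<phi> u'"; simp)+
  then obtain h where h: "h \<in> carrier (Sp B)" "\<phi> \<circ> h = \<phi>" "\<And>a. a \<in> perp B U \<Longrightarrow> h a = a" "h u = u'"
    using nonsingular_move[OF forms(1) U neg u(1) u'(1)] by blast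
  have hU: "h ` U = U"
    using h(1) U(1) h(3) by (rule sp_fix_perp_image)
  have hphi: "\<phi> (h x) = \<phi> x" for x
    using fun_cong[OF h(2), of x] by simp
  have "\<phi>' (t (h x)) = \<phi> x \<and> \<psi>' (t (h x)) = \<psi> x" if x: "x \<in> U" for x
  proof -
    have hx: "h x \<in> U"
      using x hU by blast
    then have "t (h x) \<in> U"
      using tU by blast
    then have "\<phi>' (t (h x)) = \<phi> x"
      using tphi[of "t (h x)"] t(2) hphi by simp
    moreover have "\<psi>' (t (h x)) = \<psi> x"
      using u'(3)[OF hx] u(3)[OF x] hphi sp_B[OF h(1), of u x] h(4) by (simp add: \<psi>''_def)
    ultimately show ?thesis ..
  qed
  then show ?thesis
    using t(1) h(1,3) tfix by (intro bexI[of _ "t \<circ> h"]) (auto intro: sp_comp)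
qed

text \<open>The two forms of a pair have opposite types on \<open>U\<close>, so one of them is of
  minus type and may play the role of \<open>\<phi>\<close>.\<close>

lemma form_pair_move:
  assumes forms: "\<phi> \<in> quad_forms B" "\<psi> \<in> quad_forms B" "\<phi>' \<in> quad_forms B" "\<psi>' \<in> quad_forms B"
    and U: "nondeg U" "vec.dim U = 2 * m"
    and q: "qsum \<phi>' U = qsum \<phi> U" "qsum \<psi> U = - qsum \<phi> U" "qsum \<psi>' U = - qsum \<phi> U"
  shows "\<exists>g\<in>carrier (Sp B). (\<forall>a\<in>perp B U. g a = a) \<and> (\<forall>x\<in>U. \<phi>' (g x) = \<phi> x \<and> \<psi>' (g x) = \<psi> x)"
proof (cases "qsum \<phi> U < 0")
  case True
  show ?thesis
    by (rule form_pair_move_neg[OF forms U True q])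
next
  case False
  have "qsum \<phi> U \<noteq> 0"
    using qsum_square[OF forms(1) U(1)] nondegD(2)[OF U(1)] by auto
  then show ?thesis
    using form_pair_move_neg[OF forms(2,1,4,3) U] q False by fastforce
qed

end

subsection \<open>Symplectic coordinates\<close>

definition std_space :: "nat \<Rightarrow> (nat \<Rightarrow> bit) set" where
  "std_space r = {v. \<forall>i\<ge>r. v i = 0}"

definition std_form :: "nat \<Rightarrow> (nat \<Rightarrow> bit) \<Rightarrow> (nat \<Rightarrow> bit) \<Rightarrow> bit" where
  "std_form m x y = (\<Sum>i<m. x (2 * i) * y (2 * i + 1) + x (2 * i + 1) * y (2 * i))"

lemma Sp_std_eq: "Sp_std (2 * m) = isometry_group (\<lambda>c v i. c * v i) (std_space (2 * m)) (std_form m)"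
  by (simp add: Sp_std_def std_space_def std_form_def[abs_def])

lemma std_space_add: "v \<in> std_space r \<Longrightarrow> w \<in> std_space r \<Longrightarrow> v + w \<in> std_space r"
  by (simp add: std_space_def)

context symplectic_space
begin

text \<open>One step of a symplectic Gram-Schmidt process: \<open>red\<close> removes from
  \<open>y\<close> its components along the hyperbolic pair \<open>e\<close>, \<open>f\<close>, so a
  vector orthogonal to everything in the complement would be orthogonal to all of
  \<open>U\<close>.\<close>

lemma hyperbolic_split:
  assumes U: "nondeg U" and dim: "vec.dim U = 2 * Suc m"
  obtains e f where "e \<in> U" "f \<in> U" "B e f = 1" "nondeg {x\<in>U. B x e = 0 \<and> B x f = 0}"
    "vec.dim {x\<in>U. B x e = 0 \<and> B x f = 0} = 2 * m"
proof -
  have cU: "card U = 4 * 2 ^ (2 * m)"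
    using card_subspace[of U] U dim by (simp add: nondegD)
  have "U \<noteq> {0}"
    using cU by auto
  then obtain e where e: "e \<in> U" "e \<noteq> 0"
    using nondegD(2)[OF U] by blast
  then obtain f where f: "f \<in> U" "B e f = 1"
    using nondegD(4)[OF U, of e] by (metis bit_not_one_iff)
  have fe: "B f e = 1"
    using f B_sym by metis
  define H where "H = vec.span {e, f}"
  define U' where "U' = U \<inter> perp B H"
  have U'_iff: "x \<in> U' \<longleftrightarrow> x \<in> U \<and> B x e = 0 \<and> B x f = 0" for x
    by (auto simp: U'_def H_def perp_def[of B "{e, f}"])
  have "f \<noteq> 0" "e \<noteq> f"
    using f by auto
  have "vec.span {f} = {0, f}"
    using span_insert_bit[of f "{}"] by auto
  then have "e \<notin> vec.span {f}"
    using e \<open>e \<noteq> f\<close> by auto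
  then have cH: "card H = 4"
    using card_span_insert[of e "{f}"] \<open>vec.span {f} = {0, f}\<close> \<open>f \<noteq> 0\<close> by (simp add: H_def)
  have "H \<subseteq> U"
    unfolding H_def using e f nondegD(1)[OF U] by (intro vec.span_minimal) auto
  then have "card H * card U' = card U"
    unfolding U'_def by (intro card_perp_in U) (auto simp: H_def)
  then have cU': "card U' = 2 ^ (2 * m)"
    using cU cH by simp
  have subU': "vec.subspace U'"
    using nondegD[OF U] by (auto simp: subspace_bit_iff U'_iff)
  define red where "red y = y + (B y f *s e + B y e *s f)" for y
  have red: "red y \<in> U'" if "y \<in> U" for y
    using that e f fe nondegD(3)[OF U]
    by (cases "B y e"; cases "B y f") (auto simp: red_def U'_iff)
  have "x = 0" if x: "x \<in> U'" "\<And>y. y \<in> U' \<Longrightarrow> B x y = 0" for x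
  proof (rule nondegD(4)[OF U])
    show "x \<in> U"
      using x by (simp add: U'_iff)
    show "B x y = 0" if "y \<in> U" for y
      using x(2)[OF red[OF that]] x(1)
      by (cases "B y e"; cases "B y f") (auto simp: red_def U'_iff)
  qed
  then have "nondeg U'"
    using subU' by (auto simp: nondeg_def nondegenerate_def perp_def subspace_bit_iff)
  moreover have "vec.dim U' = 2 * m"
    using card_subspace[OF subU'] cU' by simp
  moreover have "U' = {x\<in>U. B x e = 0 \<and> B x f = 0}"
    using U'_iff by auto
  ultimately show ?thesis
    using that e(1) f by simp
qed

lemma symplectic_coordinates:
  assumes "nondeg U" "vec.dim U = 2 * m"
  shows "\<exists>c. bij_betw c (std_space (2 * m)) U \<and>
    (\<forall>v\<in>std_space (2 * m). \<forall>w\<in>std_space (2 * m). c (v + w) = c v + c w) \<and>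
    (\<forall>v\<in>std_space (2 * m). \<forall>w\<in>std_space (2 * m). B (c v) (c w) = std_form m v w)"
  using assms
proof (induction m arbitrary: U)
  case 0
  then have "card U = 1"
    using card_subspace[of U] by (simp add: nondegD)
  then have "U = {0}"
    using nondegD(2)[OF 0(1)] by (metis card_1_singletonE singletonD)
  moreover have "std_space 0 = {\<lambda>_. 0}"
    by (auto simp: std_space_def)
  ultimately show ?case
    by (intro exI[of _ "\<lambda>_. 0"]) (auto simp: bij_betw_def std_form_def)
next
  case (Suc m)
  have U: "nondeg U"
    using Suc by blast
  obtain e f where e: "e \<in> U" and f: "f \<in> U" "B e f = 1"
    and split: "nondeg {x\<in>U. B x e = 0 \<and> B x f = 0}" "vec.dim {x\<in>U. B x e = 0 \<and> B x f = 0} = 2 * m"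
    using hyperbolic_split[OF Suc.prems] by blast
  have fe: "B f e = 1"
    using f B_sym by metis
  define U' where "U' = {x\<in>U. B x e = 0 \<and> B x f = 0}"
  have U'_iff: "x \<in> U' \<longleftrightarrow> x \<in> U \<and> B x e = 0 \<and> B x f = 0" for x
    by (simp add: U'_def)
  define red where "red y = y + (B y f *s e + B y e *s f)" for y
  have red: "red y \<in> U'" if "y \<in> U" for y
    using that e f fe nondegD(3)[OF U]
    by (cases "B y e"; cases "B y f") (auto simp: red_def U'_iff)
  obtain c where c: "bij_betw c (std_space (2 * m)) U'"
    "\<And>v w. v \<in> std_space (2 * m) \<Longrightarrow> w \<in> std_space (2 * m) \<Longrightarrow> c (v + w) = c v + c w"
    "\<And>v w. v \<in> std_space (2 * m) \<Longrightarrow> w \<in> std_space (2 * m) \<Longrightarrow> B (c v) (c w) = std_form m v w"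
    using Suc.IH[OF split] unfolding U'_def by blast
  define r where "r v = (\<lambda>i. if i < 2 * m then v i else 0)" for v :: "nat \<Rightarrow> bit"
  \<comment> \<open>Coordinate \<open>2 * m\<close> is the coefficient of \<open>e\<close> and is
    recovered by pairing with \<open>f\<close>; coordinate \<open>2 * m + 1\<close> is the
    coefficient of \<open>f\<close> and is recovered by pairing with \<open>e\<close>.\<close>
  define C where "C v = c (r v) + (v (2 * m) *s e + v (2 * m + 1) *s f)" for v
  have r: "r v \<in> std_space (2 * m)" for v
    by (simp add: r_def std_space_def)
  have cr: "c (r v) \<in> U'" for v
    using r c(1) by (auto simp: bij_betw_def)
  have cr0: "B (c (r v)) e = 0" "B (c (r v)) f = 0" "B e (c (r v)) = 0" "B f (c (r v)) = 0" for v
    using cr[of v] by (auto simp: U'_iff B_sym)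
  have CU: "C v \<in> U" for v
    using cr[of v] e f nondegD[OF U]
    by (cases "v (2 * m)"; cases "v (2 * m + 1)") (auto simp: C_def U'_iff)
  have coord: "B (C v) f = v (2 * m)" "B (C v) e = v (2 * m + 1)" for v
    using cr0[of v] f fe by (cases "v (2 * m)"; cases "v (2 * m + 1)"; auto simp: C_def)+
  have "inj_on C (std_space (2 * Suc m))"
  proof (rule inj_onI)
    fix v w assume vw: "v \<in> std_space (2 * Suc m)" "w \<in> std_space (2 * Suc m)" "C v = C w"
    then have eq: "v (2 * m) = w (2 * m)" "v (2 * m + 1) = w (2 * m + 1)"
      using coord by metis+
    then have "c (r v) = c (r w)"
      using vw(3) by (simp add: C_def)
    then have "r v = r w"
      using c(1) r by (auto simp: bij_betw_def inj_on_def)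
    show "v = w"
    proof
      fix i
      consider "i < 2 * m" | "i = 2 * m" | "i = 2 * m + 1" | "i \<ge> 2 * Suc m"
        by (metis add_2_eq_Suc' le_eq_less_or_eq less_Suc_eq mult_Suc_right not_less Suc_eq_plus1 add.commute)
      then show "v i = w i"
      proof cases
        case 1
        then show ?thesis
          using fun_cong[OF \<open>r v = r w\<close>, of i] by (simp add: r_def)
      qed (use eq vw in \<open>auto simp: std_space_def\<close>)
    qed
  qed
  moreover have "C ` std_space (2 * Suc m) = U"
  proof
    show "C ` std_space (2 * Suc m) \<subseteq> U"
      using CU by auto
    show "U \<subseteq> C ` std_space (2 * Suc m)"
    proof
      fix y assume y: "y \<in> U"
      obtain v where v: "v \<in> std_space (2 * m)" "c v = red y"
        using red[OF y] c(1) by (auto simp: bij_betw_def image_iff)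
      define w where "w = v(2 * m := B y f, 2 * m + 1 := B y e)"
      have "r w = v"
        using v(1) by (auto simp: r_def w_def std_space_def)
      then have "C w = y"
        using v(2) by (simp add: C_def w_def red_def add.assoc)
      moreover have "w \<in> std_space (2 * Suc m)"
        using v(1) by (auto simp: w_def std_space_def)
      ultimately show "y \<in> C ` std_space (2 * Suc m)"
        by blast
    qed
  qed
  moreover have "C (v + w) = C v + C w" for v w
  proof -
    have "r (v + w) = r v + r w"
      by (auto simp: r_def)
    then show ?thesis
      using c(2)[OF r r, of v w] by (simp add: C_def vec.scale_left_distrib add_ac)
  qed
  moreover have "B (C v) (C w) = std_form (Suc m) v w" for v w
  proof -
    have "B (C v) (C w) = B (c (r v)) (c (r w)) + (v (2 * m) * w (2 * m + 1) + v (2 * m + 1) * w (2 * m))"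
      using cr0[of v] cr0[of w] f fe
      by (cases "v (2 * m)"; cases "v (2 * m + 1)"; cases "w (2 * m)"; cases "w (2 * m + 1)")
        (auto simp: C_def)
    also have "B (c (r v)) (c (r w)) = std_form m v w"
      unfolding c(3)[OF r r] std_form_def by (intro sum.cong refl) (auto simp: r_def)
    finally show ?thesis
      by (simp add: std_form_def)
  qed
  ultimately show ?case
    unfolding bij_betw_def by blast
qed

definition isometric_on :: "(bit^'m \<Rightarrow> bit^'m) \<Rightarrow> (bit^'m) set \<Rightarrow> (bit^'m) set \<Rightarrow> bool" where
  "isometric_on h U W \<longleftrightarrow> bij_betw h U W \<and> (\<forall>x\<in>U. \<forall>y\<in>U. h (x + y) = h x + h y) \<and>
     (\<forall>x\<in>U. \<forall>y\<in>U. B (h x) (h y) = B x y)"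

lemma isometry_exists:
  assumes "nondeg U" "vec.dim U = 2 * m" "nondeg W" "vec.dim W = 2 * m"
  shows "\<exists>h. isometric_on h U W"
proof -
  let ?S = "std_space (2 * m)"
  obtain c where c: "bij_betw c ?S U" "\<And>v w. v \<in> ?S \<Longrightarrow> w \<in> ?S \<Longrightarrow> c (v + w) = c v + c w"
    "\<And>v w. v \<in> ?S \<Longrightarrow> w \<in> ?S \<Longrightarrow> B (c v) (c w) = std_form m v w"
    using symplectic_coordinates[OF assms(1,2)] by blast
  obtain c' where c': "bij_betw c' ?S W" "\<And>v w. v \<in> ?S \<Longrightarrow> w \<in> ?S \<Longrightarrow> c' (v + w) = c' v + c' w"
    "\<And>v w. v \<in> ?S \<Longrightarrow> w \<in> ?S \<Longrightarrow> B (c' v) (c' w) = std_form m v w"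
    using symplectic_coordinates[OF assms(3,4)] by blast
  let ?i = "inv_into ?S c"
  have i: "?i x \<in> ?S" "c (?i x) = x" if "x \<in> U" for x
    using that c(1) by (auto simp: bij_betw_def inv_into_into f_inv_into_f)
  have iadd: "?i (x + y) = ?i x + ?i y" if "x \<in> U" "y \<in> U" for x y
  proof -
    have "c (?i x + ?i y) = x + y"
      using c(2) i that by simp
    then show ?thesis
      using c(1) std_space_add[OF i(1) i(1), OF that] by (metis bij_betw_inv_into_left)
  qed
  have "bij_betw (c' \<circ> ?i) U W"
    using bij_betw_trans[OF bij_betw_inv_into[OF c(1)] c'(1)] .
  moreover have "B (c' (?i x)) (c' (?i y)) = B x y" if "x \<in> U" "y \<in> U" for x y
    using c'(3)[OF i(1) i(1), OF that] c(3)[OF i(1) i(1), OF that] i(2) that by simp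
  ultimately show ?thesis
    using c'(2)[OF i(1) i(1)] iadd by (intro exI[of _ "c' \<circ> ?i"]) (auto simp: isometric_on_def)
qed

text \<open>The space is the orthogonal sum of \<open>U\<close> and its complement, so isometries on
  the two summands combine freely. Prescribing both of them takes the place of an extension
  theorem.\<close>

lemma isometry_glue:
  assumes U: "nondeg U" and W: "nondeg W"
    and h: "isometric_on h U W" and h': "isometric_on h' (perp B U) (perp B W)"
  shows "\<exists>g\<in>carrier (Sp B). (\<forall>x\<in>U. g x = h x) \<and> (\<forall>x\<in>perp B U. g x = h' x)"
proof -
  define g where "g x = h (proj U x) + h' (x + proj U x)" for x
  note P = proj_props[OF U]
  have zero: "h 0 = 0" "h' 0 = 0"
    using h h' nondegD(2)[OF U] nondegD(2)[OF nondeg_perp[OF U]]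
    by (metis add_0_right isometric_on_def vec_add_self)+
  have "g (x + y) = g x + g y" for x y
  proof -
    have "h (proj U (x + y)) = h (proj U x) + h (proj U y)"
      using h P by (simp add: isometric_on_def)
    moreover have "x + y + proj U (x + y) = (x + proj U x) + (y + proj U y)"
      by (simp add: P add_ac)
    moreover have "h' ((x + proj U x) + (y + proj U y)) = h' (x + proj U x) + h' (y + proj U y)"
      using h' P(2) unfolding isometric_on_def by blast
    ultimately show ?thesis
      by (simp add: g_def add_ac)
  qed
  moreover have "B (g x) (g y) = B x y" for x y
  proof -
    have img: "h (proj U z) \<in> W" "h' (z + proj U z) \<in> perp B W" for z
      using h h' P by (auto simp: isometric_on_def bij_betw_def)
    have "B (g x) (g y) = B (h (proj U x)) (h (proj U y)) + B (h' (x + proj U x)) (h' (y + proj U y))"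
      using perpD[OF img(2) img(1)] by (simp add: g_def)
    also have "B (h (proj U x)) (h (proj U y)) = B (proj U x) (proj U y)"
      using h P unfolding isometric_on_def by blast
    also have "B (h' (x + proj U x)) (h' (y + proj U y)) = B (x + proj U x) (y + proj U y)"
      using h' P unfolding isometric_on_def by blast
    also have "B (proj U x) (proj U y) + B (x + proj U x) (y + proj U y)
      = B (proj U x + (x + proj U x)) (proj U y + (y + proj U y))"
      using perpD[OF P(2) P(1)] by (simp only: B_add) simp
    also have "\<dots> = B x y"
      by (simp add: add.left_commute)
    finally show ?thesis .
  qed
  moreover have "\<forall>x\<in>U. g x = h x" "\<forall>x\<in>perp B U. g x = h' x"
    by (auto simp: g_def P zero)
  ultimately show ?thesis
    by (intro bexI[of _ g]) (auto simp: sp_iff)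
qed

lemma nondeg_subspaces_iff: "U \<in> nondeg_subspaces B r \<longleftrightarrow> nondeg U \<and> vec.dim U = r"
  by (auto simp: nondeg_subspaces_def nondeg_def)

text \<open>Descends from the whole space, splitting off one hyperbolic plane at a time.\<close>

lemma nondeg_subspaces_nonempty:
  assumes "CARD('m) = 2 * n" "m \<le> n"
  shows "nondeg_subspaces B (2 * m) \<noteq> {}"
  using assms(2)
proof (induction rule: inc_induct)
  case base
  have "vec.dim (UNIV :: (bit^'m) set) = 2 * n"
    using assms by (simp del: vec.dim_UNIV add: vec_dim_card)
  then have "UNIV \<in> nondeg_subspaces B (2 * n)"
    by (simp del: vec.dim_UNIV add: nondeg_subspaces_iff)
  then show ?case
    by blast
next
  case (step m)
  then obtain U where "nondeg U" "vec.dim U = 2 * Suc m"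
    by (auto simp: nondeg_subspaces_iff)
  then show ?case
    using hyperbolic_split[of U m] nondeg_subspaces_iff by blast
qed

text \<open>If \<open>\<phi>\<close> vanished on \<open>U\<close>, its polar form \<open>B\<close>
  would vanish there as well.\<close>

lemma nondeg_neg_exists:
  assumes "\<phi> \<in> quad_forms B" "nondeg U" "vec.dim U \<noteq> 0"
  shows "\<exists>u\<in>U. \<phi> u = 1"
proof (rule ccontr)
  assume "\<not> (\<exists>u\<in>U. \<phi> u = 1)"
  then have "\<phi> u = 0" if "u \<in> U" for u
    using that by auto
  then have "B x y = 0" if "x \<in> U" "y \<in> U" for x y
    using that quad_add[OF assms(1), of x y] nondegD(3)[OF assms(2)] by simp
  then have "U = {0}"
    using nondegD(2,4)[OF assms(2)] by blast
  then show False
    using assms(3) by simp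
qed

lemma quad_forms_nonempty:
  assumes "CARD('m) = 2 * n"
  shows "quad_forms B \<noteq> {}"
proof -
  let ?S = "std_space (2 * n)"
  have "vec.dim (UNIV :: (bit^'m) set) = 2 * n"
    using assms by (simp del: vec.dim_UNIV add: vec_dim_card)
  then obtain c where c: "bij_betw c ?S UNIV" "\<And>v w. v \<in> ?S \<Longrightarrow> w \<in> ?S \<Longrightarrow> c (v + w) = c v + c w"
    "\<And>v w. v \<in> ?S \<Longrightarrow> w \<in> ?S \<Longrightarrow> B (c v) (c w) = std_form n v w"
    using symplectic_coordinates[OF nondeg_UNIV] by blast
  let ?i = "inv_into ?S c"
  have i: "?i x \<in> ?S" "c (?i x) = x" for x
    using c(1) by (auto simp: bij_betw_def inv_into_into f_inv_into_f)
  have iadd: "?i (x + y) = ?i x + ?i y" for x y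
  proof -
    have "c (?i x + ?i y) = x + y"
      using c(2) i by simp
    then show ?thesis
      using c(1) std_space_add[OF i(1) i(1)] by (metis bij_betw_inv_into_left)
  qed
  \<comment> \<open>The hyperbolic quadratic form, whose polarisation is
    \<open>std_form\<close>.\<close>
  define q where "q v = (\<Sum>i<n. v (2 * i) * v (2 * i + 1))" for v :: "nat \<Rightarrow> bit"
  have "q (v + w) = q v + q w + std_form n v w" for v w
    unfolding q_def std_form_def sum.distrib[symmetric]
    by (intro sum.cong refl) (simp add: algebra_simps)
  then have "q (?i (x + y)) = q (?i x) + q (?i y) + B x y" for x y
    using c(3)[OF i(1) i(1), of x y] by (simp add: iadd i(2))
  then have "q \<circ> ?i \<in> quad_forms B"
    by (simp add: quad_forms_iff)
  then show ?thesis
    by blast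
qed

text \<open>Twisting by a vector of \<open>U\<close> changes the sign on \<open>U\<close> only, and
  likewise for the complement, so any form can be corrected on the two summands
  independently.\<close>

lemma form_with_types_exists:
  assumes "CARD('m) = 2 * n" and U: "nondeg U" "vec.dim U = 2 * d" "d \<noteq> 0"
    and P: "vec.dim (perp B U) = 2 * d'" "d' \<noteq> 0" and signs: "\<delta> \<in> {1, -1}" "\<delta>' \<in> {1, -1}"
  shows "\<exists>\<phi>\<in>quad_forms B. qsum \<phi> U = \<delta> * 2 ^ d \<and> qsum \<phi> (perp B U) = \<delta>' * 2 ^ d'"
proof -
  obtain \<phi> where \<phi>: "\<phi> \<in> quad_forms B"
    using quad_forms_nonempty[OF assms(1)] by blast
  have adjust: "\<exists>u\<in>W. sg (\<phi> u) * qsum \<phi> W = \<eta> * 2 ^ e"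
    if W: "nondeg W" "vec.dim W = 2 * e" "e \<noteq> 0" "\<eta> \<in> {1, -1}" for W e \<eta>
  proof (cases "qsum \<phi> W = \<eta> * 2 ^ e")
    case True
    then show ?thesis
      using nondegD(2)[OF W(1)] \<phi> by (intro bexI[of _ 0]) auto
  next
    case False
    obtain u where u: "u \<in> W" "\<phi> u = 1"
      using nondeg_neg_exists[OF \<phi> W(1)] W(2,3) by auto
    have "qsum \<phi> W = - (\<eta> * 2 ^ e)"
      using witt_index_cases[OF \<phi> W(1,2)] False W(4) by auto
    then show ?thesis
      using u by (intro bexI[of _ u]) auto
  qed
  obtain u where u: "u \<in> U" "sg (\<phi> u) * qsum \<phi> U = \<delta> * 2 ^ d"
    using adjust[OF U signs(1)] by blast
  obtain w where w: "w \<in> perp B U" "sg (\<phi> w) * qsum \<phi> (perp B U) = \<delta>' * 2 ^ d'"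
    using adjust[OF nondeg_perp[OF U(1)] P signs(2)] by blast
  have "proj (perp B U) (u + w) = w"
    using proj_add[OF nondeg_perp[OF U(1)] w(1), of u] U(1) u(1) by (simp add: add.commute)
  then have "qsum (twist \<phi> (u + w)) U = \<delta> * 2 ^ d" "qsum (twist \<phi> (u + w)) (perp B U) = \<delta>' * 2 ^ d'"
    using u w U(1) by (simp_all add: qsum_twist[OF \<phi>])
  then show ?thesis
    using \<phi> by blast
qed

end

subsection \<open>Sums over singular vectors\<close>

lemma sum_mult_product:
  fixes f :: "'a \<Rightarrow> int"
  shows "(\<Sum>p\<in>A \<times> C. f (fst p) * g (snd p)) = (\<Sum>x\<in>A. f x) * (\<Sum>y\<in>C. g y)"
  by (simp add: sum_product sum.cartesian_product case_prod_unfold)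

context symplectic_space
begin

definition zeros :: "(bit^'m \<Rightarrow> bit) \<Rightarrow> (bit^'m) set \<Rightarrow> (bit^'m) set" where
  "zeros \<phi> W = {a\<in>W. \<phi> a = 0}"

text \<open>Signed counts for an edge, a path with two edges and a triangle in the graph on
  \<open>D\<close> given by \<open>B a b = 1\<close>. Expanding indicators into signs expresses the
  numbers of pairs and triples with prescribed values of \<open>B\<close> through these three
  sums.\<close>

definition pair_sum :: "(bit^'m) set \<Rightarrow> int" where
  "pair_sum D = (\<Sum>p\<in>D \<times> D. sg (B (fst p) (snd p)))"

definition path_sum :: "(bit^'m) set \<Rightarrow> int" where
  "path_sum D = (\<Sum>p\<in>D \<times> D \<times> D. sg (B (fst p) (fst (snd p)) + B (fst p) (snd (snd p))))"

definition triangle_sum :: "(bit^'m) set \<Rightarrow> int" where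
  "triangle_sum D = (\<Sum>p\<in>D \<times> D \<times> D.
     sg (B (fst p) (fst (snd p)) + B (fst p) (snd (snd p)) + B (fst (snd p)) (snd (snd p))))"

text \<open>Twice the indicator of \<open>\<phi> b = 0\<close> is \<open>1 + sg (\<phi> b)\<close>.
  Each sum over \<open>zeros\<close> is doubled for this reason, which explains the factors 4 and 8
  below.\<close>

lemma sum_zeros: "2 * (\<Sum>b\<in>zeros \<phi> W. f b) = (\<Sum>b\<in>W. f b) + (\<Sum>b\<in>W. sg (\<phi> b) * (f b :: int))"
proof -
  have "2 * (\<Sum>b\<in>zeros \<phi> W. f b) = (\<Sum>b\<in>W. if \<phi> b = 0 then 2 * f b else 0)"
    unfolding zeros_def sum_distrib_left by (rule sum.inter_filter) simp
  also have "\<dots> = (\<Sum>b\<in>W. f b + sg (\<phi> b) * f b)"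
  proof (rule sum.cong[OF refl])
    fix b
    show "(if \<phi> b = 0 then 2 * f b else 0) = f b + sg (\<phi> b) * f b"
      by (cases "\<phi> b") auto
  qed
  finally show ?thesis
    by (simp add: sum.distrib)
qed

lemma sum_B_nondeg:
  assumes "nondeg W" "a \<in> W"
  shows "(\<Sum>b\<in>W. sg (B a b)) = (if a = 0 then int (card W) else 0)"
proof -
  have "(\<forall>b\<in>W. B a b = 0) \<longleftrightarrow> a = 0"
    using nondegD(4)[OF assms] by auto
  then show ?thesis
    using assms by (subst character_sum) (auto simp: nondegD)
qed

context
  fixes \<phi> :: "bit^'m \<Rightarrow> bit" and W :: "(bit^'m) set"
  assumes \<phi>: "\<phi> \<in> quad_forms B" and W: "nondeg W"
begin

lemma card_zeros: "2 * int (card (zeros \<phi> W)) = qsum \<phi> W * qsum \<phi> W + qsum \<phi> W"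
  using sum_zeros[where f = "\<lambda>_. 1" and \<phi> = \<phi> and W = W] qsum_square[OF \<phi> W] by (simp add: qsum_def)

lemma sum_zeros_B:
  assumes "a \<in> W"
  shows "2 * (\<Sum>b\<in>zeros \<phi> W. sg (B a b))
    = (if a = 0 then qsum \<phi> W * qsum \<phi> W else 0) + sg (\<phi> a) * qsum \<phi> W"
proof -
  have "(\<Sum>b\<in>W. sg (\<phi> b) * sg (B a b)) = qsum (twist \<phi> a) W"
    by (simp add: qsum_def twist_def sg_add)
  then show ?thesis
    by (simp add: sum_zeros sum_B_nondeg[OF W assms] qsum_square[OF \<phi> W] qsum_twist_in[OF \<phi> W assms])
qed

lemma pair_sum_zeros:
  "4 * pair_sum (zeros \<phi> W) = qsum \<phi> W * qsum \<phi> W * (qsum \<phi> W + 3)"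
proof -
  let ?x = "qsum \<phi> W" and ?Z = "zeros \<phi> W"
  have "0 \<in> ?Z"
    using \<phi> nondegD(2)[OF W] by (simp add: zeros_def)
  have "4 * pair_sum ?Z = 2 * (\<Sum>a\<in>?Z. 2 * (\<Sum>b\<in>?Z. sg (B a b)))"
    by (simp add: pair_sum_def sum.cartesian_product case_prod_unfold sum_distrib_left)
  also have "\<dots> = 2 * (\<Sum>a\<in>?Z. (if a = 0 then ?x * ?x else 0) + ?x)"
    using sum_zeros_B by (intro arg_cong[of _ _ "\<lambda>t. 2 * t"] sum.cong refl) (auto simp: zeros_def)
  also have "\<dots> = 2 * (?x * ?x) + 2 * int (card ?Z) * ?x"
    using \<open>0 \<in> ?Z\<close> by (simp add: sum.distrib)
  finally show ?thesis
    unfolding card_zeros by (simp add: algebra_simps)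
qed

lemma path_sum_zeros:
  "8 * path_sum (zeros \<phi> W) = qsum \<phi> W * qsum \<phi> W * qsum \<phi> W * (3 * qsum \<phi> W + 5)"
proof -
  let ?x = "qsum \<phi> W" and ?Z = "zeros \<phi> W"
  have "0 \<in> ?Z"
    using \<phi> nondegD(2)[OF W] by (simp add: zeros_def)
  have "8 * path_sum ?Z = 2 * (\<Sum>a\<in>?Z. (2 * (\<Sum>b\<in>?Z. sg (B a b))) * (2 * (\<Sum>c\<in>?Z. sg (B a c))))"
    by (simp add: path_sum_def sg_add sum_product sum.cartesian_product case_prod_unfold
        sum_distrib_left mult_ac)
  also have "\<dots> = 2 * (\<Sum>a\<in>?Z. ((if a = 0 then ?x * ?x else 0) + ?x) * ((if a = 0 then ?x * ?x else 0) + ?x))"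
    using sum_zeros_B by (intro arg_cong[of _ _ "\<lambda>t. 2 * t"] sum.cong refl) (auto simp: zeros_def)
  also have "\<dots> = 2 * (\<Sum>a\<in>?Z. (if a = 0 then ?x * ?x * (?x * ?x) + 2 * ?x * ?x * ?x else 0) + ?x * ?x)"
    by (intro arg_cong[of _ _ "\<lambda>t. 2 * t"] sum.cong refl) (auto simp: algebra_simps)
  also have "\<dots> = 2 * (?x * ?x * (?x * ?x) + 2 * ?x * ?x * ?x) + 2 * int (card ?Z) * (?x * ?x)"
    using \<open>0 \<in> ?Z\<close> by (simp add: sum.distrib)
  finally show ?thesis
    unfolding card_zeros by (simp add: algebra_simps)
qed

end

text \<open>Translating by \<open>a\<close> replaces \<open>\<phi>\<close> by \<open>twist \<phi> a\<close>, which has the same type.\<close>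

lemma triangle_sum_zeros:
  assumes \<phi>: "\<phi> \<in> quad_forms B" and W: "nondeg W"
  shows "triangle_sum (zeros \<phi> W) = int (card (zeros \<phi> W)) * pair_sum (zeros \<phi> W)"
proof -
  let ?Z = "zeros \<phi> W"
  have "triangle_sum ?Z = (\<Sum>a\<in>?Z. \<Sum>p\<in>?Z \<times> ?Z. sg (B a (fst p) + B a (snd p) + B (fst p) (snd p)))"
    by (simp add: triangle_sum_def sum.cartesian_product case_prod_unfold)
  also have "\<dots> = (\<Sum>a\<in>?Z. pair_sum ?Z)"
  proof (rule sum.cong[OF refl])
    fix a assume a: "a \<in> ?Z"
    then have aW: "a \<in> W" and a0: "\<phi> a = 0"
      by (auto simp: zeros_def)
    have tr: "a + x \<in> zeros (twist \<phi> a) W \<longleftrightarrow> x \<in> ?Z" for x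
      using aW a0 nondeg_add_in_iff[OF W aW] by (auto simp: zeros_def twist_def quad_add[OF \<phi>])
    have tr': "x \<in> zeros (twist \<phi> a) W \<longleftrightarrow> a + x \<in> ?Z" for x
      using tr[of "a + x"] by simp
    have "(\<Sum>p\<in>?Z \<times> ?Z. sg (B a (fst p) + B a (snd p) + B (fst p) (snd p)))
      = pair_sum (zeros (twist \<phi> a) W)"
      unfolding pair_sum_def
      by (rule sum.reindex_bij_witness[of _ "\<lambda>p. (a + fst p, a + snd p)" "\<lambda>p. (a + fst p, a + snd p)"])
        (auto simp: tr tr' B_sym[of _ a] add_ac)
    moreover have "4 * pair_sum (zeros (twist \<phi> a) W) = 4 * pair_sum ?Z"
      using pair_sum_zeros[OF \<phi> W] pair_sum_zeros[OF twist_quad[OF \<phi>] W, of a]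
        qsum_twist_in[OF \<phi> W aW] a0 by simp
    ultimately show "(\<Sum>p\<in>?Z \<times> ?Z. sg (B a (fst p) + B a (snd p) + B (fst p) (snd p))) = pair_sum ?Z"
      by simp
  qed
  finally show ?thesis
    by simp
qed

definition split_zeros :: "(bit^'m \<Rightarrow> bit) \<Rightarrow> (bit^'m) set \<Rightarrow> (bit^'m) set" where
  "split_zeros \<phi> U = {a. \<phi> a = 0 \<and> \<phi> (proj U a) = 0}"

context
  fixes \<phi> :: "bit^'m \<Rightarrow> bit" and U :: "(bit^'m) set"
  assumes \<phi>: "\<phi> \<in> quad_forms B" and U: "nondeg U"
begin

lemma split_zeros_iff:
  "a \<in> split_zeros \<phi> U \<longleftrightarrow> proj U a \<in> zeros \<phi> U \<and> a + proj U a \<in> zeros \<phi> (perp B U)"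
proof -
  have "\<phi> (proj U a + (a + proj U a)) = \<phi> (proj U a) + \<phi> (a + proj U a)"
    using perpD(2)[OF proj_props(2)[OF U] proj_props(1)[OF U], of a a] by (subst quad_add[OF \<phi>]) simp
  moreover have "proj U a + (a + proj U a) = a"
    by (simp add: add_ac)
  ultimately have "\<phi> a = \<phi> (proj U a) + \<phi> (a + proj U a)"
    by simp
  then show ?thesis
    using proj_props[OF U] by (auto simp: split_zeros_def zeros_def)
qed

private lemma B_split: "B (proj U a) (proj U b) + B (a + proj U a) (b + proj U b) = B a b"
proof -
  have "B (proj U a + (a + proj U a)) (proj U b + (b + proj U b))
    = B (proj U a) (proj U b) + B (a + proj U a) (b + proj U b)"
    using perpD[OF proj_props(2)[OF U] proj_props(1)[OF U]] by (simp only: B_add) simp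
  moreover have "proj U a + (a + proj U a) = a" for a
    by (simp add: add_ac)
  ultimately show ?thesis
    by simp
qed

private lemmas Zin = zeros_def[of \<phi>]

lemma card_split_zeros: "card (split_zeros \<phi> U) = card (zeros \<phi> U) * card (zeros \<phi> (perp B U))"
proof -
  have "bij_betw (\<lambda>(u, w). u + w) (zeros \<phi> U \<times> zeros \<phi> (perp B U)) (split_zeros \<phi> U)"
    by (rule bij_betw_byWitness[where f' = "\<lambda>a. (proj U a, a + proj U a)"])
      (auto simp: split_zeros_iff U Zin add_ac)
  then show ?thesis
    using bij_betw_same_card by (metis card_cartesian_product)
qed

private lemma sg_B_split:
  "sg (B a b) = sg (B (proj U a) (proj U b)) * sg (B (a + proj U a) (b + proj U b))"
  by (simp only: B_split sg_add[symmetric])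

text \<open>The set \<open>split_zeros\<close> is a product along \<open>U\<close> and its
  complement, and the sign of \<open>B\<close> factors in the same way. Hence every sum of such
  signs factors into one sum for each summand.\<close>

private lemma bij_split_pair:
  "bij_betw (\<lambda>(a, b). ((proj U a, proj U b), (a + proj U a, b + proj U b)))
    (split_zeros \<phi> U \<times> split_zeros \<phi> U)
    ((zeros \<phi> U \<times> zeros \<phi> U) \<times> (zeros \<phi> (perp B U) \<times> zeros \<phi> (perp B U)))"
  by (rule bij_betw_byWitness[where f' = "\<lambda>((a, b), (a', b')). (a + a', b + b')"])
    (auto simp: split_zeros_iff U Zin add_ac)

private lemma sum_split_pair:
  assumes "\<And>a b. f (a, b) = g (proj U a, proj U b) * h (a + proj U a, b + proj U b)"
  shows "(\<Sum>p\<in>split_zeros \<phi> U \<times> split_zeros \<phi> U. f p)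
    = (\<Sum>p\<in>zeros \<phi> U \<times> zeros \<phi> U. g p :: int) *
      (\<Sum>p\<in>zeros \<phi> (perp B U) \<times> zeros \<phi> (perp B U). h p)"
  unfolding sum_mult_product[symmetric] sum.reindex_bij_betw[OF bij_split_pair, symmetric]
  by (intro sum.cong refl) (auto simp: assms)

lemma pair_sum_split: "pair_sum (split_zeros \<phi> U) = pair_sum (zeros \<phi> U) * pair_sum (zeros \<phi> (perp B U))"
  unfolding pair_sum_def
proof (rule sum_split_pair)
  fix a b
  let ?p = "(proj U a, proj U b)" and ?q = "(a + proj U a, b + proj U b)"
  show "sg (B (fst (a, b)) (snd (a, b))) = sg (B (fst ?p) (snd ?p)) * sg (B (fst ?q) (snd ?q))"
    by (simp only: fst_conv snd_conv sg_B_split[of a b])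
qed

private lemma bij_split_triple:
  "bij_betw (\<lambda>(a, b, c). ((proj U a, proj U b, proj U c), (a + proj U a, b + proj U b, c + proj U c)))
    (split_zeros \<phi> U \<times> split_zeros \<phi> U \<times> split_zeros \<phi> U)
    ((zeros \<phi> U \<times> zeros \<phi> U \<times> zeros \<phi> U) \<times>
     (zeros \<phi> (perp B U) \<times> zeros \<phi> (perp B U) \<times> zeros \<phi> (perp B U)))"
  by (rule bij_betw_byWitness[where f' = "\<lambda>((a, b, c), (a', b', c')). (a + a', b + b', c + c')"])
    (auto simp: split_zeros_iff U Zin add_ac)

private lemma sum_split_triple:
  assumes "\<And>a b c. f (a, b, c) = g (proj U a, proj U b, proj U c) * h (a + proj U a, b + proj U b, c + proj U c)"
  shows "(\<Sum>p\<in>split_zeros \<phi> U \<times> split_zeros \<phi> U \<times> split_zeros \<phi> U. f p)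
    = (\<Sum>p\<in>zeros \<phi> U \<times> zeros \<phi> U \<times> zeros \<phi> U. g p :: int) *
      (\<Sum>p\<in>zeros \<phi> (perp B U) \<times> zeros \<phi> (perp B U) \<times> zeros \<phi> (perp B U). h p)"
  unfolding sum_mult_product[symmetric] sum.reindex_bij_betw[OF bij_split_triple, symmetric]
  by (intro sum.cong refl) (auto simp: assms)

lemma path_sum_split: "path_sum (split_zeros \<phi> U) = path_sum (zeros \<phi> U) * path_sum (zeros \<phi> (perp B U))"
  unfolding path_sum_def
proof (rule sum_split_triple)
  fix a b c
  show "sg (B (fst (a, b, c)) (fst (snd (a, b, c))) + B (fst (a, b, c)) (snd (snd (a, b, c)))) =
    sg (B (fst (proj U a, proj U b, proj U c)) (fst (snd (proj U a, proj U b, proj U c))) +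
        B (fst (proj U a, proj U b, proj U c)) (snd (snd (proj U a, proj U b, proj U c)))) *
    sg (B (fst (a + proj U a, b + proj U b, c + proj U c)) (fst (snd (a + proj U a, b + proj U b, c + proj U c))) +
        B (fst (a + proj U a, b + proj U b, c + proj U c)) (snd (snd (a + proj U a, b + proj U b, c + proj U c))))"
    by (simp only: fst_conv snd_conv sg_add sg_B_split[of a b] sg_B_split[of a c] mult_ac)
qed

lemma triangle_sum_split:
  "triangle_sum (split_zeros \<phi> U) = triangle_sum (zeros \<phi> U) * triangle_sum (zeros \<phi> (perp B U))"
  unfolding triangle_sum_def
proof (rule sum_split_triple)
  fix a b c
  let ?p = "(proj U a, proj U b, proj U c)" and ?q = "(a + proj U a, b + proj U b, c + proj U c)"
  show "sg (B (fst (a, b, c)) (fst (snd (a, b, c))) + B (fst (a, b, c)) (snd (snd (a, b, c))) +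
      B (fst (snd (a, b, c))) (snd (snd (a, b, c)))) =
    sg (B (fst ?p) (fst (snd ?p)) + B (fst ?p) (snd (snd ?p)) + B (fst (snd ?p)) (snd (snd ?p))) *
    sg (B (fst ?q) (fst (snd ?q)) + B (fst ?q) (snd (snd ?q)) + B (fst (snd ?q)) (snd (snd ?q)))"
    by (simp only: fst_conv snd_conv sg_add sg_B_split[of a b] sg_B_split[of a c] sg_B_split[of b c] mult_ac)
qed

text \<open>All three quantities are multiplicative along the decomposition, so the relation is
  inherited from \<open>triangle_sum_zeros\<close> on the summands.\<close>

lemma triangle_sum_split_zeros:
  "triangle_sum (split_zeros \<phi> U) = int (card (split_zeros \<phi> U)) * pair_sum (split_zeros \<phi> U)"
  by (simp add: triangle_sum_split pair_sum_split card_split_zeros triangle_sum_zeros \<phi> U)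

end

text \<open>Twice the indicator of \<open>B a b = v\<close> is
  \<open>1 + sg v * sg (B a b)\<close>.\<close>

lemma card_pairs_B:
  "2 * int (card {(a, b). a \<in> D \<and> b \<in> D \<and> B a b = 1}) = int (card D) * int (card D) - pair_sum D"
  "2 * int (card {(a, b). a \<in> D \<and> b \<in> D \<and> B a b = 0}) = int (card D) * int (card D) + pair_sum D"
proof -
  have "2 * int (card {p\<in>D \<times> D. B (fst p) (snd p) = v})
    = (\<Sum>p\<in>D \<times> D. 1 + sg v * sg (B (fst p) (snd p)))" for v
  proof -
    have "2 * int (card {p\<in>D \<times> D. B (fst p) (snd p) = v}) = (\<Sum>p\<in>D \<times> D. if B (fst p) (snd p) = v then 2 else 0)"
      by (subst sum.inter_filter[symmetric]) auto
    also have "\<dots> = (\<Sum>p\<in>D \<times> D. 1 + sg v * sg (B (fst p) (snd p)))"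
    proof (rule sum.cong[OF refl])
      fix p
      show "(if B (fst p) (snd p) = v then 2 else 0) = 1 + sg v * sg (B (fst p) (snd p))"
        by (cases v; cases "B (fst p) (snd p)") auto
    qed
    finally show ?thesis .
  qed
  from this[of 1] this[of 0] show
    "2 * int (card {(a, b). a \<in> D \<and> b \<in> D \<and> B a b = 1}) = int (card D) * int (card D) - pair_sum D"
    "2 * int (card {(a, b). a \<in> D \<and> b \<in> D \<and> B a b = 0}) = int (card D) * int (card D) + pair_sum D"
    by (simp_all add: pair_sum_def sum.distrib sum_subtractf case_prod_unfold card_cartesian_product mem_Times_iff conj_assoc)
qed

definition B_triples :: "(bit^'m) set \<Rightarrow> bit \<Rightarrow> bit \<Rightarrow> bit \<Rightarrow> ((bit^'m) \<times> (bit^'m) \<times> (bit^'m)) set" where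
  "B_triples D i j l = {p\<in>D \<times> D \<times> D. B (fst p) (fst (snd p)) = i \<and> B (fst p) (snd (snd p)) = j \<and>
     B (fst (snd p)) (snd (snd p)) = l}"

text \<open>The product of three indicators expands into eight sign sums. By symmetry the single
  signs all give \<open>card D * pair_sum D\<close> and the products of two signs all give
  \<open>path_sum D\<close>; the hypothesis reduces the product of three signs to
  \<open>card D * pair_sum D\<close> again.\<close>

lemma card_triples_B:
  assumes "triangle_sum D = int (card D) * pair_sum D"
  shows "8 * int (card (B_triples D i j l)) = int (card D) ^ 3
    + (sg i + sg j + sg l + sg i * sg j * sg l) * (int (card D) * pair_sum D)
    + (sg i * sg j + sg i * sg l + sg j * sg l) * path_sum D"
proof -
  define ab ac bc where "ab p = sg (B (fst p) (fst (snd p)))" and "ac p = sg (B (fst p) (snd (snd p)))"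
    and "bc p = sg (B (fst (snd p)) (snd (snd p)))" for p :: "(bit^'m) \<times> (bit^'m) \<times> (bit^'m)"
  let ?T = "D \<times> D \<times> D"
  have "8 * int (card (B_triples D i j l)) = (\<Sum>p\<in>?T. if p \<in> B_triples D i j l then 8 else 0)"
    by (subst sum.inter_filter[symmetric]) (auto simp: B_triples_def)
  also have "\<dots> = (\<Sum>p\<in>?T. (1 + sg i * ab p) * (1 + sg j * ac p) * (1 + sg l * bc p))"
  proof (rule sum.cong[OF refl])
    fix p assume "p \<in> ?T"
    then show "(if p \<in> B_triples D i j l then 8 else 0) = (1 + sg i * ab p) * (1 + sg j * ac p) * (1 + sg l * bc p)"
      unfolding ab_def ac_def bc_def B_triples_def
      by (cases i; cases j; cases l; cases "B (fst p) (fst (snd p))"; cases "B (fst p) (snd (snd p))";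
          cases "B (fst (snd p)) (snd (snd p))") auto
  qed
  also have "\<dots> = (\<Sum>p\<in>?T. 1 + sg i * ab p + sg j * ac p + sg l * bc p + sg i * sg j * (ab p * ac p)
      + sg i * sg l * (ab p * bc p) + sg j * sg l * (ac p * bc p) + sg i * sg j * sg l * (ab p * ac p * bc p))"
    by (intro sum.cong refl) (simp add: algebra_simps)
  also have "\<dots> = int (card ?T) + sg i * sum ab ?T + sg j * sum ac ?T + sg l * sum bc ?T
      + sg i * sg j * (\<Sum>p\<in>?T. ab p * ac p) + sg i * sg l * (\<Sum>p\<in>?T. ab p * bc p)
      + sg j * sg l * (\<Sum>p\<in>?T. ac p * bc p) + sg i * sg j * sg l * (\<Sum>p\<in>?T. ab p * ac p * bc p)"
    by (simp add: sum.distrib sum_distrib_left)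
  also have "sum ab ?T = sum bc ?T"
    by (rule sum.reindex_bij_witness[of _ "\<lambda>(c, a, b). (a, b, c)" "\<lambda>(a, b, c). (c, a, b)"])
      (auto simp: ab_def bc_def)
  also have "sum ac ?T = sum bc ?T"
    by (rule sum.reindex_bij_witness[of _ "\<lambda>(b, a, c). (a, b, c)" "\<lambda>(a, b, c). (b, a, c)"])
      (auto simp: ac_def bc_def)
  also have "sum bc ?T = int (card D) * pair_sum D"
    using sum_mult_product[of "\<lambda>_. 1" "\<lambda>p. sg (B (fst p) (snd p))" D "D \<times> D"]
    by (simp add: bc_def pair_sum_def)
  also have "(\<Sum>p\<in>?T. ab p * ac p) = path_sum D"
    by (simp add: path_sum_def ab_def ac_def sg_add)
  also have "(\<Sum>p\<in>?T. ab p * bc p) = path_sum D"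
    unfolding path_sum_def
    by (rule sum.reindex_bij_witness[of _ "\<lambda>(b, a, c). (a, b, c)" "\<lambda>(a, b, c). (b, a, c)"])
      (auto simp: ab_def bc_def sg_add B_sym)
  also have "(\<Sum>p\<in>?T. ac p * bc p) = path_sum D"
    unfolding path_sum_def
    by (rule sum.reindex_bij_witness[of _ "\<lambda>(c, a, b). (a, b, c)" "\<lambda>(a, b, c). (c, a, b)"])
      (auto simp: ac_def bc_def sg_add B_sym)
  also have "(\<Sum>p\<in>?T. ab p * ac p * bc p) = int (card D) * pair_sum D"
    using assms by (simp add: triangle_sum_def ab_def ac_def bc_def sg_add)
  finally show ?thesis
    by (simp add: card_cartesian_product power3_eq_cube algebra_simps)
qed

end

subsection \<open>The code\<close>

text \<open>With \<open>x\<close> outside \<open>A\<close> and \<open>y\<close> outside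
  \<open>C\<close>, the sum \<open>x + y\<close> would lie in neither.\<close>

lemma subspace_Un_cases:
  assumes "vec.subspace (U :: (bit^'m) set)" "vec.subspace A" "vec.subspace C" "U \<subseteq> A \<union> C"
  shows "U \<subseteq> A \<or> U \<subseteq> C"
proof (rule ccontr)
  assume "\<not> ?thesis"
  then obtain x y where xy: "x \<in> U" "x \<notin> A" "y \<in> U" "y \<notin> C"
    by blast
  then have "x \<in> C" "y \<in> A" "x + y \<in> A \<or> x + y \<in> C"
    using assms by (auto simp: subspace_bit_iff)
  moreover have "x = (x + y) + y" "y = x + (x + y)"
    by (simp_all add: add.assoc)
  ultimately show False
    using assms(2,3) xy by (metis subspace_bit_iff)
qed

locale symplectic_code = symplectic_space B for B :: "bit^'m \<Rightarrow> bit^'m \<Rightarrow> bit" +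
  fixes n d :: nat and \<epsilon> \<epsilon>' :: int
  assumes card_m: "CARD('m) = 2 * n" and n2: "2 \<le> n" and d1: "1 \<le> d" and dn: "d \<le> n - 1"
    and eps: "\<epsilon> \<in> {1, -1}" and eps': "\<epsilon>' \<in> {1, -1}"
begin

abbreviation "\<Q> \<equiv> quads B \<epsilon>"
abbreviation "\<G> \<equiv> sp_code B d \<epsilon> \<epsilon>'"
abbreviation "cw \<equiv> codeword B \<epsilon> \<epsilon>'"
abbreviation "act \<equiv> form_act B \<epsilon>"
abbreviation "\<U> \<equiv> nondeg_subspaces B (2 * d)"

lemma dim_V: "vec.dim (UNIV :: (bit^'m) set) = 2 * n"
  using card_m by (simp del: vec.dim_UNIV add: vec_dim_card)

lemma card_V: "CARD(bit^'m) = 2 ^ (2 * n)"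
  using card_subspace[of "UNIV :: (bit^'m) set"] dim_V by (simp del: vec.dim_UNIV add: subspace_bit_iff)

lemma d_less: "d < n"
  using d1 dn n2 by linarith

lemma eps_sq [simp]: "\<epsilon> * \<epsilon> = 1" "\<epsilon>' * \<epsilon>' = 1" "\<epsilon> * (\<epsilon> * t) = t" "\<epsilon>' * (\<epsilon>' * t) = t"
  using eps eps' by auto

lemma \<U>_D:
  assumes "U \<in> \<U>"
  shows "nondeg U" "vec.dim U = 2 * d" "vec.dim (perp B U) = 2 * (n - d)"
proof -
  show U: "nondeg U" "vec.dim U = 2 * d"
    using assms by (simp_all add: nondeg_subspaces_iff)
  have "(2::nat) ^ (2 * d + vec.dim (perp B U)) = 2 ^ (2 * n)"
    using card_perp[of U] U card_V by (simp add: card_subspace nondegD power_add)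
  then have "2 * d + vec.dim (perp B U) = 2 * n"
    by (simp only: power_inject_exp)
  then show "vec.dim (perp B U) = 2 * (n - d)"
    by simp
qed

lemma quads_iff: "\<phi> \<in> \<Q> \<longleftrightarrow> \<phi> \<in> quad_forms B \<and> qsum \<phi> UNIV = \<epsilon> * 2 ^ n"
  using has_type_iff[OF _ nondeg_UNIV dim_V] eps by (auto simp: quads_def)

lemma \<Q>_quad: "\<phi> \<in> \<Q> \<Longrightarrow> \<phi> \<in> quad_forms B"
  by (simp add: quads_iff)

lemma qsum_cases:
  "\<phi> \<in> quad_forms B \<Longrightarrow> U \<in> \<U> \<Longrightarrow> qsum \<phi> U = \<epsilon>' * 2 ^ d \<or> qsum \<phi> U = - (\<epsilon>' * 2 ^ d)"
  using witt_index_cases[of \<phi> U d] eps' by (auto simp: \<U>_D)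

text \<open>The Gauss sum on the whole space is fixed and is the product of those on the summands,
  so the type on \<open>U\<close> decides the type on the complement. For this reason
  \<open>codeword_iff\<close> needs only one of the two type conditions.\<close>

lemma qsum_perp:
  assumes "\<phi> \<in> \<Q>" "U \<in> \<U>" "\<eta> \<in> {1, -1}" "qsum \<phi> U = \<eta> * 2 ^ d"
  shows "qsum \<phi> (perp B U) = \<epsilon> * \<eta> * 2 ^ (n - d)"
proof -
  have "\<eta> * 2 ^ d * qsum \<phi> (perp B U) = \<epsilon> * 2 ^ n"
    using qsum_decomp[of \<phi> U] assms by (simp add: quads_iff \<U>_D)
  also have "(2::int) ^ n = 2 ^ d * 2 ^ (n - d)"
    using d_less by (simp flip: power_add)
  finally have "2 ^ d * (\<eta> * qsum \<phi> (perp B U)) = 2 ^ d * (\<epsilon> * 2 ^ (n - d))"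
    by (simp add: mult_ac)
  then have "\<eta> * qsum \<phi> (perp B U) = \<epsilon> * 2 ^ (n - d)"
    by simp
  then show ?thesis
    using assms(3) by auto
qed

lemma codeword_iff:
  assumes "U \<in> \<U>"
  shows "\<phi> \<in> cw U \<longleftrightarrow> \<phi> \<in> \<Q> \<and> qsum \<phi> U = \<epsilon>' * 2 ^ d"
proof -
  have "\<epsilon> * \<epsilon>' \<in> {1, -1}"
    using eps eps' by auto
  then show ?thesis
    using has_type_iff[of \<phi> U d] has_type_iff[of \<phi> "perp B U" "n - d"] \<U>_D[OF assms] eps'
      qsum_perp[OF _ assms eps'] \<Q>_quad
    by (auto simp: codeword_def)
qed

lemma twist_\<Q>: "\<phi> \<in> \<Q> \<Longrightarrow> twist \<phi> a \<in> \<Q> \<longleftrightarrow> \<phi> a = 0"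
  using qsum_twist_in[of \<phi> UNIV a] eps by (cases "\<phi> a") (auto simp: quads_iff)

lemma \<Q>_twist:
  assumes "\<phi> \<in> \<Q>" "\<psi> \<in> \<Q>"
  obtains a where "\<psi> = twist \<phi> a" "\<phi> a = 0"
proof -
  obtain a where a: "\<psi> = twist \<phi> a"
    using quad_forms_twist[OF \<Q>_quad[OF assms(1)] \<Q>_quad[OF assms(2)]] by blast
  then show ?thesis
    using that assms twist_\<Q>[OF assms(1), of a] by simp
qed

lemma \<Q>_eq:
  assumes "\<phi> \<in> \<Q>"
  shows "\<Q> = twist \<phi> ` zeros \<phi> UNIV"
proof
  show "\<Q> \<subseteq> twist \<phi> ` zeros \<phi> UNIV"
  proof
    fix \<psi> assume "\<psi> \<in> \<Q>"
    then obtain a where "\<psi> = twist \<phi> a" "\<phi> a = 0"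
      using \<Q>_twist[OF assms] by blast
    then show "\<psi> \<in> twist \<phi> ` zeros \<phi> UNIV"
      by (simp add: zeros_def)
  qed
  show "twist \<phi> ` zeros \<phi> UNIV \<subseteq> \<Q>"
    using twist_\<Q>[OF assms] by (auto simp: zeros_def)
qed

lemma codeword_twist:
  assumes "U \<in> \<U>" "\<phi> \<in> cw U"
  shows "twist \<phi> a \<in> cw U \<longleftrightarrow> a \<in> split_zeros \<phi> U"
proof -
  have "\<phi> \<in> quad_forms B"
    using assms by (simp add: codeword_iff quads_iff)
  moreover have "sg t * (\<epsilon>' * 2 ^ d) = \<epsilon>' * 2 ^ d \<longleftrightarrow> t = 0" for t
    using eps' by (cases t) auto
  ultimately show ?thesis
    using assms twist_\<Q>[of \<phi> a] \<U>_D(1)[OF assms(1)]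
    by (auto simp: codeword_iff split_zeros_def qsum_twist)
qed

lemma codeword_subset: "cw U \<subseteq> \<Q>"
  by (auto simp: codeword_def)

lemma codeword_eq:
  assumes "U \<in> \<U>" "\<phi> \<in> cw U"
  shows "cw U = twist \<phi> ` split_zeros \<phi> U"
proof
  show "cw U \<subseteq> twist \<phi> ` split_zeros \<phi> U"
  proof
    fix \<psi> assume \<psi>: "\<psi> \<in> cw U"
    then obtain a where "\<psi> = twist \<phi> a"
      using \<Q>_twist[of \<phi> \<psi>] assms(2) codeword_subset by blast
    then show "\<psi> \<in> twist \<phi> ` split_zeros \<phi> U"
      using codeword_twist[OF assms] \<psi> by simp
  qed
  show "twist \<phi> ` split_zeros \<phi> U \<subseteq> cw U"
    using codeword_twist[OF assms] by auto
qed

lemma codeword_nonempty: 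
  assumes "U \<in> \<U>"
  obtains \<phi> where "\<phi> \<in> cw U"
proof -
  have "\<epsilon> * \<epsilon>' \<in> {1, -1}"
    using eps eps' by auto
  then obtain \<phi> where \<phi>: "\<phi> \<in> quad_forms B" "qsum \<phi> U = \<epsilon>' * 2 ^ d"
      "qsum \<phi> (perp B U) = \<epsilon> * \<epsilon>' * 2 ^ (n - d)"
    using form_with_types_exists[OF card_m \<U>_D(1,2)[OF assms] _ \<U>_D(3)[OF assms] _ eps']
      d1 d_less by (metis not_one_le_zero zero_less_diff less_numeral_extra(3))
  have "qsum \<phi> UNIV = \<epsilon> * (2 ^ d * 2 ^ (n - d))"
    using qsum_decomp[OF \<phi>(1) \<U>_D(1)[OF assms]] \<phi>(2,3) by (simp add: mult_ac)
  then have "\<phi> \<in> \<Q>"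
    using \<phi>(1) d_less by (simp add: quads_iff flip: power_add)
  then show ?thesis
    using that \<phi>(2) assms by (simp add: codeword_iff)
qed

lemma inj_twist: "inj_on (twist \<phi>) A"
  by (simp add: inj_on_def)

lemma card_\<Q>: 
  assumes "\<phi> \<in> \<Q>"
  shows "card \<Q> = card (zeros \<phi> UNIV)" "2 * int (card \<Q>) = \<epsilon> * 2 ^ n * (\<epsilon> * 2 ^ n + 1)"
proof -
  show 1: "card \<Q> = card (zeros \<phi> UNIV)"
    using \<Q>_eq[OF assms] card_image[OF inj_twist[of \<phi>]] by metis
  show "2 * int (card \<Q>) = \<epsilon> * 2 ^ n * (\<epsilon> * 2 ^ n + 1)"
    using card_zeros[of \<phi> UNIV] assms unfolding 1 by (simp add: quads_iff algebra_simps)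
qed

lemma card_codeword:
  assumes "U \<in> \<U>" "\<phi> \<in> cw U"
  shows "card (cw U) = card (split_zeros \<phi> U)"
    "4 * int (card (cw U)) = \<epsilon>' * 2 ^ d * (\<epsilon>' * 2 ^ d + 1) * (\<epsilon> * \<epsilon>' * 2 ^ (n - d) * (\<epsilon> * \<epsilon>' * 2 ^ (n - d) + 1))"
proof -
  have \<phi>: "\<phi> \<in> \<Q>" "\<phi> \<in> quad_forms B" "qsum \<phi> U = \<epsilon>' * 2 ^ d"
    using assms by (simp_all add: codeword_iff \<Q>_quad)
  show 1: "card (cw U) = card (split_zeros \<phi> U)"
    using codeword_eq[OF assms] card_image[OF inj_twist[of \<phi>]] by metis
  have "4 * int (card (cw U)) = (2 * int (card (zeros \<phi> U))) * (2 * int (card (zeros \<phi> (perp B U))))"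
    using card_split_zeros[OF \<phi>(2) \<U>_D(1)[OF assms(1)]] by (simp add: 1)
  also have "\<dots> = \<epsilon>' * 2 ^ d * (\<epsilon>' * 2 ^ d + 1) * (\<epsilon> * \<epsilon>' * 2 ^ (n - d) * (\<epsilon> * \<epsilon>' * 2 ^ (n - d) + 1))"
    using \<U>_D(1)[OF assms(1)] \<phi>(2,3) qsum_perp[OF \<phi>(1) assms(1) eps' \<phi>(3)]
    by (simp add: card_zeros algebra_simps)
  finally show "4 * int (card (cw U)) = \<epsilon>' * 2 ^ d * (\<epsilon>' * 2 ^ d + 1) * (\<epsilon> * \<epsilon>' * 2 ^ (n - d) * (\<epsilon> * \<epsilon>' * 2 ^ (n - d) + 1))" .
qed

subsection \<open>The action on forms\<close>

text \<open>Trades the inverse in \<open>form_act\<close> for composition on the other side; the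
  action is used in this form from here on.\<close>

lemma act_eq_iff:
  assumes "g \<in> carrier (Sp B)" "\<phi> \<in> \<Q>"
  shows "act g \<phi> = \<psi> \<longleftrightarrow> \<psi> \<circ> g = \<phi>"
proof -
  have "act g \<phi> = \<phi> \<circ> inv_into UNIV g"
    using assms(2) by (simp add: form_act_def)
  moreover have "\<psi> \<circ> g \<circ> inv_into UNIV g = \<psi>" "\<phi> \<circ> inv_into UNIV g \<circ> g = \<phi>"
    using sp_inv(2,3)[OF assms(1)] by auto
  ultimately show ?thesis
    by metis
qed

lemma act_\<Q>:
  assumes "g \<in> carrier (Sp B)" "\<phi> \<in> \<Q>"
  shows "act g \<phi> \<in> \<Q>"
proof -
  have i: "inv_into UNIV g \<in> carrier (Sp B)"
    using sp_inv(1)[OF assms(1)] .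
  have "act g \<phi> = \<phi> \<circ> inv_into UNIV g"
    using assms(2) by (simp add: form_act_def)
  moreover have "qsum (\<phi> \<circ> inv_into UNIV g) UNIV = qsum \<phi> UNIV"
    using qsum_comp[OF i] sp_bij[OF i] by (simp add: bij_def)
  ultimately show ?thesis
    using assms(2) quad_comp[OF i] by (simp add: quads_iff)
qed

lemma act_comp [simp]: "g \<in> carrier (Sp B) \<Longrightarrow> \<phi> \<in> \<Q> \<Longrightarrow> act g \<phi> \<circ> g = \<phi>"
  using act_eq_iff by blast

lemma act_act:
  assumes "g \<in> carrier (Sp B)" "h \<in> carrier (Sp B)" "\<phi> \<in> \<Q>"
  shows "act (g \<circ> h) \<phi> = act g (act h \<phi>)"
proof (subst act_eq_iff[OF sp_comp[OF assms(1,2)] assms(3)])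
  show "act g (act h \<phi>) \<circ> (g \<circ> h) = \<phi>"
    using act_comp[OF assms(1) act_\<Q>[OF assms(2,3)]] act_comp[OF assms(2,3)]
    by (simp add: comp_assoc[symmetric])
qed

lemma act_id: "\<phi> \<in> \<Q> \<Longrightarrow> act id \<phi> = \<phi>"
  by (simp add: act_eq_iff sp_id)

lemma act_inv:
  assumes "g \<in> carrier (Sp B)" "\<phi> \<in> \<Q>"
  shows "act g (act (inv_into UNIV g) \<phi>) = \<phi>" "act (inv_into UNIV g) (act g \<phi>) = \<phi>"
proof -
  have "g \<circ> inv_into UNIV g = id" "inv_into UNIV g \<circ> g = id"
    using sp_inv[OF assms(1)] by auto
  then show "act g (act (inv_into UNIV g) \<phi>) = \<phi>" "act (inv_into UNIV g) (act g \<phi>) = \<phi>"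
    using act_act assms sp_inv(1)[OF assms(1)] act_id by metis+
qed

lemma act_Bij: "g \<in> carrier (Sp B) \<Longrightarrow> act g \<in> Bij \<Q>"
  unfolding Bij_def
proof
  assume g: "g \<in> carrier (Sp B)"
  show "act g \<in> {f. bij_betw f \<Q> \<Q>}"
    using act_inv[OF g] act_\<Q>[OF g] act_\<Q>[OF sp_inv(1)[OF g]]
    by (intro CollectI bij_betw_byWitness[where f' = "act (inv_into UNIV g)"]) auto
qed (simp add: form_act_def)

lemma act_image_codeword:
  assumes "g \<in> carrier (Sp B)" "U \<in> \<U>"
  shows "g ` U \<in> \<U>" "act g ` cw U = cw (g ` U)"
proof -
  have US: "g ` U \<in> \<U>" if g: "g \<in> carrier (Sp B)" "U \<in> \<U>" for g U
  proof -
    have "card (g ` U) = card U"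
      by (rule sp_card_image[OF g(1)])
    then have "(2::nat) ^ vec.dim (g ` U) = 2 ^ vec.dim U"
      using card_subspace[OF nondegD(1)[OF sp_nondeg_image[OF g(1) \<U>_D(1)[OF g(2)]]]]
        card_subspace[OF nondegD(1)[OF \<U>_D(1)[OF g(2)]]] by simp
    then have "vec.dim (g ` U) = vec.dim U"
      by (simp only: power_inject_exp)
    then show ?thesis
      using sp_nondeg_image[OF g(1)] g(2) by (auto simp: nondeg_subspaces_iff)
  qed
  show "g ` U \<in> \<U>"
    using US assms .
  have sub: "act g ` cw U \<subseteq> cw (g ` U)" if g: "g \<in> carrier (Sp B)" "U \<in> \<U>" for g U
  proof
    fix \<psi> assume "\<psi> \<in> act g ` cw U"
    then obtain \<phi> where \<phi>: "\<phi> \<in> cw U" "\<psi> = act g \<phi>"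
      by blast
    then have "\<phi> \<in> \<Q>"
      using codeword_subset by blast
    then show "\<psi> \<in> cw (g ` U)"
      using \<phi> qsum_comp[OF g(1), of \<psi> U] act_\<Q>[OF g(1)] act_comp[OF g(1)] US[OF g] g(2)
      by (simp add: codeword_iff)
  qed
  have i: "inv_into UNIV g \<in> carrier (Sp B)"
    using sp_inv(1)[OF assms(1)] .
  have gi: "inv_into UNIV g ` g ` U = U"
    using sp_inv(3)[OF assms(1)] by (simp add: image_image)
  have "cw (g ` U) \<subseteq> act g ` cw U"
  proof
    fix \<psi> assume \<psi>: "\<psi> \<in> cw (g ` U)"
    then have "act (inv_into UNIV g) \<psi> \<in> cw U"
      using sub[OF i US[OF assms]] gi by auto
    moreover have "\<psi> = act g (act (inv_into UNIV g) \<psi>)"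
      using act_inv(1)[OF assms(1), of \<psi>] \<psi> codeword_subset[of "g ` U"] by auto
    ultimately show "\<psi> \<in> act g ` cw U"
      by blast
  qed
  then show "act g ` cw U = cw (g ` U)"
    using sub[OF assms] by blast
qed

lemma group_action_act: "group_action (Sp B) \<Q> act"
proof -
  have "act \<in> hom (Sp B) (BijGroup \<Q>)"
  proof (rule homI)
    fix g h assume gh: "g \<in> carrier (Sp B)" "h \<in> carrier (Sp B)"
    show "act (g \<otimes>\<^bsub>Sp B\<^esub> h) = act g \<otimes>\<^bsub>BijGroup \<Q>\<^esub> act h"
    proof
      fix \<phi>
      show "act (g \<otimes>\<^bsub>Sp B\<^esub> h) \<phi> = (act g \<otimes>\<^bsub>BijGroup \<Q>\<^esub> act h) \<phi>"
      proof (cases "\<phi> \<in> \<Q>")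
        case True
        then show ?thesis
          using gh act_act by (simp add: BijGroup_def act_Bij compose_def)
      next
        case False
        then show ?thesis
          using gh by (simp add: BijGroup_def act_Bij compose_def) (simp add: form_act_def)
      qed
    qed
  qed (simp add: BijGroup_def act_Bij)
  then show ?thesis
    by (intro group_action.intro group_hom.intro group_Sp group_BijGroup) (simp add: group_hom_axioms_def)
qed

text \<open>Spaces of equal dimension are isometric, and so are their complements; the two
  isometries are glued.\<close>

lemma \<U>_transitive:
  assumes "U \<in> \<U>" "W \<in> \<U>"
  obtains g where "g \<in> carrier (Sp B)" "g ` U = W"
proof -
  obtain h where h: "isometric_on h U W"
    using isometry_exists \<U>_D assms by metis
  obtain h' where h': "isometric_on h' (perp B U) (perp B W)"
    using isometry_exists \<U>_D nondeg_perp assms by metis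
  obtain g where "g \<in> carrier (Sp B)" "\<forall>x\<in>U. g x = h x"
    using isometry_glue[OF _ _ h h'] \<U>_D assms by blast
  moreover have "h ` U = W"
    using h by (simp add: isometric_on_def bij_betw_def)
  ultimately show ?thesis
    using that by (metis image_cong)
qed

text \<open>A form in \<open>\<Q> - cw U\<close> has both types opposite to those of the codeword.
  So \<open>form_pair_move\<close> applies on \<open>U\<close> and on its complement separately, and
  the product of the two isometries moves both forms at once, since a quadratic form is determined
  by its restrictions to the summands.\<close>

lemma flag_transitive:
  assumes U: "U \<in> \<U>" and \<phi>: "\<phi> \<in> cw U" "\<phi>' \<in> cw U" and \<psi>: "\<psi> \<in> \<Q> - cw U" "\<psi>' \<in> \<Q> - cw U"
  shows "\<exists>g\<in>carrier (Sp B). act g ` cw U = cw U \<and> act g \<phi> = \<phi>' \<and> act g \<psi> = \<psi>'"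
proof -
  let ?P = "perp B U"
  have nd: "nondeg U" "nondeg ?P" "perp B ?P = U"
    using \<U>_D[OF U] by auto
  have Qs: "\<phi> \<in> \<Q>" "\<phi>' \<in> \<Q>" "\<psi> \<in> \<Q>" "\<psi>' \<in> \<Q>"
    using \<phi> \<psi> codeword_subset by auto
  then have quads: "\<phi> \<in> quad_forms B" "\<psi> \<in> quad_forms B" "\<phi>' \<in> quad_forms B" "\<psi>' \<in> quad_forms B"
    by (simp_all add: \<Q>_quad)
  have qU: "qsum \<phi> U = \<epsilon>' * 2 ^ d" "qsum \<phi>' U = \<epsilon>' * 2 ^ d"
      "qsum \<psi> U = - \<epsilon>' * 2 ^ d" "qsum \<psi>' U = - \<epsilon>' * 2 ^ d"
    using \<phi> \<psi> U qsum_cases[OF quads(2) U] qsum_cases[OF quads(4) U] by (auto simp: codeword_iff)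
  have "- \<epsilon>' \<in> {1, -1}"
    using eps' by auto
  note qP = qsum_perp[OF Qs(1) U eps' qU(1)] qsum_perp[OF Qs(2) U eps' qU(2)]
    qsum_perp[OF Qs(3) U this qU(3)] qsum_perp[OF Qs(4) U this qU(4)]
  obtain g1 where g1: "g1 \<in> carrier (Sp B)" "\<And>a. a \<in> ?P \<Longrightarrow> g1 a = a"
      "\<And>x. x \<in> U \<Longrightarrow> \<phi>' (g1 x) = \<phi> x" "\<And>x. x \<in> U \<Longrightarrow> \<psi>' (g1 x) = \<psi> x"
    using form_pair_move[OF quads nd(1) \<U>_D(2)[OF U]] qU by force
  obtain g2 where g2: "g2 \<in> carrier (Sp B)" "\<And>a. a \<in> U \<Longrightarrow> g2 a = a"
      "\<And>x. x \<in> ?P \<Longrightarrow> \<phi>' (g2 x) = \<phi> x" "\<And>x. x \<in> ?P \<Longrightarrow> \<psi>' (g2 x) = \<psi> x"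
    using form_pair_move[OF quads nd(2) \<U>_D(3)[OF U]] qP nd(3) by force
  define g where "g = g1 \<circ> g2"
  have g: "g \<in> carrier (Sp B)"
    using g1(1) g2(1) by (simp add: g_def sp_comp)
  have g1U: "g1 ` U = U"
    using sp_fix_perp_image[OF g1(1) nd(1)] g1(2) by blast
  have g2P: "g2 ` ?P = ?P"
    using sp_fix_perp_image[OF g2(1) nd(2)] g2(2) nd(3) by simp
  have g2U: "g2 ` U = U"
    using g2(2) by force
  have "\<theta>' \<circ> g = \<theta>"
    if "\<theta> \<in> quad_forms B" "\<theta>' \<in> quad_forms B" "\<And>x. x \<in> U \<Longrightarrow> \<theta>' (g1 x) = \<theta> x"
      "\<And>x. x \<in> ?P \<Longrightarrow> \<theta>' (g2 x) = \<theta> x" for \<theta> \<theta>'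
  proof
    fix x
    obtain u w where uw: "u \<in> U" "w \<in> ?P" "x = u + w"
      using nondeg_decomp[OF nd(1)] by blast
    have "g2 w \<in> ?P" "g1 u \<in> U"
      using uw g1U g2P by blast+
    then have "g x = g1 u + g2 w" "B (g1 u) (g2 w) = 0"
      using uw g1(2) g2(2) by (simp_all add: g_def sp_add[OF g1(1)] sp_add[OF g2(1)] perpD)
    then show "(\<theta>' \<circ> g) x = \<theta> x"
      using that uw by (simp add: quad_add perpD)
  qed
  then have "act g \<phi> = \<phi>'" "act g \<psi> = \<psi>'"
    using act_eq_iff[OF g] Qs quads g1 g2 by auto
  moreover have "act g ` cw U = cw U"
    using act_image_codeword(2)[OF g U] g1U g2U image_comp[of g1 g2 U] by (simp add: g_def)
  ultimately show ?thesis
    using g by blast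
qed

theorem code_strongly_incidence_transitive: "strongly_incidence_transitive (Sp B) act \<Q> \<G>"
  unfolding strongly_incidence_transitive_def
proof (intro conjI ballI)
  show "group_action (Sp B) \<Q> act"
    by (rule group_action_act)
  have sub: "(`) (act g) ` \<G> \<subseteq> \<G>" if "g \<in> carrier (Sp B)" for g
    using act_image_codeword[OF that] by (auto simp: sp_code_def)
  fix g assume g: "g \<in> carrier (Sp B)"
  have "(`) (act (inv_into UNIV g)) ` \<G> \<subseteq> \<G>"
    using sub[OF sp_inv(1)[OF g]] .
  moreover have "act g ` act (inv_into UNIV g) ` \<Delta> = \<Delta>" if "\<Delta> \<in> \<G>" for \<Delta>
  proof -
    have "\<Delta> \<subseteq> \<Q>"
      using that codeword_subset by (auto simp: sp_code_def)
    then show ?thesis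
      using act_inv(1)[OF g] by (force simp: image_image)
  qed
  ultimately have "\<Delta> \<in> (`) (act g) ` \<G>" if "\<Delta> \<in> \<G>" for \<Delta>
    using that by (intro image_eqI[of _ _ "act (inv_into UNIV g) ` \<Delta>"]) auto
  then show "(`) (act g) ` \<G> = \<G>"
    using sub[OF g] by blast
next
  fix \<Delta> \<Delta>' assume "\<Delta> \<in> \<G>" "\<Delta>' \<in> \<G>"
  then obtain U W where UW: "U \<in> \<U>" "W \<in> \<U>" "\<Delta> = cw U" "\<Delta>' = cw W"
    by (auto simp: sp_code_def)
  then obtain g where "g \<in> carrier (Sp B)" "g ` U = W"
    using \<U>_transitive by metis
  then show "\<exists>g\<in>carrier (Sp B). act g ` \<Delta> = \<Delta>'"
    using UW act_image_codeword(2) by blast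
next
  fix \<Delta> \<phi> \<psi> \<phi>' \<psi>' assume "\<Delta> \<in> \<G>" "\<phi> \<in> \<Delta>" "\<psi> \<in> \<Q> - \<Delta>" "\<phi>' \<in> \<Delta>" "\<psi>' \<in> \<Q> - \<Delta>"
  then show "\<exists>g\<in>carrier (Sp B). act g ` \<Delta> = \<Delta> \<and> act g \<phi> = \<phi>' \<and> act g \<psi> = \<psi>'"
    unfolding sp_code_def by (elim imageE) (metis flag_transitive)
qed

end

subsection \<open>Stabilisers, sizes and complements\<close>

lemma two_power_cases:
  assumes "1 \<le> (m::nat)"
  shows "m = 1 \<and> (2::int) ^ m = 2 \<or> 2 \<le> m \<and> (2::int) ^ m \<ge> 4"
proof (cases "m = 1")
  case False
  then have "2 \<le> m"
    using assms by simp
  moreover from this have "(2::int) ^ 2 \<le> 2 ^ m"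
    by (rule power_increasing) simp
  ultimately show ?thesis
    by simp
qed simp

context symplectic_code
begin

lemma \<U>_nonempty: "\<U> \<noteq> {}"
  using nondeg_subspaces_nonempty[OF card_m, of d] d_less by simp

lemma \<Q>_nonempty:
  obtains \<phi> where "\<phi> \<in> \<Q>"
proof -
  obtain U where "U \<in> \<U>"
    using \<U>_nonempty by blast
  then show ?thesis
    using codeword_nonempty[of U] codeword_subset[of U] that by blast
qed

text \<open>Twists of one form by vectors \<open>b\<close> are tested: the product of three factors
  is nonzero exactly when the twist is in \<open>\<Q>\<close> and has the required values. Expanding
  its sum over all \<open>b\<close>, the pure character sums vanish because \<open>a\<close>,
  \<open>v\<close> and \<open>a + v\<close> are nonzero, the four Gauss sums cancel, and the size of
  the space remains.\<close>

lemma form_separating: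
  assumes "a \<noteq> 0" "v \<noteq> 0" "a \<noteq> v" "B a v = 0"
  shows "\<exists>\<phi>\<in>\<Q>. \<phi> a = 0 \<and> \<phi> v = 1"
proof -
  obtain \<phi> where \<phi>Q: "\<phi> \<in> \<Q>"
    using \<Q>_nonempty .
  then have \<phi>: "\<phi> \<in> quad_forms B"
    by (rule \<Q>_quad)
  let ?x = "qsum \<phi> UNIV"
  define F where "F b = sg (\<phi> b)" for b
  define A where "A b = sg (B a b)" for b
  define N where "N b = sg (B v b)" for b
  have char: "(\<Sum>b\<in>UNIV. sg (B c b)) = 0" if "c \<noteq> 0" for c
    using sum_B_nondeg[OF nondeg_UNIV, of c] that by simp
  have qchar: "(\<Sum>b\<in>UNIV. sg (\<phi> b) * sg (B c b)) = sg (\<phi> c) * ?x" for c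
    using qsum_twist_in[OF \<phi> nondeg_UNIV, of c] by (simp add: qsum_def twist_def sg_add)
  have AN: "A b * N b = sg (B (a + v) b)" for b
    by (simp add: A_def N_def sg_add)
  have sums: "sum A UNIV = 0" "sum N UNIV = 0" "(\<Sum>b\<in>UNIV. A b * N b) = 0"
    "(\<Sum>b\<in>UNIV. F b * A b) = sg (\<phi> a) * ?x" "(\<Sum>b\<in>UNIV. F b * N b) = sg (\<phi> v) * ?x"
    "(\<Sum>b\<in>UNIV. F b * (A b * N b)) = sg (\<phi> a) * sg (\<phi> v) * ?x" "sum F UNIV = ?x"
    using char[of a] char[of v] char[of "a + v"] qchar[of a] qchar[of v] qchar[of "a + v"] assms
    unfolding AN F_def by (simp_all add: A_def N_def qsum_def quad_add[OF \<phi>] sg_add)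
  have "(\<Sum>b\<in>UNIV. (1 + F b) * (1 + sg (\<phi> a) * A b) * (1 - sg (\<phi> v) * N b))
    = (\<Sum>b\<in>UNIV. 1 + sg (\<phi> a) * A b - sg (\<phi> v) * N b - sg (\<phi> a) * sg (\<phi> v) * (A b * N b)
        + F b + sg (\<phi> a) * (F b * A b) - sg (\<phi> v) * (F b * N b) - sg (\<phi> a) * sg (\<phi> v) * (F b * (A b * N b)))"
    by (intro sum.cong refl) (simp add: algebra_simps)
  also have "\<dots> = int CARD(bit^'m) + sg (\<phi> a) * sum A UNIV - sg (\<phi> v) * sum N UNIV
      - sg (\<phi> a) * sg (\<phi> v) * (\<Sum>b\<in>UNIV. A b * N b) + sum F UNIV + sg (\<phi> a) * (\<Sum>b\<in>UNIV. F b * A b)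
      - sg (\<phi> v) * (\<Sum>b\<in>UNIV. F b * N b) - sg (\<phi> a) * sg (\<phi> v) * (\<Sum>b\<in>UNIV. F b * (A b * N b))"
    by (simp add: sum.distrib sum_subtractf sum_distrib_left)
  also have "\<dots> = int CARD(bit^'m)"
    unfolding sums by (cases "\<phi> a"; cases "\<phi> v") simp_all
  finally have "(\<Sum>b\<in>UNIV. (1 + F b) * (1 + sg (\<phi> a) * A b) * (1 - sg (\<phi> v) * N b)) \<noteq> 0"
    by simp
  then obtain b where b: "(1 + F b) * (1 + sg (\<phi> a) * A b) * (1 - sg (\<phi> v) * N b) \<noteq> 0"
    by (meson sum.not_neutral_contains_not_neutral)
  have "\<phi> b = 0" "\<phi> a + B a b = 0" "\<phi> v + B v b = 1"
    using b unfolding F_def A_def N_def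
    by (cases "\<phi> b"; cases "\<phi> a"; cases "B a b"; cases "\<phi> v"; cases "B v b"; simp)+
  then show ?thesis
    using twist_\<Q>[OF \<phi>Q, of b] by (intro bexI[of _ "twist \<phi> b"]) (auto simp: twist_def B_sym[of b])
qed

text \<open>Equal codewords mean equal types on \<open>U\<close> and \<open>W\<close> for all forms
  in \<open>\<Q>\<close>, hence, comparing twists,
  \<open>\<phi> (proj U a) = \<phi> (proj W a)\<close> for singular \<open>a\<close>. A vector lies
  in one of the two summands exactly if its projection is 0 or the vector itself;
  \<open>form_separating\<close> then shows that \<open>U \<union> perp B U\<close> is contained in
  \<open>W \<union> perp B W\<close>.\<close>

lemma codeword_eq_cases:
  assumes U: "U \<in> \<U>" and W: "W \<in> \<U>" and eq: "cw U = cw W"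
  shows "W = U \<or> W = perp B U"
proof -
  note ndU = \<U>_D(1)[OF U] and ndW = \<U>_D(1)[OF W]
  have q: "qsum \<phi> U = qsum \<phi> W" if "\<phi> \<in> \<Q>" for \<phi>
    using that eq qsum_cases[OF \<Q>_quad[OF that] U] qsum_cases[OF \<Q>_quad[OF that] W]
      codeword_iff[OF U, of \<phi>] codeword_iff[OF W, of \<phi>] by auto
  have same: "\<phi> (proj U a) = \<phi> (proj W a)" if \<phi>: "\<phi> \<in> \<Q>" "\<phi> a = 0" for \<phi> a
  proof -
    have "sg (\<phi> (proj U a)) * qsum \<phi> U = sg (\<phi> (proj W a)) * qsum \<phi> U"
      using q[of "twist \<phi> a"] q[OF \<phi>(1)] twist_\<Q>[OF \<phi>(1)] \<phi>(2) \<Q>_quad[OF \<phi>(1)] ndU ndW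
      by (simp add: qsum_twist)
    moreover have "qsum \<phi> U \<noteq> 0"
      using qsum_cases[OF \<Q>_quad[OF \<phi>(1)] U] eps' by auto
    ultimately show ?thesis
      by simp
  qed
  have "proj W a \<in> {0, a}" if "proj U a \<in> {0, a}" for a
  proof (rule ccontr)
    assume *: "proj W a \<notin> {0, a}"
    have "B a (proj W a) = 0"
      using B_proj[OF ndW proj_props(1)[OF ndW], of a a] by simp
    moreover have "a \<noteq> 0"
      using * proj_props(4)[OF ndW nondegD(2)[OF ndW]] by auto
    ultimately obtain \<phi> where \<phi>: "\<phi> \<in> \<Q>" "\<phi> a = 0" "\<phi> (proj W a) = 1"
      using form_separating[of a "proj W a"] * by auto
    then show False
      using same[OF \<phi>(1,2)] that \<Q>_quad by auto
  qed
  then have "a \<in> W \<union> perp B W" if "a \<in> U \<union> perp B U" for a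
    using that proj_props(4,5)[OF ndU, of a] proj_props(1,2)[OF ndW, of a] by fastforce
  then have "U \<subseteq> W \<or> U \<subseteq> perp B W" "perp B U \<subseteq> W \<or> perp B U \<subseteq> perp B W"
    using subspace_Un_cases[of _ W "perp B W"] nondegD(1)[OF ndU] nondegD(1)[OF ndW] by blast+
  moreover have "W = U" if "U \<subseteq> W"
  proof -
    have "card U = card W"
      using \<U>_D[OF U] \<U>_D[OF W] by (simp add: card_subspace nondegD)
    then show ?thesis
      using that subspace_eq_by_card by (metis order_refl)
  qed
  moreover have "\<not> perp B U \<subseteq> perp B W" if "U \<subseteq> perp B W"
  proof
    assume *: "perp B U \<subseteq> perp B W"
    have all: "x \<in> perp B W" for x
    proof -
      obtain u w where "u \<in> U" "w \<in> perp B U" "x = u + w"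
        using nondeg_decomp[OF ndU] by blast
      then show ?thesis
        using that * nondegD(3)[OF nondeg_perp[OF ndW], of u w] by auto
    qed
    have "W \<subseteq> {0}"
      using perpD(2)[OF all] by (auto intro: B_nondeg)
    then have "vec.dim W \<le> vec.dim ({0} :: (bit^'m) set)"
      by (rule vec.dim_subset)
    then show False
      using \<U>_D(2)[OF W] d1 by simp
  qed
  moreover have "W = perp B U" if "U \<subseteq> perp B W" "perp B U \<subseteq> W"
    using perp_antimono[OF that(1)] that(2) ndW by auto
  ultimately show ?thesis
    by metis
qed

lemma perp_\<U>:
  assumes "2 * d = n" "U \<in> \<U>"
  shows "perp B U \<in> \<U>"
proof -
  have "n - d = d"
    using assms(1) by arith
  then show ?thesis
    using \<U>_D[OF assms(2)] by (simp add: nondeg_subspaces_iff)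
qed

text \<open>For \<open>2 * d = n\<close> the Gauss sum on the complement is
  \<open>\<epsilon>\<close> times the one on \<open>U\<close>. Both exceptional cases originate
  here: exchanging the summands fixes the codeword or complements it, according to the sign.\<close>

lemma codeword_perp:
  assumes "2 * d = n" "U \<in> \<U>"
  shows "\<epsilon> = 1 \<Longrightarrow> cw (perp B U) = cw U" "\<epsilon> = -1 \<Longrightarrow> cw (perp B U) = \<Q> - cw U"
proof -
  have nd: "n - d = d"
    using assms(1) by simp
  have P: "qsum \<phi> (perp B U) = \<epsilon> * qsum \<phi> U" if "\<phi> \<in> \<Q>" for \<phi>
    using qsum_perp[OF that assms(2), of \<epsilon>'] qsum_perp[OF that assms(2), of "- \<epsilon>'"]
      qsum_cases[OF \<Q>_quad[OF that] assms(2)] eps' by (auto simp: nd)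
  have neg: "- qsum \<phi> U = \<epsilon>' * 2 ^ d \<longleftrightarrow> qsum \<phi> U \<noteq> \<epsilon>' * 2 ^ d" if "\<phi> \<in> \<Q>" for \<phi>
    using qsum_cases[OF \<Q>_quad[OF that] assms(2)] eps' by auto
  note iff = codeword_iff[OF assms(2)] codeword_iff[OF perp_\<U>[OF assms]]
  show "cw (perp B U) = cw U" if "\<epsilon> = 1"
    using P that by (intro Set.set_eqI) (metis iff mult_1)
  show "cw (perp B U) = \<Q> - cw U" if "\<epsilon> = -1"
    using P neg that by (intro Set.set_eqI) (metis (no_types, lifting) iff mult_minus1 Diff_iff)
qed

section \<open>Stabilisers of codewords in the symplectic group\<close>

lemma stab_codeword_eq:
  assumes "U \<in> \<U>"
  shows "stab_codeword B \<epsilon> (cw U) = {g \<in> carrier (Sp B). cw (g ` U) = cw U}"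
proof -
  have "act g ` cw U = cw (g ` U)" if "g \<in> carrier (Sp B)" for g
    using act_image_codeword[OF that assms] by blast
  then show ?thesis
    unfolding stab_codeword_def by (metis (no_types, lifting))
qed

lemma stab_pair_iff:
  assumes "g \<in> carrier (Sp B)" "U \<in> \<U>"
  shows "g \<in> stab_pair B U \<longleftrightarrow> g ` U = U \<or> g ` U = perp B U"
proof -
  have "g ` U = U \<Longrightarrow> g ` perp B U = perp B U" "g ` U = perp B U \<Longrightarrow> g ` perp B U = U"
    using sp_perp_image[OF assms(1), of U] \<U>_D(1)[OF assms(2)] by simp_all
  then show ?thesis
    using assms(1) by (auto simp: stab_pair_def doubleton_eq_iff)
qed

lemma subgroup_stab_subspace: "subgroup (stab_subspace B U) (Sp B)"
proof (rule group.subgroup_carrier_updateI[OF group_Sp])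
  fix g h assume "g \<in> stab_subspace B U" "h \<in> stab_subspace B U"
  then show "g \<otimes>\<^bsub>Sp B\<^esub> h \<in> stab_subspace B U"
    using image_comp[of g h U] by (simp add: stab_subspace_def sp_comp)
qed (auto simp: stab_subspace_def sp_id finite_Sp)

lemma subgroup_stab_codeword: "U \<in> \<U> \<Longrightarrow> subgroup (stab_codeword B \<epsilon> (cw U)) (Sp B)"
proof (rule group.subgroup_carrier_updateI[OF group_Sp])
  assume U: "U \<in> \<U>"
  show "\<one>\<^bsub>Sp B\<^esub> \<in> stab_codeword B \<epsilon> (cw U)"
    by (simp add: stab_codeword_eq[OF U] sp_id)
  fix g h assume gh: "g \<in> stab_codeword B \<epsilon> (cw U)" "h \<in> stab_codeword B \<epsilon> (cw U)"
  then have g: "g \<in> carrier (Sp B)" "act g ` cw U = cw U" and h: "h \<in> carrier (Sp B)" "act h ` cw U = cw U"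
    by (auto simp: stab_codeword_def)
  have "act (g \<circ> h) ` cw U = act g ` act h ` cw U"
    using act_act[OF g(1) h(1)] codeword_subset[of U] by (force simp: image_image)
  then show "g \<otimes>\<^bsub>Sp B\<^esub> h \<in> stab_codeword B \<epsilon> (cw U)"
    using g h by (simp add: stab_codeword_def sp_comp)
qed (auto simp: stab_codeword_def finite_Sp)

text \<open>An element fixing the codeword but not \<open>U\<close> sends \<open>U\<close> to its
  complement, which forces \<open>2 * d = n\<close>; with \<open>\<epsilon> = -1\<close> the
  codeword would then be its own complement.\<close>

lemma stab_codeword_generic:
  assumes U: "U \<in> \<U>" and "\<not> (2 * d = n \<and> \<epsilon> = 1)"
  shows "stab_subspace B U = stab_codeword B \<epsilon> (cw U)"
proof -
  have "g ` U = U" if g: "g \<in> carrier (Sp B)" "cw (g ` U) = cw U" for g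
  proof (rule ccontr)
    assume "g ` U \<noteq> U"
    then have gU: "g ` U = perp B U"
      using codeword_eq_cases[OF U act_image_codeword(1)[OF g(1) U]] g(2) by simp
    then have "vec.dim (perp B U) = 2 * d"
      using act_image_codeword(1)[OF g(1) U] \<U>_D(2) by metis
    then have "2 * d = n"
      using \<U>_D(3)[OF U] d_less by simp
    then have "\<epsilon> = -1"
      using assms(2) eps by auto
    then have "cw U = \<Q> - cw U"
      using codeword_perp(2)[OF \<open>2 * d = n\<close> U] g(2) gU by simp
    then show False
      using codeword_nonempty[OF U] codeword_subset[of U] by blast
  qed
  then show ?thesis
    by (auto simp: stab_codeword_eq[OF U] stab_subspace_def)
qed

lemma stab_codeword_exceptional:
  assumes U: "U \<in> \<U>" and "2 * d = n" "\<epsilon> = 1"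
  shows "stab_codeword B \<epsilon> (cw U) = stab_pair B U"
proof (rule Set.set_eqI)
  fix g
  show "g \<in> stab_codeword B \<epsilon> (cw U) \<longleftrightarrow> g \<in> stab_pair B U"
  proof (cases "g \<in> carrier (Sp B)")
    case True
    have "cw (g ` U) = cw U \<longleftrightarrow> g ` U = U \<or> g ` U = perp B U"
      using codeword_eq_cases[OF U act_image_codeword(1)[OF True U]] codeword_perp(1)[OF assms(2) U assms(3)]
      by auto
    then show ?thesis
      using True stab_pair_iff[OF True U] by (simp add: stab_codeword_eq[OF U])
  qed (simp add: stab_codeword_def stab_pair_def)
qed

lemma subgroup_stab_pair: "U \<in> \<U> \<Longrightarrow> subgroup (stab_pair B U) (Sp B)"
proof (rule group.subgroup_carrier_updateI[OF group_Sp])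
  fix g h assume gh: "g \<in> stab_pair B U" "h \<in> stab_pair B U"
  then have g: "g \<in> carrier (Sp B)" "{g ` U, g ` perp B U} = {U, perp B U}"
    and h: "h \<in> carrier (Sp B)" "{h ` U, h ` perp B U} = {U, perp B U}"
    by (auto simp: stab_pair_def)
  have "{(g \<circ> h) ` U, (g \<circ> h) ` perp B U} = (`) g ` {h ` U, h ` perp B U}"
    by (simp add: image_comp)
  also have "\<dots> = {U, perp B U}"
    unfolding h(2) using g(2) by simp
  finally show "g \<otimes>\<^bsub>Sp B\<^esub> h \<in> stab_pair B U"
    using g h by (simp add: stab_pair_def sp_comp)
qed (auto simp: stab_pair_def finite_Sp sp_id)

text \<open>
  A proper overgroup of the stabiliser of the decomposition moves some vector of \<open>U \<union> perp B U\<close> out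
  of this set; it is then transitive on nonzero vectors and so contains all transvections.
\<close>

lemma maximal_stab_pair:
  assumes U: "U \<in> \<U>" and "2 * d = n"
  shows "maximal_subgroup (stab_pair B U) (Sp B)"
  unfolding maximal_subgroup_def
proof (intro conjI allI impI)
  let ?P = "perp B U"
  note nd = \<U>_D(1)[OF U] and ndP = nondeg_perp[OF \<U>_D(1)[OF U]]
  have PP: "perp B ?P = U"
    using nd by simp
  show "subgroup (stab_pair B U) (Sp B)"
    using subgroup_stab_pair[OF U] .
  have nonzero: "\<exists>x\<in>A. x \<noteq> 0" if "nondeg A" "vec.dim A \<noteq> 0" for A
  proof (rule ccontr)
    assume "\<not> (\<exists>x\<in>A. x \<noteq> 0)"
    then have "A = {0}"
      using nondegD(2)[OF that(1)] by blast
    then show False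
      using that(2) by simp
  qed
  obtain u0 where u0: "u0 \<in> U" "u0 \<noteq> 0"
    using nonzero[OF nd] \<U>_D(2)[OF U] d1 by auto
  obtain w0 where w0: "w0 \<in> ?P" "w0 \<noteq> 0"
    using nonzero[OF ndP] \<U>_D(3)[OF U] d_less by auto
  have out: "u + w \<notin> U \<union> ?P" if "u \<in> U" "w \<in> ?P" "u \<noteq> 0" "w \<noteq> 0" for u w
    using that nondeg_add_in_iff[OF nd, of u w] nondeg_add_in_iff[OF ndP, of w u] nondegD(5)[OF nd]
    by (auto simp: add.commute)
  have tU: "transv v \<in> stab_pair B U" if "v \<in> U \<union> ?P" for v
  proof -
    have "transv v ` A = A" if "v \<in> perp B A" for A
      using that by (force simp: transv_simps perpD)
    then have "transv v ` U = U \<or> transv v ` ?P = ?P"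
      using that PP by auto
    then have "transv v ` U = U"
      using sp_perp_image[OF transv_sp, of v U] sp_perp_image[OF transv_sp, of v ?P] PP by auto
    then show ?thesis
      using stab_pair_iff[OF transv_sp U] by simp
  qed
  \<comment> \<open>A subspace contained in \<open>U \<union> ?P\<close> lies in one of the
    summands, and by equality of sizes it is that summand.\<close>
  have not_preserved: "\<exists>x\<in>U \<union> ?P. g x \<notin> U \<union> ?P" if g: "g \<in> carrier (Sp B)" "g \<notin> stab_pair B U" for g
  proof (rule ccontr)
    assume "\<not> (\<exists>x\<in>U \<union> ?P. g x \<notin> U \<union> ?P)"
    then have "g ` U \<subseteq> U \<union> ?P"
      by auto
    then have "g ` U \<subseteq> U \<or> g ` U \<subseteq> ?P"
      using subspace_Un_cases sp_subspace_image[OF g(1)] nondegD(1)[OF nd] subspace_perp by blast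
    moreover have "card (g ` U) = card U" "card U = card ?P"
      using sp_card_image[OF g(1)] \<U>_D[OF U] assms(2) nd ndP by (simp_all add: card_subspace nondegD)
    ultimately have "g ` U = U \<or> g ` U = ?P"
      by (metis subspace_eq_by_card order_refl)
    then show False
      using g stab_pair_iff[OF g(1) U] by simp
  qed
  \<comment> \<open>A witness that the stabiliser is proper: the transvection by
    \<open>p + w0\<close> sends \<open>u0\<close> to a vector with nonzero components in both
    summands.\<close>
  obtain p where p: "p \<in> U" "B u0 p = 1"
    using nondegD(4)[OF nd u0(1)] u0(2) by (metis bit_not_one_iff)
  have "transv (p + w0) u0 = (u0 + p) + w0"
    using p u0 w0 by (simp add: transv_simps perpD add.assoc)
  moreover have "u0 \<noteq> p"
    using p by auto
  ultimately have "transv (p + w0) u0 \<notin> U \<union> ?P"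
    using out[of "u0 + p" w0] nondegD(3)[OF nd u0(1) p(1)] w0 by auto
  moreover have "g u0 \<in> U \<union> ?P" if "g \<in> stab_pair B U" for g
    using that u0 by (auto simp: stab_pair_def doubleton_eq_iff)
  ultimately have "transv (p + w0) \<notin> stab_pair B U"
    by blast
  then show "stab_pair B U \<noteq> carrier (Sp B)"
    by auto
  fix K assume K: "subgroup K (Sp B) \<and> stab_pair B U \<subseteq> K"
  then have KS: "K \<subseteq> carrier (Sp B)" and Ks: "subgroup K (Sp B)"
    by (auto dest: subgroup.subset)
  have Kcomp: "g \<circ> h \<in> K" if "g \<in> K" "h \<in> K" for g h
    using subgroup.m_closed[OF Ks that] that KS by (auto simp: subset_iff)
  have Kinv: "inv_into UNIV g \<in> K" if "g \<in> K" for g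
    using subgroup.m_inv_closed[OF Ks that] that KS by (auto simp: subset_iff)
  show "K = stab_pair B U \<or> K = carrier (Sp B)"
  proof (cases "K = stab_pair B U")
    case False
    then obtain g where g: "g \<in> K" "g \<notin> stab_pair B U"
      using K by blast
    obtain x where x: "x \<in> U \<union> ?P" "g x \<notin> U \<union> ?P"
      using not_preserved g KS by blast
    have moveU: "\<exists>h\<in>K. (\<forall>a\<in>?P. h a = a) \<and> h c = c'" if "c \<in> U" "c' \<in> U" "c \<noteq> 0" "c' \<noteq> 0" for c c'
      using that nondegD(5)[OF nd] PP K tU
      by (intro transvections_move Ks) (auto simp: perpD)
    have moveP: "\<exists>h\<in>K. (\<forall>a\<in>U. h a = a) \<and> h c = c'" if "c \<in> ?P" "c' \<in> ?P" "c \<noteq> 0" "c' \<noteq> 0" for c c'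
      using that nondegD(5)[OF nd] nondegD(1)[OF nd] K tU
      by (intro transvections_move Ks) (auto simp: perpD)
    have "transv v \<in> K" for v
    proof (cases "v \<in> U \<union> ?P")
      case True
      then show ?thesis
        using tU K by blast
    next
      case v: False
      obtain u w where uw: "u \<in> U" "w \<in> ?P" "v = u + w"
        using nondeg_decomp[OF nd] by blast
      then have "u \<noteq> 0" "w \<noteq> 0"
        using v by auto
      obtain u' w' where uw': "u' \<in> U" "w' \<in> ?P" "g x = u' + w'"
        using nondeg_decomp[OF nd] by blast
      then have "u' \<noteq> 0" "w' \<noteq> 0"
        using x by auto
      obtain h where h: "h \<in> K" "\<forall>a\<in>?P. h a = a" "h u = u'"
        using moveU uw uw' \<open>u \<noteq> 0\<close> \<open>u' \<noteq> 0\<close> by blast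
      obtain h' where h': "h' \<in> K" "\<forall>a\<in>U. h' a = a" "h' w = w'"
        using moveP uw uw' \<open>w \<noteq> 0\<close> \<open>w' \<noteq> 0\<close> by blast
      have S: "h \<in> carrier (Sp B)" "h' \<in> carrier (Sp B)" "g \<in> carrier (Sp B)"
        using h h' g KS by auto
      \<comment> \<open>Transitivity inside each summand carries \<open>v\<close> to
        \<open>g x\<close>, so \<open>f\<close> carries \<open>v\<close> to \<open>x\<close>. This
        conjugates the transvection by \<open>v\<close> to one by a vector of
        \<open>U \<union> ?P\<close>, already known to lie in \<open>K\<close>.\<close>
      define f where "f = inv_into UNIV g \<circ> (h' \<circ> h)"
      have fK: "f \<in> K"
        using Kcomp Kinv h h' g by (simp add: f_def)
      have fS: "f \<in> carrier (Sp B)"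
        using fK KS by blast
      have "h' (h v) = g x"
        using uw uw' h h' by (simp add: sp_add[OF S(1)] sp_add[OF S(2)])
      then have fv: "f v = x"
        using sp_inv(3)[OF S(3)] by (simp add: f_def)
      have "transv v = inv_into UNIV f \<circ> (transv x \<circ> f)"
      proof
        fix y
        have "f (transv v y) = transv x (f y)"
          using sp_B[OF fS, of y v] fv
          by (cases "B y v") (auto simp: transv_simps sp_add[OF fS])
        then show "transv v y = (inv_into UNIV f \<circ> (transv x \<circ> f)) y"
          using sp_inv(3)[OF fS, of "transv v y"] by simp
      qed
      then show ?thesis
        using Kcomp Kinv[OF fK] fK tU[OF x(1)] K by auto
    qed
    then show ?thesis
      using transvections_generate[OF Ks] by blast
  qed simp
qed

section \<open>Sizes of codewords and of their complements\<close>

lemma card_codeword_formula: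
  assumes "U \<in> \<U>"
  shows "int (card (cw U)) = 2 ^ (n - 2) * (2 ^ d + \<epsilon>') * (2 ^ (n - d) + \<epsilon> * \<epsilon>')"
proof -
  obtain \<phi> where \<phi>: "\<phi> \<in> cw U"
    using codeword_nonempty[OF assms] .
  have "2 + (n - 2) = d + (n - d)"
    using n2 d_less by simp
  then have "(2::int) ^ (2 + (n - 2)) = 2 ^ (d + (n - d))"
    by (simp only:)
  then have "(4::int) * 2 ^ (n - 2) = 2 ^ d * 2 ^ (n - d)"
    by (simp only: power_add) simp
  then have "4 * (2 ^ (n - 2) * (2 ^ d + \<epsilon>') * (2 ^ (n - d) + \<epsilon> * \<epsilon>'))
    = 2 ^ d * 2 ^ (n - d) * ((2 ^ d + \<epsilon>') * (2 ^ (n - d) + \<epsilon> * \<epsilon>'))"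
    by (simp only: mult.assoc[symmetric])
  also have "\<dots> = 4 * int (card (cw U))"
    unfolding card_codeword(2)[OF assms \<phi>] using eps eps' by (auto simp: algebra_simps)
  finally have "4 * (2 ^ (n - 2) * (2 ^ d + \<epsilon>') * (2 ^ (n - d) + \<epsilon> * \<epsilon>')) = 4 * int (card (cw U))" .
  then show ?thesis
    by simp
qed

lemma card_\<Q>_formula: "2 * int (card \<Q>) = 2 ^ n * (2 ^ n + \<epsilon>)"
proof -
  obtain \<phi> where "\<phi> \<in> \<Q>"
    using \<Q>_nonempty .
  then show ?thesis
    using card_\<Q>(2) eps by auto
qed

text \<open>
  With \<open>a = 2 ^ d\<close> and \<open>b = 2 ^ (n - d)\<close>, four times the sizes of a codeword and of its complement
  are \<open>a * b * (a + \<epsilon>') * (b + \<epsilon> * \<epsilon>')\<close> and \<open>a * b * (a - \<epsilon>') * (b - \<epsilon> * \<epsilon>')\<close>.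
\<close>

context
  fixes k :: nat
  assumes k: "int k = 2 ^ (n - 2) * (2 ^ d + \<epsilon>') * (2 ^ (n - d) + \<epsilon> * \<epsilon>')"
begin

lemma k_sizes:
  "4 * int k = 2 ^ d * 2 ^ (n - d) * (2 ^ d + \<epsilon>') * (2 ^ (n - d) + \<epsilon> * \<epsilon>')"
  "4 * (int (card \<Q>) - int k) = 2 ^ d * 2 ^ (n - d) * (2 ^ d - \<epsilon>') * (2 ^ (n - d) - \<epsilon> * \<epsilon>')"
proof -
  have "2 + (n - 2) = d + (n - d)"
    using n2 d_less by simp
  then have "(2::int) ^ (2 + (n - 2)) = 2 ^ (d + (n - d))"
    by (simp only:)
  then have "(4::int) * 2 ^ (n - 2) = 2 ^ d * 2 ^ (n - d)"
    by (simp only: power_add) simp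
  then show 1: "4 * int k = 2 ^ d * 2 ^ (n - d) * (2 ^ d + \<epsilon>') * (2 ^ (n - d) + \<epsilon> * \<epsilon>')"
    unfolding k by (simp add: mult.assoc[symmetric])
  have "(2::int) ^ n = 2 ^ d * 2 ^ (n - d)"
    using d_less by (simp flip: power_add)
  then have "4 * (int (card \<Q>) - int k) = 2 * (2 ^ d * 2 ^ (n - d) * (2 ^ d * 2 ^ (n - d) + \<epsilon>))
    - 2 ^ d * 2 ^ (n - d) * (2 ^ d + \<epsilon>') * (2 ^ (n - d) + \<epsilon> * \<epsilon>')"
    using card_\<Q>_formula 1 by simp
  also have "\<dots> = 2 ^ d * 2 ^ (n - d) * (2 ^ d - \<epsilon>') * (2 ^ (n - d) - \<epsilon> * \<epsilon>')"
    using eps eps' by (auto simp: algebra_simps)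
  finally show "4 * (int (card \<Q>) - int k) = 2 ^ d * 2 ^ (n - d) * (2 ^ d - \<epsilon>') * (2 ^ (n - d) - \<epsilon> * \<epsilon>')" .
qed

lemma k_bounds:
  assumes "(n, d, \<epsilon>) \<noteq> (2, 1, 1)"
  shows "3 \<le> k" "int k \<le> int (card \<Q>) - 3"
proof -
  define a b :: int where "a = 2 ^ d" and "b = 2 ^ (n - d)"
  \<comment> \<open>The constant is four times the required 3. Taking
    \<open>\<eta> = \<epsilon>'\<close> gives the bound for \<open>k\<close>, and
    \<open>\<eta> = - \<epsilon>'\<close> the one for the complement. For \<open>a = b = 2\<close>
    it fails in plus type, which is the excluded case.\<close>
  have big: "12 \<le> a * b * (a + \<eta>) * (b + \<epsilon> * \<eta>)" if \<eta>: "\<eta> \<in> {1, -1}" for \<eta>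
  proof (cases "a = 2 \<and> b = 2")
    case True
    then have "d = 1" "n - d = 1"
      using two_power_cases[OF d1] two_power_cases[of "n - d"] d_less by (auto simp: a_def b_def)
    then have "\<epsilon> = -1"
      using assms eps by auto
    then show ?thesis
      using True \<eta> by auto
  next
    case False
    have low: "2 \<le> c * (c + t) \<and> (4 \<le> c \<longrightarrow> 12 \<le> c * (c + t))" if "2 \<le> c" "t \<in> {1, -1}" for c t :: int
    proof -
      have "2 * 1 \<le> c * (c + t)"
        using that by (intro mult_mono) auto
      moreover have "4 * 3 \<le> c * (c + t)" if "4 \<le> c"
        using that \<open>t \<in> {1, -1}\<close> by (intro mult_mono) auto
      ultimately show ?thesis
        using that by simp
    qed
    have et: "\<epsilon> * \<eta> \<in> {1, -1}"
      using eps \<eta> by auto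
    have ab: "a = 2 \<or> 4 \<le> a" "b = 2 \<or> 4 \<le> b"
      using two_power_cases[OF d1] two_power_cases[of "n - d"] d_less by (auto simp: a_def b_def)
    have "12 * 1 \<le> (a * (a + \<eta>)) * (b * (b + \<epsilon> * \<eta>))"
    proof (cases "4 \<le> a")
      case True
      then show ?thesis
        using low[OF _ \<eta>, of a] low[OF _ et, of b] ab by (intro mult_mono) auto
    next
      case False
      then have "4 \<le> b"
        using ab \<open>\<not> (a = 2 \<and> b = 2)\<close> by auto
      then have "1 * 12 \<le> (a * (a + \<eta>)) * (b * (b + \<epsilon> * \<eta>))"
        using low[OF _ \<eta>, of a] low[OF _ et, of b] ab by (intro mult_mono) auto
      then show ?thesis
        by simp
    qed
    then show ?thesis
      by (simp add: mult_ac)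
  qed
  show "3 \<le> k"
    using big[OF eps'] k_sizes(1) by (simp add: a_def b_def)
  have "- \<epsilon>' \<in> {1, -1}"
    using eps' by auto
  from big[OF this] show "int k \<le> int (card \<Q>) - 3"
    using k_sizes(2) by (simp add: a_def b_def)
qed

lemma half_size_iff: "2 * int k = int (card \<Q>) \<longleftrightarrow> 2 * d = n \<and> \<epsilon> = -1"
proof -
  define a b :: int where "a = 2 ^ d" and "b = 2 ^ (n - d)"
  have pos: "a > 0" "b > 0"
    by (simp_all add: a_def b_def)
  \<comment> \<open>The products in \<open>k_sizes\<close> differ only in the signs of their mixed
    terms, and these combine to a multiple of \<open>\<epsilon> * a + b\<close>.\<close>
  have "4 * int k - 4 * (int (card \<Q>) - int k) = 2 * a * b * \<epsilon>' * (\<epsilon> * a + b)"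
    unfolding k_sizes a_def[symmetric] b_def[symmetric] by (simp add: algebra_simps)
  moreover have "2 * int k = int (card \<Q>) \<longleftrightarrow> 4 * int k - 4 * (int (card \<Q>) - int k) = 0"
    by auto
  ultimately have "2 * int k = int (card \<Q>) \<longleftrightarrow> 2 * a * b * \<epsilon>' * (\<epsilon> * a + b) = 0"
    by simp
  also have "\<dots> \<longleftrightarrow> \<epsilon> * a + b = 0"
    using pos eps' by auto
  also have "\<dots> \<longleftrightarrow> a = b \<and> \<epsilon> = -1"
    using pos eps by auto
  also have "a = b \<longleftrightarrow> d = n - d"
    by (simp add: a_def b_def)
  finally show ?thesis
    using d_less by auto
qed

lemma card_codeword_k: "U \<in> \<U> \<Longrightarrow> card (cw U) = k"
  using card_codeword_formula[of U] k by simp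

lemma code_is_johnson_code: "johnson_code \<Q> k \<G>"
proof -
  have "cw U \<in> johnson_vertices \<Q> k" if "U \<in> \<U>" for U
    using card_codeword_k[OF that] codeword_subset[of U] by (simp add: johnson_vertices_def)
  then show ?thesis
    using \<U>_nonempty by (auto simp: johnson_code_def sp_code_def)
qed

lemma self_complementary_iff: "self_complementary \<Q> \<G> \<longleftrightarrow> 2 * d = n \<and> \<epsilon> = -1"
proof
  assume sc: "self_complementary \<Q> \<G>"
  obtain U where U: "U \<in> \<U>"
    using \<U>_nonempty by blast
  then have "\<Q> - cw U \<in> \<G>"
    using sc by (auto simp: self_complementary_def sp_code_def)
  then have "card (\<Q> - cw U) = k"
    using card_codeword_k by (auto simp: sp_code_def)
  moreover have "card (\<Q> - cw U) = card \<Q> - k" "k \<le> card \<Q>"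
    using card_codeword_k[OF U] codeword_subset[of U] by (simp_all add: card_Diff_subset card_mono flip: card_codeword_k[OF U])
  ultimately show "2 * d = n \<and> \<epsilon> = -1"
    unfolding half_size_iff[symmetric] by simp
next
  assume *: "2 * d = n \<and> \<epsilon> = -1"
  then have c: "\<Q> - cw U = cw (perp B U)" "perp B U \<in> \<U>" if "U \<in> \<U>" for U
    using codeword_perp(2) perp_\<U> that by auto
  have cc: "\<Q> - (\<Q> - cw U) = cw U" for U
    using codeword_subset by blast
  have "\<Q> - cw U \<in> \<G>" if "U \<in> \<U>" for U
    using c that by (auto simp: sp_code_def)
  moreover have "\<exists>\<Delta>. cw U = \<Q> - \<Delta> \<and> \<Delta> \<in> \<G>" if "U \<in> \<U>" for U
    using cc[of U] calculation[OF that] by metis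
  ultimately show "self_complementary \<Q> \<G>"
    unfolding self_complementary_def by (auto simp: sp_code_def)
qed

end

end

subsection \<open>Codewords through few points\<close>

context symplectic_code
begin

definition lam :: "(bit^'m \<Rightarrow> bit) set \<Rightarrow> nat" where
  "lam T = card {\<Delta>\<in>\<G>. T \<subseteq> \<Delta>}"

lemma \<G>_subset: "\<Delta> \<in> \<G> \<Longrightarrow> \<Delta> \<subseteq> \<Q>"
  using codeword_subset by (auto simp: sp_code_def)

lemma lam_invariant:
  assumes f: "bij_betw f \<Q> \<Q>" and code: "(`) f ` \<G> = \<G>" and T: "T \<subseteq> \<Q>"
  shows "lam (f ` T) = lam T"
proof -
  have inj: "inj_on f \<Q>"
    using f by (rule bij_betw_imp_inj_on)
  have "inj_on ((`) f) {\<Delta>\<in>\<G>. T \<subseteq> \<Delta>}"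
    using inj_on_image_eq_iff[OF inj] \<G>_subset by (auto intro!: inj_onI)
  moreover have "(`) f ` {\<Delta>\<in>\<G>. T \<subseteq> \<Delta>} = {\<Delta>\<in>\<G>. f ` T \<subseteq> \<Delta>}"
  proof
    show "(`) f ` {\<Delta>\<in>\<G>. T \<subseteq> \<Delta>} \<subseteq> {\<Delta>\<in>\<G>. f ` T \<subseteq> \<Delta>}"
      using code by blast
    show "{\<Delta>\<in>\<G>. f ` T \<subseteq> \<Delta>} \<subseteq> (`) f ` {\<Delta>\<in>\<G>. T \<subseteq> \<Delta>}"
    proof clarify
      fix \<Delta> assume \<Delta>: "\<Delta> \<in> \<G>" "f ` T \<subseteq> \<Delta>"
      then obtain \<Delta>' where \<Delta>': "\<Delta>' \<in> \<G>" "\<Delta> = f ` \<Delta>'"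
        using code by blast
      then have "T \<subseteq> \<Delta>'"
        using \<Delta>(2) inj_on_image_subset_iff[OF inj T \<G>_subset] by blast
      then show "\<Delta> \<in> (`) f ` {\<Delta>\<in>\<G>. T \<subseteq> \<Delta>}"
        using \<Delta>' by blast
    qed
  qed
  ultimately show ?thesis
    using card_image[of "(`) f" "{\<Delta>\<in>\<G>. T \<subseteq> \<Delta>}"] by (simp add: lam_def)
qed

lemma act_\<G>: "g \<in> carrier (Sp B) \<Longrightarrow> (`) (act g) ` \<G> = \<G>"
  using code_strongly_incidence_transitive by (simp add: strongly_incidence_transitive_def)

lemma act_bij: "g \<in> carrier (Sp B) \<Longrightarrow> bij_betw (act g) \<Q> \<Q>"
  using act_Bij by (auto simp: Bij_def)

text \<open>Two forms of the same type differ by a twist with a singular vector, which a single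
  transvection realises.\<close>

lemma \<Q>_transitive:
  assumes "\<phi> \<in> \<Q>" "\<psi> \<in> \<Q>"
  obtains g where "g \<in> carrier (Sp B)" "act g \<phi> = \<psi>"
proof -
  obtain a where a: "\<phi> = twist \<psi> a" "\<psi> a = 0"
    using \<Q>_twist[OF assms(2,1)] .
  then have "act (transv a) \<phi> = \<psi>"
    using act_eq_iff[OF transv_sp assms(1)] quad_transv(1)[OF \<Q>_quad[OF assms(2)]] by simp
  then show ?thesis
    using that by blast
qed

end

locale pointed_code = symplectic_code B n d \<epsilon> \<epsilon>' for B :: "bit^'m \<Rightarrow> bit^'m \<Rightarrow> bit" and n d \<epsilon> \<epsilon>' +
  fixes \<phi> :: "bit^'m \<Rightarrow> bit"
  assumes \<phi>Q: "\<phi> \<in> \<Q>"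
begin

abbreviation "Z \<equiv> zeros \<phi> UNIV"
abbreviation "y \<equiv> \<epsilon>' * 2 ^ d"
abbreviation "z \<equiv> \<epsilon> * \<epsilon>' * 2 ^ (n - d)"

lemma \<phi>: "\<phi> \<in> quad_forms B"
  using \<phi>Q by (rule \<Q>_quad)

lemma yz: "qsum \<phi> UNIV = y * z" "y * z = \<epsilon> * 2 ^ n"
proof -
  have "(2::int) ^ n = 2 ^ d * 2 ^ (n - d)"
    using d_less by (simp flip: power_add)
  then show "y * z = \<epsilon> * 2 ^ n"
    by (simp add: mult_ac)
  then show "qsum \<phi> UNIV = y * z"
    using \<phi>Q unfolding quads_iff by metis
qed

lemma Z_iff: "a \<in> Z \<longleftrightarrow> \<phi> a = 0"
  by (simp add: zeros_def)

lemma Z_zero: "0 \<in> Z"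
  using \<phi> by (simp add: Z_iff)

lemma twist_in: "a \<in> Z \<Longrightarrow> twist \<phi> a \<in> \<Q>"
  using twist_\<Q>[OF \<phi>Q] by (simp add: Z_iff)

definition trace :: "(bit^'m \<Rightarrow> bit) set \<Rightarrow> (bit^'m) set" where
  "trace \<Delta> = {a. twist \<phi> a \<in> \<Delta>}"

abbreviation "\<G>\<phi> \<equiv> {\<Delta>\<in>\<G>. \<phi> \<in> \<Delta>}"

lemma trace_cases:
  assumes "\<Delta> \<in> \<G>\<phi>"
  obtains U where "U \<in> \<U>" "trace \<Delta> = split_zeros \<phi> U" "qsum \<phi> U = y" "qsum \<phi> (perp B U) = z"
proof -
  obtain U where U: "U \<in> \<U>" "\<Delta> = cw U" "\<phi> \<in> cw U"
    using assms by (auto simp: sp_code_def)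
  then have "trace \<Delta> = split_zeros \<phi> U"
    using codeword_twist by (auto simp: trace_def)
  moreover have "qsum \<phi> U = y"
    using U by (simp add: codeword_iff)
  moreover from this have "qsum \<phi> (perp B U) = z"
    using qsum_perp[OF \<phi>Q U(1) eps'] by simp
  ultimately show ?thesis
    using that U by blast
qed

lemma trace_subset: "\<Delta> \<in> \<G>\<phi> \<Longrightarrow> trace \<Delta> \<subseteq> Z" "\<Delta> \<in> \<G>\<phi> \<Longrightarrow> 0 \<in> trace \<Delta>"
  using \<G>_subset[of \<Delta>] twist_\<Q>[OF \<phi>Q] by (auto simp: trace_def Z_iff)

text \<open>Only \<open>y\<close> and \<open>z\<close> enter, so all codewords through
  \<open>\<phi>\<close> have the same numbers of pairs and triples of each kind, as
  \<open>lam_count\<close> requires.\<close>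

lemma trace_sums:
  assumes "\<Delta> \<in> \<G>\<phi>"
  shows "4 * int (card (trace \<Delta>)) = y * z * (y + 1) * (z + 1)"
    "16 * pair_sum (trace \<Delta>) = (y * z)\<^sup>2 * (y + 3) * (z + 3)"
    "64 * path_sum (trace \<Delta>) = (y * z) ^ 3 * (3 * y + 5) * (3 * z + 5)"
    "triangle_sum (trace \<Delta>) = int (card (trace \<Delta>)) * pair_sum (trace \<Delta>)"
proof -
  obtain U where U: "U \<in> \<U>" "trace \<Delta> = split_zeros \<phi> U" "qsum \<phi> U = y" "qsum \<phi> (perp B U) = z"
    using trace_cases[OF assms] .
  have nd: "nondeg U" "nondeg (perp B U)"
    using \<U>_D(1)[OF U(1)] by auto
  let ?Y = "zeros \<phi> U" and ?W = "zeros \<phi> (perp B U)"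
  have "4 * int (card (trace \<Delta>)) = (2 * int (card ?Y)) * (2 * int (card ?W))"
    using card_split_zeros[OF \<phi> nd(1)] U(2) by simp
  then show "4 * int (card (trace \<Delta>)) = y * z * (y + 1) * (z + 1)"
    unfolding card_zeros[OF \<phi> nd(1)] card_zeros[OF \<phi> nd(2)] U(3,4) by (simp add: algebra_simps)
  have "16 * pair_sum (trace \<Delta>) = (4 * pair_sum ?Y) * (4 * pair_sum ?W)"
    using pair_sum_split[OF \<phi> nd(1)] U(2) by simp
  then show "16 * pair_sum (trace \<Delta>) = (y * z)\<^sup>2 * (y + 3) * (z + 3)"
    unfolding pair_sum_zeros[OF \<phi> nd(1)] pair_sum_zeros[OF \<phi> nd(2)] U(3,4)
    by (simp add: power2_eq_square mult_ac)
  have "64 * path_sum (trace \<Delta>) = (8 * path_sum ?Y) * (8 * path_sum ?W)"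
    using path_sum_split[OF \<phi> nd(1)] U(2) by simp
  then show "64 * path_sum (trace \<Delta>) = (y * z) ^ 3 * (3 * y + 5) * (3 * z + 5)"
    unfolding path_sum_zeros[OF \<phi> nd(1)] path_sum_zeros[OF \<phi> nd(2)] U(3,4)
    by (simp add: power3_eq_cube mult_ac)
  show "triangle_sum (trace \<Delta>) = int (card (trace \<Delta>)) * pair_sum (trace \<Delta>)"
    using triangle_sum_split_zeros[OF \<phi> nd(1)] U(2) by simp
qed

lemma Z_sums:
  "2 * int (card Z) = y * z * (y * z + 1)"
  "4 * pair_sum Z = (y * z)\<^sup>2 * (y * z + 3)"
  "8 * path_sum Z = (y * z) ^ 3 * (3 * (y * z) + 5)"
  "triangle_sum Z = int (card Z) * pair_sum Z"
  using card_zeros[OF \<phi> nondeg_UNIV] pair_sum_zeros[OF \<phi> nondeg_UNIV] path_sum_zeros[OF \<phi> nondeg_UNIV]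
    triangle_sum_zeros[OF \<phi> nondeg_UNIV]
  unfolding yz(1) by (simp_all add: power2_eq_square power3_eq_cube distrib_left)

lemma \<G>\<phi>_nonempty: "card \<G>\<phi> > 0"
proof -
  obtain U where U: "U \<in> \<U>"
    using \<U>_nonempty by blast
  obtain \<psi> where \<psi>: "\<psi> \<in> cw U"
    using codeword_nonempty[OF U] .
  then obtain g where g: "g \<in> carrier (Sp B)" "act g \<psi> = \<phi>"
    using \<Q>_transitive[OF _ \<phi>Q] codeword_subset by blast
  have "act g ` cw U \<in> \<G>\<phi>"
  proof -
    have "cw U \<in> \<G>"
      using U by (simp add: sp_code_def)
    then have "act g ` cw U \<in> \<G>"
      using act_\<G>[OF g(1)] by blast
    then show ?thesis
      using \<psi> g(2) by blast
  qed
  moreover have "finite \<G>\<phi>"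
    by simp
  ultimately show ?thesis
    by (metis card_gt_0_iff empty_iff)
qed

lemma sum_lam:
  assumes "finite P"
  shows "(\<Sum>p\<in>P. lam (insert \<phi> (S p))) = (\<Sum>\<Delta>\<in>\<G>\<phi>. card {p\<in>P. S p \<subseteq> \<Delta>})"
proof -
  have fin: "finite \<G>\<phi>"
    by simp
  have "lam (insert \<phi> (S p)) = (\<Sum>\<Delta>\<in>\<G>\<phi>. if S p \<subseteq> \<Delta> then 1 else 0)" for p
  proof -
    have "{\<Delta>\<in>\<G>. insert \<phi> (S p) \<subseteq> \<Delta>} = {\<Delta>\<in>\<G>\<phi>. S p \<subseteq> \<Delta>}"
      by auto
    then show ?thesis
      unfolding lam_def using sum.inter_filter[OF fin, of "\<lambda>_. 1::nat" "\<lambda>\<Delta>. S p \<subseteq> \<Delta>"] by simp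
  qed
  then have "(\<Sum>p\<in>P. lam (insert \<phi> (S p))) = (\<Sum>p\<in>P. \<Sum>\<Delta>\<in>\<G>\<phi>. if S p \<subseteq> \<Delta> then 1 else 0)"
    by simp
  also have "\<dots> = (\<Sum>\<Delta>\<in>\<G>\<phi>. \<Sum>p\<in>P. if S p \<subseteq> \<Delta> then 1 else 0)"
    by (rule sum.swap)
  also have "\<dots> = (\<Sum>\<Delta>\<in>\<G>\<phi>. card {p\<in>P. S p \<subseteq> \<Delta>})"
    using sum.inter_filter[OF assms, of "\<lambda>_. 1::nat"] by simp
  finally show ?thesis .
qed

text \<open>Incidences between the configurations in \<open>P\<close> and the codewords through
  \<open>\<phi>\<close> are counted in two ways.\<close>

lemma lam_count:
  assumes "finite P" "\<And>p. p \<in> P \<Longrightarrow> lam (insert \<phi> (S p)) = l"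
    and "\<And>\<Delta>. \<Delta> \<in> \<G>\<phi> \<Longrightarrow> int (card {p\<in>P. S p \<subseteq> \<Delta>}) = c"
  shows "int l * int (card P) = int (card \<G>\<phi>) * c"
proof -
  have "int l * int (card P) = int (\<Sum>p\<in>P. lam (insert \<phi> (S p)))"
    using assms(2) by simp
  also have "\<dots> = int (card \<G>\<phi>) * c"
    unfolding sum_lam[OF assms(1)] using assms(3) by simp
  finally show ?thesis .
qed

section \<open>Moving pairs and triples of singular vectors\<close>

lemma lam_move:
  assumes "g \<in> carrier (Sp B)" "\<phi> \<circ> g = \<phi>" "A \<subseteq> Z"
  shows "lam (insert \<phi> (twist \<phi> ` g ` A)) = lam (insert \<phi> (twist \<phi> ` A))"
proof -
  have "act g \<phi> = \<phi>"
    using act_eq_iff[OF assms(1) \<phi>Q] assms(2) by simp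
  moreover have "act g (twist \<phi> a) = twist \<phi> (g a)" if "a \<in> A" for a
    using act_eq_iff[OF assms(1) twist_in] twist_comp[OF assms(1), of \<phi> a] assms(2,3) that by auto
  then have "act g ` twist \<phi> ` A = twist \<phi> ` g ` A"
    by (force simp: image_image)
  ultimately have "act g ` insert \<phi> (twist \<phi> ` A) = insert \<phi> (twist \<phi> ` g ` A)"
    by simp
  moreover have "lam (act g ` insert \<phi> (twist \<phi> ` A)) = lam (insert \<phi> (twist \<phi> ` A))"
    using assms twist_in \<phi>Q by (intro lam_invariant act_bij act_\<G>) auto
  ultimately show ?thesis
    by simp
qed

text \<open>The span of \<open>S\<close>, \<open>c\<close> and \<open>c'\<close> has at most
  \<open>2 ^ (card S + 2)\<close> elements, and the square of its size must not exceed
  \<open>2 ^ (2 * n)\<close>. The lower bounds on \<open>n\<close> in \<open>pair_move\<close> and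
  \<open>triple_move\<close> come from here.\<close>

lemma singular_move_span:
  assumes S: "finite S" "card S + 2 \<le> n"
    and c: "c \<in> Z" "c' \<in> Z" "c \<notin> vec.span S" "c' \<notin> vec.span S" "\<And>s. s \<in> S \<Longrightarrow> B s c = B s c'"
  shows "\<exists>g\<in>carrier (Sp B). \<phi> \<circ> g = \<phi> \<and> (\<forall>s\<in>S. g s = s) \<and> g c = c'"
proof -
  have "vec.span (insert c (insert c' (vec.span S))) = vec.span (insert c (insert c' S))"
  proof (rule vec.span_eq[THEN iffD2], intro conjI)
    show "insert c (insert c' (vec.span S)) \<subseteq> vec.span (insert c (insert c' S))"
      using vec.span_mono[of S "insert c (insert c' S)"] by (auto simp: vec.span_base)
    show "insert c (insert c' S) \<subseteq> vec.span (insert c (insert c' (vec.span S)))"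
      by (auto simp: vec.span_base)
  qed
  moreover have "card (vec.span (insert c (insert c' S))) \<le> 2 ^ n"
  proof -
    have "card (vec.span (insert c (insert c' S))) \<le> 2 ^ card (insert c (insert c' S))"
      using S(1) by (intro card_span_le) simp
    also have "\<dots> \<le> 2 ^ n"
      using S card_insert_le_m1[of "card S + 2" "insert c' S" c] card_insert_le_m1[of "card S + 1" S c']
      by (intro power_increasing) auto
    finally show ?thesis .
  qed
  ultimately have "card (vec.span (insert c (insert c' (vec.span S)))) * card (vec.span (insert c (insert c' (vec.span S)))) \<le> 2 ^ n * 2 ^ n"
    by (simp add: mult_mono)
  also have "\<dots> = CARD(bit^'m)"
    unfolding card_V by (simp flip: power_add add: mult_2)
  finally have size: "card (vec.span (insert c (insert c' (vec.span S)))) * card (vec.span (insert c (insert c' (vec.span S)))) \<le> CARD(bit^'m)" .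
  have "vec.span S \<subseteq> {x. B x c = B x c'}"
    using c(5) by (intro vec.span_minimal) (auto simp: subspace_bit_iff)
  then have "\<exists>g\<in>carrier (Sp B). \<phi> \<circ> g = \<phi> \<and> (\<forall>a\<in>vec.span S. g a = a) \<and> g c = c'"
    using c size by (intro singular_move[OF \<phi>]) (auto simp: Z_iff)
  then show ?thesis
    using vec.span_base[of _ S] by meson
qed

lemma span_single: "vec.span {a} = {0, a :: bit^'m}"
  using span_insert_bit[of a "{}"] by auto

lemma span_pair: "vec.span {a, b} = {0, b, a, a + b :: bit^'m}"
  using span_insert_bit[of a "{b}"] span_single[of b] by auto

text \<open>The vector \<open>a\<close> is moved with nothing fixed, then the image of
  \<open>b\<close> with \<open>a'\<close> fixed; the second step is the one that uses
  \<open>3 \<le> n\<close>.\<close>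

lemma pair_move:
  assumes "3 \<le> n" and ab: "a \<in> Z" "b \<in> Z" "a \<noteq> 0" "b \<noteq> 0" "a \<noteq> b"
    and ab': "a' \<in> Z" "b' \<in> Z" "a' \<noteq> 0" "b' \<noteq> 0" "a' \<noteq> b'" and eq: "B a b = B a' b'"
  obtains g where "g \<in> carrier (Sp B)" "\<phi> \<circ> g = \<phi>" "g a = a'" "g b = b'"
proof -
  obtain g where g: "g \<in> carrier (Sp B)" "\<phi> \<circ> g = \<phi>" "g a = a'"
  proof -
    have "\<exists>g\<in>carrier (Sp B). \<phi> \<circ> g = \<phi> \<and> (\<forall>s\<in>{}. g s = s) \<and> g a = a'"
      using ab ab' assms(1) by (intro singular_move_span) auto
    then show ?thesis
      using that by blast
  qed
  have gb: "g b \<in> Z" "g b \<noteq> 0" "g b \<noteq> a'" "B a' (g b) = B a' b'"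
    using fun_cong[OF g(2), of b] ab sp_inj[OF g(1), of b] sp_inj[OF g(1), of b 0] sp_zero[OF g(1)]
      sp_inj[OF g(1), of b a] sp_B[OF g(1), of a b] g(3) eq by (auto simp: Z_iff)
  obtain h where h: "h \<in> carrier (Sp B)" "\<phi> \<circ> h = \<phi>" "h a' = a'" "h (g b) = b'"
  proof -
    have "\<exists>h\<in>carrier (Sp B). \<phi> \<circ> h = \<phi> \<and> (\<forall>s\<in>{a'}. h s = s) \<and> h (g b) = b'"
      using gb ab' assms(1) by (intro singular_move_span) (auto simp: span_single)
    then show ?thesis
      using that by blast
  qed
  have "\<phi> \<circ> (h \<circ> g) = \<phi>"
    using g(2) h(2) by (simp add: comp_assoc[symmetric])
  then show ?thesis
    using that[of "h \<circ> g"] g h by (simp add: sp_comp)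
qed

text \<open>With \<open>B a b = 1\<close> the sum \<open>a + b\<close> is not singular, so a
  singular \<open>c\<close> other than \<open>0\<close>, \<open>a\<close>, \<open>b\<close> is
  automatically outside the span of \<open>a\<close> and \<open>b\<close>. For this reason triples
  are always taken with a nonorthogonal first pair.\<close>

lemma triple_move:
  assumes "4 \<le> n" and ab: "a \<in> Z" "b \<in> Z" "B a b = 1" and c: "c \<in> Z" "c \<notin> {0, a, b}"
    and ab': "a' \<in> Z" "b' \<in> Z" "B a' b' = 1" and c': "c' \<in> Z" "c' \<notin> {0, a', b'}"
    and eq: "B a c = B a' c'" "B b c = B b' c'"
  obtains g where "g \<in> carrier (Sp B)" "\<phi> \<circ> g = \<phi>" "g a = a'" "g b = b'" "g c = c'"
proof -
  have distinct: "u \<noteq> 0 \<and> v \<noteq> 0 \<and> u \<noteq> v" if "B u v = 1" for u v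
    using that by auto
  obtain g where g: "g \<in> carrier (Sp B)" "\<phi> \<circ> g = \<phi>" "g a = a'" "g b = b'"
    using pair_move[of a b a' b'] ab ab' distinct[OF ab(3)] distinct[OF ab'(3)] assms(1) by auto
  have notsum: "t \<noteq> u + v" if "t \<in> Z" "u \<in> Z" "v \<in> Z" "B u v = 1" for t u v
    using that quad_add[OF \<phi>, of u v] by (auto simp: Z_iff)
  have gZ: "g c \<in> Z"
    using fun_cong[OF g(2), of c] c(1) by (simp add: Z_iff)
  have gc: "g c \<notin> {0, a', b'}" "B a' (g c) = B a' c'" "B b' (g c) = B b' c'"
    using c(2) sp_inj[OF g(1), of c 0] sp_zero[OF g(1)] sp_inj[OF g(1), of c a] sp_inj[OF g(1), of c b]
      sp_B[OF g(1), of a c] sp_B[OF g(1), of b c] g(3,4) eq by auto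
  have "g c \<notin> vec.span {a', b'}" "c' \<notin> vec.span {a', b'}"
    using gc(1) c'(2) notsum[OF gZ ab'] notsum[OF c'(1) ab'] by (auto simp: span_pair)
  moreover have "card {a', b'} + 2 \<le> n"
    using assms(1) by (simp add: card_insert_if)
  ultimately have "\<exists>h\<in>carrier (Sp B). \<phi> \<circ> h = \<phi> \<and> (\<forall>s\<in>{a', b'}. h s = s) \<and> h (g c) = c'"
    using gZ c'(1) gc(2,3) by (intro singular_move_span) auto
  then obtain h where h: "h \<in> carrier (Sp B)" "\<phi> \<circ> h = \<phi>" "h a' = a'" "h b' = b'" "h (g c) = c'"
    by blast
  have "\<phi> \<circ> (h \<circ> g) = \<phi>"
    using g(2) h(2) by (simp add: comp_assoc[symmetric])
  then show ?thesis
    using that[of "h \<circ> g"] g h by (simp add: sp_comp)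
qed

end

text \<open>Eliminates the two unknowns of the double counts, the common number \<open>l\<close> of
  codewords through a configuration and the number \<open>r\<close> of codewords through
  \<open>\<phi>\<close>.\<close>

lemma cross_multiply:
  fixes l :: int
  assumes "l * p = r * c" "l * p' = r * c'" "r \<noteq> 0"
  shows "c' * p = c * p'"
proof -
  have "r * (c' * p) = (l * p') * p"
    by (simp add: assms(2) mult.assoc)
  also have "\<dots> = (l * p) * p'"
    by (simp add: mult_ac)
  also have "\<dots> = r * (c * p')"
    by (simp add: assms(1) mult.assoc)
  finally show ?thesis
    using assms(3) by simp
qed

text \<open>In terms of \<open>x = y * z\<close> and \<open>w = y + z\<close>.\<close>

lemma pair_count_identity:
  fixes x w :: int
  defines "k \<equiv> x * (x + w + 1)" and "s \<equiv> x * x * (x + 3 * w + 9)"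
    and "N \<equiv> x * (x + 1)" and "t \<equiv> x * x * (x + 3)"
  shows "(k * k + s - 24 * k + 64) * (N * N - t) - (k * k - s) * (N * N + t - 12 * N + 16)
    = 2 * (x + 2) * (x - 1) * (x - 4) * x * x * w * (x - w + 1)"
  unfolding assms by (simp add: algebra_simps)

context symplectic_space
begin

text \<open>The pairs to be discarded are those with first entry 0, with second entry 0, and with
  equal entries. The pair of zeros is counted in the first family only, which gives
  \<open>3 * card D - 2\<close>.\<close>

lemma card_nondegenerate_orthogonal_pairs:
  assumes "0 \<in> D"
  shows "int (card {(a, b). a \<in> D \<and> b \<in> D \<and> B a b = 0 \<and> a \<noteq> 0 \<and> b \<noteq> 0 \<and> a \<noteq> b})
    = int (card {(a, b). a \<in> D \<and> b \<in> D \<and> B a b = 0}) - 3 * int (card D) + 2"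
proof -
  let ?N = "{(a, b). a \<in> D \<and> b \<in> D \<and> B a b = 0 \<and> a \<noteq> 0 \<and> b \<noteq> 0 \<and> a \<noteq> b}"
  let ?E1 = "(\<lambda>b. (0 :: bit^'m, b)) ` D" and ?E2 = "(\<lambda>a. (a, 0 :: bit^'m)) ` (D - {0})" and ?E3 = "(\<lambda>a. (a, a)) ` (D - {0})"
  have fin: "finite D" "finite ?N"
    by simp_all
  have split: "{(a, b). a \<in> D \<and> b \<in> D \<and> B a b = 0} = ?N \<union> (?E1 \<union> (?E2 \<union> ?E3))"
    using assms by auto
  have "card (?N \<union> (?E1 \<union> (?E2 \<union> ?E3))) = card ?N + card (?E1 \<union> (?E2 \<union> ?E3))"
    by (rule card_Un_disjoint) auto
  also have "card (?E1 \<union> (?E2 \<union> ?E3)) = card ?E1 + card (?E2 \<union> ?E3)"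
    by (rule card_Un_disjoint) auto
  also have "card (?E2 \<union> ?E3) = card ?E2 + card ?E3"
    by (rule card_Un_disjoint) auto
  also have "card ?E1 = card D"
    by (rule card_image) (simp add: inj_on_def)
  also have "card ?E2 = card (D - {0})"
    by (rule card_image) (simp add: inj_on_def)
  also have "card ?E3 = card (D - {0})"
    by (rule card_image) (simp add: inj_on_def)
  also have "card (D - {0}) = card D - 1"
    using assms by simp
  finally have "card {(a, b). a \<in> D \<and> b \<in> D \<and> B a b = 0} = card ?N + (card D + ((card D - 1) + (card D - 1)))"
    unfolding split .
  moreover have "card D \<ge> 1"
    using assms by (simp add: Suc_le_eq card_gt_0_iff) auto
  ultimately show ?thesis
    by simp
qed

text \<open>Together with the base point 0 these give four distinct points; the value 1 of
  \<open>B\<close> on the first pair already separates its entries from each other and from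
  0.\<close>

definition proper_triples :: "(bit^'m) set \<Rightarrow> bit \<Rightarrow> bit \<Rightarrow> ((bit^'m) \<times> (bit^'m) \<times> (bit^'m)) set" where
  "proper_triples D i j = {p\<in>B_triples D 1 i j. snd (snd p) \<notin> {0, fst p, fst (snd p)}}"

lemma proper_triples_iff:
  "(a, b, c) \<in> proper_triples D i j \<longleftrightarrow>
    a \<in> D \<and> b \<in> D \<and> c \<in> D \<and> B a b = 1 \<and> B a c = i \<and> B b c = j \<and> c \<notin> {0, a, b}"
  by (auto simp: proper_triples_def B_triples_def)

text \<open>A vector \<open>c\<close> among \<open>0\<close>, \<open>a\<close>, \<open>b\<close> is
  orthogonal to \<open>a\<close> or to \<open>b\<close>, so no degenerate triples have to be
  subtracted.\<close>

lemma card_proper_triples_11: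
  assumes "triangle_sum D = int (card D) * pair_sum D"
  shows "8 * int (card (proper_triples D 1 1)) = int (card D) ^ 3 - 4 * (int (card D) * pair_sum D) + 3 * path_sum D"
proof -
  have "proper_triples D 1 1 = B_triples D 1 1 1"
    by (auto simp: proper_triples_def B_triples_def)
  then show ?thesis
    using card_triples_B[OF assms, of 1 1 1] by simp
qed

lemma card_proper_triples:
  assumes "triangle_sum D = int (card D) * pair_sum D" "0 \<in> D" "(i, j) \<noteq> (1, 1)"
  shows "8 * int (card (proper_triples D i j)) =
    int (card D) ^ 3 - path_sum D - 4 * (int (card D) * int (card D) - pair_sum D)"
proof -
  \<comment> \<open>Each nonorthogonal pair extends to exactly one degenerate triple of a given
    mixed pattern: \<open>c = b\<close> for \<open>(1, 0)\<close>, \<open>c = a\<close> for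
    \<open>(0, 1)\<close>, \<open>c = 0\<close> for \<open>(0, 0)\<close>. The correction is
    therefore the same for all three patterns.\<close>
  define w where "w = (\<lambda>(a, b). (a, b, if i = 1 then b else if j = 1 then a else (0 :: bit^'m)))"
  let ?P = "{(a, b). a \<in> D \<and> b \<in> D \<and> B a b = 1}"
  have ij: "i = 1 \<and> j = 0 \<or> i = 0 \<and> j = 1 \<or> i = 0 \<and> j = 0"
    using assms(3) by (cases i; cases j) auto
  have ba: "B b a = B a b" for a b
    by (rule B_sym)
  have "B_triples D 1 i j = proper_triples D i j \<union> w ` ?P"
  proof (rule Set.set_eqI)
    fix p :: "(bit^'m) \<times> (bit^'m) \<times> (bit^'m)"
    obtain a b c where p: "p = (a, b, c)"
      by (cases p)
    have "p \<in> w ` ?P \<longleftrightarrow> a \<in> D \<and> b \<in> D \<and> B a b = 1 \<and> c = (if i = 1 then b else if j = 1 then a else 0)"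
      by (auto simp: w_def p image_iff)
    then show "p \<in> B_triples D 1 i j \<longleftrightarrow> p \<in> proper_triples D i j \<union> w ` ?P"
      using ij assms(2) ba[of b a] by (auto simp: p proper_triples_iff B_triples_def)
  qed
  moreover have "proper_triples D i j \<inter> w ` ?P = {}"
    by (auto simp: w_def proper_triples_iff split: if_splits)
  moreover have "finite (proper_triples D i j)" "finite (w ` ?P)"
    by simp_all
  ultimately have "card (B_triples D 1 i j) = card (proper_triples D i j) + card (w ` ?P)"
    by (simp add: card_Un_disjoint)
  moreover have "card (w ` ?P) = card ?P"
    by (rule card_image) (auto simp: w_def inj_on_def)
  ultimately have "8 * int (card (proper_triples D i j)) = 8 * int (card (B_triples D 1 i j)) - 4 * (2 * int (card ?P))"
    by simp
  then show ?thesis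
    unfolding card_pairs_B(1) card_triples_B[OF assms(1)] using ij by auto
qed

end

context pointed_code
begin

lemma sgn_size: "y * z = 2 ^ n \<or> y * z = - (2 ^ n)"
  using eps unfolding yz(2) by auto

lemma pow_n_ge: "m \<le> n \<Longrightarrow> (2::int) ^ m \<le> 2 ^ n"
  by (rule power_increasing) auto

abbreviation "lamt A \<equiv> lam (insert \<phi> (twist \<phi> ` A))"

lemma pairs_trace:
  assumes "\<Delta> \<in> \<G>\<phi>"
  shows "{p\<in>{(a, b). a \<in> Z \<and> b \<in> Z \<and> P a b}. twist \<phi> ` {fst p, snd p} \<subseteq> \<Delta>}
    = {(a, b). a \<in> trace \<Delta> \<and> b \<in> trace \<Delta> \<and> P a b}"
  using trace_subset[OF assms] by (auto simp: trace_def)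

text \<open>
  If three-point sets of the two kinds lay in equally many codewords, the proportion of the kinds
  inside a codeword would be the same as in all of \<open>\<Q>\<close>.
\<close>

lemma pair_type_separation:
  assumes "3 \<le> n" "y + z \<noteq> 0"
    and p1: "a1 \<in> Z" "b1 \<in> Z" "B a1 b1 = 1"
    and p0: "a0 \<in> Z" "b0 \<in> Z" "B a0 b0 = 0" "a0 \<noteq> 0" "b0 \<noteq> 0" "a0 \<noteq> b0"
  shows "lamt {a1, b1} \<noteq> lamt {a0, b0}"
proof
  assume eq: "lamt {a1, b1} = lamt {a0, b0}"
  define l where "l = lamt {a1, b1}"
  define P1 where "P1 D = {(a, b). a \<in> D \<and> b \<in> D \<and> B a b = 1}" for D
  define P0 where "P0 D = {(a, b). a \<in> D \<and> b \<in> D \<and> B a b = 0 \<and> a \<noteq> 0 \<and> b \<noteq> 0 \<and> a \<noteq> b}" for D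
  define S where "S p = twist \<phi> ` {fst p, snd p}" for p
  have const: "lamt {a, b} = lamt {a', b'}"
    if ab: "a \<in> Z" "b \<in> Z" "a \<noteq> 0" "b \<noteq> 0" "a \<noteq> b" "a' \<in> Z" "b' \<in> Z" "a' \<noteq> 0" "b' \<noteq> 0" "a' \<noteq> b'"
      "B a b = B a' b'" for a b a' b'
  proof -
    obtain g where g: "g \<in> carrier (Sp B)" "\<phi> \<circ> g = \<phi>" "g a = a'" "g b = b'"
      using pair_move[OF assms(1) ab] .
    then show ?thesis
      using lam_move[OF g(1,2), of "{a, b}"] ab by simp
  qed
  have ne: "u \<noteq> 0 \<and> v \<noteq> 0 \<and> u \<noteq> v" if "B u v = 1" for u v
    using that by auto
  have lP1: "lam (insert \<phi> (S p)) = l" if "p \<in> P1 Z" for p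
    using that const[of "fst p" "snd p" a1 b1] p1 ne[of "fst p" "snd p"] ne[OF p1(3)]
    by (auto simp: P1_def S_def l_def)
  have lP0: "lam (insert \<phi> (S p)) = l" if "p \<in> P0 Z" for p
    using that const[of "fst p" "snd p" a0 b0] p0 eq by (auto simp: P0_def S_def l_def)
  have fin: "finite (P1 Z)" "finite (P0 Z)"
    by simp_all
  define k s :: int where "k = y * z * (y + 1) * (z + 1)" and "s = (y * z)\<^sup>2 * (y + 3) * (z + 3)"
  define N t :: int where "N = y * z * (y * z + 1)" and "t = (y * z)\<^sup>2 * (y * z + 3)"
  \<comment> \<open>The factor 32 lets the counts be expressed by the integers
    \<open>4 * card D\<close> and \<open>16 * pair_sum D\<close>, which for a codeword are
    polynomials in \<open>y\<close> and \<open>z\<close>.\<close>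
  have sz: "32 * int (card (P1 D)) = K * K - R" "32 * int (card (P0 D)) = K * K + R - 24 * K + 64"
    if "4 * int (card D) = K" "16 * pair_sum D = R" "0 \<in> D" for D K R
    using card_pairs_B[of D] card_nondegenerate_orthogonal_pairs[OF that(3)]
    unfolding P1_def P0_def that(1,2)[symmetric] by simp_all
  obtain \<Delta> where \<Delta>: "\<Delta> \<in> \<G>\<phi>"
    using \<G>\<phi>_nonempty by (metis (no_types, lifting) card.empty ex_in_conv less_irrefl)
  define c1 c0 where "c1 = int (card (P1 (trace \<Delta>)))" and "c0 = int (card (P0 (trace \<Delta>)))"
  have szt: "32 * int (card (P1 (trace \<Delta>'))) = k * k - s" "32 * int (card (P0 (trace \<Delta>'))) = k * k + s - 24 * k + 64"
    if "\<Delta>' \<in> \<G>\<phi>" for \<Delta>'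
    using sz[OF trace_sums(1,2)[OF that] trace_subset(2)[OF that]] unfolding k_def s_def by blast+
  have c10: "32 * c1 = k * k - s" "32 * c0 = k * k + s - 24 * k + 64"
    using szt[OF \<Delta>] by (simp_all add: c1_def c0_def)
  have tr: "{p\<in>P1 Z. S p \<subseteq> \<Delta>'} = P1 (trace \<Delta>')" "{p\<in>P0 Z. S p \<subseteq> \<Delta>'} = P0 (trace \<Delta>')"
    if "\<Delta>' \<in> \<G>\<phi>" for \<Delta>'
    unfolding P1_def P0_def S_def by (rule pairs_trace[OF that])+
  have c1: "int (card {p\<in>P1 Z. S p \<subseteq> \<Delta>'}) = c1" if "\<Delta>' \<in> \<G>\<phi>" for \<Delta>'
    unfolding tr[OF that] using szt(1)[OF that] c10(1) by linarith
  have c0: "int (card {p\<in>P0 Z. S p \<subseteq> \<Delta>'}) = c0" if "\<Delta>' \<in> \<G>\<phi>" for \<Delta>'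
    unfolding tr[OF that] using szt(2)[OF that] c10(2) by linarith
  have "int (card \<G>\<phi>) \<noteq> 0"
    using \<G>\<phi>_nonempty by linarith
  with lam_count[OF fin(1) lP1 c1] lam_count[OF fin(2) lP0 c0]
  have "c0 * int (card (P1 Z)) = c1 * int (card (P0 Z))"
    by (rule cross_multiply)
  then have "(32 * c0) * (32 * int (card (P1 Z))) = (32 * c1) * (32 * int (card (P0 Z)))"
    by simp
  moreover have "32 * int (card (P1 Z)) = 4 * (N * N - t)" "32 * int (card (P0 Z)) = 4 * (N * N + t - 12 * N + 16)"
    using sz[of Z "2 * N" "4 * t"] Z_sums(1,2) Z_zero by (simp_all add: N_def t_def)
  ultimately have "4 * ((k * k + s - 24 * k + 64) * (N * N - t)) = 4 * ((k * k - s) * (N * N + t - 12 * N + 16))"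
    unfolding c10 by (simp only: mult.left_commute[of _ 4])
  then have "(k * k + s - 24 * k + 64) * (N * N - t) - (k * k - s) * (N * N + t - 12 * N + 16) = 0"
    by (simp only: mult_cancel_left) simp
  moreover have "k = y * z * (y * z + (y + z) + 1)" "s = (y * z) * (y * z) * (y * z + 3 * (y + z) + 9)"
      "N = y * z * (y * z + 1)" "t = (y * z) * (y * z) * (y * z + 3)"
    by (simp_all add: k_def s_def N_def t_def power2_eq_square algebra_simps)
  ultimately have "2 * (y * z + 2) * (y * z - 1) * (y * z - 4) * (y * z) * (y * z) * (y + z) * (y * z - (y + z) + 1) = 0"
    using pair_count_identity[of "y * z" "y + z"] by simp
  \<comment> \<open>Apart from \<open>y + z\<close> no factor can vanish: \<open>y * z\<close> is
    \<open>2 ^ n\<close> up to sign, with \<open>n \<ge> 3\<close>, and \<open>y\<close> and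
    \<open>z\<close> are even, hence different from 1.\<close>
  moreover have "y * z - (y + z) + 1 = (y - 1) * (z - 1)"
    by (simp add: algebra_simps)
  moreover have "(2::int) ^ n \<ge> 8"
    using pow_n_ge[OF assms(1)] by simp
  then have "y * z + 2 \<noteq> 0" "y * z - 1 \<noteq> 0" "y * z - 4 \<noteq> 0" "y * z \<noteq> 0"
    using sgn_size by auto
  moreover have "y - 1 \<noteq> 0" "z - 1 \<noteq> 0"
  proof -
    have "even y" "even z"
      using d1 d_less by auto
    then show "y - 1 \<noteq> 0" "z - 1 \<noteq> 0"
      by (metis diff_eq_eq add_0 odd_one)+
  qed
  ultimately show False
    using assms(2) by simp
qed

text \<open>The indicator expands into the characters of \<open>a\<close>, \<open>b\<close> and
  \<open>a + b\<close>; the last one contributes through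
  \<open>\<phi> (a + b) = B a b\<close>.\<close>

lemma card_common:
  assumes "a \<noteq> 0" "b \<noteq> 0" "a \<noteq> b" "\<phi> a = 0" "\<phi> b = 0"
  shows "8 * int (card {c\<in>Z. B a c = i \<and> B b c = i}) = 2 * int (card Z) + (2 * sg i + sg (B a b)) * (y * z)"
proof -
  have \<zeta>: "2 * (\<Sum>c\<in>Z. sg (B v c)) = sg (\<phi> v) * (y * z)" if "v \<noteq> 0" for v
    using sum_zeros_B[OF \<phi> nondeg_UNIV, of v] that unfolding yz(1) by simp
  have "8 * int (card {c\<in>Z. B a c = i \<and> B b c = i}) = 2 * (\<Sum>c\<in>Z. if B a c = i \<and> B b c = i then 4 else 0)"
    by (subst sum.inter_filter[symmetric]) auto
  also have "\<dots> = 2 * (\<Sum>c\<in>Z. 1 + sg i * sg (B a c) + sg i * sg (B b c) + sg (B (a + b) c))"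
  proof (intro arg_cong[of _ _ "\<lambda>t. 2 * t"] sum.cong refl)
    fix c
    show "(if B a c = i \<and> B b c = i then 4 else 0) = 1 + sg i * sg (B a c) + sg i * sg (B b c) + sg (B (a + b) c)"
      by (cases "B a c"; cases "B b c"; cases i) (auto simp: sg_add)
  qed
  also have "\<dots> = 2 * int (card Z) + sg i * (2 * (\<Sum>c\<in>Z. sg (B a c))) + sg i * (2 * (\<Sum>c\<in>Z. sg (B b c)))
      + 2 * (\<Sum>c\<in>Z. sg (B (a + b) c))"
    by (simp only: sum.distrib sum_distrib_left[symmetric] distrib_left) (simp add: sum_distrib_left mult_ac)
  also have "\<dots> = 2 * int (card Z) + (2 * sg i + sg (B a b)) * (y * z)"
    using assms \<zeta>[of a] \<zeta>[of b] \<zeta>[of "a + b"] quad_add[OF \<phi>, of a b] by (simp add: algebra_simps)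
  finally show ?thesis .
qed

text \<open>
  In the self-complementary case every three-point set lies in equally many codewords, and four-point
  sets have to be used.
\<close>

lemma four_point_values:
  assumes "4 \<le> n" "z = - y"
  shows "\<exists>L. (\<forall>a b c i j. (a, b, c) \<in> proper_triples Z i j \<longrightarrow> (i, j) \<noteq> (1, 1) \<longrightarrow> lamt {a, b, c} = L) \<and>
    (\<forall>a b c. (a, b, c) \<in> proper_triples Z 1 1 \<longrightarrow> lamt {a, b, c} \<noteq> L)"
proof -
  \<comment> \<open>With \<open>z = - y\<close> all counts become polynomials in the single number
    \<open>q = 2 ^ n\<close>.\<close>
  define q where "q = y * y"
  have yzq: "y * z = - q"
    by (simp add: assms(2) q_def)
  have "q = 2 ^ n"
    using sgn_size yzq by (auto simp: q_def) (smt (verit) mult_neg_neg mult_nonneg_nonneg zero_less_power)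
  then have q16: "q \<ge> 16"
    using pow_n_ge[OF assms(1)] by simp
  have const: "lamt {a, b, c} = lamt {a', b', c'}"
    if T: "(a, b, c) \<in> proper_triples Z i j" "(a', b', c') \<in> proper_triples Z i j" for a b c a' b' c' i j
  proof -
    obtain g where g: "g \<in> carrier (Sp B)" "\<phi> \<circ> g = \<phi>" "g a = a'" "g b = b'" "g c = c'"
      using triple_move[OF assms(1), of a b c a' b' c'] T by (auto simp: proper_triples_iff)
    then show ?thesis
      using lam_move[OF g(1,2), of "{a, b, c}"] T by (auto simp: proper_triples_iff)
  qed
  define S where "S p = twist \<phi> ` {fst p, fst (snd p), snd (snd p)}" for p
  have tr: "{p\<in>proper_triples Z i j. S p \<subseteq> \<Delta>} = proper_triples (trace \<Delta>) i j" if "\<Delta> \<in> \<G>\<phi>" for \<Delta> i j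
    using trace_subset[OF that] by (auto simp: S_def trace_def proper_triples_def B_triples_def)
  have count: "int (lamt {a, b, c}) * int (card (proper_triples Z i j)) = int (card \<G>\<phi>) * C"
    if T: "(a, b, c) \<in> proper_triples Z i j" and C: "\<And>\<Delta>. \<Delta> \<in> \<G>\<phi> \<Longrightarrow> int (card (proper_triples (trace \<Delta>) i j)) = C"
    for a b c i j C
  proof (rule lam_count)
    show "finite (proper_triples Z i j)"
      by simp
    show "lam (insert \<phi> (S p)) = lamt {a, b, c}" if "p \<in> proper_triples Z i j" for p
      using const[of "fst p" "fst (snd p)" "snd (snd p)" i j a b c] that T
      by (simp add: S_def)
    show "int (card {p\<in>proper_triples Z i j. S p \<subseteq> \<Delta>}) = C" if "\<Delta> \<in> \<G>\<phi>" for \<Delta>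
      unfolding tr[OF that] by (rule C[OF that])
  qed
  have tsum: "4 * int (card (trace \<Delta>)) = q * (q - 1)" "16 * pair_sum (trace \<Delta>) = q\<^sup>2 * (9 - q)"
      "64 * path_sum (trace \<Delta>) = q ^ 3 * (9 * q - 25)" if "\<Delta> \<in> \<G>\<phi>" for \<Delta>
    using trace_sums(1-3)[OF that] unfolding yzq assms(2)
    by (simp_all add: q_def algebra_simps power2_eq_square power3_eq_cube)
  have zsum: "2 * int (card Z) = q * (q - 1)" "4 * pair_sum Z = q\<^sup>2 * (3 - q)" "8 * path_sum Z = q ^ 3 * (3 * q - 5)"
    using Z_sums(1-3) unfolding yzq by (simp_all add: algebra_simps power2_eq_square power3_eq_cube)
  \<comment> \<open>The value is the same for the three patterns \<open>(i, j)\<close> other than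
    \<open>(1, 1)\<close>, which is why one number \<open>L\<close> serves all of them.\<close>
  have pt: "512 * int (card (proper_triples (trace \<Delta>) i j)) = q\<^sup>2 * (q - 4) * (q + 2) * (q\<^sup>2 - q - 16)"
    if "\<Delta> \<in> \<G>\<phi>" "(i, j) \<noteq> (1, 1)" for \<Delta> i j
  proof -
    have "512 * int (card (proper_triples (trace \<Delta>) i j)) = (4 * int (card (trace \<Delta>))) ^ 3 - 64 * path_sum (trace \<Delta>)
      - 16 * ((4 * int (card (trace \<Delta>))) * (4 * int (card (trace \<Delta>))) - 16 * pair_sum (trace \<Delta>))"
      using card_proper_triples[OF trace_sums(4) trace_subset(2), OF that(1,1,2)] by (simp add: power3_eq_cube)
    then show ?thesis
      unfolding tsum[OF that(1)] by (simp add: algebra_simps power2_eq_square power3_eq_cube)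
  qed
  have pt1: "512 * int (card (proper_triples (trace \<Delta>) 1 1)) = q ^ 3 * (q - 4) * (q\<^sup>2 + 5 * q + 10)"
    if "\<Delta> \<in> \<G>\<phi>" for \<Delta>
  proof -
    have "512 * int (card (proper_triples (trace \<Delta>) 1 1)) = (4 * int (card (trace \<Delta>))) ^ 3
      - 4 * ((4 * int (card (trace \<Delta>))) * (16 * pair_sum (trace \<Delta>))) + 3 * (64 * path_sum (trace \<Delta>))"
      using card_proper_triples_11[OF trace_sums(4)[OF that]] by (simp add: power3_eq_cube)
    then show ?thesis
      unfolding tsum[OF that] by (simp add: algebra_simps power2_eq_square power3_eq_cube)
  qed
  have zt: "64 * int (card (proper_triples Z i j)) = q\<^sup>2 * (q + 1) * (q - 2) * (q - 4) * (q + 2)"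
    if "(i, j) \<noteq> (1, 1)" for i j
  proof -
    have "64 * int (card (proper_triples Z i j)) = (2 * int (card Z)) ^ 3 - 8 * path_sum Z
      - 8 * ((2 * int (card Z)) * (2 * int (card Z)) - 4 * pair_sum Z)"
      using card_proper_triples[OF Z_sums(4) Z_zero that] by (simp add: power3_eq_cube)
    then show ?thesis
      unfolding zsum by (simp add: algebra_simps power2_eq_square power3_eq_cube)
  qed
  have zt1: "64 * int (card (proper_triples Z 1 1)) = q ^ 3 * (q + 1) * (q - 2) * (q + 2)"
  proof -
    have "64 * int (card (proper_triples Z 1 1)) = (2 * int (card Z)) ^ 3
      - 4 * ((2 * int (card Z)) * (4 * pair_sum Z)) + 3 * (8 * path_sum Z)"
      using card_proper_triples_11[OF Z_sums(4)] by (simp add: power3_eq_cube)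
    then show ?thesis
      unfolding zsum by (simp add: algebra_simps power2_eq_square power3_eq_cube)
  qed
  obtain \<Delta> where \<Delta>: "\<Delta> \<in> \<G>\<phi>"
    using \<G>\<phi>_nonempty by (metis (no_types, lifting) card.empty ex_in_conv less_irrefl)
  define C2 where "C2 = int (card (proper_triples (trace \<Delta>) 1 0))"
  define C4 where "C4 = int (card (proper_triples (trace \<Delta>) 1 1))"
  define N2 where "N2 = int (card (proper_triples Z 1 0))"
  define N4 where "N4 = int (card (proper_triples Z 1 1))"
  have val: "512 * C2 = q\<^sup>2 * (q - 4) * (q + 2) * (q\<^sup>2 - q - 16)" "512 * C4 = q ^ 3 * (q - 4) * (q\<^sup>2 + 5 * q + 10)"
    "64 * N2 = q\<^sup>2 * (q + 1) * (q - 2) * (q - 4) * (q + 2)" "64 * N4 = q ^ 3 * (q + 1) * (q - 2) * (q + 2)"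
    using pt[OF \<Delta>, of 1 0] pt1[OF \<Delta>] zt[of 1 0] zt1 by (simp_all add: C2_def C4_def N2_def N4_def)
  have eq2: "int (card (proper_triples (trace \<Delta>') i j)) = C2" "int (card (proper_triples Z i j)) = N2"
    if "\<Delta>' \<in> \<G>\<phi>" "(i, j) \<noteq> (1, 1)" for \<Delta>' i j
    using pt[OF that] zt[OF that(2)] val by simp_all
  have eq4: "int (card (proper_triples (trace \<Delta>') 1 1)) = C4" if "\<Delta>' \<in> \<G>\<phi>" for \<Delta>'
    using pt1[OF that] val by simp
  have "64 * N2 > 0"
    unfolding val using q16 by simp
  then have N2: "N2 > 0"
    by simp
  then have "proper_triples Z 1 0 \<noteq> {}"
    by (auto simp: N2_def)
  then obtain a0 b0 c0 where T0: "(a0, b0, c0) \<in> proper_triples Z 1 0"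
    by auto
  define L where "L = lamt {a0, b0, c0}"
  have L: "int L * N2 = int (card \<G>\<phi>) * C2"
    using count[OF T0 eq2(1)] by (simp add: L_def N2_def)
  show ?thesis
  proof (intro exI[of _ L] conjI allI impI)
    fix a b c i j assume T: "(a, b, c) \<in> proper_triples Z i j" "(i, j) \<noteq> (1, 1)"
    have "int (lamt {a, b, c}) * N2 = int (card \<G>\<phi>) * C2"
      using count[OF T(1) eq2(1)[OF _ T(2)]] eq2(2)[OF \<Delta> T(2)] by simp
    then show "lamt {a, b, c} = L"
      using L N2 by (metis mult_right_cancel less_irrefl of_nat_eq_iff)
  next
    fix a b c assume T: "(a, b, c) \<in> proper_triples Z 1 1"
    show "lamt {a, b, c} \<noteq> L"
    proof
      assume "lamt {a, b, c} = L"
      then have "int L * N4 = int (card \<G>\<phi>) * C4"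
        using count[OF T eq4] by (simp add: N4_def)
      moreover have "int (card \<G>\<phi>) \<noteq> 0"
        using \<G>\<phi>_nonempty by linarith
      ultimately have "C2 * N4 = C4 * N2"
        using cross_multiply L by blast
      then have "(512 * C2) * (64 * N4) = (512 * C4) * (64 * N2)"
        by simp
      then have "(512 * C2) * (64 * N4) - (512 * C4) * (64 * N2) = 0"
        by simp
      \<comment> \<open>All factors are nonzero since \<open>q \<ge> 16\<close>, so the pattern
        \<open>(1, 1)\<close> is told apart from the others.\<close>
      moreover have "(512 * C2) * (64 * N4) - (512 * C4) * (64 * N2)
        = - (8 * q ^ 5 * (q - 4) * (q + 2) * (q + 1) * (q - 2) * (q - 1))"
        unfolding val by (simp add: algebra_simps eval_nat_numeral)
      ultimately show False
        using q16 by simp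
    qed
  qed
qed

end

subsection \<open>Permutations preserving the code\<close>

context pointed_code
begin

text \<open>If \<open>v\<close> were nonzero and orthogonal to all of \<open>Z\<close>, comparing
  \<open>card Z\<close> with the character sum over \<open>Z\<close> would give
  \<open>y * z + 1 = sg (\<phi> v)\<close>, which is impossible as the absolute value of
  \<open>y * z\<close> is at least 4.\<close>

lemma Z_separates:
  assumes "\<And>a. a \<in> Z \<Longrightarrow> B a v = 0"
  shows "v = 0"
proof (rule ccontr)
  assume "v \<noteq> 0"
  then have "2 * (\<Sum>a\<in>Z. sg (B v a)) = sg (\<phi> v) * (y * z)"
    using sum_zeros_B[OF \<phi> nondeg_UNIV, of v] unfolding yz(1) by simp
  moreover have "(\<Sum>a\<in>Z. sg (B v a)) = int (card Z)"
    using assms by (simp add: B_sym[of v])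
  ultimately have "y * z * (y * z + 1) = y * z * sg (\<phi> v)"
    using Z_sums(1) by (simp add: mult.commute)
  moreover have big: "(2::int) ^ n \<ge> 4"
    using pow_n_ge[OF n2] by simp
  then have "y * z \<noteq> 0"
    using sgn_size by linarith
  ultimately have "y * z + 1 = sg (\<phi> v)"
    by (metis mult_cancel_left)
  then show False
    using sgn_size big by (cases "\<phi> v") auto
qed

end

locale code_permutation = pointed_code B n d \<epsilon> \<epsilon>' \<phi>
  for B :: "bit^'m \<Rightarrow> bit^'m \<Rightarrow> bit" and n d \<epsilon> \<epsilon>' \<phi> +
  fixes f :: "(bit^'m \<Rightarrow> bit) \<Rightarrow> (bit^'m \<Rightarrow> bit)"
  assumes f_bij: "bij_betw f \<Q> \<Q>" and f_code: "(`) f ` \<G> = \<G>" and f_base: "f \<phi> = \<phi>"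
    and not_trivial: "(n, d, \<epsilon>) \<noteq> (2, 1, 1)"
begin

definition F :: "bit^'m \<Rightarrow> bit^'m" where
  "F a = (THE a'. f (twist \<phi> a) = twist \<phi> a')"

lemma F:
  assumes "a \<in> Z"
  shows "f (twist \<phi> a) = twist \<phi> (F a)" "F a \<in> Z"
proof -
  have "f (twist \<phi> a) \<in> \<Q>"
    using f_bij twist_in[OF assms] by (auto simp: bij_betw_def)
  then obtain a' where a': "f (twist \<phi> a) = twist \<phi> a'" "\<phi> a' = 0"
    using \<Q>_twist[OF \<phi>Q] by blast
  moreover from a'(1) have "F a = a'"
    unfolding F_def by (intro the_equality) auto
  ultimately show "f (twist \<phi> a) = twist \<phi> (F a)" "F a \<in> Z"
    by (simp_all add: Z_iff)
qed

lemma F_zero: "F 0 = 0"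
  using F(1)[OF Z_zero] f_base twist_inj[of \<phi> 0 "F 0"] by simp

lemma F_inj: "inj_on F Z"
proof (rule inj_onI)
  fix a b assume ab: "a \<in> Z" "b \<in> Z" "F a = F b"
  then have "f (twist \<phi> a) = f (twist \<phi> b)"
    using F(1) by simp
  then have "twist \<phi> a = twist \<phi> b"
    using inj_onD[OF bij_betw_imp_inj_on[OF f_bij]] twist_in ab by blast
  then show "a = b"
    by simp
qed

lemma F_eq_iff: "a \<in> Z \<Longrightarrow> b \<in> Z \<Longrightarrow> F a = F b \<longleftrightarrow> a = b"
  using F_inj by (auto simp: inj_on_def)

lemma F_image: "F ` Z = Z"
  using F(2) F_inj by (intro endo_inj_surj) auto

lemma lam_F:
  assumes "A \<subseteq> Z"
  shows "lamt (F ` A) = lamt A"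
proof -
  have "f ` insert \<phi> (twist \<phi> ` A) = insert \<phi> (twist \<phi> ` F ` A)"
    using F(1) assms f_base by (force simp: image_image)
  moreover have "lam (f ` insert \<phi> (twist \<phi> ` A)) = lamt A"
    using assms twist_in \<phi>Q by (intro lam_invariant f_bij f_code) auto
  ultimately show ?thesis
    by simp
qed

text \<open>The last hypothesis allows \<open>F\<close> to map in either direction, so that the
  lemma excludes both ways in which \<open>F\<close> could change a value of \<open>B\<close>. Only
  \<open>n = 2\<close>, the vanishing of \<open>y + z\<close>, and the generic case have to be
  distinguished.\<close>

lemma B_not_equal:
  assumes 1: "a1 \<in> Z" "b1 \<in> Z" "B a1 b1 = 1"
    and 0: "a0 \<in> Z" "b0 \<in> Z" "B a0 b0 = 0" "a0 \<noteq> 0" "b0 \<noteq> 0" "a0 \<noteq> b0"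
    and F10: "F a1 = a0 \<and> F b1 = b0 \<or> F a0 = a1 \<and> F b0 = b1"
  shows False
proof -
  have F3: "lamt {a1, b1} = lamt {a0, b0}"
    using F10 lam_F[of "{a1, b1}"] lam_F[of "{a0, b0}"] 1 0 by auto
  consider "3 \<le> n" "y + z \<noteq> 0" | "y + z = 0" "4 \<le> n" | "n = 2" "\<epsilon> = -1"
  proof -
    have "2 * d = n \<and> \<epsilon> = -1" if "y + z = 0"
    proof -
      have "\<epsilon>' * (2 ^ d + \<epsilon> * 2 ^ (n - d)) = 0"
        using that by (simp add: algebra_simps)
      then have *: "2 ^ d + \<epsilon> * 2 ^ (n - d) = 0"
        using eps' by auto
      have pos: "(2::int) ^ d > 0" "(2::int) ^ (n - d) > 0"
        by simp_all
      have "\<epsilon> \<noteq> 1"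
      proof
        assume "\<epsilon> = 1"
        then have "(2::int) ^ d + 2 ^ (n - d) = 0"
          using * by simp
        then show False
          using pos by linarith
      qed
      then have "\<epsilon> = -1"
        using eps by auto
      then have "(2::int) ^ d = 2 ^ (n - d)"
        using * by simp
      then have "d = n - d"
        by (simp only: power_inject_exp)
      then show ?thesis
        using \<open>\<epsilon> = -1\<close> d_less by linarith
    qed
    moreover have "\<epsilon> = -1" if "n = 2"
      using that not_trivial d1 dn eps by auto
    moreover have "n = 2 \<or> 3 \<le> n"
      using n2 by linarith
    moreover have "n = 2 \<or> 4 \<le> n" if "2 * d = n"
      using that n2 by presburger
    ultimately show ?thesis
      using that by blast
  qed
  then show False
  proof cases
    case 1
    then show False
      using pair_type_separation[OF _ _ assms(1-9)] F3 by blast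
  next
    case 2
    then have zy: "z = - y"
      by linarith
    obtain L where L: "\<And>a b c i j. (a, b, c) \<in> proper_triples Z i j \<Longrightarrow> (i, j) \<noteq> (1, 1) \<Longrightarrow> lamt {a, b, c} = L"
      "\<And>a b c. (a, b, c) \<in> proper_triples Z 1 1 \<Longrightarrow> lamt {a, b, c} \<noteq> L"
      using four_point_values[OF 2(2) zy] by metis
    \<comment> \<open>\<open>F\<close> preserves the size of \<open>G a b\<close>. For the
      nonorthogonal pair \<open>G\<close> misses every \<open>c\<close> with both values 1; for the
      orthogonal pair it contains every \<open>c\<close> not orthogonal to both entries. So the
      \<open>c\<close> of the first sort would be at most as many as those orthogonal to both
      entries of the second pair, contrary to \<open>card_common\<close>, as \<open>y * z\<close> is
      negative here.\<close>
    define G where "G a b = {c\<in>Z. c \<notin> {0, a, b} \<and> lamt {a, b, c} = L}" for a b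
    have GF: "card (G (F a) (F b)) = card (G a b)" if ab: "a \<in> Z" "b \<in> Z" for a b
    proof -
      have "G (F a) (F b) = F ` G a b"
      proof
        show "F ` G a b \<subseteq> G (F a) (F b)"
        proof
          fix c' assume "c' \<in> F ` G a b"
          then obtain c where c: "c \<in> Z" "c \<notin> {0, a, b}" "lamt {a, b, c} = L" "c' = F c"
            by (auto simp: G_def)
          then show "c' \<in> G (F a) (F b)"
            using lam_F[of "{a, b, c}"] ab F(2)[OF c(1)] F_eq_iff[OF c(1)] F_zero Z_zero
            by (auto simp: G_def)
        qed
        show "G (F a) (F b) \<subseteq> F ` G a b"
        proof
          fix c' assume c': "c' \<in> G (F a) (F b)"
          then obtain c where c: "c \<in> Z" "c' = F c"
            using F_image by (auto simp: G_def)
          then have "c \<in> G a b"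
            using c' lam_F[of "{a, b, c}"] ab F_zero by (auto simp: G_def)
          then show "c' \<in> F ` G a b"
            using c by blast
        qed
      qed
      moreover have "inj_on F (G a b)"
        using F_inj by (rule inj_on_subset) (auto simp: G_def)
      ultimately show ?thesis
        by (simp add: card_image)
    qed
    have "card (G a1 b1) = card (G a0 b0)"
      using F10 GF[of a1 b1] GF[of a0 b0] 1 0 by auto
    have \<phi>1: "\<phi> a1 = 0" "\<phi> b1 = 0" "a1 \<noteq> 0" "b1 \<noteq> 0" "a1 \<noteq> b1"
      using assms(1-3) by (auto simp: Z_iff)
    have \<phi>0: "\<phi> a0 = 0" "\<phi> b0 = 0"
      using assms(4,5) by (simp_all add: Z_iff)
    have "G a1 b1 \<subseteq> Z - ({0, a1, b1} \<union> {c\<in>Z. B a1 c = 1 \<and> B b1 c = 1})"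
      using L(2)[of a1 b1] assms(1-3) by (auto simp: G_def proper_triples_iff)
    then have "card (G a1 b1) \<le> card (Z - ({0, a1, b1} \<union> {c\<in>Z. B a1 c = 1 \<and> B b1 c = 1}))"
      by (intro card_mono) auto
    also have "\<dots> = card Z - card ({0, a1, b1} \<union> {c\<in>Z. B a1 c = 1 \<and> B b1 c = 1})"
      using assms(1,2) Z_zero by (intro card_Diff_subset) auto
    also have "\<dots> \<le> card Z - card {c\<in>Z. B a1 c = 1 \<and> B b1 c = 1}"
      by (intro diff_le_mono2 card_mono) auto
    finally have u1: "card (G a1 b1) + card {c\<in>Z. B a1 c = 1 \<and> B b1 c = 1} \<le> card Z"
      using card_mono[of Z "{c\<in>Z. B a1 c = 1 \<and> B b1 c = 1}"] by auto
    \<comment> \<open>Since \<open>c\<close> is not orthogonal to both vectors, the triple can be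
      reordered to begin with a nonorthogonal pair containing \<open>c\<close>; its other two values
      are not both 1 because \<open>B a0 b0 = 0\<close>.\<close>
    have "c \<in> G a0 b0" if c: "c \<in> Z" "\<not> (B a0 c = 0 \<and> B b0 c = 0)" for c
    proof -
      have cn: "c \<notin> {0, a0, b0}"
        using c(2) assms(6) B_sym[of a0 b0] by auto
      consider "B a0 c = 1" "B b0 c = 1" | "B a0 c = 1" "B b0 c = 0" | "B a0 c = 0" "B b0 c = 1"
        using c(2) by (cases "B a0 c"; cases "B b0 c") auto
      then have "lamt {a0, b0, c} = L"
      proof cases
        case 1
        then have "(c, a0, b0) \<in> proper_triples Z 1 0"
          using assms(4-9) c(1) cn by (auto simp: proper_triples_iff B_sym[of c])
        from L(1)[OF this] show ?thesis
          by (simp add: insert_commute)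
      next
        case 2
        then have "(a0, c, b0) \<in> proper_triples Z 0 0"
          using assms(4-9) c(1) cn by (auto simp: proper_triples_iff B_sym[of c])
        from L(1)[OF this] show ?thesis
          by (simp add: insert_commute)
      next
        case 3
        then have "(b0, c, a0) \<in> proper_triples Z 0 0"
          using assms(4-9) c(1) cn by (auto simp: proper_triples_iff B_sym[of c] B_sym[of b0 a0])
        from L(1)[OF this] show ?thesis
          by (simp add: insert_commute)
      qed
      then show ?thesis
        using c cn by (simp add: G_def)
    qed
    then have "Z \<subseteq> G a0 b0 \<union> {c\<in>Z. B a0 c = 0 \<and> B b0 c = 0}"
      by blast
    then have "card Z \<le> card (G a0 b0 \<union> {c\<in>Z. B a0 c = 0 \<and> B b0 c = 0})"
      by (intro card_mono) auto
    also have "\<dots> \<le> card (G a0 b0) + card {c\<in>Z. B a0 c = 0 \<and> B b0 c = 0}"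
      by (rule card_Un_le)
    finally have "card {c\<in>Z. B a1 c = 1 \<and> B b1 c = 1} \<le> card {c\<in>Z. B a0 c = 0 \<and> B b0 c = 0}"
      using u1 \<open>card (G a1 b1) = card (G a0 b0)\<close> by linarith
    moreover have "8 * int (card {c\<in>Z. B a1 c = 1 \<and> B b1 c = 1}) = 2 * int (card Z) - 3 * (y * z)"
      using card_common[OF \<phi>1(3,4,5,1,2), of 1] assms(3) by simp
    moreover have "8 * int (card {c\<in>Z. B a0 c = 0 \<and> B b0 c = 0}) = 2 * int (card Z) + 3 * (y * z)"
      using card_common[OF assms(7,8,9) \<phi>0, of 0] assms(6) by simp
    moreover have "y * z < 0"
    proof -
      have "y * y = 2 ^ d * 2 ^ d"
        by (simp add: mult_ac)
      then have "y * y > 0"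
        by (simp only:) simp
      then show ?thesis
        by (simp add: zy)
    qed
    ultimately show False
      by linarith
  next
    case 3
    \<comment> \<open>The vectors \<open>a0\<close> and \<open>b0\<close> would span a totally
      singular subspace with four elements, while minus type in dimension four allows at most
      two.\<close>
    have "vec.span {a0, b0} = {0, b0, a0, a0 + b0}"
      by (rule span_pair)
    then have "\<phi> x = 0" if "x \<in> vec.span {a0, b0}" for x
      using that 0 quad_add[OF \<phi>, of a0 b0] \<phi> by (auto simp: Z_iff)
    moreover have "qsum \<phi> UNIV < 0"
    proof -
      have "qsum \<phi> UNIV = \<epsilon> * 2 ^ n"
        using \<phi>Q unfolding quads_iff by blast
      also have "\<dots> = - (2 ^ n)"
        unfolding 3(2) by simp
      finally show ?thesis
        by simp
    qed
    ultimately have "2 * card (vec.span {a0, b0}) \<le> 2 ^ n"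
      by (intro card_tot_singular[OF \<phi> nondeg_UNIV dim_V]) auto
    moreover have "card (vec.span {a0, b0}) = 4"
      unfolding span_pair using assms(7-9) by auto
    ultimately show False
      using 3(1) by simp
  qed
qed

lemma F_isometry:
  assumes "a \<in> Z" "b \<in> Z"
  shows "B (F a) (F b) = B a b"
proof (cases "a = 0 \<or> b = 0 \<or> a = b")
  case True
  then show ?thesis
    using F_zero by auto
next
  case False
  then have "F a \<noteq> 0" "F b \<noteq> 0" "F a \<noteq> F b"
    using F_eq_iff[OF assms(1) Z_zero] F_eq_iff[OF assms(2) Z_zero] F_eq_iff[OF assms] F_zero by auto
  then show ?thesis
    using B_not_equal[of a b "F a" "F b"] B_not_equal[of "F a" "F b" a b] assms F(2) False
    by (cases "B a b"; cases "B (F a) (F b)") auto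
qed

lemma span_Z: "vec.span Z = UNIV"
proof -
  have "perp B Z = {0}"
    using Z_separates subspace_perp[of Z] by (auto simp: perp_def B_sym subspace_bit_iff)
  then have "perp B (vec.span Z) = {0}"
    by simp
  then have "perp B (perp B (vec.span Z)) = UNIV"
    by (auto simp: perp_def[of B "{0}"])
  then show ?thesis
    by (simp only: perp_perp[OF vec.subspace_span])
qed

text \<open>\<open>g\<close> extends \<open>F\<close> linearly from a basis inside \<open>Z\<close>.
  The identity \<open>B (F a) (g v) = B a v\<close> passes from basis vectors to all
  \<open>v\<close> and makes \<open>g\<close> an isometry; as \<open>g\<close> is onto,
  nondegeneracy then gives \<open>g a = F a\<close> on all of \<open>Z\<close>. Finally
  \<open>g\<close> preserves \<open>\<phi>\<close> because it preserves the zero set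
  \<open>Z\<close> of \<open>\<phi>\<close>.\<close>

lemma induced_by_isometry: "\<exists>g\<in>carrier (Sp B). \<forall>\<psi>\<in>\<Q>. f \<psi> = act g \<psi>"
proof -
  obtain b where b: "b \<subseteq> Z" "vec.independent b" "Z \<subseteq> vec.span b"
    using vec.basis_exists[of Z] by metis
  then have span: "vec.span b = UNIV"
    using span_Z vec.span_mono[OF b(3)] vec.span_span[of b] by auto
  obtain g where g: "Vector_Spaces.linear (*s) (*s) g" "\<And>x. x \<in> b \<Longrightarrow> g x = F x"
    using vec.linear_independent_extend[OF b(2)] by blast
  have gadd: "g (u + v) = g u + g v" for u v
    using g(1) by (rule vec.linear_add)
  have g0: "g 0 = 0"
    using gadd[of 0 0] by simp
  have ind: "P x" if "P 0" "\<And>u. u \<in> b \<Longrightarrow> P u" "\<And>u v. P u \<Longrightarrow> P v \<Longrightarrow> P (u + v)" for P and x :: "bit^'m"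
  proof -
    have "vec.span b \<subseteq> {x. P x}"
      using that by (intro vec.span_minimal) (auto simp: subspace_bit_iff)
    then show ?thesis
      using span by auto
  qed
  have 1: "B (F a) (g v) = B a v" if "a \<in> Z" for a v
    by (rule ind[of "\<lambda>v. B (F a) (g v) = B a v"])
      (use that b g(2) F_isometry in \<open>auto simp: g0 gadd\<close>)
  have 2: "B (g u) (g v) = B u v" for u v
    by (rule ind[of "\<lambda>u. B (g u) (g v) = B u v"])
      (use b g(2) 1 in \<open>auto simp: g0 gadd\<close>)
  have gS: "g \<in> carrier (Sp B)"
    using gadd 2 by (simp add: sp_iff)
  have gF: "g a = F a" if "a \<in> Z" for a
  proof (rule B_eqI)
    fix x
    have "x = g (inv_into UNIV g x)"
      using sp_inv(2)[OF gS] by simp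
    then show "B (g a) x = B (F a) x"
      using 1[OF that, of "inv_into UNIV g x"] 2[of a "inv_into UNIV g x"] by simp
  qed
  have "\<phi> (g x) = \<phi> x" for x
  proof -
    have "g x \<in> Z \<longleftrightarrow> x \<in> Z"
    proof
      assume "g x \<in> Z"
      then obtain x' where "x' \<in> Z" "g x = g x'"
        using F_image gF by (metis imageE)
      then show "x \<in> Z"
        using sp_inj[OF gS] by simp
    qed (use gF F(2) in simp)
    then show ?thesis
      by (cases "\<phi> x"; cases "\<phi> (g x)") (auto simp: Z_iff)
  qed
  then have inv: "\<phi> \<circ> g = \<phi>"
    by auto
  have "f \<psi> = act g \<psi>" if \<psi>: "\<psi> \<in> \<Q>" for \<psi>
  proof -
    obtain a where a: "\<psi> = twist \<phi> a" "a \<in> Z"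
      using \<Q>_twist[OF \<phi>Q \<psi>] by (metis Z_iff)
    have "f \<psi> \<circ> g = \<psi>"
      using F(1)[OF a(2)] gF[OF a(2)] twist_comp[OF gS, of \<phi> a] inv a(1) by simp
    then show ?thesis
      using act_eq_iff[OF gS \<psi>, of "f \<psi>"] by simp
  qed
  then show ?thesis
    using gS by blast
qed

end

context symplectic_code
begin

theorem code_permutation_from_isometry:
  assumes "(n, d, \<epsilon>) \<noteq> (2, 1, 1)" and f: "bij_betw f \<Q> \<Q>" "(`) f ` \<G> = \<G>"
  obtains g where "g \<in> carrier (Sp B)" "\<And>\<psi>. \<psi> \<in> \<Q> \<Longrightarrow> f \<psi> = act g \<psi>"
proof -
  obtain \<phi> where \<phi>: "\<phi> \<in> \<Q>"
    using \<Q>_nonempty .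
  then have "f \<phi> \<in> \<Q>"
    using f(1) by (auto simp: bij_betw_def)
  then obtain h where h: "h \<in> carrier (Sp B)" "act h (f \<phi>) = \<phi>"
    using \<Q>_transitive[OF _ \<phi>] by blast
  interpret P: code_permutation B n d \<epsilon> \<epsilon>' \<phi> "act h \<circ> f"
  proof
    show "bij_betw (act h \<circ> f) \<Q> \<Q>"
      using f(1) act_bij[OF h(1)] by (rule bij_betw_trans)
    have "(`) (act h \<circ> f) ` \<G> = (`) (act h) ` (`) f ` \<G>"
      by (simp add: image_image image_comp)
    then show "(`) (act h \<circ> f) ` \<G> = \<G>"
      using f(2) act_\<G>[OF h(1)] by simp
  qed (use \<phi> h assms in auto)
  obtain g where g: "g \<in> carrier (Sp B)" "\<And>\<psi>. \<psi> \<in> \<Q> \<Longrightarrow> act h (f \<psi>) = act g \<psi>"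
    using P.induced_by_isometry by auto
  have i: "inv_into UNIV h \<in> carrier (Sp B)"
    using sp_inv(1)[OF h(1)] .
  have "f \<psi> = act (inv_into UNIV h \<circ> g) \<psi>" if "\<psi> \<in> \<Q>" for \<psi>
  proof -
    have "f \<psi> \<in> \<Q>"
      using that f(1) by (auto simp: bij_betw_def)
    then show ?thesis
      using act_inv(2)[OF h(1), of "f \<psi>"] g(2)[OF that] act_act[OF i g(1) that] by simp
  qed
  then show ?thesis
    using that sp_comp[OF i g(1)] by blast
qed

text \<open>If \<open>g\<close> fixes \<open>\<phi>\<close> and its twist by a singular
  \<open>a\<close>, then \<open>B a (g x + x) = 0\<close>; such \<open>a\<close> separate
  vectors.\<close>

lemma act_faithful:
  assumes g: "g \<in> carrier (Sp B)" and "\<And>\<psi>. \<psi> \<in> \<Q> \<Longrightarrow> act g \<psi> = \<psi>"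
  shows "g = id"
proof -
  obtain \<phi> where \<phi>: "\<phi> \<in> \<Q>"
    using \<Q>_nonempty .
  interpret P: pointed_code B n d \<epsilon> \<epsilon>' \<phi>
    by unfold_locales (rule \<phi>)
  have fix_form: "\<psi> (g x) = \<psi> x" if "\<psi> \<in> \<Q>" for \<psi> x
    using act_eq_iff[OF g that, of \<psi>] assms(2)[OF that] by (auto simp: fun_eq_iff)
  have "g x = x" for x
  proof -
    have "B a (g x + x) = 0" if "\<phi> a = 0" for a
      using fix_form[OF \<phi>, of x] fix_form[OF P.twist_in, of a x] that by (simp add: P.Z_iff twist_def)
    then have "g x + x = 0"
      by (intro P.Z_separates) (simp add: P.Z_iff)
    then show ?thesis
      by simp
  qed
  then show ?thesis
    by auto
qed

end

subsection \<open>Automorphisms of Johnson graphs\<close>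

lemma johnson_vertices_iff: "finite P \<Longrightarrow> \<Delta> \<in> johnson_vertices P k \<longleftrightarrow> \<Delta> \<subseteq> P \<and> card \<Delta> = k"
  by (auto simp: johnson_vertices_def finite_subset)

lemma johnson_aut_iff:
  "f \<in> carrier (johnson_aut P k) \<longleftrightarrow> f \<in> Bij (johnson_vertices P k) \<and>
    (\<forall>\<Delta>\<in>johnson_vertices P k. \<forall>\<Delta>'\<in>johnson_vertices P k.
      johnson_adj k (f \<Delta>) (f \<Delta>') \<longleftrightarrow> johnson_adj k \<Delta> \<Delta>')"
  by (simp add: johnson_aut_def)

lemma Bij_D: "f \<in> Bij S \<Longrightarrow> bij_betw f S S" "f \<in> Bij S \<Longrightarrow> x \<in> S \<Longrightarrow> f x \<in> S"
  "f \<in> Bij S \<Longrightarrow> x \<in> S \<Longrightarrow> x' \<in> S \<Longrightarrow> f x = f x' \<longleftrightarrow> x = x'"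
  by (auto simp: Bij_def bij_betw_def inj_on_def)

lemma subgroup_johnson_aut: "subgroup (carrier (johnson_aut P k)) (BijGroup (johnson_vertices P k))"
proof -
  let ?V = "johnson_vertices P k"
  show ?thesis
  proof (rule group.subgroupI[OF group_BijGroup])
    show "carrier (johnson_aut P k) \<subseteq> carrier (BijGroup ?V)"
      by (auto simp: johnson_aut_iff BijGroup_def)
    have "(\<lambda>\<Delta>\<in>?V. \<Delta>) \<in> carrier (johnson_aut P k)"
      by (simp add: johnson_aut_iff id_Bij)
    then show "carrier (johnson_aut P k) \<noteq> {}"
      by blast
  next
    fix f assume f: "f \<in> carrier (johnson_aut P k)"
    then have fB: "f \<in> Bij ?V"
      by (simp add: johnson_aut_iff)
    have inv: "inv_into ?V f \<Delta> \<in> ?V" "f (inv_into ?V f \<Delta>) = \<Delta>" if "\<Delta> \<in> ?V" for \<Delta>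
      using that Bij_D(1)[OF fB] by (auto simp: bij_betw_def inv_into_into f_inv_into_f)
    have "johnson_adj k (inv_into ?V f \<Delta>) (inv_into ?V f \<Delta>') \<longleftrightarrow> johnson_adj k \<Delta> \<Delta>'"
      if "\<Delta> \<in> ?V" "\<Delta>' \<in> ?V" for \<Delta> \<Delta>'
      using f inv[OF that(1)] inv[OF that(2)] unfolding johnson_aut_iff by metis
    then show "inv\<^bsub>BijGroup ?V\<^esub> f \<in> carrier (johnson_aut P k)"
      by (simp add: inv_BijGroup[OF fB] johnson_aut_iff restrict_inv_into_Bij[OF fB])
  next
    fix f g assume fg: "f \<in> carrier (johnson_aut P k)" "g \<in> carrier (johnson_aut P k)"
    then have B: "f \<in> Bij ?V" "g \<in> Bij ?V"
      by (simp_all add: johnson_aut_iff)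
    then have "f \<otimes>\<^bsub>BijGroup ?V\<^esub> g = compose ?V f g"
      by (simp add: BijGroup_def)
    then show "f \<otimes>\<^bsub>BijGroup ?V\<^esub> g \<in> carrier (johnson_aut P k)"
      using fg compose_Bij[OF B] Bij_D(2)[OF B(2)] by (simp add: johnson_aut_iff compose_def)
  qed
qed

lemma group_johnson_aut: "group (johnson_aut P k)"
proof -
  have "johnson_aut P k = BijGroup (johnson_vertices P k)\<lparr>carrier := carrier (johnson_aut P k)\<rparr>"
    by (simp add: johnson_aut_def)
  then show ?thesis
    using subgroup.subgroup_is_group[OF subgroup_johnson_aut group_BijGroup] by metis
qed

lemma johnson_aut_mult:
  assumes "f \<in> carrier (johnson_aut P k)" "g \<in> carrier (johnson_aut P k)"
  shows "f \<otimes>\<^bsub>johnson_aut P k\<^esub> g = compose (johnson_vertices P k) f g"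
  using assms by (simp add: johnson_aut_def BijGroup_def)

lemma johnson_aut_one: "\<one>\<^bsub>johnson_aut P k\<^esub> = (\<lambda>\<Delta>\<in>johnson_vertices P k. \<Delta>)"
  by (simp add: johnson_aut_def BijGroup_def)

locale johnson =
  fixes P :: "'p set" and k :: nat
  assumes fin: "finite P" and k3: "3 \<le> k" and kP: "k + 3 \<le> card P"
begin

abbreviation "V \<equiv> johnson_vertices P k"
abbreviation "adj \<equiv> johnson_adj k"

lemma V_iff: "\<Delta> \<in> V \<longleftrightarrow> \<Delta> \<subseteq> P \<and> card \<Delta> = k"
  by (rule johnson_vertices_iff[OF fin])

lemma V_finite: "\<Delta> \<in> V \<Longrightarrow> finite \<Delta>"
  by (simp add: johnson_vertices_def)

lemma adj_iff: "adj \<Delta> \<Delta>' \<longleftrightarrow> card (\<Delta> \<inter> \<Delta>') = k - 1"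
  using k3 by (auto simp: johnson_adj_def)

lemma adj_sym: "adj \<Delta> \<Delta>' \<longleftrightarrow> adj \<Delta>' \<Delta>"
  by (simp add: adj_iff Int_commute)

definition swap :: "'p set \<Rightarrow> 'p \<Rightarrow> 'p \<Rightarrow> 'p set" where
  "swap \<Delta> x y = insert y (\<Delta> - {x})"

lemma swap_V: 
  assumes "\<Delta> \<in> V" "x \<in> \<Delta>" "y \<in> P - \<Delta>"
  shows "swap \<Delta> x y \<in> V" "adj \<Delta> (swap \<Delta> x y)"
proof -
  have "card (\<Delta> - {x}) = k - 1" "finite \<Delta>"
    using assms V_finite by (auto simp: V_iff)
  moreover have "\<Delta> \<inter> swap \<Delta> x y = \<Delta> - {x}"
    using assms by (auto simp: swap_def)
  ultimately show "swap \<Delta> x y \<in> V" "adj \<Delta> (swap \<Delta> x y)"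
    using assms k3 by (auto simp: V_iff swap_def adj_iff)
qed

lemma adjE:
  assumes "\<Delta> \<in> V" "\<Delta>' \<in> V" "adj \<Delta> \<Delta>'"
  obtains x y where "x \<in> \<Delta>" "y \<in> P - \<Delta>" "\<Delta>' = swap \<Delta> x y"
proof -
  have f: "finite \<Delta>" "finite \<Delta>'"
    using assms V_finite by auto
  have "card (\<Delta> - \<Delta>') = k - (k - 1)" "card (\<Delta>' - \<Delta>) = k - (k - 1)"
    using assms f card_Diff_subset_Int[of \<Delta> \<Delta>'] card_Diff_subset_Int[of \<Delta>' \<Delta>]
    by (auto simp: V_iff adj_iff Int_commute)
  then have "card (\<Delta> - \<Delta>') = 1" "card (\<Delta>' - \<Delta>) = 1"
    using k3 by simp_all
  then obtain x y where xy: "\<Delta> - \<Delta>' = {x}" "\<Delta>' - \<Delta> = {y}"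
    by (metis card_1_singletonE)
  then have "\<Delta>' = swap \<Delta> x y"
    unfolding swap_def by blast
  moreover have "x \<in> \<Delta>" "y \<in> P - \<Delta>"
    using xy assms(2) by (auto simp: V_iff)
  ultimately show ?thesis
    using that by blast
qed

lemma swap_eq_iff:
  assumes "x \<in> \<Delta>" "x' \<in> \<Delta>" "y \<notin> \<Delta>" "y' \<notin> \<Delta>"
  shows "swap \<Delta> x y = swap \<Delta> x' y' \<longleftrightarrow> x = x' \<and> y = y'"
  using assms by (auto simp: swap_def)

lemma swap_adj_iff:
  assumes "\<Delta> \<in> V" "x \<in> \<Delta>" "x' \<in> \<Delta>" "y \<in> P - \<Delta>" "y' \<in> P - \<Delta>"
  shows "adj (swap \<Delta> x y) (swap \<Delta> x' y') \<longleftrightarrow> (x = x') \<noteq> (y = y')"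
proof -
  have f: "finite \<Delta>" and c: "card \<Delta> = k"
    using assms V_finite by (auto simp: V_iff)
  have I: "swap \<Delta> x y \<inter> swap \<Delta> x' y' = (if y = y' then insert y (\<Delta> - {x, x'}) else \<Delta> - {x, x'})"
    using assms by (auto simp: swap_def)
  have "card (\<Delta> - {x, x'}) = k - card {x, x'}"
    using assms f c by (simp add: card_Diff_subset)
  then show ?thesis
    using assms f k3 unfolding adj_iff I by (auto simp: card_insert_if)
qed

text \<open>\<open>E\<close> arises from \<open>?A\<close> by exchanging some \<open>a\<close> for
  some \<open>e\<close>. Its intersection with \<open>?C\<close>, which shares only
  \<open>k - 2\<close> points with \<open>?A\<close>, reaches \<open>k - 1\<close> points only if
  \<open>a\<close> is outside \<open>?C\<close> and \<open>e\<close> inside. This leaves two choices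
  for each.\<close>

lemma common_neighbours:
  assumes \<Delta>: "\<Delta> \<in> V" and x: "x \<notin> \<Delta>" "x' \<notin> \<Delta>" "x \<noteq> x'" and y: "y \<in> \<Delta>" "y' \<in> \<Delta>" "y \<noteq> y'"
    and xP: "x \<in> P" "x' \<in> P"
    and E: "E \<in> V" "adj E (swap \<Delta> y x)" "adj E (swap \<Delta> y' x')"
  shows "E \<in> {\<Delta>, swap \<Delta> y' x, swap \<Delta> y x', swap (swap \<Delta> y x) y' x'}"
proof -
  let ?A = "swap \<Delta> y x" and ?C = "swap \<Delta> y' x'"
  have A: "?A \<in> V"
    using \<Delta> x y xP by (intro swap_V) auto
  obtain a e where ae: "a \<in> ?A" "e \<in> P - ?A" "E = swap ?A a e"
    using adjE[OF A E(1)] E(2) adj_sym by blast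
  have f: "finite \<Delta>" and c: "card \<Delta> = k"
    using \<Delta> V_finite by (auto simp: V_iff)
  have AC: "?A \<inter> ?C = \<Delta> - {y, y'}"
    using x y by (auto simp: swap_def)
  have cAC: "card (?A \<inter> ?C) = k - 2" "finite (?A \<inter> ?C)"
    unfolding AC using f c y by (simp_all add: card_Diff_subset)
  have EC: "E \<inter> ?C = (if e \<in> ?C then insert e (?A \<inter> ?C - {a}) else ?A \<inter> ?C - {a})"
    unfolding ae(3) swap_def[of "swap \<Delta> y x"] by auto
  have cEC: "card (E \<inter> ?C) = k - 1"
    using E(3) by (simp add: adj_iff)
  have le: "card (?A \<inter> ?C - {a}) \<le> k - 2"
    using cAC card_Diff1_le[of "?A \<inter> ?C" a] by simp
  have eC: "e \<in> ?C"
  proof (rule ccontr)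
    assume "e \<notin> ?C"
    then show False
      using cEC le k3 unfolding EC by simp
  qed
  have aC: "a \<notin> ?C"
  proof
    assume "a \<in> ?C"
    then have "card (?A \<inter> ?C - {a}) = k - 3"
      using ae(1) cAC by simp
    moreover have "card (E \<inter> ?C) \<le> Suc (card (?A \<inter> ?C - {a}))"
      using eC unfolding EC by (simp add: card_insert_le_m1)
    ultimately show False
      using cEC k3 by linarith
  qed
  have "a = x \<or> a = y'"
    using ae(1) aC x y by (auto simp: swap_def)
  moreover have "e = x' \<or> e = y"
    using ae(2) eC x y by (auto simp: swap_def)
  ultimately show ?thesis
    using ae(3) x y unfolding swap_def by (elim disjE) (simp_all, blast+)
qed

lemma aut_D:
  assumes "f \<in> carrier (johnson_aut P k)"
  shows "\<Delta> \<in> V \<Longrightarrow> f \<Delta> \<in> V" "\<Delta> \<in> V \<Longrightarrow> \<Delta>' \<in> V \<Longrightarrow> f \<Delta> = f \<Delta>' \<longleftrightarrow> \<Delta> = \<Delta>'"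
    "\<Delta> \<in> V \<Longrightarrow> \<Delta>' \<in> V \<Longrightarrow> adj (f \<Delta>) (f \<Delta>') \<longleftrightarrow> adj \<Delta> \<Delta>'" "f ` V = V"
proof -
  have B: "f \<in> Bij V"
    using assms by (simp add: johnson_aut_iff)
  show "\<Delta> \<in> V \<Longrightarrow> f \<Delta> \<in> V" "\<Delta> \<in> V \<Longrightarrow> \<Delta>' \<in> V \<Longrightarrow> f \<Delta> = f \<Delta>' \<longleftrightarrow> \<Delta> = \<Delta>'" "f ` V = V"
    using Bij_D[OF B] by (auto simp: bij_betw_def)
  show "\<Delta> \<in> V \<Longrightarrow> \<Delta>' \<in> V \<Longrightarrow> adj (f \<Delta>) (f \<Delta>') \<longleftrightarrow> adj \<Delta> \<Delta>'"
    using assms by (simp add: johnson_aut_iff)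
qed

text \<open>Induction on the distance from \<open>D\<close>. A vertex at distance at least two is a
  common neighbour of two nearer vertices, and their other common neighbours are nearer too; since
  \<open>f\<close> and \<open>g\<close> agree on all of these, they agree on the remaining
  one.\<close>

lemma aut_determined:
  assumes f: "f \<in> carrier (johnson_aut P k)" and g: "g \<in> carrier (johnson_aut P k)"
    and D: "D \<in> V" "f D = g D" and nb: "\<And>x y. x \<in> D \<Longrightarrow> y \<in> P - D \<Longrightarrow> f (swap D x y) = g (swap D x y)"
    and "\<Delta> \<in> V"
  shows "f \<Delta> = g \<Delta>"
  using \<open>\<Delta> \<in> V\<close>
proof (induction "card (D - \<Delta>)" arbitrary: \<Delta> rule: less_induct)
  case less
  have fin: "finite D" "finite \<Delta>" and cards: "card D = k" "card \<Delta> = k" and sub: "D \<subseteq> P" "\<Delta> \<subseteq> P"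
    using D(1) less.prems V_finite by (auto simp: V_iff)
  have same: "card (\<Delta> - D) = card (D - \<Delta>)"
    using fin cards card_Diff_subset_Int[of D \<Delta>] card_Diff_subset_Int[of \<Delta> D] by (simp add: Int_commute)
  consider "card (D - \<Delta>) = 0" | "card (D - \<Delta>) = 1" | "card (D - \<Delta>) \<ge> 2"
    by linarith
  then show ?case
  proof cases
    case 1
    then have "D - \<Delta> = {}" "\<Delta> - D = {}"
      using fin same by (metis card_0_eq finite_Diff)+
    then have "\<Delta> = D"
      by blast
    then show ?thesis
      using D by simp
  next
    case 2
    then obtain x y where "D - \<Delta> = {x}" "\<Delta> - D = {y}"
      using same by (metis card_1_singletonE)
    then have "\<Delta> = swap D x y" "x \<in> D" "y \<in> P - D"
      using sub by (auto simp: swap_def)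
    then show ?thesis
      using nb by simp
  next
    case 3
    obtain x x' where xs: "x \<in> D - \<Delta>" "x' \<in> D - \<Delta>" "x \<noteq> x'"
      using 3 by (metis card_le_Suc0_iff_eq fin(1) finite_Diff not_less_eq_eq numeral_2_eq_2)
    obtain y y' where ys: "y \<in> \<Delta> - D" "y' \<in> \<Delta> - D" "y \<noteq> y'"
      using 3 same by (metis card_le_Suc0_iff_eq fin(2) finite_Diff not_less_eq_eq numeral_2_eq_2)
    have step: "swap E b a \<in> V \<and> card (D - swap E b a) < card (D - E)"
      if "E \<in> V" "a \<in> D - E" "b \<in> E - D" for E a b
    proof -
      have "D - swap E b a = (D - E) - {a}"
        using that by (auto simp: swap_def)
      moreover have "card ((D - E) - {a}) < card (D - E)"
        using that(2) fin(1) by (intro card_Diff1_less) auto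
      ultimately show ?thesis
        using swap_V(1)[OF that(1), of b a] that sub by auto
    qed
    have agree: "swap \<Delta> b a \<in> V" "f (swap \<Delta> b a) = g (swap \<Delta> b a)" if "a \<in> D - \<Delta>" "b \<in> \<Delta> - D" for a b
      using step[OF less.prems that] less.hyps by auto
    have "swap (swap \<Delta> y x) y' x' \<in> V \<and> card (D - swap (swap \<Delta> y x) y' x') < card (D - swap \<Delta> y x)"
      using xs ys agree(1)[of x y] by (intro step) (auto simp: swap_def)
    then have agree2: "swap (swap \<Delta> y x) y' x' \<in> V"
        "f (swap (swap \<Delta> y x) y' x') = g (swap (swap \<Delta> y x) y' x')"
      using step[OF less.prems, of x y] xs ys less.hyps[of "swap (swap \<Delta> y x) y' x'"] by auto
    \<comment> \<open>Adjacency transported by \<open>f\<close> and back by \<open>g\<close> shows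
      that this \<open>E\<close> is adjacent to the same nearer vertices as \<open>\<Delta>\<close>.
      Any other common neighbour is excluded, as \<open>f\<close> and \<open>g\<close> agree on it
      and \<open>f\<close> is injective.\<close>
    obtain E where E: "E \<in> V" "g E = f \<Delta>"
      using aut_D(1)[OF f less.prems] aut_D(4)[OF g] by (metis imageE)
    have adj: "adj E (swap \<Delta> b a)" if "a \<in> D - \<Delta>" "b \<in> \<Delta> - D" for a b
    proof -
      have "adj (f \<Delta>) (f (swap \<Delta> b a))"
        using swap_V(2)[OF less.prems, of b a] that sub aut_D(3)[OF f less.prems agree(1)[OF that]] by auto
      then show ?thesis
        using E agree[OF that] aut_D(3)[OF g E(1) agree(1)[OF that]] by simp
    qed
    have "E \<in> {\<Delta>, swap \<Delta> y' x, swap \<Delta> y x', swap (swap \<Delta> y x) y' x'}"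
      using xs ys sub adj by (intro common_neighbours[OF less.prems] E) auto
    moreover have "E = E' \<Longrightarrow> E' \<in> V \<Longrightarrow> f E' = g E' \<Longrightarrow> E' = \<Delta>" for E'
      using E(2) aut_D(2)[OF f _ less.prems, of E'] by simp
    ultimately have "E = \<Delta>"
      using agree[of x y'] agree[of x' y] agree2 xs ys by blast
    then show ?thesis
      using E(2) by simp
  qed
qed

end

section \<open>Isomorphisms between rook graphs\<close>

locale rook =
  fixes F :: "'a \<times> 'b \<Rightarrow> 'c \<times> 'd" and X Y X' Y'
  assumes F_bij: "bij_betw F (X \<times> Y) (X' \<times> Y')"
    and F_adj: "\<And>p q. p \<in> X \<times> Y \<Longrightarrow> q \<in> X \<times> Y \<Longrightarrow>
      (fst (F p) = fst (F q)) \<noteq> (snd (F p) = snd (F q)) \<longleftrightarrow> (fst p = fst q) \<noteq> (snd p = snd q)"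
    and X2: "\<exists>x\<in>X. \<exists>x'\<in>X. x \<noteq> x'" and Y2: "\<exists>y\<in>Y. \<exists>y'\<in>Y. y \<noteq> y'"
begin

lemma F_inj: "p \<in> X \<times> Y \<Longrightarrow> q \<in> X \<times> Y \<Longrightarrow> F p = F q \<longleftrightarrow> p = q"
  using F_bij by (auto simp: bij_betw_def inj_on_def)

text \<open>The images of two points of the row agree in exactly one coordinate and so determine a
  line. An image off this line could agree with both of them only in the other coordinate, in which
  they differ.\<close>

lemma row_cases:
  assumes "x \<in> X"
  shows "(\<exists>c. \<forall>y\<in>Y. fst (F (x, y)) = c) \<or> (\<exists>c. \<forall>y\<in>Y. snd (F (x, y)) = c)"
proof -
  obtain y y' where y: "y \<in> Y" "y' \<in> Y" "y \<noteq> y'"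
    using Y2 by blast
  have adj: "(fst (F (x, u)) = fst (F (x, v))) \<noteq> (snd (F (x, u)) = snd (F (x, v)))"
    if "u \<in> Y" "v \<in> Y" "u \<noteq> v" for u v
    using F_adj[of "(x, u)" "(x, v)"] assms that by simp
  consider "fst (F (x, y)) = fst (F (x, y'))" "snd (F (x, y)) \<noteq> snd (F (x, y'))"
    | "snd (F (x, y)) = snd (F (x, y'))" "fst (F (x, y)) \<noteq> fst (F (x, y'))"
    using adj[OF y] by blast
  then show ?thesis
  proof cases
    case 1
    have "fst (F (x, v)) = fst (F (x, y))" if "v \<in> Y" for v
      using 1 adj[OF that y(1)] adj[OF that y(2)] by (cases "v = y"; cases "v = y'") auto
    then show ?thesis
      by blast
  next
    case 2
    have "snd (F (x, v)) = snd (F (x, y))" if "v \<in> Y" for v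
      using 2 adj[OF that y(1)] adj[OF that y(2)] by (cases "v = y"; cases "v = y'") auto
    then show ?thesis
      by blast
  qed
qed

text \<open>A point outside the row whose image lies on the line of the row would be adjacent to
  every point of the row, and so have the same second coordinate as all of them.\<close>

lemma row_full:
  assumes "x \<in> X" "\<And>y. y \<in> Y \<Longrightarrow> fst (F (x, y)) = c" "p \<in> X \<times> Y" "fst (F p) = c"
  shows "fst p = x"
proof (rule ccontr)
  assume ne: "fst p \<noteq> x"
  have "snd p = y" if "y \<in> Y" for y
  proof -
    have q: "(x, y) \<in> X \<times> Y"
      using assms(1) that by simp
    have "F p \<noteq> F (x, y)"
      using F_inj[OF assms(3) q] ne by auto
    then have "snd (F p) \<noteq> snd (F (x, y))"
      using assms(2)[OF that] assms(4) by (auto simp: prod_eq_iff)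
    then show ?thesis
      using F_adj[OF assms(3) q] assms(2)[OF that] assms(4) ne by simp
  qed
  then show False
    using Y2 by metis
qed

lemma row_full_snd:
  assumes "x \<in> X" "\<And>y. y \<in> Y \<Longrightarrow> snd (F (x, y)) = c" "p \<in> X \<times> Y" "snd (F p) = c"
  shows "fst p = x"
proof (rule ccontr)
  assume ne: "fst p \<noteq> x"
  have "snd p = y" if "y \<in> Y" for y
  proof -
    have q: "(x, y) \<in> X \<times> Y"
      using assms(1) that by simp
    have "F p \<noteq> F (x, y)"
      using F_inj[OF assms(3) q] ne by auto
    then have "fst (F p) \<noteq> fst (F (x, y))"
      using assms(2)[OF that] assms(4) by (auto simp: prod_eq_iff)
    then show ?thesis
      using F_adj[OF assms(3) q] assms(2)[OF that] assms(4) ne by simp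
  qed
  then show False
    using Y2 by metis
qed

text \<open>A row sent into a row and a row sent into a column have image lines that meet. The
  preimage of the meeting point would lie in both rows.\<close>

lemma rows_uniform:
  "(\<forall>x\<in>X. \<exists>c. \<forall>y\<in>Y. fst (F (x, y)) = c) \<or> (\<forall>x\<in>X. \<exists>c. \<forall>y\<in>Y. snd (F (x, y)) = c)"
proof (rule ccontr)
  assume "\<not> ?thesis"
  then obtain x1 x2 where x: "x1 \<in> X" "x2 \<in> X"
    "\<not> (\<exists>c. \<forall>y\<in>Y. fst (F (x1, y)) = c)" "\<not> (\<exists>c. \<forall>y\<in>Y. snd (F (x2, y)) = c)"
    by blast
  then obtain c1 c2 where c: "\<And>y. y \<in> Y \<Longrightarrow> snd (F (x1, y)) = c1" "\<And>y. y \<in> Y \<Longrightarrow> fst (F (x2, y)) = c2"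
    using row_cases by meson
  obtain y where y: "y \<in> Y"
    using Y2 by blast
  have "F (x1, y) \<in> X' \<times> Y'" "F (x2, y) \<in> X' \<times> Y'"
    using F_bij x y by (auto simp: bij_betw_def)
  then have "(c2, c1) \<in> X' \<times> Y'"
    using c[OF y] by (auto simp: mem_Times_iff)
  then obtain p where p: "p \<in> X \<times> Y" "F p = (c2, c1)"
    using F_bij by (metis bij_betw_def imageE)
  then have "fst p = x1" "fst p = x2"
    using row_full_snd[OF x(1) c(1) p(1)] row_full[OF x(2) c(2) p(1)] by simp_all
  then show False
    using x c by blast
qed

text \<open>Columns are treated by the same locale with the source coordinates exchanged; the image
  of a column cannot have constant first coordinate, because \<open>\<sigma>\<close> is
  injective.\<close>

lemma product_form:
  assumes rows: "\<forall>x\<in>X. \<exists>c. \<forall>y\<in>Y. fst (F (x, y)) = c"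
  shows "\<exists>\<sigma> \<tau>. bij_betw \<sigma> X X' \<and> bij_betw \<tau> Y Y' \<and> (\<forall>x\<in>X. \<forall>y\<in>Y. F (x, y) = (\<sigma> x, \<tau> y))"
proof -
  interpret T: rook "F \<circ> prod.swap" Y X X' Y'
  proof
    have "bij_betw prod.swap (Y \<times> X) (X \<times> Y)"
      by (rule bij_betw_byWitness[where f' = prod.swap]) auto
    then show "bij_betw (F \<circ> prod.swap) (Y \<times> X) (X' \<times> Y')"
      using F_bij by (rule bij_betw_trans)
    show "(fst ((F \<circ> prod.swap) p) = fst ((F \<circ> prod.swap) q)) \<noteq> (snd ((F \<circ> prod.swap) p) = snd ((F \<circ> prod.swap) q))
      \<longleftrightarrow> (fst p = fst q) \<noteq> (snd p = snd q)" if "p \<in> Y \<times> X" "q \<in> Y \<times> X" for p q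
      using F_adj[of "prod.swap p" "prod.swap q"] that by auto
  qed (use X2 Y2 in auto)
  obtain \<sigma> where \<sigma>: "\<And>x y. x \<in> X \<Longrightarrow> y \<in> Y \<Longrightarrow> fst (F (x, y)) = \<sigma> x"
    using rows by metis
  have \<sigma>_inj: "x = x'" if "x \<in> X" "x' \<in> X" "\<sigma> x = \<sigma> x'" for x x'
    using row_full[OF that(1) \<sigma>[OF that(1)], of "(x', _)"] \<sigma>[OF that(2)] that Y2 by fastforce
  have cols: "\<exists>c. \<forall>x\<in>X. snd (F (x, y)) = c" if y: "y \<in> Y" for y
  proof -
    have "\<not> (\<exists>c. \<forall>x\<in>X. fst (F (x, y)) = c)"
      using \<sigma>[OF _ y] \<sigma>_inj X2 by metis
    then show ?thesis
      using T.row_cases[OF y] by auto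
  qed
  then obtain \<tau> where \<tau>: "\<And>x y. x \<in> X \<Longrightarrow> y \<in> Y \<Longrightarrow> snd (F (x, y)) = \<tau> y"
    by metis
  have form: "F (x, y) = (\<sigma> x, \<tau> y)" if "x \<in> X" "y \<in> Y" for x y
    using \<sigma> \<tau> that by (simp add: prod_eq_iff)
  obtain x0 y0 where xy0: "x0 \<in> X" "y0 \<in> Y"
    using X2 Y2 by blast
  have \<tau>_inj: "y = y'" if "y \<in> Y" "y' \<in> Y" "\<tau> y = \<tau> y'" for y y'
    using F_inj[of "(x0, y)" "(x0, y')"] form xy0 that by simp
  have img: "F ` (X \<times> Y) = X' \<times> Y'"
    using F_bij by (simp add: bij_betw_def)
  have "F ` (X \<times> Y) = \<sigma> ` X \<times> \<tau> ` Y"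
    using form by force
  then have eq: "\<sigma> ` X \<times> \<tau> ` Y = X' \<times> Y'"
    using img by simp
  have "\<sigma> ` X \<noteq> {}" "\<tau> ` Y \<noteq> {}"
    using xy0 by auto
  then have "\<sigma> ` X = X'" "\<tau> ` Y = Y'"
    using eq by (metis times_eq_iff)+
  then have "bij_betw \<sigma> X X'" "bij_betw \<tau> Y Y'"
    using \<sigma>_inj \<tau>_inj by (auto simp: bij_betw_def inj_on_def)
  then show ?thesis
    using form by blast
qed

text \<open>If rows go to columns, exchanging the target coordinates leads back to
  \<open>product_form\<close>.\<close>

theorem rook_cases:
  "(\<exists>\<sigma> \<tau>. bij_betw \<sigma> X X' \<and> bij_betw \<tau> Y Y' \<and> (\<forall>x\<in>X. \<forall>y\<in>Y. F (x, y) = (\<sigma> x, \<tau> y))) \<or>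
   (\<exists>\<sigma> \<tau>. bij_betw \<sigma> Y X' \<and> bij_betw \<tau> X Y' \<and> (\<forall>x\<in>X. \<forall>y\<in>Y. F (x, y) = (\<sigma> y, \<tau> x)))"
proof (cases "\<forall>x\<in>X. \<exists>c. \<forall>y\<in>Y. fst (F (x, y)) = c")
  case True
  then show ?thesis
    using product_form by blast
next
  case False
  then have rows: "\<forall>x\<in>X. \<exists>c. \<forall>y\<in>Y. snd (F (x, y)) = c"
    using rows_uniform by blast
  interpret T: rook "prod.swap \<circ> F" X Y Y' X'
  proof
    have "bij_betw prod.swap (X' \<times> Y') (Y' \<times> X')"
      by (rule bij_betw_byWitness[where f' = prod.swap]) auto
    with F_bij show "bij_betw (prod.swap \<circ> F) (X \<times> Y) (Y' \<times> X')"
      by (rule bij_betw_trans)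
    show "(fst ((prod.swap \<circ> F) p) = fst ((prod.swap \<circ> F) q)) \<noteq> (snd ((prod.swap \<circ> F) p) = snd ((prod.swap \<circ> F) q))
      \<longleftrightarrow> (fst p = fst q) \<noteq> (snd p = snd q)" if "p \<in> X \<times> Y" "q \<in> X \<times> Y" for p q
      using F_adj[OF that] by auto
  qed (use X2 Y2 in auto)
  obtain \<tau> \<sigma> where "bij_betw \<tau> X Y'" "bij_betw \<sigma> Y X'" "\<forall>x\<in>X. \<forall>y\<in>Y. (prod.swap \<circ> F) (x, y) = (\<tau> x, \<sigma> y)"
    using T.product_form rows by auto
  moreover from this have "\<forall>x\<in>X. \<forall>y\<in>Y. F (x, y) = (\<sigma> y, \<tau> x)"
    by (auto simp: prod_eq_iff)
  ultimately show ?thesis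
    by blast
qed

end

section \<open>From neighbourhoods to permutations of the points\<close>

context johnson
begin

lemma perm_V: "bij_betw \<pi> P P \<Longrightarrow> \<Delta> \<in> V \<Longrightarrow> \<pi> ` \<Delta> \<in> V"
  by (auto simp: V_iff bij_betw_def card_image[OF inj_on_subset])

lemma perm_aut:
  assumes \<pi>: "bij_betw \<pi> P P"
  shows "(\<lambda>\<Delta>\<in>V. \<pi> ` \<Delta>) \<in> carrier (johnson_aut P k)"
proof -
  have inj: "inj_on \<pi> P"
    using \<pi> by (rule bij_betw_imp_inj_on)
  have "adj (\<pi> ` \<Delta>) (\<pi> ` \<Delta>') \<longleftrightarrow> adj \<Delta> \<Delta>'" if "\<Delta> \<in> V" "\<Delta>' \<in> V" for \<Delta> \<Delta>'
  proof -
    have sub: "\<Delta> \<subseteq> P" "\<Delta>' \<subseteq> P"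
      using that by (simp_all add: V_iff)
    have "\<pi> ` \<Delta> \<inter> \<pi> ` \<Delta>' = \<pi> ` (\<Delta> \<inter> \<Delta>')"
      using inj_on_image_Int[OF inj sub] by simp
    moreover have "card (\<pi> ` (\<Delta> \<inter> \<Delta>')) = card (\<Delta> \<inter> \<Delta>')"
      using sub by (intro card_image inj_on_subset[OF inj]) auto
    ultimately show ?thesis
      by (simp add: adj_iff)
  qed
  moreover have "bij_betw (\<lambda>\<Delta>\<in>V. \<pi> ` \<Delta>) V V"
  proof (rule bij_betw_byWitness[where f' = "\<lambda>\<Delta>. inv_into P \<pi> ` \<Delta>"])
    have i: "bij_betw (inv_into P \<pi>) P P"
      using \<pi> by (rule bij_betw_inv_into)
    show "\<forall>\<Delta>\<in>V. inv_into P \<pi> ` ((\<lambda>\<Delta>\<in>V. \<pi> ` \<Delta>) \<Delta>) = \<Delta>"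
      using inj by (auto simp: V_iff image_image subset_iff)
    show "\<forall>\<Delta>\<in>V. (\<lambda>\<Delta>\<in>V. \<pi> ` \<Delta>) (inv_into P \<pi> ` \<Delta>) = \<Delta>"
    proof
      fix \<Delta> assume \<Delta>: "\<Delta> \<in> V"
      then have "\<pi> ` inv_into P \<pi> ` \<Delta> = \<Delta>"
        using \<pi> by (intro image_inv_into_cancel) (auto simp: bij_betw_def V_iff)
      then show "(\<lambda>\<Delta>\<in>V. \<pi> ` \<Delta>) (inv_into P \<pi> ` \<Delta>) = \<Delta>"
        using perm_V[OF i \<Delta>] by simp
    qed
  qed (use perm_V[OF \<pi>] perm_V[OF bij_betw_inv_into[OF \<pi>]] in auto)
  ultimately show ?thesis
    by (simp add: johnson_aut_iff Bij_def)
qed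

lemma compl_V:
  assumes "card P = 2 * k" "\<Delta> \<in> V"
  shows "P - \<Delta> \<in> V"
  using assms fin by (auto simp: V_iff card_Diff_subset finite_subset)

lemma compl_aut:
  assumes "card P = 2 * k"
  shows "compl_map P k \<in> carrier (johnson_aut P k)"
proof -
  have "adj (P - \<Delta>) (P - \<Delta>') \<longleftrightarrow> adj \<Delta> \<Delta>'" if "\<Delta> \<in> V" "\<Delta>' \<in> V" for \<Delta> \<Delta>'
  proof -
    have sub: "\<Delta> \<subseteq> P" "\<Delta>' \<subseteq> P" and cards: "card \<Delta> = k" "card \<Delta>' = k" and fins: "finite \<Delta>" "finite \<Delta>'"
      using that V_finite by (auto simp: V_iff)
    have "(P - \<Delta>) \<inter> (P - \<Delta>') = P - (\<Delta> \<union> \<Delta>')"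
      by blast
    moreover have "card (P - (\<Delta> \<union> \<Delta>')) = 2 * k - card (\<Delta> \<union> \<Delta>')"
      using sub fins assms by (simp add: card_Diff_subset)
    moreover have "card (\<Delta> \<union> \<Delta>') + card (\<Delta> \<inter> \<Delta>') = 2 * k"
      using card_Un_Int[OF fins] cards by simp
    ultimately have "card ((P - \<Delta>) \<inter> (P - \<Delta>')) = card (\<Delta> \<inter> \<Delta>')"
      by simp
    then show ?thesis
      by (simp add: adj_iff)
  qed
  moreover have "bij_betw (compl_map P k) V V"
    using compl_V[OF assms]
    by (intro bij_betw_byWitness[where f' = "\<lambda>\<Delta>. P - \<Delta>"]) (auto simp: compl_map_def V_iff)
  ultimately show ?thesis
    using compl_V[OF assms] by (simp add: johnson_aut_iff Bij_def compl_map_def)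
qed

lemma bij_betw_if:
  assumes "bij_betw \<sigma> A A'" "bij_betw \<tau> (P - A) (P - A')" "A \<subseteq> P" "A' \<subseteq> P"
  shows "bij_betw (\<lambda>x. if x \<in> A then \<sigma> x else \<tau> x) P P"
proof -
  have "bij_betw (\<lambda>x. if x \<in> A then \<sigma> x else \<tau> x) (A \<union> (P - A)) (A' \<union> (P - A'))"
  proof (rule bij_betw_combine)
    show "bij_betw (\<lambda>x. if x \<in> A then \<sigma> x else \<tau> x) A A'"
      using assms(1) by (subst bij_betw_cong[where g = \<sigma>]) auto
    show "bij_betw (\<lambda>x. if x \<in> A then \<sigma> x else \<tau> x) (P - A) (P - A')"
      using assms(2) by (subst bij_betw_cong[where g = \<tau>]) auto
  qed auto
  moreover have "A \<union> (P - A) = P" "A' \<union> (P - A') = P"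
    using assms(3,4) by auto
  ultimately show ?thesis
    by simp
qed

theorem johnson_aut_cases:
  assumes f: "f \<in> carrier (johnson_aut P k)"
  shows "(\<exists>\<pi>. bij_betw \<pi> P P \<and> (\<forall>\<Delta>\<in>V. f \<Delta> = \<pi> ` \<Delta>)) \<or>
    card P = 2 * k \<and> (\<exists>\<pi>. bij_betw \<pi> P P \<and> (\<forall>\<Delta>\<in>V. f \<Delta> = \<pi> ` (P - \<Delta>)))"
proof -
  obtain D where "D \<subseteq> P" "card D = k"
    using kP by (metis add_leD1 obtain_subset_with_card_n)
  then have D: "D \<in> V"
    by (simp add: V_iff)
  define E where "E = f D"
  have E: "E \<in> V"
    using aut_D(1)[OF f D] by (simp add: E_def)
  have sub: "D \<subseteq> P" "E \<subseteq> P" and cards: "card D = k" "card E = k"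
    using D E by (simp_all add: V_iff)
  \<comment> \<open>A neighbour of \<open>D\<close> is coded by the point removed and the point
    inserted; \<open>F\<close> is the action of \<open>f\<close> on these codes.\<close>
  define F where "F = (\<lambda>p. SOME q. q \<in> E \<times> (P - E) \<and> f (swap D (fst p) (snd p)) = swap E (fst q) (snd q))"
  have F: "F p \<in> E \<times> (P - E) \<and> f (swap D (fst p) (snd p)) = swap E (fst (F p)) (snd (F p))"
    if p: "p \<in> D \<times> (P - D)" for p
  proof -
    have nb: "swap D (fst p) (snd p) \<in> V" "adj D (swap D (fst p) (snd p))"
      using p swap_V[OF D] by auto
    then have "adj E (f (swap D (fst p) (snd p)))" "f (swap D (fst p) (snd p)) \<in> V"
      using aut_D(3)[OF f D nb(1)] aut_D(1)[OF f nb(1)] by (simp_all add: E_def)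
    then obtain x y where "x \<in> E" "y \<in> P - E" "f (swap D (fst p) (snd p)) = swap E x y"
      using adjE[OF E] by metis
    then have "\<exists>q. q \<in> E \<times> (P - E) \<and> f (swap D (fst p) (snd p)) = swap E (fst q) (snd q)"
      by (intro exI[of _ "(x, y)"]) simp
    then show ?thesis
      unfolding F_def by (rule someI_ex)
  qed
  have inj: "inj_on F (D \<times> (P - D))"
  proof (rule inj_onI)
    fix p q assume pq: "p \<in> D \<times> (P - D)" "q \<in> D \<times> (P - D)" "F p = F q"
    then have "f (swap D (fst p) (snd p)) = f (swap D (fst q) (snd q))"
      using F[OF pq(1)] F[OF pq(2)] by simp
    then have "swap D (fst p) (snd p) = swap D (fst q) (snd q)"
      using aut_D(2)[OF f] swap_V(1)[OF D] pq by auto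
    then show "p = q"
      using pq swap_eq_iff[of "fst p" D "fst q" "snd p" "snd q"] by (auto simp: prod_eq_iff)
  qed
  have "F ` (D \<times> (P - D)) = E \<times> (P - E)"
  proof (rule card_subset_eq)
    show "finite (E \<times> (P - E))"
      using fin sub by (auto intro: finite_subset)
    show "F ` (D \<times> (P - D)) \<subseteq> E \<times> (P - E)"
      using F by blast
    show "card (F ` (D \<times> (P - D))) = card (E \<times> (P - E))"
      using card_image[OF inj] fin sub cards
      by (simp add: card_cartesian_product card_Diff_subset finite_subset)
  qed
  with inj have bij: "bij_betw F (D \<times> (P - D)) (E \<times> (P - E))"
    by (simp add: bij_betw_def)
  have two: "\<exists>x\<in>A. \<exists>x'\<in>A. x \<noteq> x'" if "card A \<ge> 3" for A :: "'p set"
  proof -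
    have "finite A" "\<not> card A \<le> Suc 0"
      using that by (auto intro: card_ge_0_finite)
    then show ?thesis
      using card_le_Suc0_iff_eq[of A] by blast
  qed
  have "card (P - D) \<ge> 3"
    using kP cards sub fin by (simp add: card_Diff_subset finite_subset)
  interpret R: rook F D "P - D" E "P - E"
  proof
    show "(fst (F p) = fst (F q)) \<noteq> (snd (F p) = snd (F q)) \<longleftrightarrow> (fst p = fst q) \<noteq> (snd p = snd q)"
      if pq: "p \<in> D \<times> (P - D)" "q \<in> D \<times> (P - D)" for p q
    proof -
      have "adj (f (swap D (fst p) (snd p))) (f (swap D (fst q) (snd q)))
        \<longleftrightarrow> adj (swap D (fst p) (snd p)) (swap D (fst q) (snd q))"
        using pq swap_V(1)[OF D] by (intro aut_D(3)[OF f]) auto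
      then show ?thesis
        using F[OF pq(1)] F[OF pq(2)] pq swap_adj_iff[OF E, of "fst (F p)" "fst (F q)" "snd (F p)" "snd (F q)"]
          swap_adj_iff[OF D, of "fst p" "fst q" "snd p" "snd q"] by (auto simp: mem_Times_iff)
    qed
  qed (use bij two[of D] two[of "P - D"] k3 cards \<open>card (P - D) \<ge> 3\<close> in auto)
  have f_swap: "f (swap D x y) = swap E (fst (F (x, y))) (snd (F (x, y)))" if "x \<in> D" "y \<in> P - D" for x y
    using F[of "(x, y)"] that by simp
  from R.rook_cases show ?thesis
  proof (elim disjE exE conjE)
    fix \<sigma> \<tau> assume st: "bij_betw \<sigma> D E" "bij_betw \<tau> (P - D) (P - E)"
      and form: "\<forall>x\<in>D. \<forall>y\<in>P - D. F (x, y) = (\<sigma> x, \<tau> y)"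
    define \<pi> where "\<pi> = (\<lambda>x. if x \<in> D then \<sigma> x else \<tau> x)"
    have \<pi>: "bij_betw \<pi> P P"
      unfolding \<pi>_def using st sub by (intro bij_betw_if)
    have inj\<pi>: "inj_on \<pi> P"
      using \<pi> by (rule bij_betw_imp_inj_on)
    have \<pi>D: "\<pi> ` D = E"
      using st(1) by (auto simp: \<pi>_def bij_betw_def)
    have "f \<Delta> = (\<lambda>\<Delta>\<in>V. \<pi> ` \<Delta>) \<Delta>" if "\<Delta> \<in> V" for \<Delta>
    proof (rule aut_determined[OF f perm_aut[OF \<pi>] D _ _ that])
      show "f D = (\<lambda>\<Delta>\<in>V. \<pi> ` \<Delta>) D"
        using D \<pi>D by (simp add: E_def)
      fix x y assume xy: "x \<in> D" "y \<in> P - D"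
      have "\<pi> ` (D - {x}) = E - {\<pi> x}"
        using inj_on_image_set_diff[OF inj\<pi>, of D "{x}"] xy sub \<pi>D by auto
      moreover have "\<pi> x = \<sigma> x" "\<pi> y = \<tau> y"
        using xy by (simp_all add: \<pi>_def)
      ultimately have "\<pi> ` swap D x y = swap E (\<sigma> x) (\<tau> y)"
        by (simp add: swap_def)
      then show "f (swap D x y) = (\<lambda>\<Delta>\<in>V. \<pi> ` \<Delta>) (swap D x y)"
        using f_swap[OF xy] form xy swap_V(1)[OF D xy] by simp
    qed
    then have "\<forall>\<Delta>\<in>V. f \<Delta> = \<pi> ` \<Delta>"
      by simp
    then show ?thesis
      using \<pi> by blast
  next
    fix \<sigma> \<tau> assume st: "bij_betw \<sigma> (P - D) E" "bij_betw \<tau> D (P - E)"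
      and form: "\<forall>x\<in>D. \<forall>y\<in>P - D. F (x, y) = (\<sigma> y, \<tau> x)"
    \<comment> \<open>When the coordinates are exchanged, the points outside \<open>D\<close>
      correspond to the points of \<open>E\<close>, so a vertex and its complement have the same
      size.\<close>
    have half: "card P = 2 * k"
      using bij_betw_same_card[OF st(1)] cards sub fin kP
      by (simp add: card_Diff_subset finite_subset)
    define \<pi> where "\<pi> = (\<lambda>x. if x \<in> D then \<tau> x else \<sigma> x)"
    have "P - (P - E) = E"
      using sub by blast
    then have \<pi>: "bij_betw \<pi> P P"
      unfolding \<pi>_def using st sub by (intro bij_betw_if[where A' = "P - E"]) auto
    have inj\<pi>: "inj_on \<pi> P"
      using \<pi> by (rule bij_betw_imp_inj_on)
    have \<pi>D: "\<pi> ` (P - D) = E"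
      using st(1) by (auto simp: \<pi>_def bij_betw_def)
    \<comment> \<open>The permutation \<open>\<pi>\<close> carries \<open>P - D\<close> onto
      \<open>E\<close>, so it has to be preceded by complementation to agree with \<open>f\<close>
      at \<open>D\<close> and at its neighbours.\<close>
    define h where "h = (\<lambda>\<Delta>\<in>V. \<pi> ` \<Delta>) \<otimes>\<^bsub>johnson_aut P k\<^esub> compl_map P k"
    have h: "h \<in> carrier (johnson_aut P k)"
      unfolding h_def using perm_aut[OF \<pi>] compl_aut[OF half] group_johnson_aut
      by (metis group.is_monoid monoid.m_closed)
    have h_eq: "h \<Delta> = \<pi> ` (P - \<Delta>)" if "\<Delta> \<in> V" for \<Delta>
      unfolding h_def johnson_aut_mult[OF perm_aut[OF \<pi>] compl_aut[OF half]]
      using that compl_V[OF half that] by (simp add: compose_def compl_map_def)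
    have "f \<Delta> = h \<Delta>" if "\<Delta> \<in> V" for \<Delta>
    proof (rule aut_determined[OF f h D _ _ that])
      show "f D = h D"
        using D \<pi>D by (simp add: E_def h_eq)
      fix x y assume xy: "x \<in> D" "y \<in> P - D"
      have "P - swap D x y = insert x ((P - D) - {y})"
        using xy sub by (auto simp: swap_def)
      moreover have "\<pi> ` ((P - D) - {y}) = E - {\<pi> y}"
        using inj_on_image_set_diff[OF inj\<pi>, of "P - D" "{y}"] xy sub \<pi>D by auto
      moreover have "\<pi> x = \<tau> x" "\<pi> y = \<sigma> y"
        using xy by (simp_all add: \<pi>_def)
      ultimately have "\<pi> ` (P - swap D x y) = swap E (\<sigma> y) (\<tau> x)"
        by (simp add: swap_def[of E])
      then show "f (swap D x y) = h (swap D x y)"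
        using f_swap[OF xy] form xy swap_V(1)[OF D xy] h_eq by simp
    qed
    then have "\<forall>\<Delta>\<in>V. f \<Delta> = \<pi> ` (P - \<Delta>)"
      using h_eq by simp
    then show ?thesis
      using \<pi> half by blast
  qed
qed

end

subsection \<open>The wreath product\<close>

lemma isometry_group_iff:
  "g \<in> carrier (isometry_group sc W b) \<longleftrightarrow> g \<in> extensional W \<and> bij_betw g W W \<and>
     (\<forall>x\<in>W. \<forall>y\<in>W. g (x + y) = g x + g y) \<and> (\<forall>c. \<forall>x\<in>W. g (sc c x) = sc c (g x)) \<and>
     (\<forall>x\<in>W. \<forall>y\<in>W. b (g x) (g y) = b x y)"
  by (simp add: isometry_group_def Bij_def)

lemma Sp_std_iff:
  "g \<in> carrier (Sp_std (2 * m)) \<longleftrightarrow> g \<in> extensional (std_space (2 * m)) \<and>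
     bij_betw g (std_space (2 * m)) (std_space (2 * m)) \<and>
     (\<forall>x\<in>std_space (2 * m). \<forall>y\<in>std_space (2 * m). g (x + y) = g x + g y) \<and>
     (\<forall>x\<in>std_space (2 * m). \<forall>y\<in>std_space (2 * m). std_form m (g x) (g y) = std_form m x y)"
proof -
  let ?S = "std_space (2 * m)"
  have "g (\<lambda>i. c * x i) = (\<lambda>i. c * g x i)"
    if "\<forall>x\<in>?S. \<forall>y\<in>?S. g (x + y) = g x + g y" "x \<in> ?S" for c :: bit and x
  proof (cases c)
    assume "c = 0"
    have zero: "(0 :: nat \<Rightarrow> bit) \<in> ?S"
      by (simp add: std_space_def)
    then have "g (0 + 0) = g 0 + g 0"
      using that(1) by blast
    then have "g 0 = 0"
      by simp
    then show ?thesis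
      using \<open>c = 0\<close> by (simp add: zero_fun_def)
  qed simp
  then show ?thesis
    unfolding Sp_std_eq isometry_group_iff by blast
qed

lemma Sp_std_mult:
  assumes "g \<in> carrier (Sp_std (2 * m))" "h \<in> carrier (Sp_std (2 * m))"
  shows "g \<otimes>\<^bsub>Sp_std (2 * m)\<^esub> h = compose (std_space (2 * m)) g h"
  using assms unfolding Sp_std_eq by (simp add: isometry_group_def BijGroup_def)

abbreviation "swap12 \<equiv> Transposition.transpose (1::nat) 2"

lemma carrier_sym_group_2: "carrier (sym_group 2) = {id, swap12}"
proof -
  have "{1..2::nat} = {1, 2}"
    by auto
  then show ?thesis
    using permutes_doubleton_iff[of _ "1::nat" 2] by (auto simp: sym_group_def)
qed

lemma swap12_eq_id [simp]: "swap12 \<noteq> id" "id \<noteq> swap12"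
  by (metis id_apply n_not_Suc_n numeral_2_eq_2 One_nat_def transpose_apply_first)+

context symplectic_code
begin

context
  fixes U :: "(bit^'m) set"
  assumes U: "U \<in> \<U>" and half: "2 * d = n"
begin

lemma half_D: "nondeg U" "nondeg (perp B U)" "perp B (perp B U) = U"
    "vec.dim U = 2 * d" "vec.dim (perp B U) = 2 * d" "perp B U \<noteq> U"
proof -
  show "nondeg U" "nondeg (perp B U)" "perp B (perp B U) = U" "vec.dim U = 2 * d"
    using \<U>_D[OF U] by auto
  show "vec.dim (perp B U) = 2 * d"
    using \<U>_D(2)[OF perp_\<U>[OF half U]] .
  show "perp B U \<noteq> U"
  proof
    assume "perp B U = U"
    then have "U = {0}"
      using nondegD(2,5)[OF \<U>_D(1)[OF U]] by blast
    then show False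
      using \<U>_D(2)[OF U] d1 by simp
  qed
qed

lemma stab_pair_D:
  assumes "g \<in> stab_pair B U"
  shows "g \<in> carrier (Sp B)" "g ` U = U \<and> g ` perp B U = perp B U \<or> g ` U = perp B U \<and> g ` perp B U = U"
  using assms by (auto simp: stab_pair_def doubleton_eq_iff)

text \<open>An isometry from \<open>U\<close> to its complement, glued with its own inverse in the
  other direction, squares to the identity.\<close>

lemma interchanging_involution:
  obtains x where "x \<in> stab_pair B U" "x \<noteq> id" "x \<circ> x = id" "x ` U = perp B U" "x ` perp B U = U"
proof -
  let ?P = "perp B U"
  obtain h where h: "isometric_on h U ?P"
    using isometry_exists[OF half_D(1,4,2,5)] by blast
  let ?h = "inv_into U h"
  have hi: "?h w \<in> U" "h (?h w) = w" if "w \<in> ?P" for w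
    using h that by (auto simp: isometric_on_def bij_betw_def inv_into_into f_inv_into_f)
  have ih: "?h (h u) = u" "h u \<in> ?P" if "u \<in> U" for u
    using h that by (auto simp: isometric_on_def bij_betw_def)
  have "isometric_on ?h ?P U"
    unfolding isometric_on_def
  proof (intro conjI ballI)
    show "bij_betw ?h ?P U"
      using h by (simp add: isometric_on_def bij_betw_inv_into)
    fix v w assume vw: "v \<in> ?P" "w \<in> ?P"
    have "h (?h v + ?h w) = v + w"
      using h hi vw by (simp add: isometric_on_def)
    then show "?h (v + w) = ?h v + ?h w"
      using ih(1)[of "?h v + ?h w"] nondegD(3)[OF half_D(1) hi(1) hi(1)] vw by simp
    show "B (?h v) (?h w) = B v w"
      using h hi vw unfolding isometric_on_def by metis
  qed
  then have "\<exists>x\<in>carrier (Sp B). (\<forall>u\<in>U. x u = h u) \<and> (\<forall>w\<in>?P. x w = ?h w)"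
    using isometry_glue[OF half_D(1,2) h, of ?h] half_D(3) by simp
  then obtain x where x: "x \<in> carrier (Sp B)" "\<And>u. u \<in> U \<Longrightarrow> x u = h u" "\<And>w. w \<in> ?P \<Longrightarrow> x w = ?h w"
    by blast
  have "x (x v) = v" for v
  proof -
    obtain u w where uw: "u \<in> U" "w \<in> ?P" "v = u + w"
      using nondeg_decomp[OF half_D(1)] by blast
    then show ?thesis
      using x(2,3) hi ih by (simp add: sp_add[OF x(1)])
  qed
  then have inv: "x \<circ> x = id"
    by auto
  have "x ` U = h ` U" "x ` ?P = ?h ` ?P"
    using x(2,3) by auto
  then have img: "x ` U = ?P" "x ` ?P = U"
    using h \<open>isometric_on ?h ?P U\<close> by (auto simp: isometric_on_def bij_betw_def)
  then have "x \<noteq> id"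
    using half_D(6) by auto
  moreover have "x \<in> stab_pair B U"
    using stab_pair_iff[OF x(1) U] img by simp
  ultimately show ?thesis
    using that inv img by blast
qed

definition half :: "nat \<Rightarrow> (bit^'m) set" where
  "half i = (if i = 1 then U else perp B U)"

text \<open>Indexed from the target: \<open>perm_of g i\<close> is the index of the half that
  \<open>g\<close> maps onto \<open>half i\<close>. Both permutations of two indices are
  involutions, so this agrees with the inverse that occurs in \<open>wreath_sym\<close>.\<close>

definition perm_of :: "(bit^'m \<Rightarrow> bit^'m) \<Rightarrow> nat \<Rightarrow> nat" where
  "perm_of g = (if g ` U = U then id else swap12)"

lemma half_image:
  assumes "g \<in> stab_pair B U" "i \<in> {1, 2}"
  shows "g ` half (perm_of g i) = half i" "perm_of g i \<in> {1, 2}"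
  using stab_pair_D[OF assms(1)] assms(2) half_D(6) by (auto simp: half_def perm_of_def)

lemma perm_of_comp:
  assumes "g \<in> stab_pair B U" "h \<in> stab_pair B U"
  shows "perm_of (g \<circ> h) = perm_of g \<circ> perm_of h" "perm_of g (perm_of h i) = perm_of h (perm_of g i)"
proof -
  have "(g \<circ> h) ` U = g ` h ` U"
    by (simp add: image_comp)
  then have "(g \<circ> h) ` U = U \<longleftrightarrow> (g ` U = U) = (h ` U = U)"
    using stab_pair_D(2)[OF assms(1)] stab_pair_D(2)[OF assms(2)] half_D(6) by metis
  then show "perm_of (g \<circ> h) = perm_of g \<circ> perm_of h"
    unfolding perm_of_def by (cases "g ` U = U"; cases "h ` U = U") simp_all
  show "perm_of g (perm_of h i) = perm_of h (perm_of g i)"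
    by (simp add: perm_of_def)
qed

lemma perm_of_perm_of [simp]: "perm_of g (perm_of g i) = i" "inv_into UNIV (perm_of g) = perm_of g"
  by (simp_all add: perm_of_def)

text \<open>Both halves have coordinates in the same standard space, so an element of the stabiliser
  amounts to two isometries of that space and a permutation of the halves.\<close>

theorem stab_pair_wreath: "Sp B\<lparr>carrier := stab_pair B U\<rparr> \<cong> wreath_sym (Sp_std n) 2"
proof -
  let ?S = "std_space (2 * d)"
  obtain c1 where c1: "bij_betw c1 ?S U" "\<And>v w. v \<in> ?S \<Longrightarrow> w \<in> ?S \<Longrightarrow> c1 (v + w) = c1 v + c1 w"
    "\<And>v w. v \<in> ?S \<Longrightarrow> w \<in> ?S \<Longrightarrow> B (c1 v) (c1 w) = std_form d v w"
    using symplectic_coordinates[OF half_D(1,4)] by blast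
  obtain c2 where c2: "bij_betw c2 ?S (perp B U)" "\<And>v w. v \<in> ?S \<Longrightarrow> w \<in> ?S \<Longrightarrow> c2 (v + w) = c2 v + c2 w"
    "\<And>v w. v \<in> ?S \<Longrightarrow> w \<in> ?S \<Longrightarrow> B (c2 v) (c2 w) = std_form d v w"
    using symplectic_coordinates[OF half_D(2,5)] by blast
  define c where "c i = (if i = 1 then c1 else c2)" for i :: nat
  have c: "bij_betw (c i) ?S (half i)" "\<And>v w. v \<in> ?S \<Longrightarrow> w \<in> ?S \<Longrightarrow> c i (v + w) = c i v + c i w"
    "\<And>v w. v \<in> ?S \<Longrightarrow> w \<in> ?S \<Longrightarrow> B (c i v) (c i w) = std_form d v w" for i
    using c1 c2 by (auto simp: c_def half_def)
  define ci where "ci i = inv_into ?S (c i)" for i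
  have ci: "ci i x \<in> ?S" "c i (ci i x) = x" if "x \<in> half i" for i x
    using c(1)[of i] that by (auto simp: ci_def bij_betw_def inv_into_into f_inv_into_f)
  have cin: "c i v \<in> half i" "ci i (c i v) = v" if "v \<in> ?S" for i v
    using c(1)[of i] that by (auto simp: ci_def bij_betw_def)
  have nd: "nondeg (half i)" for i
    using half_D by (simp add: half_def)
  have ci_add: "ci i (x + y) = ci i x + ci i y" if "x \<in> half i" "y \<in> half i" for i x y
    using cin(2)[OF std_space_add[OF ci(1)[OF that(1)] ci(1)[OF that(2)]], of i]
      c(2)[OF ci(1)[OF that(1)] ci(1)[OF that(2)], of i] ci(2) that by simp
  have ci_form: "std_form d (ci i x) (ci i y) = B x y" if "x \<in> half i" "y \<in> half i" for i x y
    using c(3)[OF ci(1)[OF that(1)] ci(1)[OF that(2)], of i] ci(2) that by simp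
  \<comment> \<open>Component \<open>i\<close> is the part of \<open>g\<close> that arrives in half
    \<open>i\<close>, read in coordinates of its source and target. Indexing by the target makes the
    components multiply as in \<open>wreath_sym\<close>.\<close>
  define \<kappa> where "\<kappa> g i = (\<lambda>v\<in>?S. ci i (g (c (perm_of g i) v)))" for g i
  define \<Psi> where "\<Psi> g = (\<lambda>i\<in>{1..2}. \<kappa> g i, perm_of g)" for g
  have g_half: "g x \<in> half i" if "g \<in> stab_pair B U" "i \<in> {1, 2}" "x \<in> half (perm_of g i)" for g i x
    using half_image(1)[OF that(1,2)] that(3) by blast
  have \<kappa>: "\<kappa> g i \<in> carrier (Sp_std (2 * d))" if g: "g \<in> stab_pair B U" "i \<in> {1, 2}" for g i
  proof -
    note gS = stab_pair_D(1)[OF g(1)]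
    have b1: "bij_betw g (half (perm_of g i)) (half i)"
      using half_image(1)[OF g] sp_bij[OF gS] by (metis bij_betw_def bij_is_inj inj_on_subset subset_UNIV)
    have b2: "bij_betw (ci i) (half i) ?S"
      unfolding ci_def using c(1) by (rule bij_betw_inv_into)
    have "bij_betw (ci i \<circ> (g \<circ> c (perm_of g i))) ?S ?S"
      using bij_betw_trans[OF bij_betw_trans[OF c(1) b1] b2] .
    then have "bij_betw (\<kappa> g i) ?S ?S"
      by (subst bij_betw_cong[where g = "ci i \<circ> (g \<circ> c (perm_of g i))"]) (auto simp: \<kappa>_def)
    moreover have "\<kappa> g i (v + w) = \<kappa> g i v + \<kappa> g i w" if "v \<in> ?S" "w \<in> ?S" for v w
      using that c(2)[OF that] std_space_add[OF that] ci_add[OF g_half[OF g cin(1)[OF that(1)]] g_half[OF g cin(1)[OF that(2)]]]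
      by (simp add: \<kappa>_def sp_add[OF gS])
    moreover have "std_form d (\<kappa> g i v) (\<kappa> g i w) = std_form d v w" if "v \<in> ?S" "w \<in> ?S" for v w
      using that ci_form[OF g_half[OF g cin(1)[OF that(1)]] g_half[OF g cin(1)[OF that(2)]]] c(3)[OF that]
      by (simp add: \<kappa>_def sp_B[OF gS])
    ultimately show ?thesis
      by (simp add: Sp_std_iff \<kappa>_def)
  qed
  have idx: "i \<in> {1..2} \<longleftrightarrow> i \<in> {1, 2}" for i :: nat
    by auto
  have car: "\<Psi> g \<in> carrier (wreath_sym (Sp_std n) 2)" if g: "g \<in> stab_pair B U" for g
  proof -
    have "\<kappa> g i \<in> carrier (Sp_std n)" if "i \<in> {1..2}" for i
      using \<kappa>[OF g, of i] that half unfolding idx by simp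
    moreover have "perm_of g \<in> carrier (sym_group 2)"
      unfolding carrier_sym_group_2 by (simp add: perm_of_def)
    ultimately show ?thesis
      by (simp add: \<Psi>_def wreath_sym_def restrict_PiE_iff)
  qed
  have mult: "\<Psi> (g \<circ> h) = \<Psi> g \<otimes>\<^bsub>wreath_sym (Sp_std n) 2\<^esub> \<Psi> h" if g: "g \<in> stab_pair B U" and h: "h \<in> stab_pair B U" for g h
  proof -
    have key: "\<kappa> (g \<circ> h) i = \<kappa> g i \<otimes>\<^bsub>Sp_std n\<^esub> \<kappa> h (perm_of g i)" if i: "i \<in> {1, 2}" for i
    proof -
      have pi: "perm_of g i \<in> {1, 2}"
        using half_image(2)[OF g i] .
      have "\<kappa> g i \<otimes>\<^bsub>Sp_std n\<^esub> \<kappa> h (perm_of g i) = compose ?S (\<kappa> g i) (\<kappa> h (perm_of g i))"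
        using Sp_std_mult[OF \<kappa>[OF g i] \<kappa>[OF h pi]] half by simp
      also have "\<dots> = \<kappa> (g \<circ> h) i"
      proof
        fix v
        show "compose ?S (\<kappa> g i) (\<kappa> h (perm_of g i)) v = \<kappa> (g \<circ> h) i v"
        proof (cases "v \<in> ?S")
          case True
          have hv: "h (c (perm_of h (perm_of g i)) v) \<in> half (perm_of g i)"
            using g_half[OF h pi cin(1)[OF True]] .
          show ?thesis
            using True ci[OF hv] by (simp add: compose_def \<kappa>_def perm_of_comp(1)[OF g h] perm_of_comp(2)[OF g h])
        qed (simp add: compose_def \<kappa>_def)
      qed
      finally show ?thesis ..
    qed
    have "(\<lambda>i\<in>{1..2}. \<kappa> (g \<circ> h) i) = (\<lambda>i\<in>{1..2}. (\<lambda>i\<in>{1..2}. \<kappa> g i) i \<otimes>\<^bsub>Sp_std n\<^esub>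
        (\<lambda>i\<in>{1..2}. \<kappa> h i) (inv_into UNIV (perm_of g) i))"
    proof (rule restrict_ext)
      fix i :: nat assume i: "i \<in> {1..2}"
      then have "perm_of g i \<in> {1..2}"
        using half_image(2)[OF g] unfolding idx by blast
      then show "\<kappa> (g \<circ> h) i = (\<lambda>i\<in>{1..2}. \<kappa> g i) i \<otimes>\<^bsub>Sp_std n\<^esub> (\<lambda>i\<in>{1..2}. \<kappa> h i) (inv_into UNIV (perm_of g) i)"
        using i key[of i] idx[of i] by simp
    qed
    then show ?thesis
      by (simp add: \<Psi>_def wreath_sym_def perm_of_comp(1)[OF g h] sym_group_mult)
  qed
  have inj: "g = h" if g: "g \<in> stab_pair B U" and h: "h \<in> stab_pair B U" and eq: "\<Psi> g = \<Psi> h" for g h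
  proof
    fix x
    have p: "perm_of g = perm_of h"
      using eq by (simp add: \<Psi>_def)
    have \<kappa>eq: "\<kappa> g i = \<kappa> h i" if "i \<in> {1, 2}" for i
    proof -
      have "(\<lambda>i\<in>{1..2}. \<kappa> g i) = (\<lambda>i\<in>{1..2}. \<kappa> h i)"
        using eq by (simp add: \<Psi>_def)
      from fun_cong[OF this, of i] show ?thesis
        using that unfolding idx[symmetric] by simp
    qed
    have agree: "g w = h w" if j: "j \<in> {1, 2}" and w: "w \<in> half j" for j w
    proof -
      define i where "i = perm_of g j"
      have i: "i \<in> {1, 2}" "perm_of g i = j" "perm_of h i = j"
        using half_image(2)[OF g j] p by (simp_all add: i_def)
      have "ci i (g w) = ci i (h w)"
        using fun_cong[OF \<kappa>eq[OF i(1)], of "ci j w"] ci[OF w] i(2,3) by (simp add: \<kappa>_def)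
      moreover have "g w \<in> half i" "h w \<in> half i"
        using g_half[OF g i(1), of w] g_half[OF h i(1), of w] w i by simp_all
      ultimately show ?thesis
        using ci(2) by metis
    qed
    obtain u w where uw: "u \<in> U" "w \<in> perp B U" "x = u + w"
      using nondeg_decomp[OF half_D(1)] by blast
    have "g u = h u" "g w = h w"
      using agree[of 1 u] agree[of 2 w] uw by (auto simp: half_def)
    then show "g x = h x"
      using uw by (simp add: sp_add[OF stab_pair_D(1)[OF g]] sp_add[OF stab_pair_D(1)[OF h]])
  qed
  have surj: "\<exists>g\<in>stab_pair B U. \<Psi> g = t" if t: "t \<in> carrier (wreath_sym (Sp_std n) 2)" for t
  proof -
    obtain f p where fp: "t = (f, p)"
      by (cases t)
    then have f: "f \<in> {1..2} \<rightarrow>\<^sub>E carrier (Sp_std (2 * d))" and p: "p = id \<or> p = swap12"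
      using t carrier_sym_group_2 half by (auto simp: wreath_sym_def)
    have pp: "p (p i) = i" for i
      using p by auto
    have pin: "p i \<in> {1, 2}" if "i \<in> {1, 2}" for i
      using p that by auto
    have fi: "f i \<in> carrier (Sp_std (2 * d))" if "i \<in> {1, 2}" for i
      using f that idx by blast
    \<comment> \<open>The part of the preimage that starts in half \<open>j\<close>; it arrives in
      half \<open>p j\<close> and hence uses the component with index \<open>p j\<close>.\<close>
    define h where "h j x = c (p j) (f (p j) (ci j x))" for j x
    have iso: "isometric_on (h j) (half j) (half (p j))" if j: "j \<in> {1, 2}" for j
      unfolding isometric_on_def
    proof (intro conjI ballI)
      note fS = fi[OF pin[OF j], unfolded Sp_std_iff]
      have fin: "f (p j) v \<in> ?S" if "v \<in> ?S" for v
        using fS that by (auto simp: bij_betw_def)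
      have "bij_betw (c (p j) \<circ> (f (p j) \<circ> ci j)) (half j) (half (p j))"
        using bij_betw_trans[OF bij_betw_trans[OF bij_betw_inv_into[OF c(1)[of j]]] c(1)] fS
        unfolding ci_def by blast
      then show "bij_betw (h j) (half j) (half (p j))"
        by (simp add: h_def[abs_def] comp_def)
      fix x y assume xy: "x \<in> half j" "y \<in> half j"
      show "h j (x + y) = h j x + h j y"
        using xy ci(1) fS c(2)[OF fin[OF ci(1)[OF xy(1)]] fin[OF ci(1)[OF xy(2)]]] by (simp add: h_def ci_add)
      show "B (h j x) (h j y) = B x y"
        using xy ci(1) fS c(3)[OF fin[OF ci(1)[OF xy(1)]] fin[OF ci(1)[OF xy(2)]]] ci_form[OF xy] by (simp add: h_def)
    qed
    have perp_half: "perp B (half (p 1)) = half (p 2)" "half 1 = U" "half 2 = perp B U"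
    proof -
      show "perp B (half (p 1)) = half (p 2)"
        using p
      proof
        assume "p = id"
        then show ?thesis by (simp add: half_def)
      next
        assume "p = swap12"
        then show ?thesis using half_D(3) by (simp add: half_def)
      qed
    qed (simp_all add: half_def)
    have "isometric_on (h 1) U (half (p 1))" "isometric_on (h 2) (perp B U) (perp B (half (p 1)))"
      using iso[of 1, unfolded perp_half(2)] iso[of 2, unfolded perp_half(3)] unfolding perp_half(1) by simp_all
    from isometry_glue[OF half_D(1) nd this]
    obtain g where g: "g \<in> carrier (Sp B)" "\<And>x. x \<in> U \<Longrightarrow> g x = h 1 x" "\<And>x. x \<in> perp B U \<Longrightarrow> g x = h 2 x"
      by metis
    have gh: "g x = h j x" if "j \<in> {1, 2}" "x \<in> half j" for j x
    proof (cases "j = 1")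
      case True
      then show ?thesis using g(2) that(2) by (simp add: half_def)
    next
      case False
      then have "j = 2" using that(1) by simp
      then show ?thesis using g(3) that(2) by (simp add: half_def)
    qed
    have "g ` U = h 1 ` U"
      using g(2) by auto
    also have "\<dots> = half (p 1)"
      using iso[of 1, unfolded perp_half(2)] by (simp add: isometric_on_def bij_betw_def)
    finally have gU: "g ` U = half (p 1)" .
    then have "g ` U = U \<or> g ` U = perp B U"
      by (simp add: half_def)
    then have gst: "g \<in> stab_pair B U"
      using stab_pair_iff[OF g(1) U] by simp
    have pg: "perm_of g = p"
      using p
    proof
      assume "p = id"
      then show ?thesis using gU by (simp add: perm_of_def half_def)
    next
      assume "p = swap12"
      then show ?thesis using gU half_D(6) by (simp add: perm_of_def half_def)
    qed
    have "\<kappa> g i = f i" if i: "i \<in> {1, 2}" for i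
    proof
      fix v
      show "\<kappa> g i v = f i v"
      proof (cases "v \<in> ?S")
        case True
        have "f i v \<in> ?S"
          using fi[OF i] True by (auto simp: Sp_std_iff bij_betw_def)
        then show ?thesis
          using True gh[OF pin[OF i] cin(1)[OF True]] cin(2)[OF True] cin(2)
          by (simp add: \<kappa>_def pg h_def pp)
      next
        case False
        then show ?thesis
          using fi[OF i] by (auto simp: \<kappa>_def Sp_std_iff extensional_def)
      qed
    qed
    then have "\<kappa> g i = f i" if "i \<in> {1..2}" for i
      using that unfolding idx by blast
    then have "(\<lambda>i\<in>{1..2}. \<kappa> g i) = (\<lambda>i\<in>{1..2}. f i)"
      by (rule restrict_ext)
    also have "\<dots> = f"
      using f by (simp add: PiE_def extensional_restrict)
    finally have "(\<lambda>i\<in>{1..2}. \<kappa> g i) = f" .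
    then have "\<Psi> g = t"
      by (simp add: \<Psi>_def pg fp)
    then show ?thesis
      using gst by blast
  qed
  have "\<Psi> \<in> iso (Sp B\<lparr>carrier := stab_pair B U\<rparr>) (wreath_sym (Sp_std n) 2)"
  proof (rule isoI)
    show "\<Psi> \<in> hom (Sp B\<lparr>carrier := stab_pair B U\<rparr>) (wreath_sym (Sp_std n) 2)"
      using car mult stab_pair_D(1) by (auto simp: hom_def)
    show "bij_betw \<Psi> (carrier (Sp B\<lparr>carrier := stab_pair B U\<rparr>)) (carrier (wreath_sym (Sp_std n) 2))"
    proof (rule bij_betwI')
      fix g h
      assume "g \<in> carrier (Sp B\<lparr>carrier := stab_pair B U\<rparr>)" "h \<in> carrier (Sp B\<lparr>carrier := stab_pair B U\<rparr>)"
      then show "(\<Psi> g = \<Psi> h) = (g = h)"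
        using inj[of g h] by auto
    next
      fix g assume "g \<in> carrier (Sp B\<lparr>carrier := stab_pair B U\<rparr>)"
      then show "\<Psi> g \<in> carrier (wreath_sym (Sp_std n) 2)"
        using car[of g] by simp
    next
      fix t assume "t \<in> carrier (wreath_sym (Sp_std n) 2)"
      from surj[OF this] show "\<exists>g\<in>carrier (Sp B\<lparr>carrier := stab_pair B U\<rparr>). t = \<Psi> g"
        by auto
    qed
  qed
  then show ?thesis
    unfolding is_iso_def by blast
qed

end

end

subsection \<open>The automorphism group of the code\<close>

lemma (in group) generate_involution:
  assumes "t \<in> carrier G" "t \<otimes> t = \<one>"
  shows "generate G {t} = {\<one>, t}" "subgroup {\<one>, t} G"
proof -
  have "inv t = t"
    using assms by (simp add: inv_equality)
  then show sub: "subgroup {\<one>, t} G"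
    using assms by (intro subgroupI) auto
  show "generate G {t} = {\<one>, t}"
    using generate_subgroup_incl[OF _ sub, of "{t}"] by (auto intro: generate.one generate.incl)
qed

context johnson
begin

lemma separating_vertex:
  assumes "x \<in> P" "u \<in> P" "x \<noteq> u"
  obtains \<Delta> where "\<Delta> \<in> V" "x \<in> \<Delta>" "u \<notin> \<Delta>"
proof -
  have "k - 1 \<le> card (P - {x, u})"
    using kP assms fin by (simp add: card_Diff_subset)
  then obtain T where T: "T \<subseteq> P - {x, u}" "card T = k - 1"
    by (rule obtain_subset_with_card_n)
  then have "finite T" "x \<notin> T"
    using fin finite_subset by blast+
  then have "insert x T \<in> V"
    using T assms k3 by (auto simp: V_iff)
  then show ?thesis
    using that T assms by auto
qed

lemma containing_vertex:
  assumes "x \<in> P" "u \<in> P"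
  obtains \<Delta> where "\<Delta> \<in> V" "x \<in> \<Delta>" "u \<in> \<Delta>"
proof -
  have c: "card {x, u} \<le> 2" "{x, u} \<subseteq> P"
    using assms by (auto simp: card_insert_if)
  have "k - card {x, u} \<le> card (P - {x, u})"
    using kP assms fin by (simp add: card_Diff_subset)
  then obtain T where T: "T \<subseteq> P - {x, u}" "card T = k - card {x, u}"
    by (rule obtain_subset_with_card_n)
  have "card (T \<union> {x, u}) = card T + card {x, u}"
    using T(1) fin by (intro card_Un_disjoint) (auto intro: finite_subset)
  then have "T \<union> {x, u} \<in> V"
    using T c k3 by (auto simp: V_iff)
  then show ?thesis
    using that by blast
qed

text \<open>If the images of \<open>x\<close> differed, \<open>\<pi> x\<close> would be
  \<open>\<sigma> u\<close> for another point \<open>u\<close>, and a vertex containing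
  \<open>x\<close> but not \<open>u\<close> would distinguish the permutations.\<close>

lemma perm_determined:
  assumes "bij_betw \<pi> P P" "bij_betw \<sigma> P P" "\<And>\<Delta>. \<Delta> \<in> V \<Longrightarrow> \<pi> ` \<Delta> = \<sigma> ` \<Delta>" "x \<in> P"
  shows "\<pi> x = \<sigma> x"
proof (rule ccontr)
  assume ne: "\<pi> x \<noteq> \<sigma> x"
  have "\<pi> x \<in> P"
    using assms(1,4) by (auto simp: bij_betw_def)
  then obtain u where u: "u \<in> P" "\<sigma> u = \<pi> x"
    using assms(2) by (metis bij_betw_def imageE)
  obtain \<Delta> where \<Delta>: "\<Delta> \<in> V" "x \<in> \<Delta>" "u \<notin> \<Delta>"
    using separating_vertex[OF assms(4) u(1)] u(2) ne by metis
  then have "\<sigma> u \<in> \<sigma> ` \<Delta>"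
    using assms(3) u(2) by blast
  then have "u \<in> \<Delta>"
    using assms(2) u(1) \<Delta>(1) by (auto simp: V_iff bij_betw_def inj_on_def subset_iff)
  then show False
    using \<Delta>(3) by simp
qed

text \<open>A vertex containing both \<open>x\<close> and \<open>\<pi> x\<close> meets its image.
  This keeps complementation out of the image of the symplectic group.\<close>

lemma perm_not_complement:
  assumes "bij_betw \<pi> P P" and "\<And>\<Delta>. \<Delta> \<in> V \<Longrightarrow> \<pi> ` \<Delta> = P - \<Delta>"
  shows False
proof -
  obtain x where x: "x \<in> P"
    using kP by (metis all_not_in_conv card.empty add_is_0 le_zero_eq numeral_eq_Suc nat.distinct(1))
  then have "\<pi> x \<in> P"
    using assms(1) by (auto simp: bij_betw_def)
  then obtain \<Delta> where "\<Delta> \<in> V" "x \<in> \<Delta>" "\<pi> x \<in> \<Delta>"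
    using containing_vertex[OF x] by blast
  then show False
    using assms(2) by blast
qed

end

locale symplectic_johnson_code = symplectic_code B n d \<epsilon> \<epsilon>'
  for B :: "bit^'m \<Rightarrow> bit^'m \<Rightarrow> bit" and n d \<epsilon> \<epsilon>' +
  fixes k :: nat
  assumes k_def: "int k = 2 ^ (n - 2) * (2 ^ d + \<epsilon>') * (2 ^ (n - d) + \<epsilon> * \<epsilon>')"
    and not_trivial: "(n, d, \<epsilon>) \<noteq> (2, 1, 1)"
begin

sublocale J: johnson \<Q> k
  using k_bounds[OF k_def not_trivial] by unfold_locales auto

abbreviation "A \<equiv> code_aut \<Q> k \<G>"
abbreviation "\<rho> \<equiv> induced_act act \<Q> k"
abbreviation "s \<equiv> compl_map \<Q> k"

lemma cw_V: "U \<in> \<U> \<Longrightarrow> cw U \<in> J.V"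
  using card_codeword_k[OF k_def, of U] codeword_subset[of U] by (simp add: J.V_iff)

lemma \<G>_V: "\<G> \<subseteq> J.V"
  using cw_V by (auto simp: sp_code_def)

lemma A_iff: "f \<in> carrier A \<longleftrightarrow> f \<in> carrier (johnson_aut \<Q> k) \<and> f ` \<G> = \<G>"
  by (simp add: code_aut_def)

lemma A_ext:
  assumes "f \<in> carrier A" "g \<in> carrier A" "\<And>\<Delta>. \<Delta> \<in> J.V \<Longrightarrow> f \<Delta> = g \<Delta>"
  shows "f = g"
proof -
  have "f \<in> extensional J.V" "g \<in> extensional J.V"
    using assms(1,2) by (auto simp: A_iff johnson_aut_iff Bij_def)
  then show ?thesis
    using assms(3) by (rule extensionalityI)
qed

lemma A_mult:
  assumes "f \<in> carrier A" "g \<in> carrier A"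
  shows "f \<otimes>\<^bsub>A\<^esub> g = compose J.V f g"
proof -
  have "f \<otimes>\<^bsub>A\<^esub> g = f \<otimes>\<^bsub>johnson_aut \<Q> k\<^esub> g"
    by (simp add: code_aut_def)
  then show ?thesis
    using assms johnson_aut_mult[of f \<Q> k g] by (simp add: A_iff)
qed

lemma A_apply: "f \<in> carrier A \<Longrightarrow> g \<in> carrier A \<Longrightarrow> \<Delta> \<in> J.V \<Longrightarrow> (f \<otimes>\<^bsub>A\<^esub> g) \<Delta> = f (g \<Delta>)"
  by (simp add: A_mult compose_def)

lemma A_one: "\<one>\<^bsub>A\<^esub> = (\<lambda>\<Delta>\<in>J.V. \<Delta>)"
  by (simp add: code_aut_def johnson_aut_one)

lemma A_V: "f \<in> carrier A \<Longrightarrow> \<Delta> \<in> J.V \<Longrightarrow> f \<Delta> \<in> J.V"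
  using J.aut_D(1) by (simp add: A_iff)

lemma subgroup_A: "subgroup (carrier A) (johnson_aut \<Q> k)"
proof (rule group.subgroup_carrier_updateI[OF group_johnson_aut])
  have "(\<lambda>\<Delta>\<in>J.V. \<Delta>) ` \<G> = \<G>"
    using \<G>_V by (force simp: image_iff)
  moreover have "(\<lambda>\<Delta>\<in>J.V. \<Delta>) \<in> carrier (johnson_aut \<Q> k)"
    using monoid.one_closed[OF group.is_monoid[OF group_johnson_aut]] by (simp add: johnson_aut_one)
  ultimately show "\<one>\<^bsub>johnson_aut \<Q> k\<^esub> \<in> carrier A"
    by (simp add: A_iff johnson_aut_one)
  fix f g assume fg: "f \<in> carrier A" "g \<in> carrier A"
  then have J: "f \<in> carrier (johnson_aut \<Q> k)" "g \<in> carrier (johnson_aut \<Q> k)" and im: "f ` \<G> = \<G>" "g ` \<G> = \<G>"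
    by (simp_all add: A_iff)
  have "compose J.V f g ` \<G> = f ` g ` \<G>"
    using \<G>_V by (force simp: compose_def image_iff)
  moreover have "f \<otimes>\<^bsub>johnson_aut \<Q> k\<^esub> g \<in> carrier (johnson_aut \<Q> k)"
    using monoid.m_closed[OF group.is_monoid[OF group_johnson_aut] J] .
  ultimately show "f \<otimes>\<^bsub>johnson_aut \<Q> k\<^esub> g \<in> carrier A"
    using im by (simp add: A_iff johnson_aut_mult[OF J])
qed (auto simp: A_iff)

lemma group_A: "group A"
proof -
  have "A = johnson_aut \<Q> k\<lparr>carrier := carrier A\<rparr>"
    by (simp add: code_aut_def)
  then show ?thesis
    using subgroup.subgroup_is_group[OF subgroup_A group_johnson_aut] by metis
qed

interpretation A: group A
  by (rule group_A)

interpretation X: group "Sp B"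
  by (rule group_Sp)

lemma \<rho>_apply: "\<Delta> \<in> J.V \<Longrightarrow> \<rho> g \<Delta> = act g ` \<Delta>"
  by (simp add: induced_act_def)

lemma perm_in_A:
  assumes "bij_betw \<pi> \<Q> \<Q>" "(`) \<pi> ` \<G> = \<G>"
  shows "(\<lambda>\<Delta>\<in>J.V. \<pi> ` \<Delta>) \<in> carrier A"
proof -
  have "(\<lambda>\<Delta>\<in>J.V. \<pi> ` \<Delta>) ` \<G> = (`) \<pi> ` \<G>"
    using \<G>_V by (intro image_cong) auto
  then show ?thesis
    using J.perm_aut[OF assms(1)] assms(2) by (simp add: A_iff)
qed

lemma \<rho>_A: "g \<in> carrier (Sp B) \<Longrightarrow> \<rho> g \<in> carrier A"
  unfolding induced_act_def by (intro perm_in_A act_bij act_\<G>)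

lemma \<rho>_mult:
  assumes "g \<in> carrier (Sp B)" "h \<in> carrier (Sp B)"
  shows "\<rho> (g \<circ> h) = \<rho> g \<otimes>\<^bsub>A\<^esub> \<rho> h"
proof (rule A_ext)
  show "\<rho> (g \<circ> h) \<in> carrier A" "\<rho> g \<otimes>\<^bsub>A\<^esub> \<rho> h \<in> carrier A"
    using assms by (simp_all add: \<rho>_A sp_comp)
  fix \<Delta> assume \<Delta>: "\<Delta> \<in> J.V"
  then have "\<Delta> \<subseteq> \<Q>"
    by (simp add: J.V_iff)
  then have "act (g \<circ> h) ` \<Delta> = act g ` act h ` \<Delta>"
    using act_act[OF assms] by (force simp: image_image)
  then show "\<rho> (g \<circ> h) \<Delta> = (\<rho> g \<otimes>\<^bsub>A\<^esub> \<rho> h) \<Delta>"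
    using \<Delta> A_V[OF \<rho>_A[OF assms(2)] \<Delta>] by (simp add: A_apply \<rho>_A assms \<rho>_apply)
qed

lemma \<rho>_inj:
  assumes g: "g \<in> carrier (Sp B)" and h: "h \<in> carrier (Sp B)" and "\<rho> g = \<rho> h"
  shows "g = h"
proof -
  have "act g ` \<Delta> = act h ` \<Delta>" if "\<Delta> \<in> J.V" for \<Delta>
    using assms(3) \<rho>_apply[OF that] by metis
  then have eq: "act g \<psi> = act h \<psi>" if "\<psi> \<in> \<Q>" for \<psi>
    using J.perm_determined[OF act_bij[OF g] act_bij[OF h] _ that] by blast
  have i: "inv_into UNIV h \<in> carrier (Sp B)"
    using sp_inv(1)[OF h] .
  have "act (inv_into UNIV h \<circ> g) \<psi> = \<psi>" if "\<psi> \<in> \<Q>" for \<psi>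
    using act_act[OF i g that] eq[OF that] act_inv(2)[OF h that] by simp
  then have "inv_into UNIV h \<circ> g = id"
    using act_faithful[OF sp_comp[OF i g]] by blast
  then have "g x = h x" for x
    using sp_inv(2)[OF h, of "g x"] by (metis comp_apply id_apply)
  then show ?thesis
    by auto
qed

lemma perm_from_\<rho>:
  assumes "f \<in> carrier A" "bij_betw \<pi> \<Q> \<Q>" "\<And>\<Delta>. \<Delta> \<in> J.V \<Longrightarrow> f \<Delta> = \<pi> ` \<Delta>"
  shows "f \<in> \<rho> ` carrier (Sp B)"
proof -
  have "(`) \<pi> ` \<G> = f ` \<G>"
    using assms(3) \<G>_V by (intro image_cong) auto
  then have "(`) \<pi> ` \<G> = \<G>"
    using assms(1) by (simp add: A_iff)
  then obtain g where g: "g \<in> carrier (Sp B)" "\<And>\<psi>. \<psi> \<in> \<Q> \<Longrightarrow> \<pi> \<psi> = act g \<psi>"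
    using code_permutation_from_isometry[OF not_trivial assms(2)] by blast
  have "f = \<rho> g"
  proof (rule A_ext[OF assms(1) \<rho>_A[OF g(1)]])
    fix \<Delta> assume \<Delta>: "\<Delta> \<in> J.V"
    then have "\<pi> ` \<Delta> = act g ` \<Delta>"
      using g(2) by (intro image_cong) (auto simp: J.V_iff)
    then show "f \<Delta> = \<rho> g \<Delta>"
      using \<Delta> assms(3) by (simp add: \<rho>_apply)
  qed
  then show ?thesis
    using g(1) by blast
qed

text \<open>Complementation enters only for \<open>card \<Q> = 2 * k\<close>, which
  \<open>half_size_iff\<close> excludes here; so every automorphism comes from a permutation
  preserving the code.\<close>

theorem \<rho>_iso:
  assumes "\<not> (2 * d = n \<and> \<epsilon> = -1)"
  shows "\<rho> \<in> iso (Sp B) A"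
proof (rule isoI)
  show "\<rho> \<in> hom (Sp B) A"
    using \<rho>_A \<rho>_mult by (auto intro!: homI)
  have "f \<in> \<rho> ` carrier (Sp B)" if f: "f \<in> carrier A" for f
  proof -
    have "card \<Q> \<noteq> 2 * k"
      using half_size_iff[OF k_def] assms by linarith
    then obtain \<pi> where \<pi>: "bij_betw \<pi> \<Q> \<Q>" "\<forall>\<Delta>\<in>J.V. f \<Delta> = \<pi> ` \<Delta>"
      using J.johnson_aut_cases[of f] f by (auto simp: A_iff)
    then show ?thesis
      using perm_from_\<rho>[OF f \<pi>(1)] by simp
  qed
  then show "bij_betw \<rho> (carrier (Sp B)) (carrier A)"
    using \<rho>_A \<rho>_inj unfolding bij_betw_def inj_on_def by blast
qed

section \<open>The automorphism group in the self-complementary case\<close>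

context
  assumes half: "2 * d = n" and neg: "\<epsilon> = -1"
begin

lemma card_\<Q>_half: "card \<Q> = 2 * k"
  using half_size_iff[OF k_def] half neg by linarith

lemma s_apply: "\<Delta> \<in> J.V \<Longrightarrow> s \<Delta> = \<Q> - \<Delta>"
  by (simp add: compl_map_def)

lemma s_A: "s \<in> carrier A"
proof -
  have "s ` \<G> = {\<Q> - \<Delta> |\<Delta>. \<Delta> \<in> \<G>}"
    using \<G>_V by (force simp: compl_map_def)
  then have "s ` \<G> = \<G>"
    using self_complementary_iff[OF k_def] half neg by (simp add: self_complementary_def)
  then show ?thesis
    using J.compl_aut[OF card_\<Q>_half] by (simp add: A_iff)
qed

lemma s_s: "s \<otimes>\<^bsub>A\<^esub> s = \<one>\<^bsub>A\<^esub>"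
proof (rule A_ext)
  fix \<Delta> assume \<Delta>: "\<Delta> \<in> J.V"
  then have "\<Q> - (\<Q> - \<Delta>) = \<Delta>"
    by (auto simp: J.V_iff)
  then show "(s \<otimes>\<^bsub>A\<^esub> s) \<Delta> = \<one>\<^bsub>A\<^esub> \<Delta>"
    using \<Delta> J.compl_V[OF card_\<Q>_half \<Delta>] by (simp add: A_apply s_A s_apply A_one)
qed (simp_all add: s_A)

lemma s_commute:
  assumes "g \<in> carrier (Sp B)"
  shows "s \<otimes>\<^bsub>A\<^esub> \<rho> g = \<rho> g \<otimes>\<^bsub>A\<^esub> s"
proof (rule A_ext)
  fix \<Delta> assume \<Delta>: "\<Delta> \<in> J.V"
  then have "act g ` (\<Q> - \<Delta>) = act g ` \<Q> - act g ` \<Delta>"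
    using act_bij[OF assms] by (intro inj_on_image_set_diff) (auto simp: J.V_iff bij_betw_def)
  also have "act g ` \<Q> = \<Q>"
    using act_bij[OF assms] by (simp add: bij_betw_def)
  finally show "(s \<otimes>\<^bsub>A\<^esub> \<rho> g) \<Delta> = (\<rho> g \<otimes>\<^bsub>A\<^esub> s) \<Delta>"
    using \<Delta> J.compl_V[OF card_\<Q>_half \<Delta>] A_V[OF \<rho>_A[OF assms] \<Delta>]
    by (simp add: A_apply s_A \<rho>_A assms s_apply \<rho>_apply)
qed (simp_all add: s_A \<rho>_A assms)

lemma s_not_\<rho>: "s \<notin> \<rho> ` carrier (Sp B)"
proof
  assume "s \<in> \<rho> ` carrier (Sp B)"
  then obtain g where g: "g \<in> carrier (Sp B)" "s = \<rho> g"
    by blast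
  have "act g ` \<Delta> = \<Q> - \<Delta>" if "\<Delta> \<in> J.V" for \<Delta>
    using \<rho>_apply[OF that, of g] s_apply[OF that] g(2) by simp
  then show False
    using J.perm_not_complement[OF act_bij[OF g(1)]] by blast
qed

lemma \<rho>_id: "\<rho> id = \<one>\<^bsub>A\<^esub>"
proof (rule A_ext)
  fix \<Delta> assume \<Delta>: "\<Delta> \<in> J.V"
  then have "act id ` \<Delta> = \<Delta>"
    using act_id by (force simp: J.V_iff image_iff)
  then show "\<rho> id \<Delta> = \<one>\<^bsub>A\<^esub> \<Delta>"
    using \<Delta> by (simp add: \<rho>_apply A_one)
qed (simp_all add: \<rho>_A sp_id)

text \<open>An equation with \<open>s\<close> on one side only would put \<open>s\<close> into the
  image of \<open>\<rho>\<close>.\<close>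

lemma \<rho>_s_unique:
  assumes "g \<in> carrier (Sp B)" "h \<in> carrier (Sp B)" "t \<in> {\<one>\<^bsub>A\<^esub>, s}" "t' \<in> {\<one>\<^bsub>A\<^esub>, s}"
    and eq: "\<rho> g \<otimes>\<^bsub>A\<^esub> t = \<rho> h \<otimes>\<^bsub>A\<^esub> t'"
  shows "g = h \<and> t = t'"
proof -
  have mixed: "\<rho> g' \<otimes>\<^bsub>A\<^esub> s \<noteq> \<rho> h'" if S: "g' \<in> carrier (Sp B)" "h' \<in> carrier (Sp B)" for g' h'
  proof
    assume *: "\<rho> g' \<otimes>\<^bsub>A\<^esub> s = \<rho> h'"
    have i: "inv_into UNIV g' \<in> carrier (Sp B)"
      using sp_inv(1)[OF S(1)] .
    have "inv_into UNIV g' \<circ> g' = id"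
      using sp_inv(3)[OF S(1)] by auto
    then have "\<rho> (inv_into UNIV g') \<otimes>\<^bsub>A\<^esub> \<rho> g' = \<one>\<^bsub>A\<^esub>"
      using \<rho>_mult[OF i S(1)] \<rho>_id by simp
    then have "s = \<rho> (inv_into UNIV g') \<otimes>\<^bsub>A\<^esub> (\<rho> g' \<otimes>\<^bsub>A\<^esub> s)"
      using \<rho>_A[OF i] \<rho>_A[OF S(1)] s_A by (simp flip: A.m_assoc)
    also have "\<dots> = \<rho> (inv_into UNIV g' \<circ> h')"
      using * \<rho>_mult[OF i S(2)] by simp
    finally show False
      using s_not_\<rho> sp_comp[OF i S(2)] by blast
  qed
  have "t = t'"
    using assms(3,4) eq mixed[OF assms(1,2)] mixed[OF assms(2,1)] \<rho>_A[OF assms(1)] \<rho>_A[OF assms(2)]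
    by (auto simp: A.r_one)
  then have "\<rho> g = \<rho> h"
    using eq assms(3) A.right_cancel[OF _ \<rho>_A[OF assms(1)] \<rho>_A[OF assms(2)], of t] s_A by auto
  then show ?thesis
    using \<rho>_inj[OF assms(1,2)] \<open>t = t'\<close> by simp
qed

lemma A_cases:
  assumes "f \<in> carrier A"
  obtains g t where "g \<in> carrier (Sp B)" "t \<in> {\<one>\<^bsub>A\<^esub>, s}" "f = \<rho> g \<otimes>\<^bsub>A\<^esub> t"
proof -
  from J.johnson_aut_cases[of f] assms
  consider \<pi> where "bij_betw \<pi> \<Q> \<Q>" "\<forall>\<Delta>\<in>J.V. f \<Delta> = \<pi> ` \<Delta>"
    | \<pi> where "bij_betw \<pi> \<Q> \<Q>" "\<forall>\<Delta>\<in>J.V. f \<Delta> = \<pi> ` (\<Q> - \<Delta>)"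
    by (auto simp: A_iff)
  then show ?thesis
  proof cases
    case 1
    then obtain g where "g \<in> carrier (Sp B)" "f = \<rho> g"
      using perm_from_\<rho>[OF assms 1(1)] by auto
    then show ?thesis
      using that[of g "\<one>\<^bsub>A\<^esub>"] \<rho>_A[of g] by simp
  next
    case 2
    have fs: "f \<otimes>\<^bsub>A\<^esub> s \<in> carrier A"
      using assms s_A by simp
    moreover have "(f \<otimes>\<^bsub>A\<^esub> s) \<Delta> = \<pi> ` \<Delta>" if \<Delta>: "\<Delta> \<in> J.V" for \<Delta>
    proof -
      have "\<Q> - (\<Q> - \<Delta>) = \<Delta>"
        using \<Delta> by (auto simp: J.V_iff)
      then show ?thesis
        using 2(2) \<Delta> J.compl_V[OF card_\<Q>_half \<Delta>] by (simp add: A_apply assms s_A s_apply)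
    qed
    ultimately have "f \<otimes>\<^bsub>A\<^esub> s \<in> \<rho> ` carrier (Sp B)"
      by (rule perm_from_\<rho>[OF _ 2(1)])
    then obtain g where g: "g \<in> carrier (Sp B)" "f \<otimes>\<^bsub>A\<^esub> s = \<rho> g"
      by blast
    have "f = f \<otimes>\<^bsub>A\<^esub> (s \<otimes>\<^bsub>A\<^esub> s)"
      using assms by (simp add: s_s)
    then have "f = \<rho> g \<otimes>\<^bsub>A\<^esub> s"
      using assms s_A g(2) by (simp flip: A.m_assoc)
    then show ?thesis
      using that[of g s] g(1) by blast
  qed
qed

lemma generate_s: "generate A {s} = {\<one>\<^bsub>A\<^esub>, s}" "subgroup {\<one>\<^bsub>A\<^esub>, s} A"
  using A.generate_involution[OF s_A s_s] .

lemma \<rho>_t_mult: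
  assumes "g \<in> carrier (Sp B)" "h \<in> carrier (Sp B)" "t \<in> {\<one>\<^bsub>A\<^esub>, s}" "t' \<in> {\<one>\<^bsub>A\<^esub>, s}"
  shows "(\<rho> g \<otimes>\<^bsub>A\<^esub> t) \<otimes>\<^bsub>A\<^esub> (\<rho> h \<otimes>\<^bsub>A\<^esub> t') = \<rho> (g \<circ> h) \<otimes>\<^bsub>A\<^esub> (t \<otimes>\<^bsub>A\<^esub> t')"
proof -
  have c: "\<rho> g \<in> carrier A" "\<rho> h \<in> carrier A" "t \<in> carrier A" "t' \<in> carrier A"
    using assms \<rho>_A s_A by auto
  have "t \<otimes>\<^bsub>A\<^esub> \<rho> h = \<rho> h \<otimes>\<^bsub>A\<^esub> t"
    using assms(3) s_commute[OF assms(2)] c by auto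
  have "(\<rho> g \<otimes>\<^bsub>A\<^esub> t) \<otimes>\<^bsub>A\<^esub> (\<rho> h \<otimes>\<^bsub>A\<^esub> t') = \<rho> g \<otimes>\<^bsub>A\<^esub> (t \<otimes>\<^bsub>A\<^esub> \<rho> h) \<otimes>\<^bsub>A\<^esub> t'"
    using c by (simp add: A.m_assoc)
  also have "\<dots> = \<rho> g \<otimes>\<^bsub>A\<^esub> \<rho> h \<otimes>\<^bsub>A\<^esub> (t \<otimes>\<^bsub>A\<^esub> t')"
    unfolding \<open>t \<otimes>\<^bsub>A\<^esub> \<rho> h = \<rho> h \<otimes>\<^bsub>A\<^esub> t\<close> using c by (simp add: A.m_assoc)
  finally show ?thesis
    using \<rho>_mult[OF assms(1,2)] by simp
qed

text \<open>The product is direct because \<open>s\<close> commutes with the image of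
  \<open>\<rho>\<close> and lies outside it, while every automorphism is in that image up to one
  factor \<open>s\<close>.\<close>

theorem product_iso:
  "(\<lambda>(g, t). \<rho> g \<otimes>\<^bsub>A\<^esub> t) \<in> iso (Sp B \<times>\<times> (A\<lparr>carrier := generate A {s}\<rparr>)) A"
proof (rule isoI)
  show "(\<lambda>(g, t). \<rho> g \<otimes>\<^bsub>A\<^esub> t) \<in> hom (Sp B \<times>\<times> (A\<lparr>carrier := generate A {s}\<rparr>)) A"
  proof (rule homI)
    fix p assume "p \<in> carrier (Sp B \<times>\<times> (A\<lparr>carrier := generate A {s}\<rparr>))"
    then show "(case p of (g, t) \<Rightarrow> \<rho> g \<otimes>\<^bsub>A\<^esub> t) \<in> carrier A"
      using \<rho>_A s_A by (auto simp: DirProd_def generate_s)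
  next
    fix p q assume "p \<in> carrier (Sp B \<times>\<times> (A\<lparr>carrier := generate A {s}\<rparr>))"
      "q \<in> carrier (Sp B \<times>\<times> (A\<lparr>carrier := generate A {s}\<rparr>))"
    then obtain g t h t' where pq: "p = (g, t)" "q = (h, t')" "g \<in> carrier (Sp B)" "h \<in> carrier (Sp B)"
      "t \<in> {\<one>\<^bsub>A\<^esub>, s}" "t' \<in> {\<one>\<^bsub>A\<^esub>, s}"
      by (auto simp: DirProd_def generate_s)
    then show "(case p \<otimes>\<^bsub>Sp B \<times>\<times> (A\<lparr>carrier := generate A {s}\<rparr>)\<^esub> q of (g, t) \<Rightarrow> \<rho> g \<otimes>\<^bsub>A\<^esub> t)
      = (case p of (g, t) \<Rightarrow> \<rho> g \<otimes>\<^bsub>A\<^esub> t) \<otimes>\<^bsub>A\<^esub> (case q of (g, t) \<Rightarrow> \<rho> g \<otimes>\<^bsub>A\<^esub> t)"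
      using \<rho>_t_mult[OF pq(3-6)] by (simp add: DirProd_def)
  qed
  show "bij_betw (\<lambda>(g, t). \<rho> g \<otimes>\<^bsub>A\<^esub> t) (carrier (Sp B \<times>\<times> (A\<lparr>carrier := generate A {s}\<rparr>))) (carrier A)"
    unfolding bij_betw_def
  proof
    show "inj_on (\<lambda>(g, t). \<rho> g \<otimes>\<^bsub>A\<^esub> t) (carrier (Sp B \<times>\<times> (A\<lparr>carrier := generate A {s}\<rparr>)))"
    proof (rule inj_onI, clarify)
      fix g t h t'
      assume "(g, t) \<in> carrier (Sp B \<times>\<times> (A\<lparr>carrier := generate A {s}\<rparr>))"
        "(h, t') \<in> carrier (Sp B \<times>\<times> (A\<lparr>carrier := generate A {s}\<rparr>))" "\<rho> g \<otimes>\<^bsub>A\<^esub> t = \<rho> h \<otimes>\<^bsub>A\<^esub> t'"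
      then show "g = h \<and> t = t'"
        using \<rho>_s_unique[of g h t t'] by (simp add: DirProd_def generate_s)
    qed
    show "(\<lambda>(g, t). \<rho> g \<otimes>\<^bsub>A\<^esub> t) ` carrier (Sp B \<times>\<times> (A\<lparr>carrier := generate A {s}\<rparr>)) = carrier A"
    proof
      show "(\<lambda>(g, t). \<rho> g \<otimes>\<^bsub>A\<^esub> t) ` carrier (Sp B \<times>\<times> (A\<lparr>carrier := generate A {s}\<rparr>)) \<subseteq> carrier A"
        using \<rho>_A s_A by (auto simp: DirProd_def generate_s)
      show "carrier A \<subseteq> (\<lambda>(g, t). \<rho> g \<otimes>\<^bsub>A\<^esub> t) ` carrier (Sp B \<times>\<times> (A\<lparr>carrier := generate A {s}\<rparr>))"
      proof
        fix f assume "f \<in> carrier A"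
        then obtain g t where "g \<in> carrier (Sp B)" "t \<in> {\<one>\<^bsub>A\<^esub>, s}" "f = \<rho> g \<otimes>\<^bsub>A\<^esub> t"
          by (rule A_cases)
        then show "f \<in> (\<lambda>(g, t). \<rho> g \<otimes>\<^bsub>A\<^esub> t) ` carrier (Sp B \<times>\<times> (A\<lparr>carrier := generate A {s}\<rparr>))"
          by (intro image_eqI[of _ _ "(g, t)"]) (simp_all add: DirProd_def generate_s)
      qed
    qed
  qed
qed

section \<open>Stabilisers of codewords in the self-complementary case\<close>

context
  fixes U :: "(bit^'m) set"
  assumes U: "U \<in> \<U>"
begin

definition stab_A where
  "stab_A = {a \<in> carrier A. a (cw U) = cw U}"

text \<open>An isometry exchanging \<open>U\<close> and its complement sends \<open>cw U\<close> to
  the complement of \<open>cw U\<close>; the factor \<open>s\<close> repairs this. The stabiliser of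
  the codeword is thereby a copy of the stabiliser of the pair, embedded with a correction on its
  nontrivial coset.\<close>

definition lift where
  "lift g = \<rho> g \<otimes>\<^bsub>A\<^esub> (if g ` U = U then \<one>\<^bsub>A\<^esub> else s)"

lemmas halves = half_D[OF U half]
lemmas pair_D = stab_pair_D[OF U half]

lemma \<rho>_cw: "g \<in> carrier (Sp B) \<Longrightarrow> \<rho> g (cw U) = cw (g ` U)"
  using \<rho>_apply[OF cw_V[OF U]] act_image_codeword(2)[OF _ U] by simp

lemma \<rho>_s_cw:
  assumes "g \<in> carrier (Sp B)"
  shows "(\<rho> g \<otimes>\<^bsub>A\<^esub> s) (cw U) = cw (g ` perp B U)"
proof -
  have P: "perp B U \<in> \<U>"
    using perp_\<U>[OF half U] .
  have "s (cw U) = cw (perp B U)"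
    using s_apply[OF cw_V[OF U]] codeword_perp(2)[OF half U neg] by simp
  then show ?thesis
    using A_apply[OF \<rho>_A[OF assms] s_A cw_V[OF U]] \<rho>_apply[OF cw_V[OF P], of g]
      act_image_codeword(2)[OF assms P] by simp
qed

lemma cw_inj:
  assumes "W \<in> \<U>" "cw W = cw U"
  shows "W = U"
proof (rule ccontr)
  assume "W \<noteq> U"
  then have "W = perp B U"
    using codeword_eq_cases[OF U assms(1)] assms(2) by simp
  then have "cw U = \<Q> - cw U"
    using codeword_perp(2)[OF half U neg] assms(2) by simp
  then show False
    using codeword_nonempty[OF U] codeword_subset[of U] by blast
qed

lemma lift_stab:
  assumes "g \<in> stab_pair B U"
  shows "lift g \<in> stab_A"
proof -
  note g = pair_D(1)[OF assms]
  show ?thesis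
  proof (cases "g ` U = U")
    case True
    then show ?thesis
      using \<rho>_A[OF g] \<rho>_cw[OF g] by (simp add: stab_A_def lift_def)
  next
    case False
    then have "g ` perp B U = U"
      using pair_D(2)[OF assms] by blast
    then show ?thesis
      using False \<rho>_A[OF g] s_A \<rho>_s_cw[OF g] by (simp add: stab_A_def lift_def)
  qed
qed

text \<open>Exchanging or fixing the summands behaves like a sign under composition, and
  \<open>s\<close> is an involution commuting with the isometries, so the corrections multiply in
  the same way.\<close>

lemma lift_mult:
  assumes "g \<in> stab_pair B U" "h \<in> stab_pair B U"
  shows "lift (g \<circ> h) = lift g \<otimes>\<^bsub>A\<^esub> lift h"
proof -
  have "(g \<circ> h) ` U = g ` h ` U"
    by (simp add: image_comp)
  then have "(g \<circ> h) ` U = U \<longleftrightarrow> (g ` U = U) = (h ` U = U)"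
    using pair_D(2)[OF assms(1)] pair_D(2)[OF assms(2)] halves(6) by metis
  then show ?thesis
    unfolding lift_def
    by (subst \<rho>_t_mult[OF pair_D(1)[OF assms(1)] pair_D(1)[OF assms(2)]]) (auto simp: s_s s_A)
qed

lemma lift_inj:
  assumes "g \<in> stab_pair B U" "h \<in> stab_pair B U" "lift g = lift h"
  shows "g = h"
proof -
  have "(if g ` U = U then \<one>\<^bsub>A\<^esub> else s) \<in> {\<one>\<^bsub>A\<^esub>, s}" "(if h ` U = U then \<one>\<^bsub>A\<^esub> else s) \<in> {\<one>\<^bsub>A\<^esub>, s}"
    by simp_all
  from \<rho>_s_unique[OF pair_D(1)[OF assms(1)] pair_D(1)[OF assms(2)] this assms(3)[unfolded lift_def]]
  show ?thesis ..
qed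

lemma lift_surj:
  assumes "a \<in> stab_A"
  shows "\<exists>g\<in>stab_pair B U. lift g = a"
proof -
  have a: "a \<in> carrier A" "a (cw U) = cw U"
    using assms by (simp_all add: stab_A_def)
  then obtain g t where g: "g \<in> carrier (Sp B)" "t \<in> {\<one>\<^bsub>A\<^esub>, s}" "a = \<rho> g \<otimes>\<^bsub>A\<^esub> t"
    using A_cases by blast
  show ?thesis
  proof (cases "t = \<one>\<^bsub>A\<^esub>")
    case True
    then have "cw (g ` U) = cw U"
      using a(2) g \<rho>_cw[OF g(1)] \<rho>_A[OF g(1)] by simp
    then have "g ` U = U"
      using cw_inj act_image_codeword(1)[OF g(1) U] by blast
    then show ?thesis
      using True g stab_pair_iff[OF g(1) U] by (intro bexI[of _ g]) (auto simp: lift_def)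
  next
    case False
    then have t: "t = s"
      using g(2) by simp
    then have "cw (g ` perp B U) = cw U"
      using a(2) g \<rho>_s_cw[OF g(1)] by simp
    then have "g ` perp B U = U"
      using cw_inj act_image_codeword(1)[OF g(1) perp_\<U>[OF half U]] by blast
    then have gU: "g ` U = perp B U"
      using sp_perp_image[OF g(1), of "perp B U"] halves(3) by simp
    then have "g ` U \<noteq> U"
      using halves(6) by simp
    then show ?thesis
      using t g gU stab_pair_iff[OF g(1) U] by (intro bexI[of _ g]) (auto simp: lift_def)
  qed
qed

lemma subgroup_stab_A: "subgroup stab_A A"
proof (rule A.subgroup_carrier_updateI)
  show "\<one>\<^bsub>A\<^esub> \<in> stab_A"
    using cw_V[OF U] A.one_closed by (simp add: stab_A_def A_one)
qed (use cw_V[OF U] in \<open>auto simp: stab_A_def A_apply\<close>)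

lemma lift_iso: "lift \<in> iso (Sp B\<lparr>carrier := stab_pair B U\<rparr>) (A\<lparr>carrier := stab_A\<rparr>)"
proof (rule isoI)
  show "lift \<in> hom (Sp B\<lparr>carrier := stab_pair B U\<rparr>) (A\<lparr>carrier := stab_A\<rparr>)"
    using lift_stab lift_mult pair_D(1) by (auto intro!: homI)
  show "bij_betw lift (carrier (Sp B\<lparr>carrier := stab_pair B U\<rparr>)) (carrier (A\<lparr>carrier := stab_A\<rparr>))"
    using lift_stab lift_inj lift_surj by (force simp: bij_betw_def inj_on_def)
qed

lemma stab_A_wreath: "A\<lparr>carrier := stab_A\<rparr> \<cong> wreath_sym (Sp_std n) 2"
proof -
  have "group (Sp B\<lparr>carrier := stab_pair B U\<rparr>)"
    using subgroup.subgroup_is_group[OF subgroup_stab_pair[OF U] group_Sp] .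
  then have "A\<lparr>carrier := stab_A\<rparr> \<cong> Sp B\<lparr>carrier := stab_pair B U\<rparr>"
    using lift_iso group.iso_sym by (metis is_isoI)
  then show ?thesis
    using stab_pair_wreath[OF U half] by (rule iso_trans)
qed

text \<open>Carried through \<open>lift\<close>, the claim concerns the stabiliser of the pair: the
  elements fixing \<open>U\<close> are a normal subgroup, and the exchanging involution
  \<open>x\<close> generates a complement to it.\<close>

lemma stab_A_semidirect:
  assumes x: "x \<in> stab_pair B U" "x \<circ> x = id" "x ` U = perp B U" "x ` perp B U = U"
  shows "internal_semidirect (A\<lparr>carrier := stab_A\<rparr>) (\<rho> ` stab_subspace B U) (generate A {\<rho> x \<otimes>\<^bsub>A\<^esub> s})"
proof -
  let ?N = "stab_subspace B U"
  have grp: "group (A\<lparr>carrier := stab_A\<rparr>)" "group (Sp B\<lparr>carrier := stab_pair B U\<rparr>)"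
    using subgroup.subgroup_is_group[OF subgroup_stab_A group_A]
      subgroup.subgroup_is_group[OF subgroup_stab_pair[OF U] group_Sp] by auto
  interpret L: group_hom "Sp B\<lparr>carrier := stab_pair B U\<rparr>" "A\<lparr>carrier := stab_A\<rparr>" lift
    using grp lift_iso by (intro group_hom.intro) (auto simp: group_hom_axioms_def iso_def)
  have NP: "?N \<subseteq> stab_pair B U"
    using stab_pair_iff[OF _ U] by (auto simp: stab_subspace_def)
  have lift_N: "lift g = \<rho> g" if "g \<in> ?N" for g
    using that \<rho>_A by (simp add: lift_def stab_subspace_def)
  then have img: "\<rho> ` ?N = lift ` ?N"
    by auto
  have Nsub: "subgroup ?N (Sp B\<lparr>carrier := stab_pair B U\<rparr>)"
    using X.subgroup_incl[OF subgroup_stab_subspace subgroup_stab_pair[OF U] NP] .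
  have inv_pair: "inv_into UNIV g \<in> stab_pair B U" if "g \<in> stab_pair B U" for g
    using subgroup.m_inv_closed[OF subgroup_stab_pair[OF U] that] Sp_inv[OF pair_D(1)[OF that]] by simp
  have inv_eq: "inv\<^bsub>Sp B\<lparr>carrier := stab_pair B U\<rparr>\<^esub> g = inv_into UNIV g" if "g \<in> stab_pair B U" for g
    using X.m_inv_consistent[OF subgroup_stab_pair[OF U] that] Sp_inv[OF pair_D(1)[OF that]] by simp
  have "\<rho> ` ?N \<lhd> A\<lparr>carrier := stab_A\<rparr>"
    unfolding group.normal_inv_iff[OF grp(1)]
  proof (intro conjI ballI)
    show "subgroup (\<rho> ` ?N) (A\<lparr>carrier := stab_A\<rparr>)"
      unfolding img using L.subgroup_img_is_subgroup[OF Nsub] .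
    fix a b assume "a \<in> carrier (A\<lparr>carrier := stab_A\<rparr>)" and b: "b \<in> \<rho> ` ?N"
    then obtain g where g: "g \<in> stab_pair B U" "a = lift g"
      using lift_surj by auto
    obtain h where h: "h \<in> ?N" "b = lift h"
      using b img by auto
    then have hP: "h \<in> stab_pair B U"
      using NP by blast
    let ?g = "inv_into UNIV g"
    have gi: "?g \<in> stab_pair B U"
      using inv_pair[OF g(1)] .
    have "inv\<^bsub>A\<lparr>carrier := stab_A\<rparr>\<^esub> a = lift ?g"
      using L.hom_inv[of g] g inv_eq[OF g(1)] by simp
    moreover have ghP: "g \<circ> h \<in> stab_pair B U"
      using subgroup.m_closed[OF subgroup_stab_pair[OF U] g(1) hP] pair_D(1)[OF g(1)] pair_D(1)[OF hP] by simp
    ultimately have eq: "a \<otimes>\<^bsub>A\<lparr>carrier := stab_A\<rparr>\<^esub> b \<otimes>\<^bsub>A\<lparr>carrier := stab_A\<rparr>\<^esub> inv\<^bsub>A\<lparr>carrier := stab_A\<rparr>\<^esub> a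
      = lift (g \<circ> h \<circ> ?g)"
      using g(2) h(2) lift_mult[OF g(1) hP] lift_mult[OF ghP gi] by simp
    have conj: "(g \<circ> h \<circ> ?g) ` U = U"
    proof -
      have hW: "h ` U = U" "h ` perp B U = perp B U"
        using h(1) sp_perp_image[OF pair_D(1)[OF hP], of U] by (simp_all add: stab_subspace_def)
      have "g ` ?g ` U = U"
        using sp_inv(2)[OF pair_D(1)[OF g(1)]] by (simp add: image_image)
      moreover have "h ` ?g ` U = ?g ` U"
        using pair_D(2)[OF gi] hW by (elim disjE conjE) simp_all
      ultimately show ?thesis
        by (simp only: image_comp[symmetric])
    qed
    have "g \<circ> h \<circ> ?g \<in> carrier (Sp B)"
      using pair_D(1)[OF ghP] pair_D(1)[OF gi] by (rule sp_comp)
    then have "g \<circ> h \<circ> ?g \<in> ?N"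
      using conj by (simp add: stab_subspace_def)
    then show "a \<otimes>\<^bsub>A\<lparr>carrier := stab_A\<rparr>\<^esub> b \<otimes>\<^bsub>A\<lparr>carrier := stab_A\<rparr>\<^esub> inv\<^bsub>A\<lparr>carrier := stab_A\<rparr>\<^esub> a \<in> \<rho> ` ?N"
      unfolding eq img by blast
  qed
  moreover have xN: "x ` U \<noteq> U"
    using x(3) halves(6) by simp
  have lx: "lift x = \<rho> x \<otimes>\<^bsub>A\<^esub> s"
    using xN by (simp add: lift_def)
  have lxA: "lift x \<in> stab_A" "lift x \<in> carrier A"
    using lift_stab[OF x(1)] by (auto simp: stab_A_def)
  have "lift x \<otimes>\<^bsub>A\<^esub> lift x = \<one>\<^bsub>A\<^esub>"
    using lift_mult[OF x(1) x(1)] x(2) by (simp add: lift_def \<rho>_id)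
  then have gen: "generate A {\<rho> x \<otimes>\<^bsub>A\<^esub> s} = {\<one>\<^bsub>A\<^esub>, lift x}" "subgroup {\<one>\<^bsub>A\<^esub>, lift x} A"
    using A.generate_involution[OF lxA(2)] lx by auto
  moreover have "subgroup (generate A {\<rho> x \<otimes>\<^bsub>A\<^esub> s}) (A\<lparr>carrier := stab_A\<rparr>)"
    unfolding gen(1) using lxA(1) subgroup.one_closed[OF subgroup_stab_A]
    by (intro A.subgroup_incl gen(2) subgroup_stab_A) auto
  moreover have "lift x \<notin> \<rho> ` ?N"
  proof
    assume "lift x \<in> \<rho> ` ?N"
    then obtain h where "h \<in> ?N" "lift x = lift h"
      using img by auto
    then have "x \<in> ?N"
      using lift_inj[OF x(1)] NP by blast
    then show False
      using xN by (simp add: stab_subspace_def)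
  qed
  moreover have oneN: "\<one>\<^bsub>A\<^esub> \<in> \<rho> ` ?N"
    using \<rho>_id sp_id by (intro image_eqI[of _ _ id]) (auto simp: stab_subspace_def)
  moreover have "\<rho> ` ?N <#>\<^bsub>A\<lparr>carrier := stab_A\<rparr>\<^esub> {\<one>\<^bsub>A\<^esub>, lift x} = stab_A"
  proof
    have NA: "a \<in> stab_A" if "a \<in> \<rho> ` ?N" for a
      using that img lift_stab NP by auto
    show "\<rho> ` ?N <#>\<^bsub>A\<lparr>carrier := stab_A\<rparr>\<^esub> {\<one>\<^bsub>A\<^esub>, lift x} \<subseteq> stab_A"
      using NA lxA(1) subgroup.one_closed[OF subgroup_stab_A] subgroup.m_closed[OF subgroup_stab_A]
      by (auto simp: set_mult_def)
    show "stab_A \<subseteq> \<rho> ` ?N <#>\<^bsub>A\<lparr>carrier := stab_A\<rparr>\<^esub> {\<one>\<^bsub>A\<^esub>, lift x}"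
    proof
      fix a assume "a \<in> stab_A"
      then obtain g where g: "g \<in> stab_pair B U" "a = lift g"
        using lift_surj by blast
      show "a \<in> \<rho> ` ?N <#>\<^bsub>A\<lparr>carrier := stab_A\<rparr>\<^esub> {\<one>\<^bsub>A\<^esub>, lift x}"
      proof (cases "g ` U = U")
        case True
        then have "g \<in> ?N"
          using pair_D(1)[OF g(1)] by (simp add: stab_subspace_def)
        then have "a \<in> \<rho> ` ?N" "a = a \<otimes>\<^bsub>A\<^esub> \<one>\<^bsub>A\<^esub>"
          using g(2) lift_N \<rho>_A[OF pair_D(1)[OF g(1)]] by auto
        then show ?thesis
          unfolding set_mult_def by auto
      next
        case False
        then have "g ` perp B U = U"
          using pair_D(2)[OF g(1)] by blast
        then have "(g \<circ> x) ` U = U"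
          using x(3) image_comp[of g x U] by simp
        then have gx: "g \<circ> x \<in> ?N"
          using sp_comp[OF pair_D(1)[OF g(1)] pair_D(1)[OF x(1)]] by (simp add: stab_subspace_def)
        \<comment> \<open>Composing with \<open>x\<close> undoes the exchange, so
          \<open>g \<circ> x\<close> fixes \<open>U\<close>, and \<open>x\<close> is its own
          inverse.\<close>
        have "g = (g \<circ> x) \<circ> x"
          using x(2) by (simp add: comp_assoc)
        then have "a = \<rho> (g \<circ> x) \<otimes>\<^bsub>A\<^esub> lift x"
          using g(2) lift_mult[OF _ x(1), of "g \<circ> x"] gx NP lift_N[OF gx] by auto
        then show ?thesis
          using gx unfolding set_mult_def by auto
      qed
    qed
  qed
  ultimately show ?thesis
    unfolding internal_semidirect_def gen(1) by (auto simp: code_aut_def)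
qed

end

end

end

theorem theorem5p6:
  fixes B :: "bit^'m \<Rightarrow> bit^'m \<Rightarrow> bit"
    and n d k :: nat
    and \<epsilon> \<epsilon>' :: int
    and X :: "(bit^'m \<Rightarrow> bit^'m) monoid"
    and Q :: "(bit^'m \<Rightarrow> bit) set"
    and \<Gamma> :: "(bit^'m \<Rightarrow> bit) set set"
    and A :: "((bit^'m \<Rightarrow> bit) set \<Rightarrow> (bit^'m \<Rightarrow> bit) set) monoid"
    and s :: "(bit^'m \<Rightarrow> bit) set \<Rightarrow> (bit^'m \<Rightarrow> bit) set"
    and \<rho> :: "(bit^'m \<Rightarrow> bit^'m) \<Rightarrow> (bit^'m \<Rightarrow> bit) set \<Rightarrow> (bit^'m \<Rightarrow> bit) set"
  assumes "CARD('m) = 2 * n"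
    and "symplectic_form B"
    and "2 \<le> n" and "1 \<le> d" and "d \<le> n - 1"
    and "\<epsilon> \<in> {1, -1}" and "\<epsilon>' \<in> {1, -1}"
    and "(n, d, \<epsilon>) \<noteq> (2, 1, 1)"
    and "X = Sp B"
    and "Q = quads B \<epsilon>"
    and "\<Gamma> = sp_code B d \<epsilon> \<epsilon>'"
    and "int k = 2 ^ (n - 2) * (2 ^ d + \<epsilon>') * (2 ^ (n - d) + \<epsilon> * \<epsilon>')"
    and "A = code_aut Q k \<Gamma>"
    and "s = compl_map Q k"
    and "\<rho> = induced_act (form_act B \<epsilon>) Q k"
  shows
   "(\<forall>U \<in> nondeg_subspaces B (2 * d).
        subgroup (stab_subspace B U)
          (X\<lparr>carrier := stab_codeword B \<epsilon> (codeword B \<epsilon> \<epsilon>' U)\<rparr>) \<and>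
        (\<not> (2 * d = n \<and> \<epsilon> = 1) \<longrightarrow>
           stab_subspace B U = stab_codeword B \<epsilon> (codeword B \<epsilon> \<epsilon>' U)) \<and>
        (2 * d = n \<and> \<epsilon> = 1 \<longrightarrow>
           stab_codeword B \<epsilon> (codeword B \<epsilon> \<epsilon>' U)
             = stab_codeword B \<epsilon> (codeword B \<epsilon> \<epsilon>' (perp B U)) \<and>
           stab_codeword B \<epsilon> (codeword B \<epsilon> \<epsilon>' U) = stab_pair B U \<and>
           U \<inter> perp B U = {0} \<and> {u + w |u w. u \<in> U \<and> w \<in> perp B U} = UNIV \<and>
           X\<lparr>carrier := stab_pair B U\<rparr> \<cong> wreath_sym (Sp_std n) 2 \<and>
           maximal_subgroup (stab_pair B U) X)) \<and>
    strongly_incidence_transitive X (form_act B \<epsilon>) Q \<Gamma> \<and>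
    johnson_code Q k \<Gamma> \<and>
    (\<forall>\<Delta>\<in>\<Gamma>. int (card \<Delta>) = 2 ^ (n - 2) * (2 ^ d + \<epsilon>') * (2 ^ (n - d) + \<epsilon> * \<epsilon>')) \<and>
    3 \<le> k \<and>
    int k \<le> int (card Q) - 3 \<and>
    (self_complementary Q \<Gamma> \<longleftrightarrow> 2 * d = n \<and> \<epsilon> = -1) \<and>
    (\<not> (2 * d = n \<and> \<epsilon> = -1) \<longrightarrow> \<rho> \<in> iso X A) \<and>
    (2 * d = n \<and> \<epsilon> = -1 \<longrightarrow>
       s \<in> carrier A \<and>
       (\<lambda>(g, t). \<rho> g \<otimes>\<^bsub>A\<^esub> t) \<in> iso (X \<times>\<times> (A\<lparr>carrier := generate A {s}\<rparr>)) A \<and>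
       (\<forall>U \<in> nondeg_subspaces B (2 * d).
          \<exists>x \<in> stab_pair B U.
            x \<noteq> \<one>\<^bsub>X\<^esub> \<and> x \<otimes>\<^bsub>X\<^esub> x = \<one>\<^bsub>X\<^esub> \<and> x ` U = perp B U \<and> x ` perp B U = U \<and>
            internal_semidirect
              (A\<lparr>carrier := {a \<in> carrier A. a (codeword B \<epsilon> \<epsilon>' U) = codeword B \<epsilon> \<epsilon>' U}\<rparr>)
              (\<rho> ` stab_subspace B U) (generate A {\<rho> x \<otimes>\<^bsub>A\<^esub> s}) \<and>
            A\<lparr>carrier := {a \<in> carrier A. a (codeword B \<epsilon> \<epsilon>' U) = codeword B \<epsilon> \<epsilon>' U}\<rparr>
              \<cong> wreath_sym (Sp_std n) 2))"
proof -
  have dn: "d < n"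
    using assms(3-5) by linarith
  interpret symplectic_johnson_code B n d \<epsilon> \<epsilon>' k
    using assms by unfold_locales auto
  have a: "subgroup (stab_subspace B U) (X\<lparr>carrier := stab_codeword B \<epsilon> (codeword B \<epsilon> \<epsilon>' U)\<rparr>) \<and>
        (\<not> (2 * d = n \<and> \<epsilon> = 1) \<longrightarrow>
           stab_subspace B U = stab_codeword B \<epsilon> (codeword B \<epsilon> \<epsilon>' U)) \<and>
        (2 * d = n \<and> \<epsilon> = 1 \<longrightarrow>
           stab_codeword B \<epsilon> (codeword B \<epsilon> \<epsilon>' U)
             = stab_codeword B \<epsilon> (codeword B \<epsilon> \<epsilon>' (perp B U)) \<and>
           stab_codeword B \<epsilon> (codeword B \<epsilon> \<epsilon>' U) = stab_pair B U \<and>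
           U \<inter> perp B U = {0} \<and> {u + w |u w. u \<in> U \<and> w \<in> perp B U} = UNIV \<and>
           X\<lparr>carrier := stab_pair B U\<rparr> \<cong> wreath_sym (Sp_std n) 2 \<and>
           maximal_subgroup (stab_pair B U) X)" if U: "U \<in> nondeg_subspaces B (2 * d)" for U
  proof (intro conjI impI)
    have "stab_subspace B U \<subseteq> stab_codeword B \<epsilon> (codeword B \<epsilon> \<epsilon>' U)"
      by (auto simp: stab_codeword_eq[OF U] stab_subspace_def)
    then show "subgroup (stab_subspace B U) (X\<lparr>carrier := stab_codeword B \<epsilon> (codeword B \<epsilon> \<epsilon>' U)\<rparr>)"
      unfolding assms(9)
      by (intro group.subgroup_incl[OF group_Sp] subgroup_stab_subspace subgroup_stab_codeword[OF U])
    show "stab_subspace B U = stab_codeword B \<epsilon> (codeword B \<epsilon> \<epsilon>' U)" if "\<not> (2 * d = n \<and> \<epsilon> = 1)"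
      using stab_codeword_generic[OF U that] .
    assume ex: "2 * d = n \<and> \<epsilon> = 1"
    show "stab_codeword B \<epsilon> (codeword B \<epsilon> \<epsilon>' U) = stab_codeword B \<epsilon> (codeword B \<epsilon> \<epsilon>' (perp B U))"
      using codeword_perp(1)[OF _ U] ex by simp
    show "stab_codeword B \<epsilon> (codeword B \<epsilon> \<epsilon>' U) = stab_pair B U"
      using stab_codeword_exceptional[OF U] ex by blast
    show "U \<inter> perp B U = {0}"
      using \<U>_D(1)[OF U] by (simp add: nondeg_def nondegenerate_def)
    have "x \<in> {u + w |u w. u \<in> U \<and> w \<in> perp B U}" for x
      using nondeg_decomp[OF \<U>_D(1)[OF U], of x] by blast
    then show "{u + w |u w. u \<in> U \<and> w \<in> perp B U} = UNIV"
      by blast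
    show "X\<lparr>carrier := stab_pair B U\<rparr> \<cong> wreath_sym (Sp_std n) 2"
      unfolding assms(9) using stab_pair_wreath[OF U] ex by blast
    show "maximal_subgroup (stab_pair B U) X"
      unfolding assms(9) using maximal_stab_pair[OF U] ex by blast
  qed
  have c: "int (card \<Delta>) = 2 ^ (n - 2) * (2 ^ d + \<epsilon>') * (2 ^ (n - d) + \<epsilon> * \<epsilon>')" if "\<Delta> \<in> \<Gamma>" for \<Delta>
    using that card_codeword_formula unfolding assms(11) sp_code_def by blast
  have e: "s \<in> carrier A \<and>
       (\<lambda>(g, t). \<rho> g \<otimes>\<^bsub>A\<^esub> t) \<in> iso (X \<times>\<times> (A\<lparr>carrier := generate A {s}\<rparr>)) A \<and>
       (\<forall>U \<in> nondeg_subspaces B (2 * d).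
          \<exists>x \<in> stab_pair B U.
            x \<noteq> \<one>\<^bsub>X\<^esub> \<and> x \<otimes>\<^bsub>X\<^esub> x = \<one>\<^bsub>X\<^esub> \<and> x ` U = perp B U \<and> x ` perp B U = U \<and>
            internal_semidirect
              (A\<lparr>carrier := {a \<in> carrier A. a (codeword B \<epsilon> \<epsilon>' U) = codeword B \<epsilon> \<epsilon>' U}\<rparr>)
              (\<rho> ` stab_subspace B U) (generate A {\<rho> x \<otimes>\<^bsub>A\<^esub> s}) \<and>
            A\<lparr>carrier := {a \<in> carrier A. a (codeword B \<epsilon> \<epsilon>' U) = codeword B \<epsilon> \<epsilon>' U}\<rparr>
              \<cong> wreath_sym (Sp_std n) 2)" if ex: "2 * d = n" "\<epsilon> = -1"
    unfolding assms(9-11,13-15)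
  proof (intro conjI ballI)
    show "compl_map (quads B \<epsilon>) k \<in> carrier (code_aut (quads B \<epsilon>) k (sp_code B d \<epsilon> \<epsilon>'))"
      using s_A[OF ex] .
    show "(\<lambda>(g, t). induced_act (form_act B \<epsilon>) (quads B \<epsilon>) k g \<otimes>\<^bsub>code_aut (quads B \<epsilon>) k (sp_code B d \<epsilon> \<epsilon>')\<^esub> t)
      \<in> iso (Sp B \<times>\<times> (code_aut (quads B \<epsilon>) k (sp_code B d \<epsilon> \<epsilon>')
          \<lparr>carrier := generate (code_aut (quads B \<epsilon>) k (sp_code B d \<epsilon> \<epsilon>')) {compl_map (quads B \<epsilon>) k}\<rparr>))
        (code_aut (quads B \<epsilon>) k (sp_code B d \<epsilon> \<epsilon>'))"
      using product_iso[OF ex] .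
    fix U assume U: "U \<in> nondeg_subspaces B (2 * d)"
    obtain x where x: "x \<in> stab_pair B U" "x \<noteq> id" "x \<circ> x = id" "x ` U = perp B U" "x ` perp B U = U"
      using interchanging_involution[OF U ex(1)] .
    have xX: "x \<in> carrier (Sp B)"
      using stab_pair_D(1)[OF U ex(1) x(1)] .
    show "\<exists>x\<in>stab_pair B U. x \<noteq> \<one>\<^bsub>Sp B\<^esub> \<and> x \<otimes>\<^bsub>Sp B\<^esub> x = \<one>\<^bsub>Sp B\<^esub> \<and> x ` U = perp B U \<and> x ` perp B U = U \<and>
        internal_semidirect
          (code_aut (quads B \<epsilon>) k (sp_code B d \<epsilon> \<epsilon>')\<lparr>carrier := {a \<in> carrier (code_aut (quads B \<epsilon>) k (sp_code B d \<epsilon> \<epsilon>')).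
             a (codeword B \<epsilon> \<epsilon>' U) = codeword B \<epsilon> \<epsilon>' U}\<rparr>)
          (induced_act (form_act B \<epsilon>) (quads B \<epsilon>) k ` stab_subspace B U)
          (generate (code_aut (quads B \<epsilon>) k (sp_code B d \<epsilon> \<epsilon>'))
            {induced_act (form_act B \<epsilon>) (quads B \<epsilon>) k x \<otimes>\<^bsub>code_aut (quads B \<epsilon>) k (sp_code B d \<epsilon> \<epsilon>')\<^esub>
              compl_map (quads B \<epsilon>) k}) \<and>
        code_aut (quads B \<epsilon>) k (sp_code B d \<epsilon> \<epsilon>')\<lparr>carrier := {a \<in> carrier (code_aut (quads B \<epsilon>) k (sp_code B d \<epsilon> \<epsilon>')).
          a (codeword B \<epsilon> \<epsilon>' U) = codeword B \<epsilon> \<epsilon>' U}\<rparr> \<cong> wreath_sym (Sp_std n) 2"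
    proof (intro bexI[of _ x] conjI)
      show "x \<noteq> \<one>\<^bsub>Sp B\<^esub>" "x \<otimes>\<^bsub>Sp B\<^esub> x = \<one>\<^bsub>Sp B\<^esub>"
        using x(2,3) xX by simp_all
    qed (fact x stab_A_semidirect[OF ex U x(1,3-5), unfolded stab_A_def[OF ex U]]
        stab_A_wreath[OF ex U, unfolded stab_A_def[OF ex U]])+
  qed
  show ?thesis
  proof (intro conjI)
    show "strongly_incidence_transitive X (form_act B \<epsilon>) Q \<Gamma>"
      unfolding assms(9-11) by (rule code_strongly_incidence_transitive)
    show "johnson_code Q k \<Gamma>" "int k \<le> int (card Q) - 3"
      unfolding assms(10,11) by (rule code_is_johnson_code[OF k_def] k_bounds(2)[OF k_def not_trivial])+
    show "3 \<le> k"
      by (rule k_bounds(1)[OF k_def not_trivial])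
    show "self_complementary Q \<Gamma> \<longleftrightarrow> 2 * d = n \<and> \<epsilon> = -1"
      unfolding assms(10,11) by (rule self_complementary_iff[OF k_def])
    show "\<not> (2 * d = n \<and> \<epsilon> = -1) \<longrightarrow> \<rho> \<in> iso X A"
      unfolding assms(9-11,13-15) using \<rho>_iso by (rule impI)
  qed (rule ballI impI, erule a c conjE, (erule (1) e)?)+
qed

end
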